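(* Let $G=G_1\times\cdots\times G_n$, the automorphism $\phi$ of $G$ cyclically permuting the factors, $\widetilde G=G\rtimes\langle\phi\rangle$ and the $\widetilde G$-module $V=V_1\oplus\cdots\oplus V_n$ be as in the context. Assume $n$ is a prime number and $\chi\in\mathrm{Irr}(G\mid d)^{\phi}$ for some $d\in\mathbb{N}_0$. If $\widetilde\chi\in\mathrm{Irr}(\widetilde G)$ is the $b$-preferred extension of $\chi$, then $$j_G^{\widetilde G}(\chi)=\widetilde\chi .$$
   Context: All modules are finite dimensional over $\overline{\mathbb{Q}}_\ell$ (an algebraically closed field of characteristic $0$). **Twisting.** For a finite group $H$ with automorphism $\phi$ and an $H$-module $V$, $V_\phi$ is $V$ with the action $h\star v=\phi(h)v$. An isomorphism $\sigma:V\to V_\phi$ of $H$-modules is used to make $V$ an $H\rtimes\langle\phi\rangle$-module by letting $\phi$ act as $\sigma$ (here $\langle\phi\rangle\leqslant\mathrm{Aut}(H)$); if $\chi$ is the character of $V$ the resulting character is called the $\sigma$-extension of $\chi$. **$b$-invariants and $j$-induction.** For a finite group $H$, an $H$-module $V$ and $\chi\in\mathrm{Irr}(H)$, the Molien series is $P_\chi^V(t)=\sum_{d\geqslant0}m_d t^d$ with $m_d$ the multiplicity of $\chi$ in the symmetric power $S^d(V)$; equivalently $P_\chi^V(t)=\frac1{|H|}\sum_{h\in H}\chi(h^{-1})/\det_V(\mathrm{id}-t\,h)$. Write $P_\chi^V(t)=\gamma_\chi^Vt^{b_\chi^V}+$ higher powers of $t$, with $\gamma_\chi^V\geqslant 1$.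 $\mathrm{Irr}^V(H\mid d)=\{\chi\in\mathrm{Irr}(H):\gamma_\chi^V=1,\ b_\chi^V=d\}$ (superscript $V$ omitted when clear). For $H\leqslant H'$ finite groups, $V$ an $H'$-module and $U=V/\mathrm{Fix}_H(V)$ with $\mathrm{Fix}_H(V)=\{v: hv=v\ \forall h\in H\}$, $j_H^{H'}:\mathrm{Irr}^U(H\mid d)\to\mathrm{Irr}^V(H'\mid d)$ sends $\chi$ to the unique irreducible character $\psi$ of $H'$ with $\langle\mathrm{Ind}_H^{H'}(\chi),\psi\rangle=1$ and $b_\psi^V=b_\chi^U$. **The group.** $G=G_1\times\cdots\times G_n$ is finite with all factors isomorphic, and $\phi(g_1,\dots,g_n)=(\phi_n(g_n),\phi_1(g_1),\dots,\phi_{n-1}(g_{n-1}))$ with isomorphisms $\phi_i:G_i\to G_{i+1}$ ($1\leqslant i\leqslant n-1$), $\phi_n:G_n\to G_1$. $\psi_i=\phi_{i-1}\cdots\phi_1\phi_n\cdots\phi_i\in\mathrm{Aut}(G_i)$ and $\widetilde G_i=G_i\rtimes\langle\psi_i\rangle$. $\mathrm{Irr}(G)^\phi$, $\mathrm{Irr}(G\mid d)^\phi$, $\mathrm{Irr}(G_i)^{\psi_i}$ denote the characters stable under the automorphism. Indices are cyclic modulo $n$. **The module.** $V=V_1\oplus\cdots\oplus V_n$ is a $G$-module with $V_i\neq0$ a $G_i$-module and $V=V_i\oplus\mathrm{Fix}_{G_i}(V)$ for all $i$ (so $\mathrm{Fix}_G(V)=\mathrm{Fix}_{G_i}(V_i)=0$).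 There is an isomorphism $\sigma:V\to V_\phi$ making $V$ a $\widetilde G$-module, of the form $\sigma(v_1,\dots,v_n)=(\sigma_n(v_n),\sigma_1(v_1),\dots,\sigma_{n-1}(v_{n-1}))$ with linear isomorphisms $\sigma_i:V_i\to V_{i+1}$ ($\sigma_n:V_n\to V_1$) satisfying $\sigma_i(g_iv_i)=\phi_i(g_i)\sigma_i(v_i)$. Then $\tau_i=\sigma_{i-1}\cdots\sigma_1\sigma_n\cdots\sigma_i:V_i\to(V_i)_{\psi_i}$ makes $V_i$ a $\widetilde G_i$-module. It is assumed that $V$ has a $\sigma$-invariant basis $\mathcal{B}=\mathcal{B}_1\sqcup\cdots\sqcup\mathcal{B}_n$ with $\mathcal{B}_i$ a basis of $V_i$. $b$-invariants for $G,\widetilde G$ are with respect to $V$, those for $G_i,\widetilde G_i$ with respect to $V_i$. **$b$-preferred extension.** Let $\chi\in\mathrm{Irr}(G\mid d)^\phi$ be afforded by $E=E_1\boxtimes\cdots\boxtimes E_n$ with $E_i$ a simple $G_i$-module with character $\chi_i$; then $\chi_i\in\mathrm{Irr}(G_i\mid d/n)^{\psi_i}$. There are linear isomorphisms $\delta_i:E_i\to E_{i+1}$ ($\delta_n:E_n\to E_1$), unique up to scalars, with $\delta_i(g_iv_i)=\phi_i(g_i)\delta_i(v_i)$. Put $\alpha_i=\delta_{i-1}\cdots\delta_1\delta_n\cdots\delta_i:E_i\to(E_i)_{\psi_i}$. The $\delta_i$ are scaled so that, for every $i$, the $\alpha_i$-extension $\widetilde\chi_i$ of $\chi_i$ to $\widetilde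 G_i$ is the unique extension with $b_{\widetilde\chi_i}=b_{\chi_i}$, i.e. $\widetilde\chi_i=j_{G_i}^{\widetilde G_i}(\chi_i)$. Define $\alpha:E\to E_\phi$ by $\alpha(v_1\boxtimes\cdots\boxtimes v_n)=\delta_n(v_n)\boxtimes\delta_1(v_1)\boxtimes\cdots\boxtimes\delta_{n-1}(v_{n-1})$. The $\alpha$-extension $\widetilde\chi$ of $\chi$ to $\widetilde G$ is the $b$-preferred extension of $\chi$. *)

theory Defs
  imports
    "Jordan_Normal_Form.VS_Connect"
    "HOL-Algebra.AbelCoset"
    "HOL-Algebra.Product_Groups"
    "HOL-Algebra.Generated_Groups"
    "HOL-Algebra.Bij"
    "HOL-Computational_Algebra.Formal_Power_Series"
    "HOL-Library.Extended_Nat"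
begin

hide_const (open) Modules.module_hom

section \<open>Modules of a group\<close>

text \<open>
  The ground field is an arbitrary type \<open>'k\<close>, turned into a ring record by \<^term>\<open>class_ring\<close>.
  A module of a group \<open>H\<close> is a vector space record \<open>V\<close> together with an action
  \<open>\<rho> :: 'h \<Rightarrow> 'v \<Rightarrow> 'v\<close>, which is only relevant on \<^term>\<open>carrier H\<close> and \<^term>\<open>carrier V\<close>.
\<close>

locale group_module = group H + vectorspace class_ring V
  for H :: "('h, 'm) monoid_scheme" (structure) and V :: "('k::field, 'v) module" +
  fixes \<rho> :: "'h \<Rightarrow> 'v \<Rightarrow> 'v"
  assumes fin_dim: "fin_dim"
    and act_hom: "h \<in> carrier H \<Longrightarrow> \<rho> h \<in> module_hom class_ring V V"
    and act_one: "v \<in> carrier V \<Longrightarrow> \<rho> \<one>\<^bsub>H\<^esub> v = v"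
    and act_mult: "g \<in> carrier H \<Longrightarrow> h \<in> carrier H \<Longrightarrow> v \<in> carrier V \<Longrightarrow>
                   \<rho> (g \<otimes>\<^bsub>H\<^esub> h) v = \<rho> g (\<rho> h v)"

definition linear_isos :: "('k::field, 'v) module \<Rightarrow> ('k, 'w) module \<Rightarrow> ('v \<Rightarrow> 'w) set" where
  "linear_isos V W =
     {f \<in> module_hom class_ring V W. bij_betw f (carrier V) (carrier W)}"

definition module_isos ::
  "('h, 'm) monoid_scheme \<Rightarrow> ('k::field, 'v) module \<Rightarrow> ('h \<Rightarrow> 'v \<Rightarrow> 'v) \<Rightarrow>
   ('k, 'w) module \<Rightarrow> ('h \<Rightarrow> 'w \<Rightarrow> 'w) \<Rightarrow> ('v \<Rightarrow> 'w) set" where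
  "module_isos H V \<rho> W \<rho>' =
     {f \<in> linear_isos V W. \<forall>h\<in>carrier H. \<forall>v\<in>carrier V. f (\<rho> h v) = \<rho>' h (f v)}"

definition simple_module ::
  "('h, 'm) monoid_scheme \<Rightarrow> ('k::field, 'v) module \<Rightarrow> ('h \<Rightarrow> 'v \<Rightarrow> 'v) \<Rightarrow> bool" where
  "simple_module H V \<rho> \<longleftrightarrow>
     group_module H V \<rho> \<and> carrier V \<noteq> {\<zero>\<^bsub>V\<^esub>} \<and>
     (\<forall>W. submodule class_ring W V \<and> (\<forall>h\<in>carrier H. \<rho> h ` W \<subseteq> W) \<longrightarrow>
          W = {\<zero>\<^bsub>V\<^esub>} \<or> W = carrier V)"

definition fixed_points ::
  "('h, 'm) monoid_scheme \<Rightarrow> ('k, 'v) module \<Rightarrow> ('h \<Rightarrow> 'v \<Rightarrow> 'v) \<Rightarrow> 'v set" where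
  "fixed_points H V \<rho> = {v \<in> carrier V. \<forall>h\<in>carrier H. \<rho> h v = v}"

text \<open>The quotient space, its elements being the cosets of \<open>W\<close>; \<open>mult\<close> and \<open>one\<close> are junk.\<close>

definition quotient_space :: "('k, 'v) module \<Rightarrow> 'v set \<Rightarrow> ('k, 'v set) module" where
  "quotient_space V W =
     \<lparr>carrier = a_rcosets\<^bsub>V\<^esub> W, monoid.mult = (\<lambda>X Y. W), one = W, zero = W, add = set_add V,
      smult = (\<lambda>c X. \<Union>x\<in>X. W +>\<^bsub>V\<^esub> (c \<odot>\<^bsub>V\<^esub> x))\<rparr>"

definition quotient_act :: "('h \<Rightarrow> 'v \<Rightarrow> 'v) \<Rightarrow> 'h \<Rightarrow> 'v set \<Rightarrow> 'v set" where
  "quotient_act \<rho> h X = \<rho> h ` X"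


section \<open>Tensor products and symmetric powers\<close>

definition multilinear_forms ::
  "'i set \<Rightarrow> ('i \<Rightarrow> ('k::field, 'v) module) \<Rightarrow> (('i \<Rightarrow> 'v) \<Rightarrow> 'k) set" where
  "multilinear_forms I E =
     {f \<in> (\<Pi>\<^sub>E i\<in>I. carrier (E i)) \<rightarrow>\<^sub>E UNIV.
        \<forall>v \<in> \<Pi>\<^sub>E i\<in>I. carrier (E i). \<forall>i\<in>I. \<forall>x\<in>carrier (E i).
          (\<forall>y\<in>carrier (E i). f (v(i := x \<oplus>\<^bsub>E i\<^esub> y)) = f (v(i := x)) + f (v(i := y))) \<and>
          (\<forall>c. f (v(i := c \<odot>\<^bsub>E i\<^esub> x)) = c * f (v(i := x)))}"

definition symmetric_forms ::
  "nat \<Rightarrow> ('k::field, 'v) module \<Rightarrow> ((nat \<Rightarrow> 'v) \<Rightarrow> 'k) set" where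
  "symmetric_forms d V =
     {f \<in> multilinear_forms {..<d} (\<lambda>_. V).
        \<forall>p v. p permutes {..<d} \<and> v \<in> {..<d} \<rightarrow>\<^sub>E carrier V \<longrightarrow> f (v \<circ> p) = f v}"

definition form_space :: "'x set \<Rightarrow> ('x \<Rightarrow> 'k::field) set \<Rightarrow> ('k, 'x \<Rightarrow> 'k) module" where
  "form_space D F = (ring.func_space class_ring D)\<lparr>carrier := F\<rparr>"

definition dual_space :: "('k::field, 'v) module \<Rightarrow> ('k, 'v \<Rightarrow> 'k) module" where
  "dual_space V = form_space (carrier V)
     {x \<in> carrier V \<rightarrow>\<^sub>E UNIV.
        \<forall>u\<in>carrier V. (\<forall>w\<in>carrier V. x (u \<oplus>\<^bsub>V\<^esub> w) = x u + x w) \<and>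
                       (\<forall>c. x (c \<odot>\<^bsub>V\<^esub> u) = c * x u)}"

text \<open>
  For finite-dimensional spaces, the tensor product is the dual of the space of multilinear forms,
  the pure tensor of \<open>v\<close> being the evaluation \<open>f \<mapsto> f v\<close>. Likewise the \<open>d\<close>-th symmetric power
  of \<open>V\<close> itself (not of its dual) is the dual of the space of symmetric \<open>d\<close>-linear forms, the
  evaluation at \<open>v\<close> being the monomial \<open>v 0 \<cdots> v (d - 1)\<close>.
\<close>

definition tensor :: "'i set \<Rightarrow> ('i \<Rightarrow> ('k::field, 'v) module) \<Rightarrow>
    ('k, (('i \<Rightarrow> 'v) \<Rightarrow> 'k) \<Rightarrow> 'k) module" where
  "tensor I E =
     dual_space (form_space (\<Pi>\<^sub>E i\<in>I. carrier (E i)) (multilinear_forms I E))"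

definition sym_power :: "nat \<Rightarrow> ('k::field, 'v) module \<Rightarrow>
    ('k, ((nat \<Rightarrow> 'v) \<Rightarrow> 'k) \<Rightarrow> 'k) module" where
  "sym_power d V = dual_space (form_space ({..<d} \<rightarrow>\<^sub>E carrier V) (symmetric_forms d V))"

text \<open>
  The linear map of spaces of functionals induced by a map \<open>T\<close> of tuples; it takes the evaluation
  at \<open>v\<close> to the evaluation at \<open>T v\<close>.
\<close>

definition push :: "'x set \<Rightarrow> ('y \<Rightarrow> 'k) set \<Rightarrow> ('x \<Rightarrow> 'y) \<Rightarrow>
    (('x \<Rightarrow> 'k) \<Rightarrow> 'k) \<Rightarrow> (('y \<Rightarrow> 'k) \<Rightarrow> 'k)" where
  "push D F T x = (\<lambda>f\<in>F. x (\<lambda>v\<in>D. f (T v)))"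

lemma push_evaluation:
  assumes "v \<in> D" and "\<And>f. f \<in> F' \<Longrightarrow> (\<lambda>v\<in>D. f (T v)) \<in> F"
  shows "push D F' T (\<lambda>f\<in>F. f v) = (\<lambda>f\<in>F'. f (T v))"
  using assms by (auto simp: push_def fun_eq_iff)

definition sym_act :: "nat \<Rightarrow> ('k::field, 'v) module \<Rightarrow> ('h \<Rightarrow> 'v \<Rightarrow> 'v) \<Rightarrow>
    'h \<Rightarrow> (((nat \<Rightarrow> 'v) \<Rightarrow> 'k) \<Rightarrow> 'k) \<Rightarrow> (((nat \<Rightarrow> 'v) \<Rightarrow> 'k) \<Rightarrow> 'k)" where
  "sym_act d V \<rho> h =
     push ({..<d} \<rightarrow>\<^sub>E carrier V) (symmetric_forms d V) (\<lambda>v. \<lambda>i\<in>{..<d}. \<rho> h (v i))"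

definition tensor_act :: "'i set \<Rightarrow> ('i \<Rightarrow> ('k::field, 'v) module) \<Rightarrow> ('i \<Rightarrow> 'h \<Rightarrow> 'v \<Rightarrow> 'v) \<Rightarrow>
    ('i \<Rightarrow> 'h) \<Rightarrow> ((('i \<Rightarrow> 'v) \<Rightarrow> 'k) \<Rightarrow> 'k) \<Rightarrow> ((('i \<Rightarrow> 'v) \<Rightarrow> 'k) \<Rightarrow> 'k)" where
  "tensor_act I E r g =
     push (\<Pi>\<^sub>E i\<in>I. carrier (E i)) (multilinear_forms I E) (\<lambda>v. \<lambda>i\<in>I. r i (g i) (v i))"


section \<open>Characters\<close>

definition coords :: "('k::field, 'v) module \<Rightarrow> 'v set \<Rightarrow> 'v \<Rightarrow> 'v \<Rightarrow> 'k" where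
  "coords V B v = (THE a. a \<in> B \<rightarrow>\<^sub>E UNIV \<and> module.lincomb V a B = v)"

definition endo_trace :: "('k::field, 'v) module \<Rightarrow> ('v \<Rightarrow> 'v) \<Rightarrow> 'k" where
  "endo_trace V f =
     (let B = (SOME B. finite B \<and> vectorspace.basis class_ring V B)
      in \<Sum>b\<in>B. coords V B (f b) b)"

definition character ::
  "('h, 'm) monoid_scheme \<Rightarrow> ('k::field, 'v) module \<Rightarrow> ('h \<Rightarrow> 'v \<Rightarrow> 'v) \<Rightarrow> 'h \<Rightarrow> 'k" where
  "character H V \<rho> = (\<lambda>h\<in>carrier H. endo_trace V (\<rho> h))"

text \<open>
  Every finite-dimensional module is isomorphic to one on a coordinate space, so it is enough to
  let those range over the simple modules here.
\<close>

definition irr :: "('h, 'm) monoid_scheme \<Rightarrow> ('h \<Rightarrow> 'k::field) set" where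
  "irr H = {character H (module_vec TYPE('k) m) \<rho> |m \<rho>.
              simple_module H (module_vec TYPE('k) m) \<rho>}"

definition char_inner ::
  "('h, 'm) monoid_scheme \<Rightarrow> ('h \<Rightarrow> 'k::field) \<Rightarrow> ('h \<Rightarrow> 'k) \<Rightarrow> 'k" where
  "char_inner H \<chi> \<theta> =
     (\<Sum>h\<in>carrier H. \<chi> h * \<theta> (inv\<^bsub>H\<^esub> h)) / of_nat (card (carrier H))"

definition induced ::
  "('h, 'm) monoid_scheme \<Rightarrow> 'h set \<Rightarrow> ('h \<Rightarrow> 'k::field) \<Rightarrow> 'h \<Rightarrow> 'k" where
  "induced H' H \<chi> = (\<lambda>x\<in>carrier H'.
     (\<Sum>y\<in>carrier H'. if y \<otimes>\<^bsub>H'\<^esub> x \<otimes>\<^bsub>H'\<^esub> inv\<^bsub>H'\<^esub> y \<in> H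
                       then \<chi> (y \<otimes>\<^bsub>H'\<^esub> x \<otimes>\<^bsub>H'\<^esub> inv\<^bsub>H'\<^esub> y) else 0) / of_nat (card H))"


section \<open>\<open>b\<close>-invariants and \<open>j\<close>-induction\<close>

definition molien :: "('h, 'm) monoid_scheme \<Rightarrow> ('k::field, 'v) module \<Rightarrow>
    ('h \<Rightarrow> 'v \<Rightarrow> 'v) \<Rightarrow> ('h \<Rightarrow> 'k) \<Rightarrow> 'k fps" where
  "molien H V \<rho> \<chi> =
     Abs_fps (\<lambda>d. char_inner H (character H (sym_power d V) (sym_act d V \<rho>)) \<chi>)"

text \<open>
  The Molien series can vanish if \<open>V\<close> is not faithful; \<open>\<chi>\<close> has no (finite) \<open>b\<close>-invariant then.
\<close>

definition b_inv :: "('h, 'm) monoid_scheme \<Rightarrow> ('k::field, 'v) module \<Rightarrow>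
    ('h \<Rightarrow> 'v \<Rightarrow> 'v) \<Rightarrow> ('h \<Rightarrow> 'k) \<Rightarrow> enat" where
  "b_inv H V \<rho> \<chi> =
     (if molien H V \<rho> \<chi> = 0 then \<infinity> else enat (subdegree (molien H V \<rho> \<chi>)))"

definition gamma_inv :: "('h, 'm) monoid_scheme \<Rightarrow> ('k::field, 'v) module \<Rightarrow>
    ('h \<Rightarrow> 'v \<Rightarrow> 'v) \<Rightarrow> ('h \<Rightarrow> 'k) \<Rightarrow> 'k" where
  "gamma_inv H V \<rho> \<chi> = fps_nth (molien H V \<rho> \<chi>) (subdegree (molien H V \<rho> \<chi>))"

definition irr_deg :: "('h, 'm) monoid_scheme \<Rightarrow> ('k::field, 'v) module \<Rightarrow>
    ('h \<Rightarrow> 'v \<Rightarrow> 'v) \<Rightarrow> nat \<Rightarrow> ('h \<Rightarrow> 'k) set" where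
  "irr_deg H V \<rho> d = {\<chi> \<in> irr H. gamma_inv H V \<rho> \<chi> = 1 \<and> b_inv H V \<rho> \<chi> = enat d}"

text \<open>
  \<open>j\<close>-induction from the subgroup with carrier \<open>H\<close> to \<open>H'\<close>, with respect to the module
  \<open>(V, \<rho>)\<close> of \<open>H'\<close>.
\<close>

definition j_induction :: "('h, 'm) monoid_scheme \<Rightarrow> 'h set \<Rightarrow> ('k::field, 'v) module \<Rightarrow>
    ('h \<Rightarrow> 'v \<Rightarrow> 'v) \<Rightarrow> ('h \<Rightarrow> 'k) \<Rightarrow> 'h \<Rightarrow> 'k" where
  "j_induction H' H V \<rho> \<chi> =
     (let H\<^sub>0 = H'\<lparr>carrier := H\<rparr>; U = quotient_space V (fixed_points H\<^sub>0 V \<rho>)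
      in THE \<psi>. \<psi> \<in> irr H' \<and> char_inner H' (induced H' H \<chi>) \<psi> = 1 \<and>
                b_inv H' V \<rho> \<psi> = b_inv H\<^sub>0 U (quotient_act \<rho>) \<chi>)"


section \<open>Extensions to a semidirect product\<close>

text \<open>
  The elements of the semidirect product of \<open>H\<close> with the cyclic subgroup of the automorphism
  group generated by \<open>\<phi>\<close> are pairs \<open>(g, a)\<close>, and \<open>(\<one>, a) (g, \<one>) (\<one>, a)\<^sup>-\<^sup>1 = (a g, \<one>)\<close>.
\<close>

definition semidirect ::
  "('h, 'm) monoid_scheme \<Rightarrow> ('h \<Rightarrow> 'h) \<Rightarrow> ('h \<times> ('h \<Rightarrow> 'h)) monoid" where
  "semidirect H \<phi> =
     \<lparr>carrier = carrier H \<times> generate (AutoGroup H) {\<phi>},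
      monoid.mult = (\<lambda>(g, a) (h, b). (g \<otimes>\<^bsub>H\<^esub> a h, a \<otimes>\<^bsub>AutoGroup H\<^esub> b)),
      one = (\<one>\<^bsub>H\<^esub>, \<one>\<^bsub>AutoGroup H\<^esub>)\<rparr>"

definition base_subgroup :: "('h, 'm) monoid_scheme \<Rightarrow> ('h \<times> ('h \<Rightarrow> 'h)) set" where
  "base_subgroup H = carrier H \<times> {\<one>\<^bsub>AutoGroup H\<^esub>}"

definition base_char ::
  "('h, 'm) monoid_scheme \<Rightarrow> ('h \<Rightarrow> 'k) \<Rightarrow> 'h \<times> ('h \<Rightarrow> 'h) \<Rightarrow> 'k" where
  "base_char H \<chi> = (\<lambda>x\<in>base_subgroup H. \<chi> (fst x))"

text \<open>The action in which \<open>\<phi>\<close> acts as \<open>\<sigma>\<close>.\<close>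

definition ext_act :: "('h, 'm) monoid_scheme \<Rightarrow> ('h \<Rightarrow> 'h) \<Rightarrow> ('h \<Rightarrow> 'v \<Rightarrow> 'v) \<Rightarrow>
    ('v \<Rightarrow> 'v) \<Rightarrow> 'h \<times> ('h \<Rightarrow> 'h) \<Rightarrow> 'v \<Rightarrow> 'v" where
  "ext_act H \<phi> \<rho> \<sigma> =
     (\<lambda>(g, a). \<rho> g \<circ> (\<sigma> ^^ (LEAST k::nat. a = \<phi> [^]\<^bsub>AutoGroup H\<^esub> k)))"

text \<open>
  The last condition follows from the others unless \<open>\<phi>\<close> is the identity, when it forces \<open>\<sigma>\<close> to be
  the identity, too.
\<close>

definition extends_by :: "('h, 'm) monoid_scheme \<Rightarrow> ('h \<Rightarrow> 'h) \<Rightarrow> ('k::field, 'v) module \<Rightarrow>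
    ('h \<Rightarrow> 'v \<Rightarrow> 'v) \<Rightarrow> ('v \<Rightarrow> 'v) \<Rightarrow> bool" where
  "extends_by H \<phi> V \<rho> \<sigma> \<longleftrightarrow>
     \<sigma> \<in> module_isos H V \<rho> V (\<lambda>h. \<rho> (\<phi> h)) \<and>
     group_module (semidirect H \<phi>) V (ext_act H \<phi> \<rho> \<sigma>) \<and>
     (\<forall>v\<in>carrier V. ext_act H \<phi> \<rho> \<sigma> (\<one>\<^bsub>H\<^esub>, \<phi>) v = \<sigma> v)"


section \<open>Cyclic permutation of factors\<close>

text \<open>
  Indices run over \<open>{..<n}\<close>, cyclically, so \<open>f i\<close> goes from the \<open>i\<close>-th object to the one with
  index \<open>Suc i mod n\<close>.
\<close>

definition cyc_pred :: "nat \<Rightarrow> nat \<Rightarrow> nat" where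
  "cyc_pred n i = (i + n - 1) mod n"

text \<open>
  \<open>cyc_path n f i m\<close> composes \<open>m\<close> consecutive maps, applying \<open>f i\<close> first; for \<open>m = n\<close> this goes
  once around the cycle and returns to the object with index \<open>i\<close>.
\<close>

primrec cyc_path :: "nat \<Rightarrow> (nat \<Rightarrow> 'x \<Rightarrow> 'x) \<Rightarrow> nat \<Rightarrow> nat \<Rightarrow> 'x \<Rightarrow> 'x" where
  "cyc_path n f i 0 = id"
| "cyc_path n f i (Suc m) = f ((i + m) mod n) \<circ> cyc_path n f i m"

definition cyc_loop :: "nat \<Rightarrow> (nat \<Rightarrow> 'x \<Rightarrow> 'x) \<Rightarrow> nat \<Rightarrow> 'x \<Rightarrow> 'x" where
  "cyc_loop n f i = cyc_path n f i n"

definition cyc_shift :: "nat \<Rightarrow> (nat \<Rightarrow> 'x \<Rightarrow> 'x) \<Rightarrow> (nat \<Rightarrow> 'x) \<Rightarrow> nat \<Rightarrow> 'x" where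
  "cyc_shift n f v = (\<lambda>i\<in>{..<n}. f (cyc_pred n i) (v (cyc_pred n i)))"

abbreviation prod_group :: "nat \<Rightarrow> (nat \<Rightarrow> ('g, 'm) monoid_scheme) \<Rightarrow> (nat \<Rightarrow> 'g) monoid" where
  "prod_group n G \<equiv> product_group {..<n} G"

definition cyc_aut :: "nat \<Rightarrow> (nat \<Rightarrow> ('g, 'm) monoid_scheme) \<Rightarrow> (nat \<Rightarrow> 'g \<Rightarrow> 'g) \<Rightarrow>
    (nat \<Rightarrow> 'g) \<Rightarrow> (nat \<Rightarrow> 'g)" where
  "cyc_aut n G \<phi> = (\<lambda>g\<in>carrier (prod_group n G). cyc_shift n \<phi> g)"

definition loop_aut :: "nat \<Rightarrow> (nat \<Rightarrow> ('g, 'm) monoid_scheme) \<Rightarrow> (nat \<Rightarrow> 'g \<Rightarrow> 'g) \<Rightarrow>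
    nat \<Rightarrow> 'g \<Rightarrow> 'g" where
  "loop_aut n G \<phi> i = (\<lambda>g\<in>carrier (G i). cyc_loop n \<phi> i g)"

definition factor_emb :: "nat \<Rightarrow> (nat \<Rightarrow> ('g, 'm) monoid_scheme) \<Rightarrow> nat \<Rightarrow> 'g \<Rightarrow> nat \<Rightarrow> 'g" where
  "factor_emb n G i g = (\<lambda>j\<in>{..<n}. if j = i then g else \<one>\<^bsub>G j\<^esub>)"

text \<open>
  The \<open>G\<close>-module \<open>V\<close> is the internal direct sum of the subspaces \<open>Vs i\<close>, on which
  the factor \<open>G i\<close> acts through its embedding into \<open>G\<close>. In the formula for \<open>\<sigma>\<close>,
  \<open>\<sigma>s i (u i)\<close> is the component with index \<open>Suc i mod n\<close>.
\<close>

locale cyclic_module =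
  fixes n :: nat
    and G :: "nat \<Rightarrow> ('g, 'm) monoid_scheme"
    and \<phi> :: "nat \<Rightarrow> 'g \<Rightarrow> 'g"
    and V :: "('k::{alg_closed_field, field_char_0}, 'v) module"
    and \<rho> :: "(nat \<Rightarrow> 'g) \<Rightarrow> 'v \<Rightarrow> 'v"
    and Vs :: "nat \<Rightarrow> 'v set"
    and \<sigma>s :: "nat \<Rightarrow> 'v \<Rightarrow> 'v"
    and \<sigma> :: "'v \<Rightarrow> 'v"
    and B :: "nat \<Rightarrow> 'v set"
  assumes n_pos: "0 < n"
    and group_factor: "i < n \<Longrightarrow> group (G i)"
    and finite_factor: "i < n \<Longrightarrow> finite (carrier (G i))"
    and factor_iso: "i < n \<Longrightarrow> \<phi> i \<in> iso (G i) (G (Suc i mod n))"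
    and V_module: "group_module (prod_group n G) V \<rho>"
    and Vs_subspace: "i < n \<Longrightarrow> submodule class_ring (Vs i) V"
    and Vs_nonzero: "i < n \<Longrightarrow> Vs i \<noteq> {\<zero>\<^bsub>V\<^esub>}"
    and V_direct_sum:
      "bij_betw (\<lambda>u. finsum V u {..<n}) (\<Pi>\<^sub>E i\<in>{..<n}. Vs i) (carrier V)"
    and Vs_invariant:
      "i < n \<Longrightarrow> g \<in> carrier (G i) \<Longrightarrow> v \<in> Vs i \<Longrightarrow> \<rho> (factor_emb n G i g) v \<in> Vs i"
    and Vs_fixed_points:
      "i < n \<Longrightarrow> bij_betw (\<lambda>(v, w). v \<oplus>\<^bsub>V\<^esub> w)
         (Vs i \<times> fixed_points (G i) V (\<lambda>g. \<rho> (factor_emb n G i g))) (carrier V)"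
    and \<sigma>s_linear:
      "i < n \<Longrightarrow> \<sigma>s i \<in> linear_isos (V\<lparr>carrier := Vs i\<rparr>) (V\<lparr>carrier := Vs (Suc i mod n)\<rparr>)"
    and \<sigma>s_equivariant:
      "i < n \<Longrightarrow> g \<in> carrier (G i) \<Longrightarrow> v \<in> Vs i \<Longrightarrow>
         \<sigma>s i (\<rho> (factor_emb n G i g) v) = \<rho> (factor_emb n G (Suc i mod n) (\<phi> i g)) (\<sigma>s i v)"
    and \<sigma>_def: "u \<in> (\<Pi>\<^sub>E i\<in>{..<n}. Vs i) \<Longrightarrow>
         \<sigma> (finsum V u {..<n}) = finsum V (\<lambda>i. \<sigma>s i (u i)) {..<n}"
    and \<sigma>_extends: "extends_by (prod_group n G) (cyc_aut n G \<phi>) V \<rho> \<sigma>"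
    and B_basis: "i < n \<Longrightarrow> vectorspace.basis class_ring (V\<lparr>carrier := Vs i\<rparr>) (B i)"
    and B_invariant: "\<sigma> ` (\<Union>i<n. B i) = (\<Union>i<n. B i)"

text \<open>
  Simple modules \<open>E i\<close> of the factors whose outer tensor product affords \<open>\<chi>\<close>, and maps \<open>\<delta> i\<close>
  scaled such that the extension of the character of \<open>E i\<close> which they define
  has the same \<open>b\<close>-invariant as the character itself.
\<close>

locale b_preferred_data =
  fixes n :: nat
    and G :: "nat \<Rightarrow> ('g, 'm) monoid_scheme"
    and \<phi> :: "nat \<Rightarrow> 'g \<Rightarrow> 'g"
    and V :: "('k::{alg_closed_field, field_char_0}, 'v) module"
    and \<rho> :: "(nat \<Rightarrow> 'g) \<Rightarrow> 'v \<Rightarrow> 'v"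
    and Vs :: "nat \<Rightarrow> 'v set"
    and \<sigma>s :: "nat \<Rightarrow> 'v \<Rightarrow> 'v"
    and \<chi> :: "(nat \<Rightarrow> 'g) \<Rightarrow> 'k"
    and E :: "nat \<Rightarrow> ('k, 'e) module"
    and r :: "nat \<Rightarrow> 'g \<Rightarrow> 'e \<Rightarrow> 'e"
    and \<delta> :: "nat \<Rightarrow> 'e \<Rightarrow> 'e"
  assumes E_simple: "i < n \<Longrightarrow> simple_module (G i) (E i) (r i)"
    and E_affords: "\<chi> = character (prod_group n G) (tensor {..<n} E) (tensor_act {..<n} E r)"
    and \<delta>_linear: "i < n \<Longrightarrow> \<delta> i \<in> linear_isos (E i) (E (Suc i mod n))"
    and \<delta>_equivariant:
      "i < n \<Longrightarrow> g \<in> carrier (G i) \<Longrightarrow> v \<in> carrier (E i) \<Longrightarrow>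
         \<delta> i (r i g v) = r (Suc i mod n) (\<phi> i g) (\<delta> i v)"
    and \<alpha>_extends:
      "i < n \<Longrightarrow> extends_by (G i) (loop_aut n G \<phi> i) (E i) (r i) (cyc_loop n \<delta> i)"
    and b_preserved:
      "i < n \<Longrightarrow>
         b_inv (semidirect (G i) (loop_aut n G \<phi> i)) (V\<lparr>carrier := Vs i\<rparr>)
           (ext_act (G i) (loop_aut n G \<phi> i) (\<lambda>g. \<rho> (factor_emb n G i g)) (cyc_loop n \<sigma>s i))
           (character (semidirect (G i) (loop_aut n G \<phi> i)) (E i)
              (ext_act (G i) (loop_aut n G \<phi> i) (r i) (cyc_loop n \<delta> i)))
         = b_inv (G i) (V\<lparr>carrier := Vs i\<rparr>) (\<lambda>g. \<rho> (factor_emb n G i g))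
             (character (G i) (E i) (r i))"

text \<open>
  The map \<open>\<alpha>\<close> below takes the pure tensor of \<open>v\<close> to that of \<^term>\<open>cyc_shift n \<delta> v\<close>.
\<close>

definition b_preferred_ext :: "nat \<Rightarrow> (nat \<Rightarrow> ('g, 'm) monoid_scheme) \<Rightarrow> (nat \<Rightarrow> 'g \<Rightarrow> 'g) \<Rightarrow>
    (nat \<Rightarrow> ('k::field, 'e) module) \<Rightarrow> (nat \<Rightarrow> 'g \<Rightarrow> 'e \<Rightarrow> 'e) \<Rightarrow> (nat \<Rightarrow> 'e \<Rightarrow> 'e) \<Rightarrow>
    (nat \<Rightarrow> 'g) \<times> ((nat \<Rightarrow> 'g) \<Rightarrow> (nat \<Rightarrow> 'g)) \<Rightarrow> 'k" where
  "b_preferred_ext n G \<phi> E r \<delta> =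
     (let \<alpha> = push (\<Pi>\<^sub>E i\<in>{..<n}. carrier (E i)) (multilinear_forms {..<n} E) (cyc_shift n \<delta>)
      in character (semidirect (prod_group n G) (cyc_aut n G \<phi>)) (tensor {..<n} E)
           (ext_act (prod_group n G) (cyc_aut n G \<phi>) (tensor_act {..<n} E r) \<alpha>))"

end

theory Submission
  imports
    Defs
    "Jordan_Normal_Form.Char_Poly"
    "HOL-Algebra.Multiplicative_Group"
begin

text \<open>
  Write \<open>H\<close> for the semidirect product of \<open>G\<close> and \<open>\<langle>\<phi>\<rangle>\<close>, and \<open>\<chi>'\<close> for the \<open>b\<close>-preferred extension of
  \<open>\<chi>\<close>. Since \<open>G\<close> fixes no nonzero vector of \<open>V\<close>, the value of \<open>j\<close>-induction at \<open>\<chi>\<close> is the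
  irreducible character \<open>\<psi>\<close> of \<open>H\<close> which occurs once in the induced character and whose first
  occurrence in the symmetric powers of \<open>V\<close> is in degree \<open>d\<close>. So \<open>\<chi>'\<close> has to have these properties,
  and it has to be the only one.

  Uniqueness needs only that \<open>\<chi>\<close> occurs exactly once in \<open>S\<^sup>d(V)\<close>. Let \<open>F\<close> afford \<open>\<psi>\<close>. By Frobenius
  reciprocity there is an embedding \<open>u: E \<rightarrow> F\<close> of \<open>G\<close>-modules; moreover there are embeddings of
  \<open>H\<close>-modules \<open>f: E \<rightarrow> S\<^sup>d(V)\<close> and \<open>f': F \<rightarrow> S\<^sup>d(V)\<close>. The \<open>G\<close>-maps \<open>f' u\<close> and \<open>f\<close> are proportional, so
  cancelling \<open>f'\<close> shows that \<open>u\<close> is a map of \<open>H\<close>-modules, and \<open>\<psi> = \<chi>'\<close> (\<open>extension_unique\<close>).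

  It remains to find \<open>\<chi>'\<close> in \<open>S\<^sup>d(V)\<close>; it cannot occur in lower degree, because its restriction to
  \<open>G\<close> does not. Let \<open>b\<close> be the \<open>b\<close>-invariant of the character of \<open>E\<^sub>0\<close>. As \<open>S\<^sup>d(V)\<close> is the sum
  of the products of the \<open>S\<^bsup>c i\<^esup>(V\<^sub>i)\<close> with \<open>\<Sum>i. c i = d\<close>, the occurrence of \<open>E\<close> in it makes
  each \<open>E\<^sub>i\<close> occur in \<open>S\<^bsup>c i\<^esup>(V\<^sub>i)\<close> for some such \<open>c\<close>. The \<open>\<sigma>\<^sub>i\<close> and \<open>\<delta>\<^sub>i\<close> identify the pair
  \<open>V\<^sub>i\<close>, \<open>E\<^sub>i\<close> with \<open>V\<^sub>0\<close>, \<open>E\<^sub>0\<close>, so \<open>n * b \<le> d\<close> (\<open>lower_bound\<close>). Conversely, the choice of the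
  scalars in \<open>\<delta>\<close> provides a map \<open>E\<^sub>0 \<rightarrow> S\<^sup>b(V\<^sub>0)\<close> which also commutes with the loops \<open>\<alpha>\<^sub>0\<close> and \<open>\<tau>\<^sub>0\<close>
  around the cycle. The product of its \<open>n\<close> translates is a map \<open>E \<rightarrow> S\<^bsup>n b\<^esup>(V)\<close> which commutes with
  \<open>\<sigma>\<close> and not only with \<open>G\<close> (\<open>upper_bound\<close>). In particular \<open>\<chi>\<close> occurs in degree \<open>n * b\<close>, so
  \<open>n * b = d\<close>, and \<open>\<chi>'\<close> occurs in degree \<open>d\<close>.

  All this is carried out with matrices. With bases \<open>C\<close> of \<open>V\<^sub>0\<close> and \<open>X\<close> of \<open>E\<^sub>0\<close>, transported around
  the cycle, \<open>V\<close> has a basis indexed by \<open>{..<n} \<times> C\<close> and \<open>E\<close> one indexed by \<open>{..<n} \<rightarrow>\<^sub>E X\<close>, and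
  \<open>H\<close> permutes the \<open>n\<close> blocks. A map into \<open>S\<^sup>k(V)\<close> becomes a symmetric tensor which commutes with
  Kronecker powers (\<open>intertwiner_sym_iff\<close>), and the two bounds amount to \<open>block_restriction\<close> and
  \<open>block_product\<close>. Characters are linked to maps by one fact: the inner product of two
  characters is the trace of the averaging projection onto the space of intertwiners, hence it is 0
  or 1 according to whether that space has dimension 0 or 1 (\<open>multiplicity_nonzero_iff\<close>,
  \<open>multiplicity_one_proportional\<close>).
\<close>

hide_const (open) Modules.module_hom

section \<open>Matrices indexed by finite sets\<close>

definition mmul :: "'y set \<Rightarrow> ('x \<Rightarrow> 'y \<Rightarrow> 'k::semiring_0) \<Rightarrow> ('y \<Rightarrow> 'z \<Rightarrow> 'k) \<Rightarrow> 'x \<Rightarrow> 'z \<Rightarrow> 'k" where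
  "mmul Y A B = (\<lambda>x z. \<Sum>y\<in>Y. A x y * B y z)"

definition mtrace :: "'x set \<Rightarrow> ('x \<Rightarrow> 'x \<Rightarrow> 'k::semiring_0) \<Rightarrow> 'k" where
  "mtrace X A = (\<Sum>x\<in>X. A x x)"

text \<open>
  Matrices are total functions, so equations between them need the entries outside to vanish.
\<close>
definition supp_in :: "'y set \<Rightarrow> 'x set \<Rightarrow> ('y \<Rightarrow> 'x \<Rightarrow> 'k::zero) \<Rightarrow> bool" where
  "supp_in Y X A \<longleftrightarrow> (\<forall>y x. A y x \<noteq> 0 \<longrightarrow> y \<in> Y \<and> x \<in> X)"

text \<open>
  The image of the unit element may be a proper idempotent. This happens for symmetric powers, whose
  matrices below are indexed by a spanning set instead of a basis.
\<close>
definition mat_rep :: "('h, 'm) monoid_scheme \<Rightarrow> 'x set \<Rightarrow> ('h \<Rightarrow> 'x \<Rightarrow> 'x \<Rightarrow> 'k::semiring_0) \<Rightarrow> bool" where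
  "mat_rep H X R \<longleftrightarrow> finite X \<and> (\<forall>g\<in>carrier H. supp_in X X (R g)) \<and>
     (\<forall>g\<in>carrier H. \<forall>h\<in>carrier H. R (g \<otimes>\<^bsub>H\<^esub> h) = mmul X (R g) (R h))"

text \<open>
  The condition on the unit makes \<open>A\<close> take values in the space on which \<open>S\<close> really acts.
\<close>
definition intertwiner :: "('h, 'm) monoid_scheme \<Rightarrow> 'y set \<Rightarrow> ('h \<Rightarrow> 'y \<Rightarrow> 'y \<Rightarrow> 'k::semiring_0) \<Rightarrow>
    'x set \<Rightarrow> ('h \<Rightarrow> 'x \<Rightarrow> 'x \<Rightarrow> 'k) \<Rightarrow> ('y \<Rightarrow> 'x \<Rightarrow> 'k) \<Rightarrow> bool" where
  "intertwiner H Y S X R A \<longleftrightarrow> supp_in Y X A \<and> mmul Y (S \<one>\<^bsub>H\<^esub>) A = A \<and>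
     (\<forall>h\<in>carrier H. mmul Y (S h) A = mmul X A (R h))"

definition multiplicity :: "('h, 'm) monoid_scheme \<Rightarrow> 'y set \<Rightarrow> ('h \<Rightarrow> 'y \<Rightarrow> 'y \<Rightarrow> 'k::field) \<Rightarrow>
    'x set \<Rightarrow> ('h \<Rightarrow> 'x \<Rightarrow> 'x \<Rightarrow> 'k) \<Rightarrow> 'k" where
  "multiplicity H Y S X R =
     (\<Sum>h\<in>carrier H. mtrace Y (S h) * mtrace X (R (inv\<^bsub>H\<^esub> h))) / of_nat (card (carrier H))"

lemma mmul_assoc:
  fixes A :: "'x \<Rightarrow> 'y \<Rightarrow> 'k::comm_semiring_1"
  shows "mmul Z (mmul Y A B) C = mmul Y A (mmul Z B C)"
proof (intro ext)
  fix x z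
  have "mmul Z (mmul Y A B) C x z = (\<Sum>c\<in>Z. \<Sum>y\<in>Y. A x y * B y c * C c z)"
    by (simp add: mmul_def sum_distrib_right)
  also have "\<dots> = (\<Sum>y\<in>Y. \<Sum>c\<in>Z. A x y * B y c * C c z)" by (rule sum.swap)
  also have "\<dots> = mmul Y A (mmul Z B C) x z"
    by (simp add: mmul_def sum_distrib_left mult.assoc)
  finally show "mmul Z (mmul Y A B) C x z = mmul Y A (mmul Z B C) x z" .
qed

lemma mmul_scale_left:
  fixes A :: "'x \<Rightarrow> 'y \<Rightarrow> 'k::comm_semiring_1"
  shows "mmul Y (\<lambda>x y. c * A x y) B = (\<lambda>x z. c * mmul Y A B x z)"
  by (simp add: mmul_def sum_distrib_left mult.assoc)

lemma mmul_scale_right: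
  fixes A :: "'x \<Rightarrow> 'y \<Rightarrow> 'k::comm_semiring_1"
  shows "mmul Y A (\<lambda>x y. c * B x y) = (\<lambda>x z. c * mmul Y A B x z)"
  by (simp add: mmul_def sum_distrib_left mult_ac)

lemma mmul_sum_right:
  fixes A :: "'x \<Rightarrow> 'y \<Rightarrow> 'k::comm_semiring_1"
  shows "mmul Y A (\<lambda>x y. \<Sum>i\<in>I. B i x y) = (\<lambda>x z. \<Sum>i\<in>I. mmul Y A (B i) x z)"
  by (intro ext) (simp add: mmul_def sum_distrib_left sum.swap[of _ I])

lemma mmul_sum_left:
  fixes B :: "'y \<Rightarrow> 'x \<Rightarrow> 'k::comm_semiring_1"
  shows "mmul Y (\<lambda>x y. \<Sum>i\<in>I. A i x y) B = (\<lambda>x z. \<Sum>i\<in>I. mmul Y (A i) B x z)"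
  by (intro ext) (simp add: mmul_def sum_distrib_right sum.swap[of _ I])

lemma mtrace_mmul:
  fixes A :: "'x \<Rightarrow> 'y \<Rightarrow> 'k::comm_semiring_1"
  shows "mtrace X (mmul Y A B) = mtrace Y (mmul X B A)"
proof -
  have "mtrace X (mmul Y A B) = (\<Sum>x\<in>X. \<Sum>y\<in>Y. A x y * B y x)"
    by (simp add: mtrace_def mmul_def)
  also have "\<dots> = (\<Sum>y\<in>Y. \<Sum>x\<in>X. A x y * B y x)" by (rule sum.swap)
  finally show ?thesis by (simp add: mtrace_def mmul_def mult.commute)
qed

lemma supp_in_mmul:
  fixes A :: "'x \<Rightarrow> 'y \<Rightarrow> 'k::semiring_0"
  assumes "supp_in X Y A" "supp_in Y Z B"
  shows "supp_in X Z (mmul Y A B)"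
proof -
  have "x \<in> X \<and> z \<in> Z" if "mmul Y A B x z \<noteq> 0" for x z
  proof -
    from that obtain y where "A x y * B y z \<noteq> 0"
      unfolding mmul_def by (meson sum.neutral)
    then have "A x y \<noteq> 0" "B y z \<noteq> 0" by auto
    then show ?thesis using assms by (auto simp: supp_in_def)
  qed
  then show ?thesis by (auto simp: supp_in_def)
qed

lemma supp_in_zero: "supp_in Y X A \<Longrightarrow> y \<notin> Y \<or> x \<notin> X \<Longrightarrow> A y x = 0"
  by (auto simp: supp_in_def)

text \<open>
  An idempotent matrix has its rank as trace: peeling off one dimension \<open>u \<otimes> w\<close> at a time clears a
  row and lowers the trace by 1.
\<close>
lemma idempotent_trace_rank:
  fixes P :: "'z \<Rightarrow> 'z \<Rightarrow> 'k::field"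
  assumes fin: "finite Z" and idem: "\<And>x y. x \<in> Z \<Longrightarrow> y \<in> Z \<Longrightarrow> (\<Sum>z\<in>Z. P x z * P z y) = P x y"
  shows "\<exists>r::nat. (\<Sum>z\<in>Z. P z z) = of_nat r \<and> (r = 0 \<longrightarrow> (\<forall>x\<in>Z. \<forall>y\<in>Z. P x y = 0)) \<and>
     (r = 1 \<longrightarrow> (\<exists>u w. \<forall>x\<in>Z. \<forall>y\<in>Z. P x y = u x * w y))"
  using idem
proof (induction "card {x\<in>Z. \<exists>y\<in>Z. P x y \<noteq> 0}" arbitrary: P rule: less_induct)
  case less
  show ?case
  proof (cases "\<forall>x\<in>Z. \<forall>y\<in>Z. P x y = 0")
    case True
    then show ?thesis by (intro exI[of _ 0]) auto
  next
    case False
    then obtain a b where ab: "a \<in> Z" "b \<in> Z" "P a b \<noteq> 0" by auto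
    define u where "u = (\<lambda>x. P x b)"
    define w where "w = (\<lambda>y. P a y / u a)"
    have ua: "u a \<noteq> 0" using ab by (simp add: u_def)
    have Pu: "(\<Sum>z\<in>Z. P x z * u z) = u x" if "x \<in> Z" for x
      using less.prems[OF that ab(2)] by (simp add: u_def)
    have wP: "(\<Sum>z\<in>Z. w z * P z y) = w y" if "y \<in> Z" for y
      using less.prems[OF ab(1) that] by (simp add: w_def sum_divide_distrib[symmetric])
    have wu: "(\<Sum>z\<in>Z. w z * u z) = 1"
      using Pu[OF ab(1)] ua by (simp add: w_def sum_divide_distrib[symmetric])
    define Q where "Q = (\<lambda>x y. P x y - u x * w y)"
    have Q: "(\<Sum>z\<in>Z. Q x z * Q z y) = Q x y" if "x \<in> Z" "y \<in> Z" for x y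
    proof -
      have "(\<Sum>z\<in>Z. Q x z * Q z y) = (\<Sum>z\<in>Z. P x z * P z y) - (\<Sum>z\<in>Z. P x z * u z) * w y
          - u x * (\<Sum>z\<in>Z. w z * P z y) + u x * (\<Sum>z\<in>Z. w z * u z) * w y"
        unfolding Q_def sum_distrib_left sum_distrib_right sum_subtractf[symmetric] sum.distrib[symmetric]
        by (intro sum.cong refl) (simp add: algebra_simps)
      then show ?thesis using less.prems[OF that] Pu[OF that(1)] wP[OF that(2)] wu
        by (simp add: Q_def)
    qed
    have "{x\<in>Z. \<exists>y\<in>Z. Q x y \<noteq> 0} \<subset> {x\<in>Z. \<exists>y\<in>Z. P x y \<noteq> 0}"
    proof -
      have "Q a y = 0" for y using ua by (simp add: Q_def w_def)
      moreover have "\<exists>y\<in>Z. P x y \<noteq> 0" if "y \<in> Z" "Q x y \<noteq> 0" for x y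
        using that ab by (cases "P x b = 0") (auto simp: Q_def u_def)
      ultimately have "{x\<in>Z. \<exists>y\<in>Z. Q x y \<noteq> 0} \<subseteq> {x\<in>Z. \<exists>y\<in>Z. P x y \<noteq> 0} - {a}" by auto
      moreover have "a \<in> {x\<in>Z. \<exists>y\<in>Z. P x y \<noteq> 0}" using ab by auto
      ultimately show ?thesis by blast
    qed
    then have "card {x\<in>Z. \<exists>y\<in>Z. Q x y \<noteq> 0} < card {x\<in>Z. \<exists>y\<in>Z. P x y \<noteq> 0}"
      using fin by (intro psubset_card_mono) auto
    from less.hyps[OF this Q] obtain r where
      r: "(\<Sum>z\<in>Z. Q z z) = of_nat r" "r = 0 \<Longrightarrow> \<forall>x\<in>Z. \<forall>y\<in>Z. Q x y = 0" by blast
    have "(\<Sum>z\<in>Z. P z z) = (\<Sum>z\<in>Z. Q z z) + (\<Sum>z\<in>Z. w z * u z)"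
      by (simp add: Q_def sum.distrib[symmetric] mult.commute)
    then have "(\<Sum>z\<in>Z. P z z) = of_nat (Suc r)" using r wu by simp
    moreover have "\<exists>u w. \<forall>x\<in>Z. \<forall>y\<in>Z. P x y = u x * w y" if "Suc r = 1"
      using r(2) that by (intro exI[of _ u] exI[of _ w]) (simp add: Q_def)
    ultimately show ?thesis by (intro exI[of _ "Suc r"]) auto
  qed
qed

lemma idempotent_trace_0:
  fixes P :: "'z \<Rightarrow> 'z \<Rightarrow> 'k::field_char_0"
  assumes "finite Z" and "\<And>x y. x \<in> Z \<Longrightarrow> y \<in> Z \<Longrightarrow> (\<Sum>z\<in>Z. P x z * P z y) = P x y"
    and "(\<Sum>z\<in>Z. P z z) = 0" "x \<in> Z" "y \<in> Z"
  shows "P x y = 0"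
  using idempotent_trace_rank[of Z P, OF assms(1,2)] assms(3-) by auto

lemma idempotent_trace_1:
  fixes P :: "'z \<Rightarrow> 'z \<Rightarrow> 'k::field_char_0"
  assumes "finite Z" and "\<And>x y. x \<in> Z \<Longrightarrow> y \<in> Z \<Longrightarrow> (\<Sum>z\<in>Z. P x z * P z y) = P x y"
    and "(\<Sum>z\<in>Z. P z z) = 1"
  obtains u w where "\<And>x y. x \<in> Z \<Longrightarrow> y \<in> Z \<Longrightarrow> P x y = u x * w y"
proof -
  obtain r :: nat where r: "(\<Sum>z\<in>Z. P z z) = of_nat r"
    "r = 1 \<longrightarrow> (\<exists>u w. \<forall>x\<in>Z. \<forall>y\<in>Z. P x y = u x * w y)"
    using idempotent_trace_rank[of Z P, OF assms(1,2)] by auto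
  then have "r = 1" using assms(3) by simp
  then show ?thesis using r that by blast
qed

section \<open>Multiplicities and intertwiners\<close>
text \<open>
  The matrix of the projection \<open>A \<mapsto> (1/|H|) \<Sum>h. S h \<cdot> A \<cdot> R h\<^sup>-\<^sup>1\<close> on the space of all \<open>Y \<times> X\<close> matrices,
  with respect to the elementary matrices. Its trace is the inner product of the two characters.
\<close>
definition averaging :: "('h, 'm) monoid_scheme \<Rightarrow> ('h \<Rightarrow> 'y \<Rightarrow> 'y \<Rightarrow> 'k::field) \<Rightarrow>
    ('h \<Rightarrow> 'x \<Rightarrow> 'x \<Rightarrow> 'k) \<Rightarrow> 'y \<times> 'x \<Rightarrow> 'y \<times> 'x \<Rightarrow> 'k" where
  "averaging H S R = (\<lambda>(y, x) (y', x').
     (\<Sum>h\<in>carrier H. S h y y' * R (inv\<^bsub>H\<^esub> h) x' x) / of_nat (card (carrier H)))"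

locale rep_pair = group H for H :: "('h, 'm) monoid_scheme" (structure) +
  fixes Y :: "'y set" and S :: "'h \<Rightarrow> 'y \<Rightarrow> 'y \<Rightarrow> 'k::field_char_0"
    and X :: "'x set" and R :: "'h \<Rightarrow> 'x \<Rightarrow> 'x \<Rightarrow> 'k"
  assumes finH: "finite (carrier H)" and S: "mat_rep H Y S" and R: "mat_rep H X R"
begin

lemma card_nonzero: "of_nat (card (carrier H)) \<noteq> (0 :: 'k)"
  using finH by (simp add: card_eq_0_iff) (use one_closed in blast)

lemma finX: "finite X" and finY: "finite Y" using S R by (auto simp: mat_rep_def)

lemma S_mult: "g \<in> carrier H \<Longrightarrow> h \<in> carrier H \<Longrightarrow> S (g \<otimes> h) = mmul Y (S g) (S h)"
  using S by (auto simp: mat_rep_def)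

lemma R_mult: "g \<in> carrier H \<Longrightarrow> h \<in> carrier H \<Longrightarrow> R (g \<otimes> h) = mmul X (R g) (R h)"
  using R by (auto simp: mat_rep_def)

lemma averaging_trace: "(\<Sum>z\<in>Y \<times> X. averaging H S R z z) = multiplicity H Y S X R"
proof -
  have "(\<Sum>z\<in>Y \<times> X. averaging H S R z z)
      = (\<Sum>z\<in>Y \<times> X. \<Sum>h\<in>carrier H. S h (fst z) (fst z) * R (inv h) (snd z) (snd z)) / of_nat (card (carrier H))"
    by (simp add: averaging_def sum_divide_distrib case_prod_unfold)
  also have "(\<Sum>z\<in>Y \<times> X. \<Sum>h\<in>carrier H. S h (fst z) (fst z) * R (inv h) (snd z) (snd z))
      = (\<Sum>h\<in>carrier H. \<Sum>z\<in>Y \<times> X. S h (fst z) (fst z) * R (inv h) (snd z) (snd z))"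
    by (rule sum.swap)
  also have "\<dots> = (\<Sum>h\<in>carrier H. mtrace Y (S h) * mtrace X (R (inv h)))"
    by (simp add: mtrace_def sum_product sum.cartesian_product case_prod_unfold)
  finally show ?thesis by (simp add: multiplicity_def)
qed

definition avg :: "('y \<Rightarrow> 'x \<Rightarrow> 'k) \<Rightarrow> 'y \<Rightarrow> 'x \<Rightarrow> 'k" where
  "avg A = (\<lambda>y x. (\<Sum>h\<in>carrier H. mmul Y (S h) (mmul X A (R (inv h))) y x) / of_nat (card (carrier H)))"

lemma sum_carrier_mult: "g \<in> carrier H \<Longrightarrow> (\<Sum>h\<in>carrier H. f (g \<otimes> h)) = (\<Sum>h\<in>carrier H. f h)"
  for f :: "'h \<Rightarrow> 'a::comm_monoid_add"
  by (rule sum.reindex_bij_witness[of _ "\<lambda>h. inv g \<otimes> h" "\<lambda>h. g \<otimes> h"]) (auto simp: m_assoc[symmetric])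

lemma avg_equivariant:
  assumes g: "g \<in> carrier H"
  shows "mmul Y (S g) (avg A) = mmul X (avg A) (R g)"
proof -
  have "mmul Y (S g) (avg A)
     = (\<lambda>y x. (\<Sum>h\<in>carrier H. mmul Y (S (g \<otimes> h)) (mmul X A (R (inv (g \<otimes> h) \<otimes> g))) y x) / of_nat (card (carrier H)))"
    unfolding avg_def divide_inverse
    using g by (simp add: mult.commute[of _ "inverse _"] mmul_scale_right mmul_sum_right S_mult mmul_assoc[symmetric] inv_mult_group m_assoc)
  also have "\<dots> = (\<lambda>y x. (\<Sum>h\<in>carrier H. mmul Y (S h) (mmul X A (R (inv h \<otimes> g))) y x) / of_nat (card (carrier H)))"
    by (intro ext arg_cong2[where f="(/)"] refl sum_carrier_mult[OF g, of "\<lambda>h. mmul Y (S h) (mmul X A (R (inv h \<otimes> g))) _ _"])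
  also have "\<dots> = mmul X (avg A) (R g)"
    unfolding avg_def divide_inverse
    using g by (simp add: mult.commute[of _ "inverse _"] mmul_scale_left mmul_sum_left R_mult mmul_assoc)
  finally show ?thesis .
qed

lemma avg_intertwiner:
  assumes A: "supp_in Y X A"
  shows "intertwiner H Y S X R (avg A)"
proof -
  have "supp_in Y X (avg A)"
  proof -
    have "avg A y x = 0" if "y \<notin> Y \<or> x \<notin> X" for y x
    proof -
      have "mmul Y (S h) (mmul X A (R (inv h))) y x = 0" if h: "h \<in> carrier H" for h
      proof -
        have "supp_in Y X (mmul Y (S h) (mmul X A (R (inv h))))"
          using S R A h by (auto intro!: supp_in_mmul simp: mat_rep_def)
        then show ?thesis using \<open>y \<notin> Y \<or> x \<notin> X\<close> by (rule supp_in_zero)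
      qed
      then show ?thesis by (simp add: avg_def)
    qed
    then show ?thesis by (auto simp: supp_in_def)
  qed
  moreover have "mmul Y (S \<one>) (avg A) = avg A"
    unfolding avg_def divide_inverse
    by (simp add: mult.commute[of _ "inverse _"] mmul_scale_right mmul_sum_right mmul_assoc[symmetric] S_mult[symmetric])
  ultimately show ?thesis using avg_equivariant by (simp add: intertwiner_def)
qed

lemma avg_fixed:
  assumes "intertwiner H Y S X R A"
  shows "avg A = A"
proof -
  have "mmul Y (S h) (mmul X A (R (inv h))) = A" if h: "h \<in> carrier H" for h
  proof -
    have "mmul Y (S h) (mmul X A (R (inv h))) = mmul Y (S h) (mmul Y (S (inv h)) A)"
      using assms h by (simp add: intertwiner_def)
    also have "\<dots> = mmul Y (S (h \<otimes> inv h)) A"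
      using h by (simp only: mmul_assoc[symmetric] S_mult inv_closed)
    also have "\<dots> = A" using assms h by (simp add: intertwiner_def)
    finally show ?thesis .
  qed
  then show ?thesis using card_nonzero by (simp add: avg_def)
qed

lemma avg_averaging:
  "avg A y x = (\<Sum>(y',x')\<in>Y \<times> X. averaging H S R (y,x) (y',x') * A y' x')"
proof -
  have "(\<Sum>h\<in>carrier H. mmul Y (S h) (mmul X A (R (inv h))) y x)
     = (\<Sum>h\<in>carrier H. \<Sum>z\<in>Y \<times> X. S h y (fst z) * R (inv h) (snd z) x * A (fst z) (snd z))"
    by (simp add: mmul_def sum_distrib_left sum.cartesian_product case_prod_unfold mult_ac)
  also have "\<dots> = (\<Sum>z\<in>Y \<times> X. \<Sum>h\<in>carrier H. S h y (fst z) * R (inv h) (snd z) x * A (fst z) (snd z))"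
    by (rule sum.swap)
  finally have *: "(\<Sum>h\<in>carrier H. mmul Y (S h) (mmul X A (R (inv h))) y x)
     = (\<Sum>z\<in>Y \<times> X. \<Sum>h\<in>carrier H. S h y (fst z) * R (inv h) (snd z) x * A (fst z) (snd z))" .
  have "(\<Sum>(y',x')\<in>Y \<times> X. averaging H S R (y,x) (y',x') * A y' x')
     = (\<Sum>z\<in>Y \<times> X. \<Sum>h\<in>carrier H. S h y (fst z) * R (inv h) (snd z) x * A (fst z) (snd z)) / of_nat (card (carrier H))"
    by (simp add: averaging_def case_prod_unfold sum_divide_distrib sum_distrib_right)
  then show ?thesis by (simp add: avg_def *)
qed

lemma averaging_column:
  assumes "y' \<in> Y" "x' \<in> X"
  shows "averaging H S R (y, x) (y', x') = avg (\<lambda>a b. if a = y' \<and> b = x' then 1 else 0) y x"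
proof -
  have "avg (\<lambda>a b. if a = y' \<and> b = x' then 1 else 0) y x
    = (\<Sum>z\<in>Y \<times> X. if z = (y',x') then averaging H S R (y,x) z else 0)"
    unfolding avg_averaging by (intro sum.cong) (auto split: if_splits)
  also have "\<dots> = averaging H S R (y, x) (y', x')" using assms finX finY by simp
  finally show ?thesis by simp
qed

lemma averaging_column_intertwiner:
  assumes "y' \<in> Y" "x' \<in> X"
  shows "intertwiner H Y S X R (\<lambda>y x. averaging H S R (y, x) (y', x'))"
  using avg_intertwiner[of "\<lambda>a b. if a = y' \<and> b = x' then 1 else 0"] assms
  by (simp add: averaging_column supp_in_def)

lemma averaging_idem:
  assumes "z \<in> Y \<times> X" "z' \<in> Y \<times> X"
  shows "(\<Sum>c\<in>Y \<times> X. averaging H S R z c * averaging H S R c z') = averaging H S R z z'"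
proof -
  obtain y x y' x' where z: "z = (y,x)" "z' = (y',x')" "y' \<in> Y" "x' \<in> X" using assms by auto
  have "avg (\<lambda>y x. averaging H S R (y, x) (y', x')) y x = averaging H S R (y, x) (y', x')"
    using avg_fixed[OF averaging_column_intertwiner[OF z(3,4)]] by simp
  then show ?thesis by (simp add: avg_averaging z case_prod_unfold)
qed

text \<open>
  The averaging projection has trace 0 only if it vanishes, and it fixes every intertwiner.
\<close>
lemma multiplicity_nonzero_iff:
  "multiplicity H Y S X R \<noteq> 0 \<longleftrightarrow> (\<exists>A. intertwiner H Y S X R A \<and> A \<noteq> (\<lambda>_ _. 0))"
proof
  assume "multiplicity H Y S X R \<noteq> 0"
  then obtain y x where "y \<in> Y" "x \<in> X" "averaging H S R (y,x) (y,x) \<noteq> 0"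
    unfolding averaging_trace[symmetric] by (metis (no_types, lifting) SigmaE sum.neutral)
  then show "\<exists>A. intertwiner H Y S X R A \<and> A \<noteq> (\<lambda>_ _. 0)"
    using averaging_column_intertwiner by (metis (mono_tags, lifting))
next
  assume "\<exists>A. intertwiner H Y S X R A \<and> A \<noteq> (\<lambda>_ _. 0)"
  then obtain A y x where A: "intertwiner H Y S X R A" "A y x \<noteq> 0" by (metis ext)
  then have yx: "y \<in> Y" "x \<in> X" by (auto simp: intertwiner_def supp_in_def)
  show "multiplicity H Y S X R \<noteq> 0"
  proof
    assume "multiplicity H Y S X R = 0"
    then have "averaging H S R z c = 0" if "z \<in> Y \<times> X" "c \<in> Y \<times> X" for z c
      using idempotent_trace_0[of "Y \<times> X" "averaging H S R"] finX finY averaging_idem that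
      by (auto simp: averaging_trace)
    then have "avg A y x = 0" using yx by (simp add: avg_averaging case_prod_unfold)
    then show False using A by (simp add: avg_fixed)
  qed
qed

text \<open>
  A projection of trace 1 has the form \<open>u \<otimes> w\<close>, so all intertwiners are multiples of \<open>u\<close>.
\<close>
lemma multiplicity_one_proportional:
  assumes "multiplicity H Y S X R = 1" "intertwiner H Y S X R A" "intertwiner H Y S X R B" "B \<noteq> (\<lambda>_ _. 0)"
  shows "\<exists>c. A = (\<lambda>y x. c * B y x)"
proof -
  obtain u w where uw: "\<And>z c. z \<in> Y \<times> X \<Longrightarrow> c \<in> Y \<times> X \<Longrightarrow> averaging H S R z c = u z * w c"
    using idempotent_trace_1[of "Y \<times> X" "averaging H S R"] finX finY averaging_idem assms(1)
    by (auto simp: averaging_trace)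
  have *: "C y x = u (y,x) * (\<Sum>z\<in>Y \<times> X. w z * C (fst z) (snd z))"
    if "intertwiner H Y S X R C" "y \<in> Y" "x \<in> X" for C y x
  proof -
    have "C y x = avg C y x" using that by (simp add: avg_fixed)
    also have "\<dots> = (\<Sum>z\<in>Y \<times> X. u (y,x) * (w z * C (fst z) (snd z)))"
      unfolding avg_averaging case_prod_unfold using that uw by (intro sum.cong) (auto simp: mult.assoc)
    finally show ?thesis by (simp add: sum_distrib_left)
  qed
  define a where "a = (\<Sum>z\<in>Y \<times> X. w z * A (fst z) (snd z))"
  define b where "b = (\<Sum>z\<in>Y \<times> X. w z * B (fst z) (snd z))"
  obtain y x where yx: "B y x \<noteq> 0" using assms(4) by (metis ext)
  then have "y \<in> Y" "x \<in> X" using assms(3) by (auto simp: intertwiner_def supp_in_def)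
  then have b: "b \<noteq> 0" using *[OF assms(3)] yx by (auto simp: b_def)
  have "A y x = a / b * B y x" for y x
  proof (cases "y \<in> Y \<and> x \<in> X")
    case True
    then show ?thesis using *[OF assms(3)] *[OF assms(2)] b by (simp add: a_def[symmetric] b_def[symmetric])
  next
    case False
    then have "A y x = 0" "B y x = 0"
      using assms(2,3) supp_in_zero[of Y X _ y x] by (auto simp: intertwiner_def)
    then show ?thesis by simp
  qed
  then show ?thesis by blast
qed

lemma multiplicity_one_if_proportional:
  assumes B: "intertwiner H Y S X R B" "B \<noteq> (\<lambda>_ _. 0)"
    and scal: "\<And>A. intertwiner H Y S X R A \<Longrightarrow> \<exists>c. A = (\<lambda>y x. c * B y x)"
  shows "multiplicity H Y S X R = 1"
proof -
  have "\<exists>c. \<forall>z\<in>Y \<times> X. \<forall>y x. averaging H S R (y,x) z = c z * B y x"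
  proof (intro bchoice ballI)
    fix z assume "z \<in> Y \<times> X"
    then obtain y' x' where z: "z = (y',x')" "y' \<in> Y" "x' \<in> X" by auto
    obtain c where "(\<lambda>y x. averaging H S R (y,x) z) = (\<lambda>y x. c * B y x)"
      using scal[OF averaging_column_intertwiner[OF z(2,3)]] z(1) by auto
    then show "\<exists>c. \<forall>y x. averaging H S R (y, x) z = c * B y x" by metis
  qed
  then obtain c where c: "\<And>z y x. z \<in> Y \<times> X \<Longrightarrow> averaging H S R (y,x) z = c z * B y x"
    by metis
  obtain y x where yx: "B y x \<noteq> 0" using B(2) by (metis ext)
  have "B y x = avg B y x" using B by (simp add: avg_fixed)
  also have "\<dots> = (\<Sum>z\<in>Y \<times> X. B y x * (c z * B (fst z) (snd z)))"
    unfolding avg_averaging case_prod_unfold by (intro sum.cong) (auto simp: c)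
  also have "\<dots> = B y x * (\<Sum>z\<in>Y \<times> X. c z * B (fst z) (snd z))" by (simp add: sum_distrib_left)
  finally have "(\<Sum>z\<in>Y \<times> X. c z * B (fst z) (snd z)) = 1" using yx by simp
  moreover have "averaging H S R z z = c z * B (fst z) (snd z)" if "z \<in> Y \<times> X" for z
    using c[OF that, of "fst z" "snd z"] by simp
  ultimately show ?thesis by (simp add: averaging_trace[symmetric])
qed

end

lemma multiplicity_sym:
  assumes H: "group H"
  shows "multiplicity H Y S X R = multiplicity H X R Y S"
proof -
  interpret group H by fact
  have "(\<Sum>h\<in>carrier H. mtrace Y (S h) * mtrace X (R (inv\<^bsub>H\<^esub> h)))
      = (\<Sum>h\<in>carrier H. mtrace X (R h) * mtrace Y (S (inv\<^bsub>H\<^esub> h)))"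
    by (rule sum.reindex_bij_witness[of _ "m_inv H" "m_inv H"]) (auto simp: mult.commute)
  then show ?thesis by (simp add: multiplicity_def)
qed

definition id_mat :: "'x set \<Rightarrow> 'x \<Rightarrow> 'x \<Rightarrow> 'k::zero_neq_one" where
  "id_mat X = (\<lambda>x y. if x = y \<and> x \<in> X then 1 else 0)"

lemma mmul_id_left: "finite X \<Longrightarrow> supp_in X Y A \<Longrightarrow> mmul X (id_mat X) A = A"
  for A :: "'x \<Rightarrow> 'y \<Rightarrow> 'k::comm_semiring_1"
proof (intro ext)
  fix x y assume A: "finite X" "supp_in X Y A"
  have "mmul X (id_mat X) A x y = (\<Sum>z\<in>X. if z = x then A x y else 0)"
    unfolding mmul_def by (intro sum.cong) (auto simp: id_mat_def)
  then show "mmul X (id_mat X) A x y = A x y" using A by (auto simp: supp_in_def)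
qed

lemma mmul_id_right: "finite X \<Longrightarrow> supp_in Y X A \<Longrightarrow> mmul X A (id_mat X) = A"
  for A :: "'y \<Rightarrow> 'x \<Rightarrow> 'k::comm_semiring_1"
proof (intro ext)
  fix y x assume A: "finite X" "supp_in Y X A"
  have "mmul X A (id_mat X) y x = (\<Sum>z\<in>X. if z = x then A y x else 0)"
    unfolding mmul_def by (intro sum.cong) (auto simp: id_mat_def)
  then show "mmul X A (id_mat X) y x = A y x" using A by (auto simp: supp_in_def)
qed

lemma supp_in_id: "supp_in X X (id_mat X)"
  by (auto simp: supp_in_def id_mat_def)

lemma intertwiner_mmul:
  fixes A :: "'z \<Rightarrow> 'y \<Rightarrow> 'k::comm_semiring_1"
  assumes "intertwiner H Z T Y S A" "intertwiner H Y S X R B"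
  shows "intertwiner H Z T X R (mmul Y A B)"
  using assms unfolding intertwiner_def
  by (auto intro: supp_in_mmul simp: mmul_assoc[symmetric]) (simp add: mmul_assoc)

text \<open>
  A representation of character norm one has only scalar endomorphisms, so averaging a suitable
  elementary matrix against a nonzero intertwiner yields a left inverse of it.
\<close>
lemma (in rep_pair) left_inverse:
  assumes one: "R \<one> = id_mat X" and irr: "multiplicity H X R X R = 1"
    and A: "intertwiner H Y S X R A" "A \<noteq> (\<lambda>_ _. 0)"
  obtains C where "intertwiner H X R Y S C" "mmul Y C A = id_mat X"
proof -
  interpret dual: rep_pair H X R Y S using finH S R by unfold_locales auto
  interpret self: rep_pair H X R X R using finH R by unfold_locales auto
  obtain y x where yx: "A y x \<noteq> 0" using A(2) by (metis ext)
  then have mem: "y \<in> Y" "x \<in> X" using A(1) by (auto simp: intertwiner_def supp_in_def)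
  \<comment> \<open>The trace of \<open>C0 A\<close> is the entry \<open>A y x\<close>, and averaging \<open>C0\<close> does not change this trace.\<close>
  define C0 :: "'x \<Rightarrow> 'y \<Rightarrow> 'k" where "C0 = (\<lambda>a b. if a = x \<and> b = y then 1 else 0)"
  define C where "C = dual.avg C0"
  have C: "intertwiner H X R Y S C"
    unfolding C_def by (rule dual.avg_intertwiner) (auto simp: supp_in_def C0_def mem split: if_splits)
  have id: "intertwiner H X R X R (id_mat X)"
    using R finX mmul_id_left[OF finX supp_in_id]
    by (auto simp: intertwiner_def mat_rep_def supp_in_id one mmul_id_left mmul_id_right)
  have id0: "id_mat X \<noteq> (\<lambda>_ _. 0 :: 'k)"
    using mem by (auto simp: id_mat_def fun_eq_iff intro!: exI[of _ x])
  obtain c where c: "mmul Y C A = (\<lambda>a b. c * id_mat X a b)"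
    using self.multiplicity_one_proportional[OF irr intertwiner_mmul[OF C A(1)] id id0] by blast
  have "mtrace X (mmul Y C A) = A y x"
  proof -
    have "mtrace X (mmul Y (mmul X (R h) (mmul Y C0 (S (inv h)))) A) = A y x" if h: "h \<in> carrier H" for h
    proof -
      have "mtrace X (mmul Y (mmul X (R h) (mmul Y C0 (S (inv h)))) A)
         = mtrace X (mmul X (R h) (mmul Y C0 (mmul Y (S (inv h)) A)))" by (simp add: mmul_assoc)
      also have "\<dots> = mtrace X (mmul X (R h) (mmul Y C0 (mmul X A (R (inv h)))))"
        using A(1) h by (simp add: intertwiner_def)
      also have "\<dots> = mtrace X (mmul X (mmul Y C0 A) (R (inv h \<otimes> h)))"
        unfolding R_mult[OF inv_closed[OF h] h] mtrace_mmul[of X X "R h"] mmul_assoc by (rule refl)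
      also have "\<dots> = mtrace X (mmul Y C0 A)"
      proof -
        have "supp_in X X (mmul Y C0 A)"
          using A(1) mem by (intro supp_in_mmul[where Y=Y]) (auto simp: intertwiner_def supp_in_def C0_def split: if_splits)
        then show ?thesis using h finX by (simp add: one mmul_id_right)
      qed
      also have "\<dots> = (\<Sum>a\<in>X. if a = x then A y x else 0)"
      proof -
        have "mmul Y C0 A a a = (if a = x then A y x else 0)" for a
        proof -
          have "mmul Y C0 A a a = (\<Sum>b\<in>Y. if b = y then (if a = x then A y x else 0) else 0)"
            unfolding mmul_def C0_def by (intro sum.cong) auto
          then show ?thesis using mem finY by simp
        qed
        then show ?thesis by (simp add: mtrace_def)
      qed
      also have "\<dots> = A y x" using mem finX by simp
      finally show ?thesis .
    qed
    then have "(\<Sum>h\<in>carrier H. mtrace X (mmul Y (mmul X (R h) (mmul Y C0 (S (inv h)))) A))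
        = of_nat (card (carrier H)) * A y x" by simp
    moreover have "mtrace X (mmul Y C A)
        = (\<Sum>h\<in>carrier H. mtrace X (mmul Y (mmul X (R h) (mmul Y C0 (S (inv h)))) A)) / of_nat (card (carrier H))"
      unfolding C_def dual.avg_def divide_inverse
      by (simp add: mult.commute[of _ "inverse _"] mmul_scale_left mmul_sum_left mtrace_def
          sum_distrib_left[symmetric] sum.swap[of _ X])
    ultimately show ?thesis using card_nonzero by simp
  qed
  then have "c \<noteq> 0" using yx c by (auto simp: mtrace_def)
  define C' where "C' = (\<lambda>a b. inverse c * C a b)"
  have "intertwiner H X R Y S C'"
    using C unfolding C'_def intertwiner_def mmul_scale_left mmul_scale_right
    by (auto simp: supp_in_def)
  moreover have "mmul Y C' A = id_mat X"
    unfolding C'_def mmul_scale_left using c \<open>c \<noteq> 0\<close> by (simp add: mult.assoc[symmetric])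
  ultimately show ?thesis by (rule that)
qed

lemma (in rep_pair) inverse_intertwiner:
  assumes one: "R \<one> = id_mat X" "S \<one> = id_mat Y"
    and irr: "multiplicity H X R X R = 1" "multiplicity H Y S Y S = 1"
    and A: "intertwiner H Y S X R A" "A \<noteq> (\<lambda>_ _. 0)"
  obtains C where "intertwiner H X R Y S C" "mmul Y C A = id_mat X" "mmul X A C = id_mat Y"
proof -
  interpret dual: rep_pair H X R Y S using finH S R by unfold_locales auto
  obtain C where C: "intertwiner H X R Y S C" "mmul Y C A = id_mat X"
    using left_inverse[OF one(1) irr(1) A] by blast
  have "C \<noteq> (\<lambda>_ _. 0)"
  proof
    assume "C = (\<lambda>_ _. 0)"
    then have "id_mat X = (\<lambda>_ _. 0 :: 'k)" using C(2) by (simp add: mmul_def fun_eq_iff)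
    moreover obtain y x where "A y x \<noteq> 0" using A(2) by (metis ext)
    moreover have "A = mmul X A (id_mat X)"
      using A(1) finX mmul_id_right[of X Y A] by (simp add: intertwiner_def)
    ultimately show False by (metis (no_types, lifting) mmul_def mult_zero_right sum.neutral)
  qed
  then obtain D where D: "intertwiner H Y S X R D" "mmul X D C = id_mat Y"
    using dual.left_inverse[OF one(2) irr(2) C(1)] by blast
  have "mmul X A C = mmul Y (mmul X D C) (mmul X A C)"
  proof -
    have "supp_in Y X A" "supp_in X Y C" using A(1) C(1) by (simp_all add: intertwiner_def)
    from mmul_id_left[OF finY supp_in_mmul[OF this]] show ?thesis unfolding D(2) by (rule sym)
  qed
  also have "\<dots> = mmul X D (mmul X (mmul Y C A) C)" by (simp add: mmul_assoc)
  also have "mmul X (mmul Y C A) C = C"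
    unfolding C(2) using C(1) by (intro mmul_id_left[OF finX, of Y]) (simp add: intertwiner_def)
  also have "mmul X D C = id_mat Y" by (rule D(2))
  finally show ?thesis using C that by blast
qed

lemma mtrace_conj:
  fixes A :: "'y \<Rightarrow> 'x \<Rightarrow> 'k::comm_semiring_1"
  assumes "finite Y" "mmul Y T A = mmul X A R" "mmul X A C = id_mat Y" "mmul Y C A = id_mat X"
    "supp_in Y Y T" "supp_in X X R" "finite X"
  shows "mtrace Y T = mtrace X R"
proof -
  have "mmul X (mmul Y T A) C = mmul Y T (id_mat Y)" by (simp only: mmul_assoc assms(3))
  then have "mtrace Y T = mtrace Y (mmul X (mmul Y T A) C)"
    by (simp only: mmul_id_right[OF assms(1,5)])
  also have "\<dots> = mtrace X (mmul Y C (mmul X A R))" unfolding assms(2) by (rule mtrace_mmul)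
  also have "mmul Y C (mmul X A R) = R"
    by (simp only: mmul_assoc[symmetric] assms(4) mmul_id_left[OF assms(7,6)])
  finally show ?thesis .
qed

section \<open>Systems of vectors and linear forms\<close>
definition lin_fun :: "('k::field, 'v) module \<Rightarrow> ('v \<Rightarrow> 'k) \<Rightarrow> bool" where
  "lin_fun W f \<longleftrightarrow> (\<forall>u\<in>carrier W. (\<forall>w\<in>carrier W. f (u \<oplus>\<^bsub>W\<^esub> w) = f u + f w) \<and>
                                (\<forall>c. f (c \<odot>\<^bsub>W\<^esub> u) = c * f u))"

definition lin_closed :: "('k::field, 'v) module \<Rightarrow> bool" where
  "lin_closed W \<longleftrightarrow> (\<forall>u\<in>carrier W. (\<forall>w\<in>carrier W. u \<oplus>\<^bsub>W\<^esub> w \<in> carrier W) \<and>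
                                (\<forall>c. c \<odot>\<^bsub>W\<^esub> u \<in> carrier W))"

text \<open>
  A resolution of the identity of \<open>F\<close>, as given by a basis and its coordinate forms. The elements of \<open>D\<close>
  need not be vectors (they are tuples for tensor products), and redundant families \<open>w\<close> are allowed,
  since symmetric powers are described by one.
\<close>
definition dual_system :: "'x set \<Rightarrow> ('x \<Rightarrow> 'k::field) set \<Rightarrow> 'j set \<Rightarrow> ('j \<Rightarrow> 'x) \<Rightarrow> ('j \<Rightarrow> 'x \<Rightarrow> 'k) \<Rightarrow> bool" where
  "dual_system D F J w e \<longleftrightarrow> finite J \<and> w \<in> J \<rightarrow> D \<and> e \<in> J \<rightarrow> F \<and>
     (\<forall>f\<in>F. \<forall>v\<in>D. f v = (\<Sum>j\<in>J. e j v * f (w j)))"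

abbreviation lin_system :: "('k::field, 'v) module \<Rightarrow> 'j set \<Rightarrow> ('j \<Rightarrow> 'v) \<Rightarrow> ('j \<Rightarrow> 'v \<Rightarrow> 'k) \<Rightarrow> bool" where
  "lin_system W \<equiv> dual_system (carrier W) {f. lin_fun W f}"

text \<open>
  The maps of \<open>D\<close> which induce a linear map on the dual space of \<open>F\<close>, namely their push-forward.
\<close>
definition admissible :: "'x set \<Rightarrow> ('x \<Rightarrow> 'k) set \<Rightarrow> ('x \<Rightarrow> 'x) \<Rightarrow> bool" where
  "admissible D F T \<longleftrightarrow> T \<in> D \<rightarrow> D \<and> (\<forall>f\<in>F. (\<lambda>v\<in>D. f (T v)) \<in> F)"

definition smat :: "'j set \<Rightarrow> ('j \<Rightarrow> 'x) \<Rightarrow> ('j \<Rightarrow> 'x \<Rightarrow> 'k::zero) \<Rightarrow> ('x \<Rightarrow> 'x) \<Rightarrow> 'j \<Rightarrow> 'j \<Rightarrow> 'k" where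
  "smat J w e T = (\<lambda>i j. if i \<in> J \<and> j \<in> J then e i (T (w j)) else 0)"

lemma supp_in_smat: "supp_in J J (smat J w e T)"
  by (auto simp: supp_in_def smat_def)

lemma smat_comp:
  assumes ds: "dual_system D F J w e" and T: "\<And>f. f \<in> F \<Longrightarrow> (\<lambda>v\<in>D. f (T v)) \<in> F" and S: "S \<in> D \<rightarrow> D"
  shows "smat J w e (T \<circ> S) = mmul J (smat J w e T) (smat J w e S)"
proof (intro ext)
  fix i j
  show "smat J w e (T \<circ> S) i j = mmul J (smat J w e T) (smat J w e S) i j"
  proof (cases "i \<in> J \<and> j \<in> J")
    case True
    then have f: "(\<lambda>v\<in>D. e i (T v)) \<in> F" and w: "w \<in> J \<rightarrow> D"
      using ds T by (auto simp: dual_system_def)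
    with True S have "S (w j) \<in> D" by auto
    with f ds have "(\<lambda>v\<in>D. e i (T v)) (S (w j)) = (\<Sum>k\<in>J. e k (S (w j)) * (\<lambda>v\<in>D. e i (T v)) (w k))"
      by (auto simp: dual_system_def)
    then have "e i (T (S (w j))) = (\<Sum>k\<in>J. e k (S (w j)) * e i (T (w k)))"
      using \<open>S (w j) \<in> D\<close> w by (simp add: Pi_iff)
    then show ?thesis using True by (simp add: smat_def mmul_def mult.commute)
  next
    case False
    then show ?thesis by (auto simp: smat_def mmul_def)
  qed
qed

lemma admissible_comp: "admissible D F T \<Longrightarrow> admissible D F S \<Longrightarrow> admissible D F (T \<circ> S)"
proof -
  assume T: "admissible D F T" and S: "admissible D F S"
  have "(\<lambda>v\<in>D. f ((T \<circ> S) v)) \<in> F" if "f \<in> F" for f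
  proof -
    have "(\<lambda>v\<in>D. f (T v)) \<in> F" using T that unfolding admissible_def by blast
    then have "(\<lambda>v\<in>D. (\<lambda>v\<in>D. f (T v)) (S v)) \<in> F" using S unfolding admissible_def by blast
    also have "(\<lambda>v\<in>D. (\<lambda>v\<in>D. f (T v)) (S v)) = (\<lambda>v\<in>D. f ((T \<circ> S) v))"
      using S by (auto simp: admissible_def fun_eq_iff)
    finally show ?thesis .
  qed
  then show ?thesis using T S by (auto simp: admissible_def)
qed

lemma smat_mult:
  "dual_system D F J w e \<Longrightarrow> admissible D F T \<Longrightarrow> admissible D F S \<Longrightarrow>
   smat J w e (T \<circ> S) = mmul J (smat J w e T) (smat J w e S)"
  by (rule smat_comp) (auto simp: admissible_def)

lemma smat_cong:
  "w \<in> J \<rightarrow> D \<Longrightarrow> (\<And>v. v \<in> D \<Longrightarrow> T v = S v) \<Longrightarrow> smat J w e T = smat J w e S"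
  by (auto simp: smat_def fun_eq_iff Pi_iff)

section \<open>Traces of endomorphisms\<close>

lemma lin_closed_module: "Module.module class_ring W \<Longrightarrow> lin_closed W"
  by (auto simp: lin_closed_def Module.module.smult_closed abelian_monoid.a_closed
      Module.module_def abelian_group_def dest: Module.module.smult_closed)

lemma lin_fun_zero:
  assumes "Module.module class_ring W" "lin_fun W f"
  shows "f \<zero>\<^bsub>W\<^esub> = 0"
proof -
  interpret Module.module class_ring W by fact
  have "f (\<zero>\<^bsub>W\<^esub> \<oplus>\<^bsub>W\<^esub> \<zero>\<^bsub>W\<^esub>) = f \<zero>\<^bsub>W\<^esub> + f \<zero>\<^bsub>W\<^esub>"
    using assms(2) M.zero_closed unfolding lin_fun_def by blast
  then have "f \<zero>\<^bsub>W\<^esub> = f \<zero>\<^bsub>W\<^esub> + f \<zero>\<^bsub>W\<^esub>" by simp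
  then show ?thesis by (simp only: add_cancel_right_right)
qed

lemma lin_fun_finsum:
  assumes "Module.module class_ring W" "lin_fun W f" "finite I" "g \<in> I \<rightarrow> carrier W"
  shows "f (finsum W g I) = (\<Sum>i\<in>I. f (g i))"
proof -
  interpret Module.module class_ring W by fact
  show ?thesis using assms(3,4)
  proof (induction I rule: finite_induct)
    case empty
    then show ?case using lin_fun_zero[OF assms(1,2)] by simp
  next
    case (insert x I)
    then show ?case using assms(2) by (simp add: lin_fun_def Pi_iff M.finsum_closed)
  qed
qed

lemma coords_properties:
  assumes "vectorspace class_ring W" "finite B" "vectorspace.basis class_ring W B" "v \<in> carrier W"
  shows "coords W B v \<in> B \<rightarrow>\<^sub>E UNIV" "module.lincomb W (coords W B v) B = v"
    and "\<And>a. a \<in> B \<rightarrow>\<^sub>E UNIV \<Longrightarrow> module.lincomb W a B = v \<Longrightarrow> coords W B v = a"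
proof -
  interpret vectorspace class_ring W by fact
  have "B \<subseteq> carrier W" using assms(3) by (simp add: basis_def)
  then have ex: "\<exists>!a. a \<in> B \<rightarrow>\<^sub>E UNIV \<and> lincomb a B = v"
    using basis_criterion[OF assms(2)] assms(3,4) by auto
  then show "coords W B v \<in> B \<rightarrow>\<^sub>E UNIV" "lincomb (coords W B v) B = v"
    using theI'[OF ex] by (simp_all add: coords_def)
  show "coords W B v = a" if "a \<in> B \<rightarrow>\<^sub>E UNIV" "lincomb a B = v" for a
    unfolding coords_def by (rule the1_equality[OF ex]) (use that in simp)
qed

lemma lin_system_basis:
  assumes "vectorspace class_ring W" "finite B" "vectorspace.basis class_ring W B"
  shows "lin_system W B (\<lambda>b. b) (\<lambda>b v. coords W B v b)"
proof -
  interpret vectorspace class_ring W by fact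
  have sub: "B \<subseteq> carrier W" using assms(3) by (simp add: basis_def)
  note c = coords_properties[OF assms]
  have m: "Module.module class_ring W" ..
  have add: "coords W B (u \<oplus>\<^bsub>W\<^esub> v) = (\<lambda>b\<in>B. coords W B u b + coords W B v b)"
    if "u \<in> carrier W" "v \<in> carrier W" for u v
  proof (rule c(3))
    have "lincomb (\<lambda>b\<in>B. coords W B u b + coords W B v b) B = lincomb (\<lambda>b. coords W B u b + coords W B v b) B"
      unfolding lincomb_def using sub by (intro M.finsum_cong') auto
    also have "\<dots> = lincomb (coords W B u) B \<oplus>\<^bsub>W\<^esub> lincomb (coords W B v) B"
    proof -
      have "lincomb (\<lambda>b. coords W B u b + coords W B v b) B
          = (\<Oplus>\<^bsub>W\<^esub>b\<in>B. coords W B u b \<odot>\<^bsub>W\<^esub> b \<oplus>\<^bsub>W\<^esub> coords W B v b \<odot>\<^bsub>W\<^esub> b)"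
        unfolding lincomb_def
      proof (rule M.finsum_cong')
        fix b assume "b \<in> B"
        then have "b \<in> carrier W" using sub by auto
        then show "(coords W B u b + coords W B v b) \<odot>\<^bsub>W\<^esub> b
            = coords W B u b \<odot>\<^bsub>W\<^esub> b \<oplus>\<^bsub>W\<^esub> coords W B v b \<odot>\<^bsub>W\<^esub> b"
          using smult_l_distr[of "coords W B u b" "coords W B v b" b] by simp
      qed (use sub in auto)
      also have "\<dots> = lincomb (coords W B u) B \<oplus>\<^bsub>W\<^esub> lincomb (coords W B v) B"
        unfolding lincomb_def using sub by (intro M.finsum_addf) auto
      finally show ?thesis .
    qed
    finally show "lincomb (\<lambda>b\<in>B. coords W B u b + coords W B v b) B = u \<oplus>\<^bsub>W\<^esub> v"
      using that c by simp
  qed (use that in auto)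
  have scale: "coords W B (k \<odot>\<^bsub>W\<^esub> u) = (\<lambda>b\<in>B. k * coords W B u b)"
    if "u \<in> carrier W" for u k
  proof (rule c(3))
    have "lincomb (\<lambda>b\<in>B. k * coords W B u b) B = lincomb (\<lambda>b. k * coords W B u b) B"
      unfolding lincomb_def using sub by (intro M.finsum_cong') auto
    also have "\<dots> = k \<odot>\<^bsub>W\<^esub> lincomb (coords W B u) B"
      unfolding lincomb_def using sub assms(2)
      by (subst finsum_smult) (auto intro!: M.finsum_cong' simp: smult_assoc1[simplified] subset_iff)
    finally show "lincomb (\<lambda>b\<in>B. k * coords W B u b) B = k \<odot>\<^bsub>W\<^esub> u"
      using that c by simp
  qed (use that in auto)
  have "f v = (\<Sum>b\<in>B. coords W B v b * f b)" if f: "lin_fun W f" and v: "v \<in> carrier W" for f v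
  proof -
    have "f v = f (lincomb (coords W B v) B)" using c v by simp
    also have "\<dots> = (\<Sum>b\<in>B. f (coords W B v b \<odot>\<^bsub>W\<^esub> b))"
      unfolding lincomb_def using sub by (intro lin_fun_finsum[OF m f assms(2)]) auto
    also have "\<dots> = (\<Sum>b\<in>B. coords W B v b * f b)"
      using f sub by (intro sum.cong) (auto simp: lin_fun_def subset_iff)
    finally show ?thesis .
  qed
  then show ?thesis using sub assms(2) by (auto simp: dual_system_def lin_fun_def add scale)
qed

lemma admissible_linear:
  assumes "lin_closed W" "T \<in> module_hom class_ring W W"
  shows "admissible (carrier W) {f. lin_fun W f} T"
  using assms by (auto simp: admissible_def lin_fun_def LinearCombinations.module_hom_def lin_closed_def Pi_iff)

text \<open>
  Both traces equal the double sum of \<open>e j b \<cdot> coords (T (w j)) b\<close>: expand \<open>b\<close> by \<open>w\<close> on the one hand, and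
  \<open>T (w j)\<close> by the basis on the other. So a redundant system gives the right trace, too.
\<close>
lemma endo_trace_lin_system:
  assumes W: "vectorspace class_ring W" "vectorspace.fin_dim class_ring W"
    and ls: "lin_system W J w e" and T: "T \<in> module_hom class_ring W W"
  shows "endo_trace W T = mtrace J (smat J w e T)"
proof -
  interpret vectorspace class_ring W by fact
  have m: "Module.module class_ring W" ..
  define B where "B = (SOME B. finite B \<and> basis B)"
  have B: "finite B \<and> basis B" unfolding B_def by (rule someI_ex[OF finite_basis_exists[OF W(2)]])
  note lb = lin_system_basis[OF W(1) conjunct1[OF B] conjunct2[OF B]]
  have sub: "B \<subseteq> carrier W" using B by (simp add: basis_def)
  have wc: "w j \<in> carrier W" and ej: "lin_fun W (e j)" if "j \<in> J" for j
    using ls that by (auto simp: dual_system_def)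
  have Tc: "T v \<in> carrier W" if "v \<in> carrier W" for v using T that by (auto simp: LinearCombinations.module_hom_def)
  have cT: "lin_fun W (\<lambda>v. coords W B (T v) b)" if "b \<in> B" for b
    using lb that T lin_closed_module[OF m] by (auto simp: dual_system_def lin_fun_def LinearCombinations.module_hom_def Pi_iff)
  have "endo_trace W T = (\<Sum>b\<in>B. coords W B (T b) b)" by (simp add: endo_trace_def B_def Let_def)
  also have "\<dots> = (\<Sum>b\<in>B. \<Sum>j\<in>J. e j b * coords W B (T (w j)) b)"
  proof (intro sum.cong refl)
    fix b assume "b \<in> B"
    then have "lin_fun W (\<lambda>v. coords W B (T v) b)" "b \<in> carrier W" using cT sub by auto
    then show "coords W B (T b) b = (\<Sum>j\<in>J. e j b * coords W B (T (w j)) b)"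
      using ls unfolding dual_system_def by fast
  qed
  also have "\<dots> = (\<Sum>j\<in>J. \<Sum>b\<in>B. coords W B (T (w j)) b * e j b)"
    by (subst sum.swap) (simp add: mult.commute)
  also have "\<dots> = (\<Sum>j\<in>J. e j (T (w j)))"
  proof (intro sum.cong refl)
    fix j assume "j \<in> J"
    then have "lin_fun W (e j)" "T (w j) \<in> carrier W" using ej Tc wc by auto
    then have "e j (T (w j)) = (\<Sum>b\<in>B. coords W B (T (w j)) b * e j b)"
      using lb unfolding dual_system_def by fast
    then show "(\<Sum>b\<in>B. coords W B (T (w j)) b * e j b) = e j (T (w j))" by (rule sym)
  qed
  finally show ?thesis by (simp add: mtrace_def smat_def)
qed

text \<open>
  The spaces of forms are spaces of extensional functions, for which the operations of
  \<^const>\<open>form_space\<close> are the pointwise ones.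
\<close>
definition fun_subspace :: "'x set \<Rightarrow> ('x \<Rightarrow> 'k::field) set \<Rightarrow> bool" where
  "fun_subspace D F \<longleftrightarrow> F \<subseteq> D \<rightarrow>\<^sub>E UNIV \<and> (\<lambda>v\<in>D. 0) \<in> F \<and>
     (\<forall>f\<in>F. (\<forall>g\<in>F. (\<lambda>v\<in>D. f v + g v) \<in> F) \<and> (\<forall>c. (\<lambda>v\<in>D. c * f v) \<in> F))"

lemma fun_subspace_sum:
  assumes "fun_subspace D F" "finite J" "\<And>j. j \<in> J \<Longrightarrow> f j \<in> F"
  shows "(\<lambda>v\<in>D. \<Sum>j\<in>J. c j * f j v) \<in> F"
  using assms(2,3)
proof (induction J rule: finite_induct)
  case empty
  have "(\<lambda>v\<in>D. 0) \<in> F" using assms(1) by (simp add: fun_subspace_def)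
  also have "(\<lambda>v\<in>D. 0) = (\<lambda>v\<in>D. \<Sum>j\<in>{}. c j * f j v)" by (rule restrict_ext) simp
  finally show ?case .
next
  case (insert j J)
  have a: "(\<lambda>v\<in>D. c j * f j v) \<in> F" using assms(1) insert.prems by (simp add: fun_subspace_def)
  have "(\<lambda>v\<in>D. \<Sum>j\<in>J. c j * f j v) \<in> F" by (rule insert.IH) (use insert.prems in auto)
  with a have "(\<lambda>v\<in>D. (\<lambda>v\<in>D. c j * f j v) v + (\<lambda>v\<in>D. \<Sum>j\<in>J. c j * f j v) v) \<in> F"
    using assms(1) unfolding fun_subspace_def by blast
  also have "(\<lambda>v\<in>D. (\<lambda>v\<in>D. c j * f j v) v + (\<lambda>v\<in>D. \<Sum>j\<in>J. c j * f j v) v)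
     = (\<lambda>v\<in>D. \<Sum>j\<in>insert j J. c j * f j v)" using insert by (auto simp: fun_eq_iff)
  finally show ?case .
qed

lemma fun_subspace_functional_sum:
  assumes F: "fun_subspace D F" and "finite J" "\<And>j. j \<in> J \<Longrightarrow> f j \<in> F"
    and x: "\<And>f g. f \<in> F \<Longrightarrow> g \<in> F \<Longrightarrow> x (\<lambda>v\<in>D. f v + g v) = x f + x g"
      "\<And>c f. f \<in> F \<Longrightarrow> x (\<lambda>v\<in>D. c * f v) = c * x f"
  shows "x (\<lambda>v\<in>D. \<Sum>j\<in>J. c j * f j v) = (\<Sum>j\<in>J. c j * x (f j))"
  using assms(2,3)
proof (induction J rule: finite_induct)
  case empty
  have "(\<lambda>v\<in>D. 0) \<in> F" using F by (simp add: fun_subspace_def)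
  from x(2)[OF this, of 0] have "0 = x (\<lambda>v\<in>D. 0 * (\<lambda>v\<in>D. 0) v)" by (simp only: mult_zero_left)
  also have "(\<lambda>v\<in>D. 0 * (\<lambda>v\<in>D. 0) v) = (\<lambda>v\<in>D. \<Sum>j\<in>{}. c j * f j v)" by (rule restrict_ext) simp
  finally show ?case by simp
next
  case (insert j J)
  have a: "(\<lambda>v\<in>D. c j * f j v) \<in> F" using F insert.prems by (simp add: fun_subspace_def)
  have b: "(\<lambda>v\<in>D. \<Sum>j\<in>J. c j * f j v) \<in> F" using insert by (intro fun_subspace_sum[OF F]) auto
  have "(\<lambda>v\<in>D. \<Sum>j\<in>insert j J. c j * f j v)
      = (\<lambda>v\<in>D. (\<lambda>v\<in>D. c j * f j v) v + (\<lambda>v\<in>D. \<Sum>j\<in>J. c j * f j v) v)"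
    using insert by (auto simp: fun_eq_iff)
  then have "x (\<lambda>v\<in>D. \<Sum>j\<in>insert j J. c j * f j v) = x (\<lambda>v\<in>D. c j * f j v) + x (\<lambda>v\<in>D. \<Sum>j\<in>J. c j * f j v)"
    by (simp only: x(1)[OF a b])
  also have "x (\<lambda>v\<in>D. c j * f j v) = c j * x (f j)" using insert.prems by (intro x(2)) auto
  also have "x (\<lambda>v\<in>D. \<Sum>j\<in>J. c j * f j v) = (\<Sum>j\<in>J. c j * x (f j))"
    by (rule insert.IH) (use insert.prems in auto)
  finally show ?case using insert.hyps by simp
qed

lemma dual_space_simps:
  "carrier (dual_space (form_space D F)) =
     {x \<in> F \<rightarrow>\<^sub>E UNIV. \<forall>f\<in>F. (\<forall>g\<in>F. x (\<lambda>v\<in>D. f v + g v) = x f + x g) \<and> (\<forall>c. x (\<lambda>v\<in>D. c * f v) = c * x f)}"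
  "x \<oplus>\<^bsub>dual_space (form_space D F)\<^esub> y = (\<lambda>f\<in>F. x f + y f)"
  "c \<odot>\<^bsub>dual_space (form_space D F)\<^esub> x = (\<lambda>f\<in>F. c * x f)"
  "\<zero>\<^bsub>dual_space (form_space D F)\<^esub> = (\<lambda>f\<in>F. 0)"
  by (simp_all add: dual_space_def form_space_def class_ring.func_space_def)

lemma fun_subspace_dual:
  assumes "fun_subspace D F"
  shows "fun_subspace F (carrier (dual_space (form_space D F)))"
  using assms unfolding fun_subspace_def dual_space_simps
  by (auto simp: algebra_simps)

lemma dual_space_vectorspace:
  assumes "fun_subspace D F"
  shows "vectorspace class_ring (dual_space (form_space D F))"
proof -
  have W: "fun_subspace F (carrier (dual_space (form_space D F)))" (is "fun_subspace F ?W")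
    by (rule fun_subspace_dual[OF assms])
  have ext: "x \<in> ?W \<Longrightarrow> (\<lambda>f\<in>F. x f) = x" for x
    using W by (auto simp: fun_subspace_def intro: extensional_restrict)
  show ?thesis
  proof (rule vs_criteria[OF class_field])
    show "\<forall>v\<in>?W. \<exists>nv\<in>?W. v \<oplus>\<^bsub>dual_space (form_space D F)\<^esub> nv = \<zero>\<^bsub>dual_space (form_space D F)\<^esub>"
    proof
      fix v assume "v \<in> ?W"
      then have "(\<lambda>f\<in>F. -1 * v f) \<in> ?W" using W unfolding fun_subspace_def by blast
      then show "\<exists>nv\<in>?W. v \<oplus>\<^bsub>dual_space (form_space D F)\<^esub> nv = \<zero>\<^bsub>dual_space (form_space D F)\<^esub>"
        by (intro bexI[of _ "(\<lambda>f\<in>F. -1 * v f)"]) (auto simp: dual_space_simps(2,4) fun_eq_iff)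
    qed
  qed (use W ext in \<open>auto simp: dual_space_simps(2-) fun_subspace_def fun_eq_iff algebra_simps
        restrict_def cong: if_cong\<close>)
qed

text \<open>
  The evaluations at the \<open>w j\<close> span the dual space of \<open>F\<close>, with evaluation at the \<open>e j\<close> as coordinates.
\<close>
lemma dual_space_lin_system:
  assumes F: "fun_subspace D F" and ds: "dual_system D F J w e"
  shows "lin_system (dual_space (form_space D F)) J (\<lambda>j. \<lambda>f\<in>F. f (w j)) (\<lambda>j x. x (e j))"
    and "vectorspace.fin_dim class_ring (dual_space (form_space D F))"
proof -
  let ?W = "dual_space (form_space D F)"
  let ?w = "\<lambda>j. \<lambda>f\<in>F. f (w j)"
  have J: "finite J" and w: "\<And>j. j \<in> J \<Longrightarrow> w j \<in> D" and e: "\<And>j. j \<in> J \<Longrightarrow> e j \<in> F"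
    and exp: "\<And>f v. f \<in> F \<Longrightarrow> v \<in> D \<Longrightarrow> f v = (\<Sum>j\<in>J. e j v * f (w j))"
    using ds by (auto simp: dual_system_def)
  have W: "fun_subspace F (carrier ?W)" by (rule fun_subspace_dual[OF F])
  have wW: "?w j \<in> carrier ?W" if "j \<in> J" for j
    using F w[OF that] by (auto simp: dual_space_simps fun_subspace_def)
  have x_eq: "x = (\<lambda>f\<in>F. \<Sum>j\<in>J. x (e j) * ?w j f)" if x: "x \<in> carrier ?W" for x
  proof -
    have "x f = (\<Sum>j\<in>J. x (e j) * f (w j))" if f: "f \<in> F" for f
    proof -
      have "f = (\<lambda>v\<in>D. \<Sum>j\<in>J. f (w j) * e j v)"
        using F f exp by (fastforce simp: fun_subspace_def mult.commute PiE_def extensional_def fun_eq_iff)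
      then have "x f = x (\<lambda>v\<in>D. \<Sum>j\<in>J. f (w j) * e j v)" by simp
      also have "\<dots> = (\<Sum>j\<in>J. f (w j) * x (e j))"
        using x unfolding dual_space_simps(1) by (intro fun_subspace_functional_sum[OF F J e]) blast+
      finally show ?thesis by (simp add: mult.commute)
    qed
    moreover have "x \<in> extensional F" using x by (auto simp: dual_space_simps PiE_def)
    ultimately show ?thesis by (auto simp: fun_eq_iff extensional_def)
  qed
  have "g x = (\<Sum>j\<in>J. x (e j) * g (?w j))" if g: "lin_fun ?W g" and x: "x \<in> carrier ?W" for g x
  proof -
    have "g x = g (\<lambda>f\<in>F. \<Sum>j\<in>J. x (e j) * ?w j f)" using x_eq[OF x] by simp
    also have "\<dots> = (\<Sum>j\<in>J. x (e j) * g (?w j))"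
      using g unfolding lin_fun_def dual_space_simps(2,3)
      by (intro fun_subspace_functional_sum[OF W J wW]) blast+
    finally show ?thesis .
  qed
  then show "lin_system ?W J ?w (\<lambda>j x. x (e j))"
    using J wW e by (auto simp: dual_system_def lin_fun_def dual_space_simps(2,3))
  interpret vectorspace class_ring ?W by (rule dual_space_vectorspace[OF F])
  have sub: "?w ` J \<subseteq> carrier ?W" using wW by auto
  interpret sp: submodule class_ring "span (?w ` J)" ?W by (rule span_is_submodule[OF sub])
  have "fun_subspace F (span (?w ` J))"
    unfolding fun_subspace_def
  proof (intro conjI ballI allI)
    show "span (?w ` J) \<subseteq> F \<rightarrow>\<^sub>E UNIV" using W sp.subset unfolding fun_subspace_def by (meson order_trans)
    show "(\<lambda>v\<in>F. 0) \<in> span (?w ` J)" using sp.zero_closed unfolding dual_space_simps .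
    fix f assume f: "f \<in> span (?w ` J)"
    {
      fix g assume "g \<in> span (?w ` J)"
      then show "(\<lambda>v\<in>F. f v + g v) \<in> span (?w ` J)"
        using sp.m_closed[OF f] unfolding dual_space_simps by simp
    }
    fix c
    show "(\<lambda>v\<in>F. c * f v) \<in> span (?w ` J)"
      using sp.smult_closed[of c f] f unfolding dual_space_simps by simp
  qed
  moreover have "?w j \<in> span (?w ` J)" if "j \<in> J" for j
    by (rule subsetD[OF in_own_span[OF sub] imageI[OF that]])
  ultimately have "(\<lambda>f\<in>F. \<Sum>j\<in>J. x (e j) * ?w j f) \<in> span (?w ` J)" for x
    using J by (intro fun_subspace_sum)
  note in_span = this
  have "span (?w ` J) = carrier ?W"
  proof (rule subset_antisym[OF sp.subset subsetI])
    fix x assume "x \<in> carrier ?W"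
    then show "x \<in> span (?w ` J)" by (subst x_eq) (auto simp only: in_span)
  qed
  then show "fin_dim" unfolding fin_dim_def by (intro exI[of _ "?w ` J"] conjI finite_imageI J sub)
qed

lemma endo_trace_push:
  assumes F: "fun_subspace D F" and ds: "dual_system D F J w e" and T: "admissible D F T"
    and P: "\<And>x. x \<in> carrier (dual_space (form_space D F)) \<Longrightarrow> P x = push D F T x"
  shows "endo_trace (dual_space (form_space D F)) P = mtrace J (smat J w e T)"
proof -
  let ?W = "dual_space (form_space D F)"
  let ?w = "\<lambda>j. \<lambda>f\<in>F. f (w j)"
  have closed: "lin_closed ?W"
    using dual_space_vectorspace[OF F] by (intro lin_closed_module) (simp add: vectorspace_def)
  have add: "(\<lambda>v\<in>D. (\<lambda>v\<in>D. f v + g v) (T v)) = (\<lambda>v\<in>D. (\<lambda>v\<in>D. f (T v)) v + (\<lambda>v\<in>D. g (T v)) v)" for f g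
    using T by (auto simp: admissible_def fun_eq_iff)
  have scale: "(\<lambda>v\<in>D. (\<lambda>v\<in>D. c * f v) (T v)) = (\<lambda>v\<in>D. c * (\<lambda>v\<in>D. f (T v)) v)" for f c
    using T by (auto simp: admissible_def fun_eq_iff)
  have pc: "push D F T x \<in> carrier ?W" if x: "x \<in> carrier ?W" for x
  proof -
    have x1: "x (\<lambda>v\<in>D. f v + g v) = x f + x g" if "f \<in> F" "g \<in> F" for f g
      using x that unfolding dual_space_simps(1) by blast
    have x2: "x (\<lambda>v\<in>D. c * f v) = c * x f" if "f \<in> F" for f c
      using x that unfolding dual_space_simps(1) by blast
    have TF: "(\<lambda>v\<in>D. f (T v)) \<in> F" if "f \<in> F" for f using T that unfolding admissible_def by blast
    have F1: "(\<lambda>v\<in>D. f v + g v) \<in> F" if "f \<in> F" "g \<in> F" for f g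
      using F that unfolding fun_subspace_def by blast
    have F2: "(\<lambda>v\<in>D. c * f v) \<in> F" if "f \<in> F" for f c
      using F that unfolding fun_subspace_def by blast
    have p: "push D F T x f = x (\<lambda>v\<in>D. f (T v))" if "f \<in> F" for f using that by (simp add: push_def)
    have "push D F T x (\<lambda>v\<in>D. f v + g v) = push D F T x f + push D F T x g" if "f \<in> F" "g \<in> F" for f g
      using that by (simp only: p F1 add x1 TF)
    moreover have "push D F T x (\<lambda>v\<in>D. c * f v) = c * push D F T x f" if "f \<in> F" for f c
      using that by (simp only: p F2 scale x2 TF)
    moreover have "push D F T x \<in> F \<rightarrow>\<^sub>E UNIV" by (simp add: push_def)
    ultimately show ?thesis unfolding dual_space_simps(1) by blast
  qed
  have "P \<in> module_hom class_ring ?W ?W"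
  proof -
    have "P (x \<oplus>\<^bsub>?W\<^esub> y) = P x \<oplus>\<^bsub>?W\<^esub> P y" if "x \<in> carrier ?W" "y \<in> carrier ?W" for x y
    proof -
      have "P (x \<oplus>\<^bsub>?W\<^esub> y) = push D F T (x \<oplus>\<^bsub>?W\<^esub> y)"
        using that closed by (intro P) (auto simp: lin_closed_def)
      also have "\<dots> = push D F T x \<oplus>\<^bsub>?W\<^esub> push D F T y"
        using T by (auto simp: push_def dual_space_simps(2) admissible_def fun_eq_iff)
      finally show ?thesis using that by (simp add: P)
    qed
    moreover have "P (c \<odot>\<^bsub>?W\<^esub> x) = c \<odot>\<^bsub>?W\<^esub> P x" if "x \<in> carrier ?W" for x c
    proof -
      have "P (c \<odot>\<^bsub>?W\<^esub> x) = push D F T (c \<odot>\<^bsub>?W\<^esub> x)"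
        using that closed by (intro P) (auto simp: lin_closed_def)
      also have "\<dots> = c \<odot>\<^bsub>?W\<^esub> push D F T x"
        using T by (auto simp: push_def dual_space_simps(3) admissible_def fun_eq_iff)
      finally show ?thesis using that by (simp add: P)
    qed
    ultimately show ?thesis using pc P by (auto simp: LinearCombinations.module_hom_def)
  qed
  then have "endo_trace ?W P = mtrace J (smat J ?w (\<lambda>j x. x (e j)) P)"
    by (intro endo_trace_lin_system dual_space_vectorspace[OF F] dual_space_lin_system[OF F ds])
  also have "\<dots> = mtrace J (smat J w e T)"
  proof -
    have "P (?w j) (e j) = e j (T (w j))" if "j \<in> J" for j
    proof -
      have "?w j \<in> carrier ?W" using dual_space_lin_system(1)[OF F ds] that by (auto simp: dual_system_def)
      moreover have "w j \<in> D" "e j \<in> F" using ds that by (auto simp: dual_system_def)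
      ultimately show ?thesis using T by (simp add: P push_evaluation admissible_def)
    qed
    then show ?thesis by (simp add: mtrace_def smat_def)
  qed
  finally show ?thesis .
qed

lemma push_comp:
  assumes "\<And>f. f \<in> F \<Longrightarrow> (\<lambda>v\<in>D. f (T v)) \<in> F" "S \<in> D \<rightarrow> D"
  shows "push D F T (push D F S x) = push D F (T \<circ> S) x"
proof -
  have "push D F T (push D F S x) f = push D F (T \<circ> S) x f" for f
  proof (cases "f \<in> F")
    case True
    have "(\<lambda>v\<in>D. (\<lambda>v\<in>D. f (T v)) (S v)) = (\<lambda>v\<in>D. f ((T \<circ> S) v))"
      using assms(2) by (auto simp: fun_eq_iff)
    then show ?thesis using True assms(1) by (simp add: push_def)
  qed (simp add: push_def)
  then show ?thesis by blast
qed

lemma push_funpow: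
  assumes F: "fun_subspace D F" and T: "admissible D F T" and x: "x \<in> carrier (dual_space (form_space D F))"
  shows "(push D F T ^^ k) x = push D F (T ^^ k) x"
proof (induction k)
  case 0
  have "(\<lambda>f\<in>F. x (\<lambda>v\<in>D. f v)) = x"
  proof -
    have r: "(\<lambda>v\<in>D. f v) = f" if "f \<in> F" for f
      using F that by (auto simp: fun_subspace_def intro: extensional_restrict)
    have "(\<lambda>f\<in>F. x (\<lambda>v\<in>D. f v)) = (\<lambda>f\<in>F. x f)" by (rule restrict_ext) (simp only: r)
    moreover have "x \<in> extensional F" using x by (auto simp: dual_space_simps PiE_def)
    ultimately show ?thesis by (simp only: extensional_restrict)
  qed
  then show ?case by (simp add: push_def)
next
  case (Suc k)
  have "T ^^ k \<in> D \<rightarrow> D" using T by (induction k) (auto simp: admissible_def)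
  then have "push D F T (push D F (T ^^ k) x) = push D F (T \<circ> (T ^^ k)) x"
    using T by (intro push_comp) (auto simp: admissible_def)
  also have "push D F T (push D F (T ^^ k) x) = (push D F T ^^ Suc k) x"
    unfolding Suc.IH[symmetric] by simp
  finally show ?case unfolding funpow.simps(2)[of k T] .
qed

section \<open>Tensor products and symmetric powers in coordinates\<close>
lemma multilinear_upd:
  assumes f: "f \<in> multilinear_forms I E" and v: "v \<in> (\<Pi>\<^sub>E i\<in>I. carrier (E i))" and i: "i \<in> I"
  shows "lin_fun (E i) (\<lambda>x. f (v(i := x)))"
  using assms by (simp add: multilinear_forms_def lin_fun_def)

lemma fun_subspace_multilinear: "fun_subspace (\<Pi>\<^sub>E i\<in>I. carrier (E i)) (multilinear_forms I E)"
  if closed: "\<And>i. i \<in> I \<Longrightarrow> lin_closed (E i)"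
proof -
  let ?D = "\<Pi>\<^sub>E i\<in>I. carrier (E i)"
  have upd: "v(i := x) \<in> ?D" if "v \<in> ?D" "i \<in> I" "x \<in> carrier (E i)" for v i x
    using that by (auto simp: PiE_def extensional_def)
  have cl: "x \<oplus>\<^bsub>E i\<^esub> y \<in> carrier (E i)" "c \<odot>\<^bsub>E i\<^esub> x \<in> carrier (E i)"
    if "i \<in> I" "x \<in> carrier (E i)" "y \<in> carrier (E i)" for i x y c
    using closed that by (auto simp: lin_closed_def)
  note mf = multilinear_forms_def
  show ?thesis
    unfolding fun_subspace_def
  proof (intro conjI ballI allI)
    show "multilinear_forms I E \<subseteq> ?D \<rightarrow>\<^sub>E UNIV" by (auto simp: mf)
    show "(\<lambda>v\<in>?D. 0) \<in> multilinear_forms I E"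
      by (simp add: mf upd cl)
    fix f assume f: "f \<in> multilinear_forms I E"
    {
      fix g assume g: "g \<in> multilinear_forms I E"
      show "(\<lambda>v\<in>?D. f v + g v) \<in> multilinear_forms I E"
        using f g by (simp add: mf upd cl algebra_simps)
    }
    fix c show "(\<lambda>v\<in>?D. c * f v) \<in> multilinear_forms I E"
      using f by (simp add: mf upd cl algebra_simps)
  qed
qed

lemma product_form_multilinear:
  assumes I: "finite I" and closed: "\<And>i. i \<in> I \<Longrightarrow> lin_closed (E i)"
    and g: "\<And>i. i \<in> I \<Longrightarrow> lin_fun (E i) (g i)"
  shows "(\<lambda>v\<in>\<Pi>\<^sub>E i\<in>I. carrier (E i). \<Prod>i\<in>I. g i (v i)) \<in> multilinear_forms I E"
proof -
  let ?D = "\<Pi>\<^sub>E i\<in>I. carrier (E i)"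
  have upd: "v(i := x) \<in> ?D" if "v \<in> ?D" "i \<in> I" "x \<in> carrier (E i)" for v i x
    using that by (auto simp: PiE_def extensional_def)
  have cl: "x \<oplus>\<^bsub>E i\<^esub> y \<in> carrier (E i)" "c \<odot>\<^bsub>E i\<^esub> x \<in> carrier (E i)"
    if "i \<in> I" "x \<in> carrier (E i)" "y \<in> carrier (E i)" for i x y c
    using closed that by (auto simp: lin_closed_def)
  have pr: "(\<Prod>j\<in>I. g j ((v(i := x)) j)) = g i x * (\<Prod>j\<in>I - {i}. g j (v j))" if "i \<in> I" for v i x
  proof -
    have "(\<Prod>j\<in>I. g j ((v(i := x)) j)) = g i x * (\<Prod>j\<in>I - {i}. g j ((v(i := x)) j))"
      using prod.remove[OF I that, of "\<lambda>j. g j ((v(i := x)) j)"] by simp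
    also have "(\<Prod>j\<in>I - {i}. g j ((v(i := x)) j)) = (\<Prod>j\<in>I - {i}. g j (v j))"
      by (intro prod.cong) auto
    finally show ?thesis .
  qed
  have "g i (x \<oplus>\<^bsub>E i\<^esub> y) = g i x + g i y" "g i (c \<odot>\<^bsub>E i\<^esub> x) = c * g i x"
    if "i \<in> I" "x \<in> carrier (E i)" "y \<in> carrier (E i)" for i x y c
    using g that by (auto simp: lin_fun_def)
  then show ?thesis
    unfolding multilinear_forms_def by (simp add: upd cl pr distrib_right mult.assoc del: fun_upd_apply)
qed

lemma sum_PiE_insert:
  assumes "i \<notin> K" "finite (J i)" "finite (PiE K J)"
  shows "(\<Sum>x\<in>PiE (insert i K) J. F x) = (\<Sum>x\<in>PiE K J. \<Sum>j\<in>J i. F (x(i := j)))"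
proof -
  have "(\<Sum>x\<in>PiE (insert i K) J. F x) = (\<Sum>p\<in>J i \<times> PiE K J. F ((snd p)(i := fst p)))"
    unfolding PiE_insert_eq using inj_combinator[OF assms(1), of J]
    by (subst sum.reindex) (auto simp: case_prod_unfold intro!: sum.cong)
  also have "\<dots> = (\<Sum>j\<in>J i. \<Sum>x\<in>PiE K J. F (x(i := j)))"
    by (simp add: sum.cartesian_product case_prod_unfold)
  also have "\<dots> = (\<Sum>x\<in>PiE K J. \<Sum>j\<in>J i. F (x(i := j)))" by (rule sum.swap)
  finally show ?thesis .
qed

lemma multilinear_expansion:
  assumes I: "finite I" and ls: "\<And>i. i \<in> I \<Longrightarrow> lin_system (E i) (J i) (w i) (e i)"
    and f: "f \<in> multilinear_forms I E" and v: "v \<in> (\<Pi>\<^sub>E i\<in>I. carrier (E i))"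
  shows "f v = (\<Sum>x\<in>PiE I J. (\<Prod>i\<in>I. e i (x i) (v i)) * f (\<lambda>i\<in>I. w i (x i)))"
proof -
  have w: "w i j \<in> carrier (E i)" if "i \<in> I" "j \<in> J i" for i j
    using ls[OF that(1)] that(2) by (auto simp: dual_system_def)
  have J: "finite (J i)" if "i \<in> I" for i using ls that by (auto simp: dual_system_def)
  have ex: "h u = (\<Sum>j\<in>J i. e i j u * h (w i j))" if "i \<in> I" "lin_fun (E i) h" "u \<in> carrier (E i)" for i h u
    using ls[OF that(1)] that(2,3) by (simp add: dual_system_def)
  have "f v = (\<Sum>x\<in>PiE K J. (\<Prod>i\<in>K. e i (x i) (v i)) * f (\<lambda>i\<in>I. if i \<in> K then w i (x i) else v i))"
    if "K \<subseteq> I" for K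
    using finite_subset[OF that I] that
  proof (induction K rule: finite_induct)
    case empty
    have "(\<lambda>i\<in>I. v i) = v" using v by (simp add: PiE_def extensional_restrict)
    then show ?case by simp
  next
    case (insert k K)
    have k: "k \<in> I" "k \<notin> K" "K \<subseteq> I" using insert by auto
    have finK: "finite (PiE K J)" using insert J by (intro finite_PiE) auto
    have "f v = (\<Sum>x\<in>PiE K J. (\<Prod>i\<in>K. e i (x i) (v i)) * f (\<lambda>i\<in>I. if i \<in> K then w i (x i) else v i))"
      by (rule insert.IH[OF k(3)])
    also have "\<dots> = (\<Sum>x\<in>PiE K J. (\<Prod>i\<in>K. e i (x i) (v i)) *
        (\<Sum>j\<in>J k. e k j (v k) * f ((\<lambda>i\<in>I. if i \<in> K then w i (x i) else v i)(k := w k j))))"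
    proof (intro sum.cong refl arg_cong2[where f="(*)"])
      fix x assume x: "x \<in> PiE K J"
      let ?u = "\<lambda>i\<in>I. if i \<in> K then w i (x i) else v i"
      have "x i \<in> J i" if "i \<in> K" for i using x that by auto
      then have u: "?u \<in> (\<Pi>\<^sub>E i\<in>I. carrier (E i))" using v k w by (auto simp: PiE_iff)
      have "v k \<in> carrier (E k)" using v k by auto
      from ex[OF k(1) multilinear_upd[OF f u k(1)] this]
      have "f (?u(k := v k)) = (\<Sum>j\<in>J k. e k j (v k) * f (?u(k := w k j)))" .
      moreover have "?u(k := v k) = ?u" using k by (auto simp: fun_eq_iff)
      ultimately show "f ?u = (\<Sum>j\<in>J k. e k j (v k) * f (?u(k := w k j)))" by simp
    qed
    also have "\<dots> = (\<Sum>x\<in>PiE (insert k K) J. (\<Prod>i\<in>insert k K. e i (x i) (v i)) *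
        f (\<lambda>i\<in>I. if i \<in> insert k K then w i (x i) else v i))"
    proof -
      have "(\<Prod>i\<in>insert k K. e i ((x(k := j)) i) (v i)) = e k j (v k) * (\<Prod>i\<in>K. e i (x i) (v i))" for x j
        using insert.hyps by (auto intro!: prod.cong)
      moreover have "(\<lambda>i\<in>I. if i \<in> insert k K then w i ((x(k := j)) i) else v i)
         = (\<lambda>i\<in>I. if i \<in> K then w i (x i) else v i)(k := w k j)" for x j
        using k by (auto simp: fun_eq_iff)
      ultimately show ?thesis
        by (simp add: sum_PiE_insert[OF k(2) J[OF k(1)] finK] sum_distrib_left mult_ac
            del: fun_upd_apply insert_iff)
    qed
    finally show ?case .
  qed
  from this[OF subset_refl] have "f v = (\<Sum>x\<in>PiE I J. (\<Prod>i\<in>I. e i (x i) (v i)) * f (\<lambda>i\<in>I. if i \<in> I then w i (x i) else v i))" .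
  moreover have "(\<lambda>i\<in>I. if i \<in> I then w i (x i) else v i) = (\<lambda>i\<in>I. w i (x i))" for x
    by (rule restrict_ext) simp
  ultimately show ?thesis by simp
qed

definition tensor_form :: "'i set \<Rightarrow> ('i \<Rightarrow> ('k::field, 'v) module) \<Rightarrow> ('i \<Rightarrow> 'j \<Rightarrow> 'v \<Rightarrow> 'k) \<Rightarrow> ('i \<Rightarrow> 'j) \<Rightarrow> ('i \<Rightarrow> 'v) \<Rightarrow> 'k" where
  "tensor_form I E e x = (\<lambda>v\<in>\<Pi>\<^sub>E i\<in>I. carrier (E i). \<Prod>i\<in>I. e i (x i) (v i))"

lemma tensor_system:
  assumes I: "finite I" and ls: "\<And>i. i \<in> I \<Longrightarrow> lin_system (E i) (J i) (w i) (e i)"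
    and closed: "\<And>i. i \<in> I \<Longrightarrow> lin_closed (E i)"
  shows "dual_system (\<Pi>\<^sub>E i\<in>I. carrier (E i)) (multilinear_forms I E) (PiE I J)
     (\<lambda>x. \<lambda>i\<in>I. w i (x i)) (tensor_form I E e)"
  unfolding dual_system_def
proof (intro conjI ballI)
  show "finite (PiE I J)" using I ls by (intro finite_PiE) (auto simp: dual_system_def)
  show "(\<lambda>x. \<lambda>i\<in>I. w i (x i)) \<in> PiE I J \<rightarrow> (\<Pi>\<^sub>E i\<in>I. carrier (E i))"
    using ls by (auto simp: dual_system_def Pi_iff PiE_iff)
  have "e i j \<in> {f. lin_fun (E i) f}" if "i \<in> I" "j \<in> J i" for i j
    using ls[OF that(1)] that(2) by (auto simp: dual_system_def)
  then show "tensor_form I E e \<in> PiE I J \<rightarrow> multilinear_forms I E"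
    unfolding tensor_form_def using I closed by (intro Pi_I product_form_multilinear) auto
  fix f v assume "f \<in> multilinear_forms I E" "v \<in> (\<Pi>\<^sub>E i\<in>I. carrier (E i))"
  then show "f v = (\<Sum>x\<in>PiE I J. tensor_form I E e x v * f (\<lambda>i\<in>I. w i (x i)))"
    using multilinear_expansion[of I E J w e f v] I ls by (simp add: tensor_form_def)
qed

lemma admissible_factorwise:
  assumes closed: "\<And>i. i \<in> I \<Longrightarrow> lin_closed (E i)"
    and T: "\<And>i. i \<in> I \<Longrightarrow> T i \<in> module_hom class_ring (E i) (E i)"
  shows "admissible (\<Pi>\<^sub>E i\<in>I. carrier (E i)) (multilinear_forms I E) (\<lambda>v. \<lambda>i\<in>I. T i (v i))"
proof -
  let ?D = "\<Pi>\<^sub>E i\<in>I. carrier (E i)"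
  let ?T = "\<lambda>v. \<lambda>i\<in>I. T i (v i)"
  have upd: "v(i := x) \<in> ?D" if "v \<in> ?D" "i \<in> I" "x \<in> carrier (E i)" for v i x
    using that by (auto simp: PiE_def extensional_def)
  have cl: "x \<oplus>\<^bsub>E i\<^esub> y \<in> carrier (E i)" "c \<odot>\<^bsub>E i\<^esub> x \<in> carrier (E i)"
    if "i \<in> I" "x \<in> carrier (E i)" "y \<in> carrier (E i)" for i x y c
    using closed that by (auto simp: lin_closed_def)
  have Tc: "T i x \<in> carrier (E i)" and Ta: "T i (x \<oplus>\<^bsub>E i\<^esub> y) = T i x \<oplus>\<^bsub>E i\<^esub> T i y"
    and Ts: "T i (c \<odot>\<^bsub>E i\<^esub> x) = c \<odot>\<^bsub>E i\<^esub> T i x"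
    if "i \<in> I" "x \<in> carrier (E i)" "y \<in> carrier (E i)" for i x y c
    using T[OF that(1)] that(2,3) by (auto simp: LinearCombinations.module_hom_def)
  have TD: "?T v \<in> ?D" if "v \<in> ?D" for v using that Tc by (auto simp: PiE_iff)
  have Tu: "?T (v(i := x)) = (?T v)(i := T i x)" if "i \<in> I" for v i x
    using that by (auto simp: fun_eq_iff)
  have "(\<lambda>v\<in>?D. f (?T v)) \<in> multilinear_forms I E" if "f \<in> multilinear_forms I E" for f
    using that TD Tc by (simp add: multilinear_forms_def upd cl Tu Ta Ts del: fun_upd_apply)
  then show ?thesis using TD by (simp add: admissible_def)
qed

lemma comp_permutes_PiE:
  assumes "p permutes I" "v \<in> I \<rightarrow>\<^sub>E A"
  shows "v \<circ> p \<in> I \<rightarrow>\<^sub>E A"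
  using assms permutes_not_in[OF assms(1)] permutes_in_image[OF assms(1)]
  by (auto simp: PiE_iff extensional_def)

lemma sum_comp_permutes:
  assumes "p permutes I"
  shows "(\<Sum>x\<in>I \<rightarrow>\<^sub>E A. f (x \<circ> p)) = (\<Sum>x\<in>I \<rightarrow>\<^sub>E A. f x)"
proof (rule sum.reindex_bij_witness[of _ "\<lambda>x. x \<circ> Hilbert_Choice.inv p" "\<lambda>x. x \<circ> p"])
  have "Hilbert_Choice.inv p permutes I" using assms by (rule permutes_inv)
  then show "x \<circ> Hilbert_Choice.inv p \<in> I \<rightarrow>\<^sub>E A" if "x \<in> I \<rightarrow>\<^sub>E A" for x using that by (rule comp_permutes_PiE)
  show "x \<circ> p \<in> I \<rightarrow>\<^sub>E A" if "x \<in> I \<rightarrow>\<^sub>E A" for x using that comp_permutes_PiE[OF assms] by blast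
qed (use permutes_inv_o[OF assms] in \<open>auto simp: o_assoc[symmetric]\<close>)

lemma prod_comp_permutes:
  assumes "p permutes I"
  shows "(\<Prod>i\<in>I. f (p i)) = (\<Prod>i\<in>I. f i)"
  using permutes_imp_bij[OF assms] by (rule prod.reindex_bij_betw)

text \<open>
  The coordinate form of the monomial \<open>w (x 0) \<cdots> w (x (d - 1))\<close>. Tuples \<open>x\<close> which differ by a
  permutation give the same monomial; averaging over the permutations shares the coefficient of a
  monomial evenly among them, so that all tuples can serve as indices.
\<close>
definition sym_form :: "nat \<Rightarrow> ('k::field_char_0, 'v) module \<Rightarrow> ('j \<Rightarrow> 'v \<Rightarrow> 'k) \<Rightarrow> (nat \<Rightarrow> 'j) \<Rightarrow> (nat \<Rightarrow> 'v) \<Rightarrow> 'k" where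
  "sym_form d V e x = (\<lambda>v\<in>{..<d} \<rightarrow>\<^sub>E carrier V.
     (\<Sum>p | p permutes {..<d}. \<Prod>i<d. e (x (p i)) (v i)) / fact d)"

lemma fun_subspace_symmetric:
  assumes "lin_closed V"
  shows "fun_subspace ({..<d} \<rightarrow>\<^sub>E carrier V) (symmetric_forms d V)"
proof -
  let ?D = "{..<d} \<rightarrow>\<^sub>E carrier V"
  note F = fun_subspace_multilinear[of "{..<d}" "\<lambda>_. V", OF assms]
  note P = comp_permutes_PiE[of _ "{..<d}" _ "carrier V"]
  show ?thesis
    unfolding fun_subspace_def
  proof (intro conjI ballI allI)
    show "symmetric_forms d V \<subseteq> ?D \<rightarrow>\<^sub>E UNIV"
      using F by (auto simp: symmetric_forms_def fun_subspace_def)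
    have "(\<lambda>v\<in>?D. 0) \<in> multilinear_forms {..<d} (\<lambda>_. V)" using F by (simp add: fun_subspace_def)
    then show "(\<lambda>v\<in>?D. 0) \<in> symmetric_forms d V"
      unfolding symmetric_forms_def using P by simp
    fix f assume f: "f \<in> symmetric_forms d V"
    {
      fix g assume g: "g \<in> symmetric_forms d V"
      have "(\<lambda>v\<in>?D. f v + g v) \<in> multilinear_forms {..<d} (\<lambda>_. V)"
        using F f g by (simp add: fun_subspace_def symmetric_forms_def)
      then show "(\<lambda>v\<in>?D. f v + g v) \<in> symmetric_forms d V"
        using f g P by (simp add: symmetric_forms_def)
    }
    fix c
    have "(\<lambda>v\<in>?D. c * f v) \<in> multilinear_forms {..<d} (\<lambda>_. V)"
      using F f by (simp add: fun_subspace_def symmetric_forms_def)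
    then show "(\<lambda>v\<in>?D. c * f v) \<in> symmetric_forms d V"
      using f P by (simp add: symmetric_forms_def)
  qed
qed

lemma sym_form_symmetric:
  assumes V: "lin_closed V" and e: "\<And>j. j \<in> J \<Longrightarrow> lin_fun V (e j)" and x: "x \<in> {..<d} \<rightarrow>\<^sub>E J"
  shows "sym_form d V e x \<in> symmetric_forms d V"
proof -
  let ?D = "{..<d} \<rightarrow>\<^sub>E carrier V"
  let ?P = "{p. p permutes {..<d}}"
  have "(\<lambda>v\<in>?D. \<Prod>i<d. e (x (p i)) (v i)) \<in> multilinear_forms {..<d} (\<lambda>_. V)" if "p \<in> ?P" for p
  proof (rule product_form_multilinear)
    fix i assume "i \<in> {..<d}"
    then show "lin_fun V (e (x (p i)))"
      using e x permutes_in_image[of p "{..<d}" i] that by auto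
  qed (use V in auto)
  then have "(\<lambda>v\<in>?D. \<Sum>p\<in>?P. (1 / fact d) * (\<lambda>v\<in>?D. \<Prod>i<d. e (x (p i)) (v i)) v) \<in> multilinear_forms {..<d} (\<lambda>_. V)"
    by (intro fun_subspace_sum[OF fun_subspace_multilinear[OF V]] finite_permutations finite_lessThan)
  also have "(\<lambda>v\<in>?D. \<Sum>p\<in>?P. (1 / fact d) * (\<lambda>v\<in>?D. \<Prod>i<d. e (x (p i)) (v i)) v) = sym_form d V e x"
    unfolding sym_form_def by (rule restrict_ext) (simp add: sum_divide_distrib)
  finally have m: "sym_form d V e x \<in> multilinear_forms {..<d} (\<lambda>_. V)" .
  have "sym_form d V e x (v \<circ> q) = sym_form d V e x v" if q: "q permutes {..<d}" and v: "v \<in> ?D" for q v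
  proof -
    have "(\<Sum>p\<in>?P. \<Prod>i<d. e (x (p i)) (v (q i))) = (\<Sum>p\<in>?P. \<Prod>i<d. e (x ((p \<circ> Hilbert_Choice.inv q) i)) (v i))"
    proof (intro sum.cong refl)
      fix p assume "p \<in> ?P"
      have "(\<Prod>i<d. e (x ((p \<circ> Hilbert_Choice.inv q) (q i))) (v (q i))) = (\<Prod>i<d. e (x ((p \<circ> Hilbert_Choice.inv q) i)) (v i))"
        by (rule prod_comp_permutes[OF q])
      then show "(\<Prod>i<d. e (x (p i)) (v (q i))) = (\<Prod>i<d. e (x ((p \<circ> Hilbert_Choice.inv q) i)) (v i))"
        using permutes_inverses[OF q] by simp
    qed
    also have "\<dots> = (\<Sum>p\<in>?P. \<Prod>i<d. e (x (p i)) (v i))"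
      by (rule sum.reindex_bij_witness[of _ "\<lambda>p. p \<circ> q" "\<lambda>p. p \<circ> Hilbert_Choice.inv q"])
        (use q permutes_inv[OF q] permutes_inv_o[OF q] in \<open>auto simp: o_assoc[symmetric] intro: permutes_compose\<close>)
    finally show ?thesis using v comp_permutes_PiE[OF q v] by (simp add: sym_form_def)
  qed
  then show ?thesis using m by (simp add: symmetric_forms_def)
qed

lemma sym_system:
  fixes V :: "('k::field_char_0, 'v) module"
  assumes ls: "lin_system V J w e" and closed: "lin_closed V"
  shows "dual_system ({..<d} \<rightarrow>\<^sub>E carrier V) (symmetric_forms d V) ({..<d} \<rightarrow>\<^sub>E J)
     (\<lambda>x. \<lambda>i\<in>{..<d}. w (x i)) (sym_form d V e)"
  unfolding dual_system_def
proof (intro conjI ballI)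
  let ?P = "{p. p permutes {..<d}}"
  have e: "\<And>j. j \<in> J \<Longrightarrow> lin_fun V (e j)" and w: "\<And>j. j \<in> J \<Longrightarrow> w j \<in> carrier V" and J: "finite J"
    using ls by (auto simp: dual_system_def)
  show "finite ({..<d} \<rightarrow>\<^sub>E J)" using J by (intro finite_PiE) auto
  show "(\<lambda>x. \<lambda>i\<in>{..<d}. w (x i)) \<in> ({..<d} \<rightarrow>\<^sub>E J) \<rightarrow> {..<d} \<rightarrow>\<^sub>E carrier V"
    using w by (auto simp: PiE_iff)
  show "sym_form d V e \<in> ({..<d} \<rightarrow>\<^sub>E J) \<rightarrow> symmetric_forms d V"
    using sym_form_symmetric[of V J e] closed e by auto
  fix f v assume f: "f \<in> symmetric_forms d V" and v: "v \<in> {..<d} \<rightarrow>\<^sub>E carrier V"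
  define W where "W = (\<lambda>x. \<lambda>i\<in>{..<d}. w (x i))"
  have fv: "f v = (\<Sum>x\<in>{..<d} \<rightarrow>\<^sub>E J. (\<Prod>i<d. e (x i) (v i)) * f (W x))"
    unfolding W_def by (rule multilinear_expansion) (use f v ls in \<open>auto simp: symmetric_forms_def\<close>)
  have "f v = (\<Sum>x\<in>{..<d} \<rightarrow>\<^sub>E J. (\<Prod>i<d. e (x (p i)) (v i)) * f (W x))" if p: "p \<in> ?P" for p
  proof -
    have "f v = (\<Sum>x\<in>{..<d} \<rightarrow>\<^sub>E J. (\<Prod>i<d. e ((x \<circ> p) i) (v i)) * f (W (x \<circ> p)))"
      using p by (subst fv, subst sum_comp_permutes[of p "{..<d}" "\<lambda>x. (\<Prod>i<d. e (x i) (v i)) * f (W x)"]) auto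
    also have "\<dots> = (\<Sum>x\<in>{..<d} \<rightarrow>\<^sub>E J. (\<Prod>i<d. e (x (p i)) (v i)) * f (W x))"
    proof (intro sum.cong refl)
      fix x assume x: "x \<in> {..<d} \<rightarrow>\<^sub>E J"
      have "W (x \<circ> p) = W x \<circ> p"
        using p permutes_in_image[of p "{..<d}"] by (auto simp: W_def fun_eq_iff)
      moreover have "W x \<in> {..<d} \<rightarrow>\<^sub>E carrier V" using x w by (auto simp: W_def PiE_iff)
      ultimately have "f (W (x \<circ> p)) = f (W x)" using f p by (simp add: symmetric_forms_def)
      then show "(\<Prod>i<d. e ((x \<circ> p) i) (v i)) * f (W (x \<circ> p)) = (\<Prod>i<d. e (x (p i)) (v i)) * f (W x)" by simp
    qed
    finally show ?thesis .
  qed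
  then have "(\<Sum>p\<in>?P. f v) = (\<Sum>p\<in>?P. \<Sum>x\<in>{..<d} \<rightarrow>\<^sub>E J. (\<Prod>i<d. e (x (p i)) (v i)) * f (W x))"
    by (intro sum.cong) auto
  then have "fact d * f v = (\<Sum>x\<in>{..<d} \<rightarrow>\<^sub>E J. (\<Sum>p\<in>?P. \<Prod>i<d. e (x (p i)) (v i)) * f (W x))"
    by (subst (asm) sum.swap) (simp add: card_permutations sum_distrib_right)
  then have "f v = (\<Sum>x\<in>{..<d} \<rightarrow>\<^sub>E J. (\<Sum>p\<in>?P. \<Prod>i<d. e (x (p i)) (v i)) * f (W x)) / fact d"
    by (simp add: field_simps)
  then show "f v = (\<Sum>x\<in>{..<d} \<rightarrow>\<^sub>E J. sym_form d V e x v * f (\<lambda>i\<in>{..<d}. w (x i)))"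
    using v by (simp add: sym_form_def W_def sum_divide_distrib[where A="{..<d} \<rightarrow>\<^sub>E J"])
qed

lemma admissible_sym:
  assumes closed: "lin_closed V" and T: "T \<in> module_hom class_ring V V"
  shows "admissible ({..<d} \<rightarrow>\<^sub>E carrier V) (symmetric_forms d V) (\<lambda>v. \<lambda>i\<in>{..<d}. T (v i))"
proof -
  let ?D = "{..<d} \<rightarrow>\<^sub>E carrier V"
  let ?T = "\<lambda>v. \<lambda>i\<in>{..<d}. T (v i)"
  have a: "admissible ?D (multilinear_forms {..<d} (\<lambda>_. V)) ?T"
    using admissible_factorwise[of "{..<d}" "\<lambda>_. V" "\<lambda>_. T"] closed T by simp
  have "(\<lambda>v\<in>?D. f (?T v)) \<in> symmetric_forms d V" if f: "f \<in> symmetric_forms d V" for f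
  proof -
    have "(\<lambda>v\<in>?D. f (?T v)) (v \<circ> p) = (\<lambda>v\<in>?D. f (?T v)) v" if p: "p permutes {..<d}" and v: "v \<in> ?D" for p v
    proof -
      have "?T (v \<circ> p) = ?T v \<circ> p" using permutes_in_image[OF p] by (auto simp: fun_eq_iff)
      moreover have "?T v \<in> ?D" using a v unfolding admissible_def by blast
      ultimately have "f (?T (v \<circ> p)) = f (?T v)" using f p by (simp add: symmetric_forms_def)
      then show ?thesis using v comp_permutes_PiE[OF p v] by simp
    qed
    moreover have "(\<lambda>v\<in>?D. f (?T v)) \<in> multilinear_forms {..<d} (\<lambda>_. V)"
      using a f unfolding admissible_def symmetric_forms_def by blast
    ultimately show ?thesis unfolding symmetric_forms_def by blast
  qed
  then show ?thesis using a by (auto simp: admissible_def)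
qed

text \<open>
  The action on the \<open>d\<close>-th symmetric power with respect to the system of all tuples. It is the
  \<open>d\<close>-th Kronecker power of \<open>M\<close> followed by symmetrization, so the identity goes to the idempotent
  which symmetrizes.
\<close>
definition sym_mat :: "nat \<Rightarrow> 'j set \<Rightarrow> ('j \<Rightarrow> 'j \<Rightarrow> 'k::field_char_0) \<Rightarrow> (nat \<Rightarrow> 'j) \<Rightarrow> (nat \<Rightarrow> 'j) \<Rightarrow> 'k" where
  "sym_mat d J M = (\<lambda>x y. if x \<in> {..<d} \<rightarrow>\<^sub>E J \<and> y \<in> {..<d} \<rightarrow>\<^sub>E J
     then (\<Sum>p | p permutes {..<d}. \<Prod>i<d. M (x (p i)) (y i)) / fact d else 0)"

lemma smat_sym:
  assumes ls: "lin_system V J w e" and T: "T \<in> carrier V \<rightarrow> carrier V"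
  shows "smat ({..<d} \<rightarrow>\<^sub>E J) (\<lambda>x. \<lambda>i\<in>{..<d}. w (x i)) (sym_form d V e) (\<lambda>v. \<lambda>i\<in>{..<d}. T (v i))
     = sym_mat d J (smat J w e T)"
proof (intro ext)
  fix x y
  show "smat ({..<d} \<rightarrow>\<^sub>E J) (\<lambda>x. \<lambda>i\<in>{..<d}. w (x i)) (sym_form d V e) (\<lambda>v. \<lambda>i\<in>{..<d}. T (v i)) x y
     = sym_mat d J (smat J w e T) x y"
  proof (cases "x \<in> {..<d} \<rightarrow>\<^sub>E J \<and> y \<in> {..<d} \<rightarrow>\<^sub>E J")
    case True
    then have y: "y i \<in> J" and x: "x i \<in> J" if "i < d" for i using that by auto
    have w: "w j \<in> carrier V" if "j \<in> J" for j using ls that by (auto simp: dual_system_def)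
    have u: "(\<lambda>i\<in>{..<d}. T ((\<lambda>i\<in>{..<d}. w (y i)) i)) = (\<lambda>i\<in>{..<d}. T (w (y i)))"
      by (rule restrict_ext) simp
    have "(\<lambda>i\<in>{..<d}. T (w (y i))) \<in> {..<d} \<rightarrow>\<^sub>E carrier V" using T w y by (auto simp: PiE_iff)
    moreover have "(\<Prod>i<d. e (x (p i)) (T (w (y i)))) = (\<Prod>i<d. smat J w e T (x (p i)) (y i))"
      if "p permutes {..<d}" for p
      using x y permutes_in_image[OF that] by (intro prod.cong) (auto simp: smat_def)
    ultimately show ?thesis using True u by (simp add: smat_def sym_mat_def sym_form_def)
  qed (auto simp: smat_def sym_mat_def)
qed

lemma sym_power_trace:
  fixes V :: "('k::field_char_0, 'v) module"
  assumes ls: "lin_system V J w e" and closed: "lin_closed V" and T: "\<rho> h \<in> module_hom class_ring V V"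
  shows "endo_trace (sym_power d V) (sym_act d V \<rho> h) = mtrace ({..<d} \<rightarrow>\<^sub>E J) (sym_mat d J (smat J w e (\<rho> h)))"
proof -
  have "\<rho> h \<in> carrier V \<rightarrow> carrier V" using T by (simp add: LinearCombinations.module_hom_def)
  then show ?thesis
    unfolding sym_power_def
    by (subst endo_trace_push[OF fun_subspace_symmetric[OF closed] sym_system[OF ls closed] admissible_sym[OF closed T]])
      (simp_all add: sym_act_def smat_sym[OF ls])
qed

section \<open>Symmetric tensors\<close>
text \<open>
  The \<open>K\<close>-fold Kronecker power of \<open>N\<close>, multiplied with \<open>A\<close>, is \<open>A\<close> multiplied with \<open>a\<close>. The sums are
  spelled out since \<open>N\<close> and \<open>a\<close> matter only on \<open>J\<close> and \<open>X\<close>.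
\<close>
definition ten_comm :: "'q set \<Rightarrow> 'j set \<Rightarrow> 'x set \<Rightarrow> (('q \<Rightarrow> 'j) \<Rightarrow> 'x \<Rightarrow> 'k::comm_ring_1) \<Rightarrow>
    ('j \<Rightarrow> 'j \<Rightarrow> 'k) \<Rightarrow> ('x \<Rightarrow> 'x \<Rightarrow> 'k) \<Rightarrow> bool" where
  "ten_comm K J X A N a \<longleftrightarrow> (\<forall>y\<in>K \<rightarrow>\<^sub>E J. \<forall>x\<in>X.
     (\<Sum>z\<in>K \<rightarrow>\<^sub>E J. (\<Prod>k\<in>K. N (y k) (z k)) * A z x) = (\<Sum>x'\<in>X. A y x' * a x' x))"

definition sym_tensor :: "'q set \<Rightarrow> 'j set \<Rightarrow> 'x set \<Rightarrow> (('q \<Rightarrow> 'j) \<Rightarrow> 'x \<Rightarrow> 'k::comm_ring_1) \<Rightarrow> bool" where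
  "sym_tensor K J X A \<longleftrightarrow> supp_in (K \<rightarrow>\<^sub>E J) X A \<and>
     (\<forall>p y x. p permutes K \<longrightarrow> y \<in> K \<rightarrow>\<^sub>E J \<longrightarrow> A (y \<circ> p) x = A y x)"

lemma prod_id_mat:
  assumes "finite K" "y \<in> K \<rightarrow>\<^sub>E J" "z \<in> K \<rightarrow>\<^sub>E J"
  shows "(\<Prod>k\<in>K. id_mat J (y k) (z k)) = (if y = z then 1 else (0::'k::comm_ring_1))"
proof (cases "y = z")
  case True
  then show ?thesis using assms by (auto simp: id_mat_def intro!: prod.neutral)
next
  case False
  then obtain k where "y k \<noteq> z k" by blast
  moreover from this have "k \<in> K" using assms by (metis PiE_arb)
  ultimately show ?thesis using False assms(1) by (auto intro!: prod_zero bexI[of _ k] simp: id_mat_def)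
qed

lemma ten_comm_id:
  assumes K: "finite K" "finite J" and A: "supp_in (K \<rightarrow>\<^sub>E J) X A" and X: "finite X"
  shows "ten_comm K J X A (id_mat J) (id_mat X)"
  unfolding ten_comm_def
proof (intro ballI)
  fix y x assume yx: "y \<in> K \<rightarrow>\<^sub>E J" "x \<in> X"
  have "(\<Sum>z\<in>K \<rightarrow>\<^sub>E J. (\<Prod>k\<in>K. id_mat J (y k) (z k)) * A z x) = (\<Sum>z\<in>K \<rightarrow>\<^sub>E J. if z = y then A y x else 0)"
    using yx K by (intro sum.cong refl) (auto simp: prod_id_mat)
  also have "\<dots> = A y x" using yx K by (simp add: finite_PiE)
  also have "\<dots> = (\<Sum>x'\<in>X. A y x' * id_mat X x' x)"
    using fun_cong[OF fun_cong[OF mmul_id_right[OF X A]]] by (simp add: mmul_def)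
  finally show "(\<Sum>z\<in>K \<rightarrow>\<^sub>E J. (\<Prod>k\<in>K. id_mat J (y k) (z k)) * A z x) = (\<Sum>x'\<in>X. A y x' * id_mat X x' x)" .
qed

lemma ten_comm_mmul:
  assumes K: "finite K" "finite J" and N: "ten_comm K J X A N a" and N': "ten_comm K J X A N' a'"
  shows "ten_comm K J X A (mmul J N N') (mmul X a a')"
  unfolding ten_comm_def
proof (intro ballI)
  fix y x assume yx: "y \<in> K \<rightarrow>\<^sub>E J" "x \<in> X"
  have "(\<Sum>z\<in>K \<rightarrow>\<^sub>E J. (\<Prod>k\<in>K. mmul J N N' (y k) (z k)) * A z x)
     = (\<Sum>z\<in>K \<rightarrow>\<^sub>E J. \<Sum>u\<in>K \<rightarrow>\<^sub>E J. (\<Prod>k\<in>K. N (y k) (u k)) * ((\<Prod>k\<in>K. N' (u k) (z k)) * A z x))"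
    unfolding mmul_def using K
    by (simp add: prod_sum_PiE sum_distrib_right prod.distrib mult.assoc)
  also have "\<dots> = (\<Sum>u\<in>K \<rightarrow>\<^sub>E J. (\<Prod>k\<in>K. N (y k) (u k)) * (\<Sum>z\<in>K \<rightarrow>\<^sub>E J. (\<Prod>k\<in>K. N' (u k) (z k)) * A z x))"
    by (subst sum.swap) (simp add: sum_distrib_left)
  also have "\<dots> = (\<Sum>u\<in>K \<rightarrow>\<^sub>E J. (\<Prod>k\<in>K. N (y k) (u k)) * (\<Sum>x'\<in>X. A u x' * a' x' x))"
    using N' yx by (intro sum.cong refl) (simp add: ten_comm_def)
  also have "\<dots> = (\<Sum>u\<in>K \<rightarrow>\<^sub>E J. \<Sum>x'\<in>X. (\<Prod>k\<in>K. N (y k) (u k)) * A u x' * a' x' x)"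
    by (simp add: sum_distrib_left mult.assoc)
  also have "\<dots> = (\<Sum>x'\<in>X. (\<Sum>u\<in>K \<rightarrow>\<^sub>E J. (\<Prod>k\<in>K. N (y k) (u k)) * A u x') * a' x' x)"
    by (subst sum.swap) (simp add: sum_distrib_right)
  also have "\<dots> = (\<Sum>x'\<in>X. (\<Sum>x''\<in>X. A y x'' * a x'' x') * a' x' x)"
    using N yx by (intro sum.cong refl) (simp add: ten_comm_def)
  also have "\<dots> = mmul X (mmul X A a) a' y x" by (simp add: mmul_def)
  also have "\<dots> = (\<Sum>x'\<in>X. A y x' * mmul X a a' x' x)" by (simp only: mmul_assoc) (simp add: mmul_def)
  finally show "(\<Sum>z\<in>K \<rightarrow>\<^sub>E J. (\<Prod>k\<in>K. mmul J N N' (y k) (z k)) * A z x)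
     = (\<Sum>x'\<in>X. A y x' * mmul X a a' x' x)" .
qed

lemma sum_via_inj:
  assumes "finite S" "inj_on f T" "f ` T \<subseteq> S" "\<And>s. s \<in> S \<Longrightarrow> s \<notin> f ` T \<Longrightarrow> g s = (0::'k::comm_monoid_add)"
  shows "(\<Sum>s\<in>S. g s) = (\<Sum>t\<in>T. g (f t))"
proof -
  have "(\<Sum>s\<in>S. g s) = (\<Sum>s\<in>f ` T. g s)" using assms by (intro sum.mono_neutral_right) auto
  also have "\<dots> = (\<Sum>t\<in>T. g (f t))" using assms(2) by (subst sum.reindex) simp_all
  finally show ?thesis .
qed

section \<open>Intertwiners into symmetric powers\<close>

text \<open>
  The symmetrization is absorbed by a factor which is symmetric already.
\<close>
lemma sym_mat_mmul:
  fixes N :: "'j \<Rightarrow> 'j \<Rightarrow> 'k::field_char_0"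
  assumes A: "\<And>p y. p permutes {..<d} \<Longrightarrow> y \<in> {..<d} \<rightarrow>\<^sub>E J \<Longrightarrow> A (y \<circ> p) x = A y x"
    and y: "y \<in> {..<d} \<rightarrow>\<^sub>E J"
  shows "mmul ({..<d} \<rightarrow>\<^sub>E J) (sym_mat d J N) A y x = (\<Sum>z\<in>{..<d} \<rightarrow>\<^sub>E J. (\<Prod>i<d. N (y i) (z i)) * A z x)"
    (is "_ = ?rhs")
proof -
  let ?P = "{p. p permutes {..<d}}"
  let ?Z = "{..<d} \<rightarrow>\<^sub>E J"
  have *: "(\<Sum>z\<in>?Z. (\<Prod>i<d. N (y (p i)) (z i)) * A z x) = ?rhs" if p: "p \<in> ?P" for p
  proof -
    have "(\<Sum>z\<in>?Z. (\<Prod>i<d. N (y (p i)) (z i)) * A z x) = (\<Sum>z\<in>?Z. (\<Prod>i<d. N (y (p i)) ((z \<circ> p) i)) * A (z \<circ> p) x)"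
      using sum_comp_permutes[of p "{..<d}" "\<lambda>z. (\<Prod>i<d. N (y (p i)) (z i)) * A z x" J] p by simp
    also have "\<dots> = ?rhs"
      using p A by (intro sum.cong refl) (simp add: prod_comp_permutes[of p "{..<d}" "\<lambda>i. N (y i) (_ i)"])
    finally show ?thesis .
  qed
  have "mmul ?Z (sym_mat d J N) A y x
      = (\<Sum>z\<in>?Z. \<Sum>p\<in>?P. (\<Prod>i<d. N (y (p i)) (z i)) * A z x) / fact d"
    using y by (simp add: mmul_def sym_mat_def sum_distrib_right sum_divide_distrib)
  also have "\<dots> = (\<Sum>p\<in>?P. \<Sum>z\<in>?Z. (\<Prod>i<d. N (y (p i)) (z i)) * A z x) / fact d"
    by (subst sum.swap) simp
  also have "\<dots> = (\<Sum>p\<in>?P. ?rhs) / fact d" using * by simp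
  also have "\<dots> = ?rhs" by (simp add: card_permutations)
  finally show ?thesis .
qed

lemma supp_in_sym_mat: "supp_in ({..<d} \<rightarrow>\<^sub>E J) ({..<d} \<rightarrow>\<^sub>E J) (sym_mat d J N)"
  by (auto simp: supp_in_def sym_mat_def)

lemma sym_mat_comp_left:
  assumes q: "q permutes {..<d}" and y: "y \<in> {..<d} \<rightarrow>\<^sub>E J"
  shows "sym_mat d J N (y \<circ> q) x = sym_mat d J N y x"
proof -
  have "(\<Sum>p | p permutes {..<d}. \<Prod>i<d. N (y (q (p i))) (x i)) = (\<Sum>p | p permutes {..<d}. \<Prod>i<d. N (y (p i)) (x i))"
    by (rule sum.reindex_bij_witness[of _ "\<lambda>p. Hilbert_Choice.inv q \<circ> p" "\<lambda>p. q \<circ> p"])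
      (use q permutes_inv[OF q] permutes_inv_o[OF q] in \<open>auto simp: o_assoc intro: permutes_compose\<close>)
  then show ?thesis using y comp_permutes_PiE[OF q y] by (simp add: sym_mat_def)
qed

lemma sym_mat_mult:
  fixes N :: "'j \<Rightarrow> 'j \<Rightarrow> 'k::field_char_0"
  assumes J: "finite J"
  shows "sym_mat d J (mmul J N N') = mmul ({..<d} \<rightarrow>\<^sub>E J) (sym_mat d J N) (sym_mat d J N')"
proof (intro ext)
  fix y x
  let ?P = "{p. p permutes {..<d}}"
  let ?Z = "{..<d} \<rightarrow>\<^sub>E J"
  show "sym_mat d J (mmul J N N') y x = mmul ?Z (sym_mat d J N) (sym_mat d J N') y x"
  proof (cases "y \<in> ?Z \<and> x \<in> ?Z")
    case True
    have "mmul ?Z (sym_mat d J N) (sym_mat d J N') y x = (\<Sum>z\<in>?Z. (\<Prod>i<d. N (y i) (z i)) * sym_mat d J N' z x)"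
      using True by (intro sym_mat_mmul) (auto intro: sym_mat_comp_left)
    also have "\<dots> = (\<Sum>z\<in>?Z. \<Sum>p\<in>?P. (\<Prod>i<d. N (y i) (z i)) * (\<Prod>i<d. N' (z (p i)) (x i))) / fact d"
      using True by (simp add: sym_mat_def sum_distrib_left sum_divide_distrib)
    also have "\<dots> = (\<Sum>p\<in>?P. \<Sum>z\<in>?Z. (\<Prod>i<d. N (y i) (z i)) * (\<Prod>i<d. N' (z (p i)) (x i))) / fact d"
      by (subst sum.swap) simp
    also have "\<dots> = (\<Sum>p\<in>?P. \<Prod>i<d. mmul J N N' (y (p i)) (x i)) / fact d"
    proof -
      have "(\<Sum>z\<in>?Z. (\<Prod>i<d. N (y i) (z i)) * (\<Prod>i<d. N' (z (p i)) (x i))) = (\<Prod>i<d. mmul J N N' (y (p i)) (x i))"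
        if p: "p \<in> ?P" for p
      proof -
        have "(\<Prod>i<d. N (y i) (z i)) = (\<Prod>i<d. N (y (p i)) (z (p i)))" for z
          using prod_comp_permutes[of p "{..<d}" "\<lambda>i. N (y i) (z i)"] p by simp
        then have "(\<Sum>z\<in>?Z. (\<Prod>i<d. N (y i) (z i)) * (\<Prod>i<d. N' (z (p i)) (x i)))
           = (\<Sum>z\<in>?Z. (\<Prod>i<d. N (y (p i)) ((z \<circ> p) i) * N' ((z \<circ> p) i) (x i)))"
          by (simp add: prod.distrib)
        also have "\<dots> = (\<Sum>z\<in>?Z. (\<Prod>i<d. N (y (p i)) (z i) * N' (z i) (x i)))"
          using p by (intro sum_comp_permutes) simp
        also have "\<dots> = (\<Prod>i<d. mmul J N N' (y (p i)) (x i))"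
          unfolding mmul_def using J by (subst prod_sum_PiE) auto
        finally show ?thesis .
      qed
      then show ?thesis by simp
    qed
    also have "\<dots> = sym_mat d J (mmul J N N') y x" using True by (simp add: sym_mat_def)
    finally show ?thesis by simp
  next
    case False
    moreover have "supp_in ?Z ?Z (mmul ?Z (sym_mat d J N) (sym_mat d J N'))"
      by (intro supp_in_mmul supp_in_sym_mat)
    ultimately have "mmul ?Z (sym_mat d J N) (sym_mat d J N') y x = 0"
      by (intro supp_in_zero[of ?Z ?Z]) auto
    then show ?thesis using False by (simp only: sym_mat_def) auto
  qed
qed

lemma mat_rep_sym:
  fixes M :: "'h \<Rightarrow> 'j \<Rightarrow> 'j \<Rightarrow> 'k::field_char_0"
  assumes "mat_rep H J M"
  shows "mat_rep H ({..<d} \<rightarrow>\<^sub>E J) (\<lambda>h. sym_mat d J (M h))"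
  using assms by (auto simp: mat_rep_def supp_in_sym_mat sym_mat_mult intro!: finite_PiE)

text \<open>
  At the unit element, the equation \<open>S \<one> A = A\<close> says that \<open>A\<close> is invariant under symmetrization. This
  is why symmetry is part of the right-hand side and can be used for the other direction.
\<close>
lemma intertwiner_sym_iff:
  fixes M :: "'h \<Rightarrow> 'j \<Rightarrow> 'j \<Rightarrow> 'k::field_char_0"
  assumes J: "finite J" and one: "M \<one>\<^bsub>H\<^esub> = id_mat J"
    and R: "finite X" "\<And>h. h \<in> carrier H \<Longrightarrow> supp_in X X (R h)"
  shows "intertwiner H ({..<d} \<rightarrow>\<^sub>E J) (\<lambda>h. sym_mat d J (M h)) X R A \<longleftrightarrow>
    sym_tensor {..<d} J X A \<and> (\<forall>h\<in>carrier H. ten_comm {..<d} J X A (M h) (R h))"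
    (is "?L \<longleftrightarrow> ?R")
proof -
  let ?Z = "{..<d} \<rightarrow>\<^sub>E J"
  have sm: "mmul ?Z (sym_mat d J N) A y x = (\<Sum>z\<in>?Z. (\<Prod>i<d. N (y i) (z i)) * A z x)"
    if "sym_tensor {..<d} J X A" "y \<in> ?Z" for N y x
    using that by (intro sym_mat_mmul) (auto simp: sym_tensor_def)
  have eqv: "mmul ?Z (sym_mat d J (M h)) A = mmul X A (R h) \<longleftrightarrow> ten_comm {..<d} J X A (M h) (R h)"
    if st: "sym_tensor {..<d} J X A" and h: "h \<in> carrier H" for h
  proof -
    have s1: "supp_in ?Z X (mmul ?Z (sym_mat d J (M h)) A)"
      using st by (intro supp_in_mmul supp_in_sym_mat) (simp add: sym_tensor_def)
    have s2: "supp_in ?Z X (mmul X A (R h))"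
      using st R(2)[OF h] by (intro supp_in_mmul) (simp_all add: sym_tensor_def)
    have "mmul ?Z (sym_mat d J (M h)) A = mmul X A (R h) \<longleftrightarrow>
       (\<forall>y\<in>?Z. \<forall>x\<in>X. mmul ?Z (sym_mat d J (M h)) A y x = mmul X A (R h) y x)"
      using supp_in_zero[OF s1] supp_in_zero[OF s2] by (auto simp: fun_eq_iff) metis
    then show ?thesis using sm[OF st] by (simp add: ten_comm_def mmul_def[of X A])
  qed
  show ?thesis
  proof
    assume L: ?L
    then have supp: "supp_in ?Z X A" and fixA: "mmul ?Z (sym_mat d J (id_mat J)) A = A"
      by (simp_all add: intertwiner_def one)
    have "A (y \<circ> p) x = A y x" if "p permutes {..<d}" "y \<in> ?Z" for p y x
    proof -
      have "A (y \<circ> p) x = mmul ?Z (sym_mat d J (id_mat J)) A (y \<circ> p) x" by (simp add: fixA)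
      also have "\<dots> = mmul ?Z (sym_mat d J (id_mat J)) A y x"
        using that by (simp add: mmul_def sym_mat_comp_left)
      finally show ?thesis by (simp add: fixA)
    qed
    then have st: "sym_tensor {..<d} J X A" using supp by (simp add: sym_tensor_def)
    with L eqv show ?R by (simp add: intertwiner_def)
  next
    assume R': ?R
    then have st: "sym_tensor {..<d} J X A" by simp
    have "mmul ?Z (sym_mat d J (id_mat J)) A = A"
    proof (intro ext)
      fix y x
      have s1: "supp_in ?Z X (mmul ?Z (sym_mat d J (id_mat J)) A)"
        using st by (intro supp_in_mmul supp_in_sym_mat) (simp add: sym_tensor_def)
      have s2: "supp_in ?Z X A" using st by (simp add: sym_tensor_def)
      show "mmul ?Z (sym_mat d J (id_mat J)) A y x = A y x"
      proof (cases "y \<in> ?Z \<and> x \<in> X")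
        case True
        have "ten_comm {..<d} J X A (id_mat J) (id_mat X)" using ten_comm_id[OF _ J s2 R(1)] by simp
        then have "(\<Sum>z\<in>?Z. (\<Prod>i<d. id_mat J (y i) (z i)) * A z x) = mmul X A (id_mat X) y x"
          using True by (simp add: ten_comm_def mmul_def)
        then show ?thesis using sm[OF st] True mmul_id_right[OF R(1) s2] by simp
      qed (use supp_in_zero[OF s1] supp_in_zero[OF s2] in auto)
    qed
    then show ?L using R' eqv[OF st] by (simp add: intertwiner_def one sym_tensor_def)
  qed
qed

lemma sym_tensor_reindex:
  fixes h :: "'p \<Rightarrow> 'q" and A :: "('q \<Rightarrow> 'j) \<Rightarrow> 'x \<Rightarrow> 'k::comm_ring_1"
  assumes h: "bij_betw h K' K" and A: "sym_tensor K J X A" "A \<noteq> (\<lambda>_ _. 0)"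
  obtains A' where "sym_tensor K' J X A'" "A' \<noteq> (\<lambda>_ _. 0)"
    "\<And>N a. ten_comm K J X A N a \<Longrightarrow> ten_comm K' J X A' N a"
proof -
  let ?Z = "K \<rightarrow>\<^sub>E J" and ?Z' = "K' \<rightarrow>\<^sub>E J"
  define g where "g = inv_into K' h"
  define f :: "('p \<Rightarrow> 'j) \<Rightarrow> 'q \<Rightarrow> 'j" where "f = (\<lambda>z. \<lambda>k\<in>K. z (g k))"
  define f' :: "('q \<Rightarrow> 'j) \<Rightarrow> 'p \<Rightarrow> 'j" where "f' = (\<lambda>y. \<lambda>k\<in>K'. y (h k))"
  have g: "\<And>k. k \<in> K \<Longrightarrow> g k \<in> K'" "\<And>k. k \<in> K \<Longrightarrow> h (g k) = k" "\<And>k. k \<in> K' \<Longrightarrow> g (h k) = k"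
    and hK: "\<And>k. k \<in> K' \<Longrightarrow> h k \<in> K"
    using h by (auto simp: g_def bij_betw_def inv_into_into f_inv_into_f)
  have gb: "bij_betw g K K'" unfolding g_def using h by (rule bij_betw_inv_into)
  have fZ: "f z \<in> ?Z" if "z \<in> ?Z'" for z using that g by (auto simp: f_def PiE_iff)
  have fZ': "f' y \<in> ?Z'" if "y \<in> ?Z" for y using that hK by (auto simp: f'_def PiE_iff)
  have ff': "f (f' y) = y" if "y \<in> ?Z" for y
    using that g by (auto simp: f_def f'_def fun_eq_iff PiE_iff extensional_def)
  have f'f: "f' (f z) = z" if "z \<in> ?Z'" for z
    using that g hK by (auto simp: f_def f'_def fun_eq_iff PiE_iff extensional_def)
  define A' where "A' = (\<lambda>z x. if z \<in> ?Z' then A (f z) x else 0)"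
  have "sym_tensor K' J X A'"
    unfolding sym_tensor_def
  proof (intro conjI allI impI)
    show "supp_in ?Z' X A'" using A(1) by (auto simp: sym_tensor_def supp_in_def A'_def)
    fix p y x assume p: "p permutes K'" and y: "y \<in> ?Z'"
    define q where "q = (\<lambda>k. if k \<in> K then h (p (g k)) else k)"
    have "bij_betw (h \<circ> p \<circ> g) K K"
      using gb permutes_imp_bij[OF p] h by (auto intro: bij_betw_trans)
    then have "bij_betw q K K" by (rule iffD1[OF bij_betw_cong, rotated]) (simp add: q_def)
    then have q: "q permutes K" by (rule bij_imp_permutes) (simp add: q_def)
    have "f (y \<circ> p) = f y \<circ> q"
      using g permutes_in_image[OF p] hK by (auto simp: f_def q_def fun_eq_iff)
    then show "A' (y \<circ> p) x = A' y x"
      using A(1) q fZ[OF y] y comp_permutes_PiE[OF p y] by (simp add: A'_def sym_tensor_def)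
  qed
  moreover have "A' \<noteq> (\<lambda>_ _. 0)"
  proof -
    obtain y x where yx: "A y x \<noteq> 0" using A(2) by (metis ext)
    then have y: "y \<in> ?Z" using A(1) by (auto simp: sym_tensor_def supp_in_def)
    then have "A' (f' y) x \<noteq> 0" using yx by (simp add: A'_def fZ' ff')
    then show ?thesis by (auto simp: fun_eq_iff)
  qed
  moreover have "ten_comm K' J X A' N a" if N: "ten_comm K J X A N a" for N a
    unfolding ten_comm_def
  proof (intro ballI)
    fix y x assume y: "y \<in> ?Z'" and x: "x \<in> X"
    have "(\<Sum>z\<in>?Z'. (\<Prod>k\<in>K'. N (y k) (z k)) * A' z x) = (\<Sum>z\<in>?Z. (\<Prod>k\<in>K. N (f y k) (z k)) * A z x)"
    proof (rule sum.reindex_bij_witness[of _ f' f])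
      fix z assume z: "z \<in> ?Z'"
      have "(\<Prod>k\<in>K'. N (y k) (z k)) = (\<Prod>k\<in>K. N (y (g k)) (z (g k)))"
        by (rule prod.reindex_bij_betw[OF gb, symmetric])
      also have "\<dots> = (\<Prod>k\<in>K. N (f y k) (f z k))" by (intro prod.cong refl) (simp add: f_def)
      finally show "(\<Prod>k\<in>K. N (f y k) (f z k)) * A (f z) x = (\<Prod>k\<in>K'. N (y k) (z k)) * A' z x"
        using z by (simp add: A'_def)
    qed (auto simp: fZ fZ' ff' f'f)
    also have "\<dots> = (\<Sum>x'\<in>X. A (f y) x' * a x' x)" using N fZ[OF y] x by (simp add: ten_comm_def)
    also have "\<dots> = (\<Sum>x'\<in>X. A' y x' * a x' x)" using y by (simp add: A'_def)
    finally show "(\<Sum>z\<in>?Z'. (\<Prod>k\<in>K'. N (y k) (z k)) * A' z x) = (\<Sum>x'\<in>X. A' y x' * a x' x)" .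
  qed
  ultimately show ?thesis by (rule that)
qed

section \<open>Splitting symmetric tensors into blocks\<close>

text \<open>
  Block matrices with one nonzero block \<open>N j\<close> in each block column \<open>j\<close>, in the block row \<open>s j\<close>.
\<close>
definition vmon :: "nat \<Rightarrow> 'c set \<Rightarrow> (nat \<Rightarrow> nat) \<Rightarrow> (nat \<Rightarrow> 'c \<Rightarrow> 'c \<Rightarrow> 'k::comm_ring_1) \<Rightarrow>
    nat \<times> 'c \<Rightarrow> nat \<times> 'c \<Rightarrow> 'k" where
  "vmon n C s N = (\<lambda>(i, c) (j, c'). if j < n \<and> i = s j \<and> c \<in> C \<and> c' \<in> C then N j c c' else 0)"

text \<open>
  The counterpart of \<^const>\<open>vmon\<close> for a tensor product: the matrix of the map which applies \<open>a j\<close> to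
  the \<open>j\<close>-th factor and moves the result to position \<open>s j\<close>.
\<close>
definition emon :: "nat \<Rightarrow> 'x set \<Rightarrow> (nat \<Rightarrow> nat) \<Rightarrow> (nat \<Rightarrow> 'x \<Rightarrow> 'x \<Rightarrow> 'k::comm_ring_1) \<Rightarrow>
    (nat \<Rightarrow> 'x) \<Rightarrow> (nat \<Rightarrow> 'x) \<Rightarrow> 'k" where
  "emon n X s a = (\<lambda>y x. if y \<in> {..<n} \<rightarrow>\<^sub>E X \<and> x \<in> {..<n} \<rightarrow>\<^sub>E X then \<Prod>j<n. a j (y (s j)) (x j) else 0)"

text \<open>
  The component of \<open>A\<close> at \<open>y0\<close> lies in a product of symmetric powers of the blocks, in which block \<open>i\<close>
  has degree \<open>card Ki\<close>. Freezing all indices outside \<open>Ki\<close>, and all tensor factors of the other side except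
  the \<open>i\<close>-th, leaves a tensor for block \<open>i\<close> alone. The relations for matrices which act
  trivially on the other blocks survive.
\<close>
lemma block_restriction:
  fixes A :: "('q \<Rightarrow> nat \<times> 'c) \<Rightarrow> (nat \<Rightarrow> 'x) \<Rightarrow> 'k::{comm_ring_1}"
  assumes fin: "finite K" "finite C" "finite X"
    and A: "sym_tensor K ({..<n} \<times> C) ({..<n} \<rightarrow>\<^sub>E X) A"
    and y0: "A y0 x0 \<noteq> 0" and i: "i < n"
  defines "Ki \<equiv> {k\<in>K. fst (y0 k) = i}"
  obtains A' where "sym_tensor Ki C X A'" "A' \<noteq> (\<lambda>_ _. 0)"
    "\<And>N a. ten_comm K ({..<n} \<times> C) ({..<n} \<rightarrow>\<^sub>E X) A
       (vmon n C id (\<lambda>j. if j = i then N else id_mat C)) (emon n X id (\<lambda>j. if j = i then a else id_mat X)) \<Longrightarrow>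
       ten_comm Ki C X A' N a"
proof -
  let ?J = "{..<n} \<times> C" and ?Y = "{..<n} \<rightarrow>\<^sub>E X"
  have y0Z: "y0 \<in> K \<rightarrow>\<^sub>E ?J" and x0Y: "x0 \<in> ?Y" using A y0 by (auto simp: sym_tensor_def supp_in_def)
  have Ki: "Ki \<subseteq> K" "finite Ki" using fin by (auto simp: Ki_def)
  define E where "E = (\<lambda>z. \<lambda>k\<in>K. if k \<in> Ki then (i, z k) else y0 k)"
  have EZ: "E z \<in> K \<rightarrow>\<^sub>E ?J" if "z \<in> Ki \<rightarrow>\<^sub>E C" for z using that y0Z i by (auto simp: E_def PiE_iff)
  have xY: "x0(i := x) \<in> ?Y" if "x \<in> X" for x using that x0Y i by (auto simp: PiE_iff extensional_def)
  define A' where "A' = (\<lambda>z x. if z \<in> Ki \<rightarrow>\<^sub>E C \<and> x \<in> X then A (E z) (x0(i := x)) else 0)"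
  have Esnd: "E (\<lambda>k\<in>Ki. snd (y0 k)) = y0"
    using y0Z by (auto simp: E_def fun_eq_iff Ki_def PiE_iff extensional_def prod_eq_iff)
  have EK: "E z k = (i, z k)" if "k \<in> Ki" for z k using that Ki(1) by (auto simp: E_def)
  have EK': "E z k = y0 k" if "k \<in> K" "k \<notin> Ki" for z k using that by (simp add: E_def)
  have "sym_tensor Ki C X A'"
    unfolding sym_tensor_def
  proof (intro conjI allI impI)
    show "supp_in (Ki \<rightarrow>\<^sub>E C) X A'" by (auto simp: supp_in_def A'_def)
    fix p y x assume p: "p permutes Ki" and y: "y \<in> Ki \<rightarrow>\<^sub>E C"
    have pK: "p permutes K" using p Ki(1) by (rule permutes_subset)
    have "E (y \<circ> p) = E y \<circ> p"
    proof
      fix k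
      show "E (y \<circ> p) k = (E y \<circ> p) k"
      proof (cases "k \<in> Ki")
        case True
        then have "p k \<in> Ki" "k \<in> K" "p k \<in> K" using permutes_in_image[OF p] Ki by auto
        then show ?thesis using True by (simp add: E_def)
      next
        case False
        then show ?thesis using permutes_not_in[OF p] by (simp add: E_def)
      qed
    qed
    then show "A' (y \<circ> p) x = A' y x"
      using A pK EZ[OF y] y comp_permutes_PiE[OF p y] by (simp add: A'_def sym_tensor_def)
  qed
  moreover have "A' \<noteq> (\<lambda>_ _. 0)"
  proof -
    have "snd (y0 k) \<in> C" if "k \<in> Ki" for k
      using PiE_mem[OF y0Z subsetD[OF Ki(1) that]] by (simp add: mem_Times_iff)
    then have "(\<lambda>k\<in>Ki. snd (y0 k)) \<in> Ki \<rightarrow>\<^sub>E C" by auto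
    moreover have "x0 i \<in> X" using x0Y i by auto
    ultimately have "A' (\<lambda>k\<in>Ki. snd (y0 k)) (x0 i) = A y0 x0" by (simp add: A'_def Esnd)
    then show ?thesis using y0 by (cases "A' = (\<lambda>_ _. 0)") simp_all
  qed
  moreover have "ten_comm Ki C X A' N a"
    if N: "ten_comm K ?J ?Y A (vmon n C id (\<lambda>j. if j = i then N else id_mat C))
       (emon n X id (\<lambda>j. if j = i then a else id_mat X))" for N a
    unfolding ten_comm_def
  proof (intro ballI)
    fix y x assume y: "y \<in> Ki \<rightarrow>\<^sub>E C" and x: "x \<in> X"
    let ?M = "vmon n C id (\<lambda>j. if j = i then N else id_mat C)"
    have M1: "?M (i, c) (i, c') = N c c'" if "c \<in> C" "c' \<in> C" for c c' using that i by (simp add: vmon_def)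
    have M2: "?M p q = (if p = q then 1 else 0)" if "p \<in> ?J" "q \<in> ?J" "fst p \<noteq> i" for p q
      using that by (auto simp: vmon_def id_mat_def split: if_splits)
    have M3: "?M (i, c) q = 0" if "fst q \<noteq> i" for c q using that by (auto simp: vmon_def split: prod.splits)
    have "(\<Sum>z\<in>Ki \<rightarrow>\<^sub>E C. (\<Prod>k\<in>Ki. N (y k) (z k)) * A' z x)
        = (\<Sum>z\<in>Ki \<rightarrow>\<^sub>E C. (\<Prod>k\<in>K. ?M (E y k) (E z k)) * A (E z) (x0(i := x)))"
    proof (intro sum.cong refl)
      fix z assume z: "z \<in> Ki \<rightarrow>\<^sub>E C"
      have "(\<Prod>k\<in>K. ?M (E y k) (E z k)) = (\<Prod>k\<in>Ki. ?M (E y k) (E z k))"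
      proof (rule prod.mono_neutral_right[OF fin(1) Ki(1)], intro ballI)
        fix k assume "k \<in> K - Ki"
        then show "?M (E y k) (E z k) = 1" using M2[of "y0 k" "y0 k"] y0Z by (auto simp: E_def Ki_def)
      qed
      also have "\<dots> = (\<Prod>k\<in>Ki. N (y k) (z k))"
        using M1 y z Ki by (intro prod.cong refl) (auto simp: E_def)
      finally show "(\<Prod>k\<in>Ki. N (y k) (z k)) * A' z x = (\<Prod>k\<in>K. ?M (E y k) (E z k)) * A (E z) (x0(i := x))"
        using z x by (simp add: A'_def)
    qed
    also have "\<dots> = (\<Sum>u\<in>K \<rightarrow>\<^sub>E ?J. (\<Prod>k\<in>K. ?M (E y k) (u k)) * A u (x0(i := x)))"
    proof (rule sum_via_inj[symmetric])
      show "finite (K \<rightarrow>\<^sub>E ?J)" using fin by (intro finite_PiE) auto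
      show "inj_on E (Ki \<rightarrow>\<^sub>E C)"
      proof (rule inj_onI)
        fix u v assume u: "u \<in> Ki \<rightarrow>\<^sub>E C" and v: "v \<in> Ki \<rightarrow>\<^sub>E C" and "E u = E v"
        then have "E u k = E v k" for k by simp
        then have uv: "u k = v k" if "k \<in> Ki" for k using EK[OF that, of u] EK[OF that, of v] by simp
        show "u = v" by (rule PiE_ext[OF u v uv])
      qed
      show "E ` (Ki \<rightarrow>\<^sub>E C) \<subseteq> K \<rightarrow>\<^sub>E ?J" using EZ by auto
      fix u assume u: "u \<in> K \<rightarrow>\<^sub>E ?J" "u \<notin> E ` (Ki \<rightarrow>\<^sub>E C)"
      have "\<exists>k\<in>K. ?M (E y k) (u k) = 0"
      proof (rule ccontr)
        assume "\<not> (\<exists>k\<in>K. ?M (E y k) (u k) = 0)"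
        then have nz: "?M (E y k) (u k) \<noteq> 0" if "k \<in> K" for k using that by blast
        have uJ: "u k \<in> ?J" if "k \<in> K" for k using u(1) that by (rule PiE_mem)
        have u1: "fst (u k) = i" if "k \<in> Ki" for k
          using nz[OF subsetD[OF Ki(1) that]] M3[of "u k" "y k"] EK[OF that, of y] by auto
        have u2: "u k = y0 k" if "k \<in> K" "k \<notin> Ki" for k
        proof -
          have "fst (y0 k) \<noteq> i" using that by (simp add: Ki_def)
          from M2[OF PiE_mem[OF y0Z that(1)] uJ[OF that(1)] this] nz[OF that(1)] EK'[OF that, of y]
          show ?thesis by (simp split: if_splits)
        qed
        have "E (\<lambda>k\<in>Ki. snd (u k)) = u"
        proof
          fix k
          consider "k \<in> Ki" | "k \<in> K" "k \<notin> Ki" | "k \<notin> K" by blast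
          then show "E (\<lambda>k\<in>Ki. snd (u k)) k = u k"
          proof cases
            case 1
            then show ?thesis using EK[OF 1] u1[OF 1] by (simp add: prod_eq_iff)
          next
            case 2
            then show ?thesis using EK'[OF 2] u2[OF 2] by simp
          next
            case 3
            then show ?thesis using PiE_arb[OF u(1) 3] by (simp add: E_def)
          qed
        qed
        moreover have "(\<lambda>k\<in>Ki. snd (u k)) \<in> Ki \<rightarrow>\<^sub>E C"
          using uJ Ki(1) by (auto simp: mem_Times_iff subset_iff)
        ultimately show False using u(2) by (metis imageI)
      qed
      then show "(\<Prod>k\<in>K. ?M (E y k) (u k)) * A u (x0(i := x)) = 0"
        using fin(1) by (auto simp: prod_zero)
    qed
    also have "\<dots> = (\<Sum>x'\<in>?Y. A (E y) x' * emon n X id (\<lambda>j. if j = i then a else id_mat X) x' (x0(i := x)))"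
      using N EZ[OF y] xY[OF x] by (simp add: ten_comm_def)
    also have "\<dots> = (\<Sum>\<xi>\<in>X. A (E y) (x0(i := \<xi>)) * emon n X id (\<lambda>j. if j = i then a else id_mat X) (x0(i := \<xi>)) (x0(i := x)))"
    proof (rule sum_via_inj)
      show "finite ?Y" using fin by (intro finite_PiE) auto
      show "inj_on (\<lambda>\<xi>. x0(i := \<xi>)) X" by (rule inj_onI) (metis fun_upd_same)
      show "(\<lambda>\<xi>. x0(i := \<xi>)) ` X \<subseteq> ?Y" using xY by auto
      fix x' assume x': "x' \<in> ?Y" "x' \<notin> (\<lambda>\<xi>. x0(i := \<xi>)) ` X"
      have "\<exists>j\<in>{..<n} - {i}. x' j \<noteq> x0 j"
      proof (rule ccontr)
        assume "\<not> ?thesis"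
        then have eq: "x' j = x0 j" if "j < n" "j \<noteq> i" for j using that by simp
        have "x' = x0(i := x' i)"
        proof
          fix j
          show "x' j = (x0(i := x' i)) j"
            using eq[of j] PiE_arb[OF x'(1), of j] PiE_arb[OF x0Y, of j] i by (cases "j < n") auto
        qed
        moreover have "x' i \<in> X" using x'(1) i by auto
        ultimately show False using x'(2) by (metis imageI)
      qed
      then obtain j where j: "j < n" "j \<noteq> i" "x' j \<noteq> x0 j" by auto
      then have "(if j = i then a else id_mat X) (x' (id j)) ((x0(i := x)) j) = 0" by (simp add: id_mat_def)
      then have *: "(\<Prod>j<n. (if j = i then a else id_mat X) (x' (id j)) ((x0(i := x)) j)) = 0"
        using j(1) by (intro prod_zero[OF finite_lessThan] bexI[of _ j]) simp_all
      have "emon n X id (\<lambda>j. if j = i then a else id_mat X) x' (x0(i := x)) = 0"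
        unfolding emon_def * by simp
      then show "A (E y) x' * emon n X id (\<lambda>j. if j = i then a else id_mat X) x' (x0(i := x)) = 0" by simp
    qed
    also have "\<dots> = (\<Sum>\<xi>\<in>X. A' y \<xi> * a \<xi> x)"
    proof (intro sum.cong refl)
      fix \<xi> assume \<xi>: "\<xi> \<in> X"
      have "emon n X id (\<lambda>j. if j = i then a else id_mat X) (x0(i := \<xi>)) (x0(i := x))
         = (\<Prod>j<n. (if j = i then a else id_mat X) ((x0(i := \<xi>)) (id j)) ((x0(i := x)) j))"
        unfolding emon_def using xY[OF \<xi>] xY[OF x] by (simp only: simp_thms if_True)
      also have "\<dots> = (\<Prod>j<n. if j = i then a \<xi> x else 1)"
        using PiE_mem[OF x0Y] by (intro prod.cong refl) (simp add: id_mat_def)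
      also have "\<dots> = a \<xi> x" using i by simp
      finally show "A (E y) (x0(i := \<xi>)) * emon n X id (\<lambda>j. if j = i then a else id_mat X) (x0(i := \<xi>)) (x0(i := x))
         = A' y \<xi> * a \<xi> x" using y \<xi> by (simp add: A'_def)
    qed
    finally show "(\<Sum>z\<in>Ki \<rightarrow>\<^sub>E C. (\<Prod>k\<in>Ki. N (y k) (z k)) * A' z x) = (\<Sum>\<xi>\<in>X. A' y \<xi> * a \<xi> x)" .
  qed
  ultimately show ?thesis by (rule that)
qed

text \<open>
  The tensor product of \<open>n\<close> copies of \<open>A0\<close>, one for each block, is defined on those index tuples which put
  the \<open>b\<close> positions of row \<open>i\<close> into block \<open>i\<close>; it is then symmetrized over all \<open>n * b\<close> positions. A
  permutation \<open>s\<close> of the blocks permutes the rows of positions, and this is absorbed by the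
  symmetrization. That sum does not vanish: permutations which preserve the rows contribute
  equal terms since \<open>A0\<close> is symmetric, and the others contribute 0 at the tuples considered.
\<close>
lemma block_product:
  fixes A0 :: "(nat \<Rightarrow> 'c) \<Rightarrow> 'x \<Rightarrow> 'k::field_char_0"
  assumes fin: "finite C" "finite X"
    and A0: "sym_tensor {..<b} C X A0" "A0 \<noteq> (\<lambda>_ _. 0)"
  obtains A where "sym_tensor ({..<n} \<times> {..<b}) ({..<n} \<times> C) ({..<n} \<rightarrow>\<^sub>E X) A" "A \<noteq> (\<lambda>_ _. 0)"
    "\<And>s N a. s permutes {..<n} \<Longrightarrow> (\<And>j. j < n \<Longrightarrow> ten_comm {..<b} C X A0 (N j) (a j)) \<Longrightarrow>
       ten_comm ({..<n} \<times> {..<b}) ({..<n} \<times> C) ({..<n} \<rightarrow>\<^sub>E X) A (vmon n C s N) (emon n X s a)"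
proof -
  let ?K = "{..<n} \<times> {..<b}" and ?J = "{..<n} \<times> C" and ?Y = "{..<n} \<rightarrow>\<^sub>E X" and ?Cb = "{..<b} \<rightarrow>\<^sub>E C"
  let ?P = "{p. p permutes ?K}"
  define row :: "(nat \<times> nat \<Rightarrow> nat \<times> 'c) \<Rightarrow> nat \<Rightarrow> nat \<Rightarrow> 'c" where "row = (\<lambda>y j. \<lambda>k\<in>{..<b}. snd (y (j, k)))"
  define A1 where "A1 = (\<lambda>y x. if y \<in> ?K \<rightarrow>\<^sub>E ?J \<and> x \<in> ?Y \<and> (\<forall>q\<in>?K. fst (y q) = fst q)
     then \<Prod>i<n. A0 (row y i) (x i) else 0)"
  define A where "A = (\<lambda>y x. if y \<in> ?K \<rightarrow>\<^sub>E ?J then \<Sum>p\<in>?P. A1 (y \<circ> p) x else 0)"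
  have finK: "finite ?K" and finJ: "finite ?J" using fin by auto
  have finP: "finite ?P" by (rule finite_permutations[OF finK])
  have finZ: "finite (?K \<rightarrow>\<^sub>E ?J)" by (rule finite_PiE[OF finK finJ])
  have rowC: "row y j \<in> ?Cb" if "y \<in> ?K \<rightarrow>\<^sub>E ?J" "j < n" for y j
  proof -
    have "snd (y (j, k)) \<in> C" if "k < b" for k
      using PiE_mem[OF \<open>y \<in> ?K \<rightarrow>\<^sub>E ?J\<close>, of "(j, k)"] that \<open>j < n\<close> by (simp add: mem_Times_iff)
    then show ?thesis by (auto simp: row_def)
  qed
  have A1_val: "A1 y x = (\<Prod>i<n. A0 (row y i) (x i))"
    if "y \<in> ?K \<rightarrow>\<^sub>E ?J" "x \<in> ?Y" "\<forall>q\<in>?K. fst (y q) = fst q" for y x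
    unfolding A1_def by (rule if_P) (use that in blast)
  have A1_0: "A1 y x = 0" if "\<not> (\<forall>q\<in>?K. fst (y q) = fst q)" for y x
    unfolding A1_def by (rule if_not_P) (use that in blast)
  have A1_comm: "(\<Sum>z\<in>?K \<rightarrow>\<^sub>E ?J. (\<Prod>q\<in>?K. vmon n C s N (y q) (z q)) * A1 z x)
      = (\<Sum>x'\<in>?Y. A1 (y \<circ> (\<lambda>q. if q \<in> ?K then (Hilbert_Choice.inv s (fst q), snd q) else q)) x' * emon n X s a x' x)"
    if s: "s permutes {..<n}" and Na: "\<And>j. j < n \<Longrightarrow> ten_comm {..<b} C X A0 (N j) (a j)"
      and y: "y \<in> ?K \<rightarrow>\<^sub>E ?J" and x: "x \<in> ?Y" for s N a y x
  proof -
    define rot where "rot = (\<lambda>q. if q \<in> ?K then (Hilbert_Choice.inv s (fst q), snd q) else q)"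
    have sn: "s j < n \<longleftrightarrow> j < n" for j using permutes_in_image[OF s, of j] by simp
    have isn: "Hilbert_Choice.inv s j < n \<longleftrightarrow> j < n" for j
      using permutes_in_image[OF permutes_inv[OF s], of j] by simp
    have rot_s: "rot (s j, k) = (j, k)" if "j < n" "k < b" for j k
      using that sn permutes_inverses[OF s] by (simp add: rot_def)
    have rotK: "rot q \<in> ?K \<longleftrightarrow> q \<in> ?K" for q
      by (cases q) (simp add: rot_def isn)
    have yrot: "y \<circ> rot \<in> ?K \<rightarrow>\<^sub>E ?J"
    proof (rule PiE_I)
      show "(y \<circ> rot) q \<in> ?J" if "q \<in> ?K" for q using PiE_mem[OF y] rotK that by simp
      show "(y \<circ> rot) q = undefined" if "q \<notin> ?K" for q
        using PiE_arb[OF y that] that by (simp add: rot_def)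
    qed
    define cond where "cond \<longleftrightarrow> (\<forall>q\<in>?K. fst (y q) = s (fst q))"
    define F where "F = (\<lambda>\<zeta>. \<lambda>q\<in>?K. (fst q, \<zeta> (fst q) (snd q) :: 'c))"
    have FZ: "F \<zeta> \<in> ?K \<rightarrow>\<^sub>E ?J" if "\<zeta> \<in> {..<n} \<rightarrow>\<^sub>E ?Cb" for \<zeta>
    proof -
      have "\<zeta> i k \<in> C" if "i < n" "k < b" for i k using \<open>\<zeta> \<in> {..<n} \<rightarrow>\<^sub>E ?Cb\<close> that by (auto dest: PiE_mem)
      then show ?thesis by (auto simp: F_def)
    qed
    have rowF: "row (F \<zeta>) j = \<zeta> j" if "\<zeta> \<in> {..<n} \<rightarrow>\<^sub>E ?Cb" "j < n" for \<zeta> j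
    proof -
      have "\<zeta> j \<in> ?Cb" using that by auto
      then show ?thesis using that(2) by (auto simp: row_def F_def fun_eq_iff PiE_def extensional_def)
    qed
    have "(\<Sum>z\<in>?K \<rightarrow>\<^sub>E ?J. (\<Prod>q\<in>?K. vmon n C s N (y q) (z q)) * A1 z x)
        = (\<Sum>\<zeta>\<in>{..<n} \<rightarrow>\<^sub>E ?Cb. (\<Prod>q\<in>?K. vmon n C s N (y q) (F \<zeta> q)) * A1 (F \<zeta>) x)"
    proof (rule sum_via_inj[OF finZ])
      show "inj_on F ({..<n} \<rightarrow>\<^sub>E ?Cb)"
      proof (rule inj_onI)
        fix u v assume uv: "u \<in> {..<n} \<rightarrow>\<^sub>E ?Cb" "v \<in> {..<n} \<rightarrow>\<^sub>E ?Cb" "F u = F v"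
        then show "u = v" using rowF[OF uv(1)] rowF[OF uv(2)] by (metis PiE_ext lessThan_iff)
      qed
      show "F ` ({..<n} \<rightarrow>\<^sub>E ?Cb) \<subseteq> ?K \<rightarrow>\<^sub>E ?J" using FZ by auto
      fix z assume z: "z \<in> ?K \<rightarrow>\<^sub>E ?J" "z \<notin> F ` ({..<n} \<rightarrow>\<^sub>E ?Cb)"
      have "\<not> (\<forall>q\<in>?K. fst (z q) = fst q)"
      proof
        assume *: "\<forall>q\<in>?K. fst (z q) = fst q"
        have "F (\<lambda>j\<in>{..<n}. row z j) q = z q" for q
        proof (cases "q \<in> ?K")
          case True
          then show ?thesis using * by (auto simp: F_def row_def prod_eq_iff)
        next
          case False
          then show ?thesis using PiE_arb[OF z(1) False] by (simp add: F_def)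
        qed
        moreover have "(\<lambda>j\<in>{..<n}. row z j) \<in> {..<n} \<rightarrow>\<^sub>E ?Cb" using rowC[OF z(1)] by auto
        ultimately show False using z(2) by (metis ext imageI)
      qed
      from A1_0[OF this] show "(\<Prod>q\<in>?K. vmon n C s N (y q) (z q)) * A1 z x = 0" by (simp only: mult_zero_right)
    qed
    also have "\<dots> = (if cond then \<Prod>j<n. \<Sum>x'\<in>X. A0 (row y j) x' * a j x' (x j) else 0)"
    proof (cases cond)
      case True
      have "(\<Prod>q\<in>?K. vmon n C s N (y q) (F \<zeta> q)) * A1 (F \<zeta>) x
          = (\<Prod>j<n. (\<Prod>k<b. N j (row y j k) (\<zeta> j k)) * A0 (\<zeta> j) (x j))"
        if \<zeta>: "\<zeta> \<in> {..<n} \<rightarrow>\<^sub>E ?Cb" for \<zeta>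
      proof -
        have "vmon n C s N (y (j,k)) (F \<zeta> (j,k)) = N j (row y j k) (\<zeta> j k)" if "j < n" "k < b" for j k
        proof -
          have "y (j,k) = (s j, row y j k)" using True that by (auto simp: cond_def row_def prod_eq_iff)
          moreover have "row y j k \<in> C" "\<zeta> j k \<in> C" using rowC[OF y] \<zeta> that by (auto dest: PiE_mem)
          ultimately show ?thesis using that by (simp add: vmon_def F_def)
        qed
        then have "(\<Prod>q\<in>?K. vmon n C s N (y q) (F \<zeta> q)) = (\<Prod>j<n. \<Prod>k<b. N j (row y j k) (\<zeta> j k))"
          by (subst prod.cartesian_product) (auto intro!: prod.cong)
        moreover have "A1 (F \<zeta>) x = (\<Prod>j<n. A0 (\<zeta> j) (x j))"
        proof -
          have "\<forall>q\<in>?K. fst (F \<zeta> q) = fst q" by (simp add: F_def)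
          then have "A1 (F \<zeta>) x = (\<Prod>j<n. A0 (row (F \<zeta>) j) (x j))"
            by (rule A1_val[OF FZ[OF \<zeta>] x])
          also have "\<dots> = (\<Prod>j<n. A0 (\<zeta> j) (x j))" by (intro prod.cong refl) (simp add: rowF[OF \<zeta>])
          finally show ?thesis .
        qed
        ultimately show ?thesis by (simp add: prod.distrib)
      qed
      then have "(\<Sum>\<zeta>\<in>{..<n} \<rightarrow>\<^sub>E ?Cb. (\<Prod>q\<in>?K. vmon n C s N (y q) (F \<zeta> q)) * A1 (F \<zeta>) x)
          = (\<Sum>\<zeta>\<in>{..<n} \<rightarrow>\<^sub>E ?Cb. \<Prod>j<n. (\<Prod>k<b. N j (row y j k) (\<zeta> j k)) * A0 (\<zeta> j) (x j))"
        by (intro sum.cong) auto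
      also have "\<dots> = (\<Prod>j<n. \<Sum>z\<in>?Cb. (\<Prod>k<b. N j (row y j k) (z k)) * A0 z (x j))"
        using fin by (subst prod_sum_PiE) (auto intro!: finite_PiE)
      also have "\<dots> = (\<Prod>j<n. \<Sum>x'\<in>X. A0 (row y j) x' * a j x' (x j))"
      proof (intro prod.cong refl)
        fix j assume "j \<in> {..<n}"
        then show "(\<Sum>z\<in>?Cb. (\<Prod>k<b. N j (row y j k) (z k)) * A0 z (x j)) = (\<Sum>x'\<in>X. A0 (row y j) x' * a j x' (x j))"
          using Na[of j] rowC[OF y, of j] PiE_mem[OF x, of j] by (simp add: ten_comm_def)
      qed
      finally show ?thesis using True by simp
    next
      case False
      then obtain q where q: "q \<in> ?K" "fst (y q) \<noteq> s (fst q)" by (auto simp: cond_def)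
      then have "vmon n C s N (y q) (F \<zeta> q) = 0" for \<zeta> by (simp add: vmon_def F_def case_prod_unfold)
      then have "(\<Prod>q\<in>?K. vmon n C s N (y q) (F \<zeta> q)) = 0" for \<zeta>
        using q(1) finK by (auto intro: prod_zero)
      then show ?thesis using False by simp
    qed
    also have "\<dots> = (\<Sum>x'\<in>?Y. A1 (y \<circ> rot) x' * emon n X s a x' x)"
    proof (cases cond)
      case True
      have fr: "\<forall>q\<in>?K. fst ((y \<circ> rot) q) = fst q"
      proof
        fix q assume q: "q \<in> ?K"
        then have "rot q \<in> ?K" using rotK by blast
        from bspec[OF True[unfolded cond_def] this] have "fst (y (rot q)) = s (fst (rot q))" .
        then show "fst ((y \<circ> rot) q) = fst q" using q permutes_inverses[OF s] by (simp add: rot_def)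
      qed
      have rr: "row (y \<circ> rot) (s j) = row y j" if "j < n" for j
        unfolding row_def by (rule restrict_ext) (simp add: rot_s that)
      have "(\<Sum>x'\<in>?Y. A1 (y \<circ> rot) x' * emon n X s a x' x)
          = (\<Sum>x'\<in>?Y. \<Prod>j<n. A0 (row y j) ((x' \<circ> s) j) * a j ((x' \<circ> s) j) (x j))"
      proof (intro sum.cong refl)
        fix x' assume x': "x' \<in> ?Y"
        have "A1 (y \<circ> rot) x' = (\<Prod>i<n. A0 (row (y \<circ> rot) i) (x' i))"
          by (rule A1_val[OF yrot x' fr])
        also have "\<dots> = (\<Prod>j<n. A0 (row (y \<circ> rot) (s j)) (x' (s j)))"
          using prod_comp_permutes[OF s, of "\<lambda>i. A0 (row (y \<circ> rot) i) (x' i)"] by simp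
        also have "\<dots> = (\<Prod>j<n. A0 (row y j) (x' (s j)))" by (intro prod.cong refl) (simp add: rr)
        finally show "A1 (y \<circ> rot) x' * emon n X s a x' x = (\<Prod>j<n. A0 (row y j) ((x' \<circ> s) j) * a j ((x' \<circ> s) j) (x j))"
          using x x' by (simp add: emon_def prod.distrib)
      qed
      also have "\<dots> = (\<Sum>x'\<in>?Y. \<Prod>j<n. A0 (row y j) (x' j) * a j (x' j) (x j))"
        by (rule sum_comp_permutes[OF s])
      also have "\<dots> = (\<Prod>j<n. \<Sum>x'\<in>X. A0 (row y j) x' * a j x' (x j))"
        using fin by (subst prod_sum_PiE) auto
      finally show ?thesis using True by simp
    next
      case False
      then obtain q where q: "q \<in> ?K" "fst (y q) \<noteq> s (fst q)" by (auto simp: cond_def)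
      then have "fst ((y \<circ> rot) (s (fst q), snd q)) \<noteq> fst (s (fst q), snd q)" "(s (fst q), snd q) \<in> ?K"
        using rot_s[of "fst q" "snd q"] sn by (auto simp: mem_Times_iff)
      then have "\<not> (\<forall>q\<in>?K. fst ((y \<circ> rot) q) = fst q)" by blast
      then have "A1 (y \<circ> rot) x' = 0" for x' by (rule A1_0)
      then show ?thesis using False by simp
    qed
    finally show ?thesis unfolding rot_def .
  qed
  have "sym_tensor ?K ?J ?Y A"
    unfolding sym_tensor_def
  proof (intro conjI allI impI)
    show "supp_in (?K \<rightarrow>\<^sub>E ?J) ?Y A"
      unfolding supp_in_def
    proof (intro allI impI)
      fix y x assume nz: "A y x \<noteq> 0"
      then have "y \<in> ?K \<rightarrow>\<^sub>E ?J" by (auto simp: A_def split: if_splits)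
      moreover from nz obtain p where "A1 (y \<circ> p) x \<noteq> 0" by (auto simp: A_def split: if_splits elim: sum.not_neutral_contains_not_neutral)
      then have "x \<in> ?Y" by (auto simp: A1_def split: if_splits)
      ultimately show "y \<in> ?K \<rightarrow>\<^sub>E ?J \<and> x \<in> ?Y" by blast
    qed
    fix q y x assume q: "q permutes ?K" and y: "y \<in> ?K \<rightarrow>\<^sub>E ?J"
    have "(\<Sum>p\<in>?P. A1 (y \<circ> q \<circ> p) x) = (\<Sum>p\<in>?P. A1 (y \<circ> p) x)"
      by (rule sum.reindex_bij_witness[of _ "\<lambda>p. Hilbert_Choice.inv q \<circ> p" "\<lambda>p. q \<circ> p"])
        (use q permutes_inv[OF q] permutes_inv_o[OF q] in \<open>auto simp: o_assoc intro: permutes_compose\<close>)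
    then show "A (y \<circ> q) x = A y x" using y comp_permutes_PiE[OF q y] by (simp add: A_def)
  qed
  moreover have "A \<noteq> (\<lambda>_ _. 0)"
  proof -
    obtain z0 x0 where zx: "A0 z0 x0 \<noteq> 0" using A0(2) by (metis ext)
    then have z0: "z0 \<in> ?Cb" and x0: "x0 \<in> X" using A0(1) by (auto simp: sym_tensor_def supp_in_def)
    define y0 where "y0 = (\<lambda>q\<in>?K. (fst q, z0 (snd q)))"
    define xx where "xx = (\<lambda>i\<in>{..<n}. x0)"
    define c where "c = A0 z0 x0 ^ n"
    have c: "c \<noteq> 0" using zx by (simp add: c_def)
    have "z0 k \<in> C" if "k < b" for k using PiE_mem[OF z0, of k] that by simp
    then have y0: "y0 \<in> ?K \<rightarrow>\<^sub>E ?J" unfolding y0_def by auto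
    have xx: "xx \<in> ?Y" using x0 by (auto simp: xx_def)
    have val: "A1 (y0 \<circ> p) xx = (if \<forall>q\<in>?K. fst (p q) = fst q then c else 0)" if p: "p \<in> ?P" for p
    proof -
      have pK: "p q \<in> ?K \<longleftrightarrow> q \<in> ?K" for q using p permutes_in_image[of p ?K q] by simp
      have yp: "y0 \<circ> p \<in> ?K \<rightarrow>\<^sub>E ?J" by (rule comp_permutes_PiE[OF _ y0]) (use p in simp)
      have fp: "fst ((y0 \<circ> p) q) = fst (p q)" if "q \<in> ?K" for q
      proof -
        have "p q \<in> ?K" by (rule iffD2[OF pK that])
        then show ?thesis by (simp add: y0_def)
      qed
      show ?thesis
      proof (cases "\<forall>q\<in>?K. fst (p q) = fst q")
        case True
        have "A0 (row (y0 \<circ> p) i) x0 = A0 z0 x0" if i: "i < n" for i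
        proof -
          define \<pi> where "\<pi> = (\<lambda>k. if k < b then snd (p (i,k)) else k)"
          have pik: "p (i,k) = (i, \<pi> k)" "\<pi> k < b" if "k < b" for k
          proof -
            have q: "(i,k) \<in> ?K" using i that by simp
            have "p (i,k) \<in> ?K" by (rule iffD2[OF pK q])
            moreover have "fst (p (i,k)) = i" using bspec[OF True q] by simp
            ultimately show "p (i,k) = (i, \<pi> k)" "\<pi> k < b"
              using that by (cases "p (i,k)", simp add: \<pi>_def)+
          qed
          have "inj_on \<pi> {..<b}"
          proof (rule inj_onI)
            fix k l assume kl: "k \<in> {..<b}" "l \<in> {..<b}" "\<pi> k = \<pi> l"
            then have "p (i,k) = p (i,l)" using pik by simp
            then show "k = l" using p permutes_inj[of p ?K] by (auto dest: injD)
          qed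
          moreover have "\<pi> ` {..<b} \<subseteq> {..<b}" using pik by auto
          ultimately have "bij_betw \<pi> {..<b} {..<b}"
            by (simp add: bij_betw_def endo_inj_surj)
          then have "\<pi> permutes {..<b}" by (rule bij_imp_permutes) (simp add: \<pi>_def)
          moreover have "row (y0 \<circ> p) i = z0 \<circ> \<pi>"
          proof
            fix k
            show "row (y0 \<circ> p) i k = (z0 \<circ> \<pi>) k"
            proof (cases "k < b")
              case True
              then show ?thesis using pik[OF True] i by (simp add: row_def y0_def)
            next
              case False
              then show ?thesis using PiE_arb[OF z0, of k] by (simp add: row_def \<pi>_def)
            qed
          qed
          ultimately show ?thesis using A0(1) z0 by (simp add: sym_tensor_def)
        qed
        moreover have "A1 (y0 \<circ> p) xx = (\<Prod>i<n. A0 (row (y0 \<circ> p) i) (xx i))"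
        proof -
          have "\<forall>q\<in>?K. fst ((y0 \<circ> p) q) = fst q" using True fp by simp
          then show ?thesis by (rule A1_val[OF yp xx])
        qed
        ultimately have "A1 (y0 \<circ> p) xx = (\<Prod>i<n. A0 z0 x0)" by (simp add: xx_def)
        then show ?thesis using True by (simp add: c_def)
      next
        case False
        then have "\<not> (\<forall>q\<in>?K. fst ((y0 \<circ> p) q) = fst q)" using fp by simp
        then have "A1 (y0 \<circ> p) xx = 0" by (rule A1_0)
        then show ?thesis using False by (simp only: if_False)
      qed
    qed
    have "A y0 xx = (\<Sum>p\<in>?P. if \<forall>q\<in>?K. fst (p q) = fst q then c else 0)"
      unfolding A_def using y0 val by (simp only: if_True) (intro sum.cong refl, simp only: val)
    also have "\<dots> = of_nat (card {p\<in>?P. \<forall>q\<in>?K. fst (p q) = fst q}) * c"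
      using finP by (subst sum.inter_filter[symmetric]) simp_all
    also have "\<dots> \<noteq> 0"
    proof -
      have "id \<in> {p\<in>?P. \<forall>q\<in>?K. fst (p q) = fst q}" by (simp add: permutes_id)
      moreover have "finite {p\<in>?P. \<forall>q\<in>?K. fst (p q) = fst q}" by (rule finite_subset[OF _ finP]) blast
      ultimately have "0 < card {p\<in>?P. \<forall>q\<in>?K. fst (p q) = fst q}"
        unfolding card_gt_0_iff by blast
      then show ?thesis using c by simp
    qed
    finally show ?thesis by (cases "A = (\<lambda>_ _. 0)") simp_all
  qed
  moreover have "ten_comm ?K ?J ?Y A (vmon n C s N) (emon n X s a)"
    if s: "s permutes {..<n}" and Na: "\<And>j. j < n \<Longrightarrow> ten_comm {..<b} C X A0 (N j) (a j)" for s N a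
    unfolding ten_comm_def
  proof (intro ballI)
    fix y x assume y: "y \<in> ?K \<rightarrow>\<^sub>E ?J" and x: "x \<in> ?Y"
    define rot where "rot = (\<lambda>q. if q \<in> ?K then (Hilbert_Choice.inv s (fst q), snd q) else q)"
    have "bij_betw (map_prod (Hilbert_Choice.inv s) id) ?K ?K"
      using permutes_imp_bij[OF permutes_inv[OF s]] by (auto intro!: bij_betw_map_prod)
    then have "bij_betw rot ?K ?K"
      by (rule iffD1[OF bij_betw_cong, rotated]) (auto simp: rot_def)
    then have rot: "rot permutes ?K" by (rule bij_imp_permutes) (simp add: rot_def)
    have "(\<Sum>z\<in>?K \<rightarrow>\<^sub>E ?J. (\<Prod>q\<in>?K. vmon n C s N (y q) (z q)) * A z x)
        = (\<Sum>z\<in>?K \<rightarrow>\<^sub>E ?J. \<Sum>p\<in>?P. (\<Prod>q\<in>?K. vmon n C s N (y q) (z q)) * A1 (z \<circ> p) x)"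
      by (intro sum.cong refl) (simp add: A_def sum_distrib_left)
    also have "\<dots> = (\<Sum>p\<in>?P. \<Sum>z\<in>?K \<rightarrow>\<^sub>E ?J. (\<Prod>q\<in>?K. vmon n C s N (y q) (z q)) * A1 (z \<circ> p) x)"
      by (rule sum.swap)
    also have "\<dots> = (\<Sum>p\<in>?P. \<Sum>x'\<in>?Y. A1 (y \<circ> (p \<circ> rot)) x' * emon n X s a x' x)"
    proof (intro sum.cong refl)
      fix p assume "p \<in> ?P"
      then have p: "p permutes ?K" by simp
      have "(\<Sum>z\<in>?K \<rightarrow>\<^sub>E ?J. (\<Prod>q\<in>?K. vmon n C s N (y q) (z q)) * A1 (z \<circ> p) x)
          = (\<Sum>z\<in>?K \<rightarrow>\<^sub>E ?J. (\<Prod>q\<in>?K. vmon n C s N ((y \<circ> p) q) ((z \<circ> p) q)) * A1 (z \<circ> p) x)"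
        using prod_comp_permutes[OF p, of "\<lambda>q. vmon n C s N (y q) (_ q)"] by simp
      also have "\<dots> = (\<Sum>z\<in>?K \<rightarrow>\<^sub>E ?J. (\<Prod>q\<in>?K. vmon n C s N ((y \<circ> p) q) (z q)) * A1 z x)"
        by (rule sum_comp_permutes[OF p])
      also have "\<dots> = (\<Sum>x'\<in>?Y. A1 (y \<circ> p \<circ> rot) x' * emon n X s a x' x)"
        unfolding rot_def by (rule A1_comm[OF s Na comp_permutes_PiE[OF p y] x])
      finally show "(\<Sum>z\<in>?K \<rightarrow>\<^sub>E ?J. (\<Prod>q\<in>?K. vmon n C s N (y q) (z q)) * A1 (z \<circ> p) x)
          = (\<Sum>x'\<in>?Y. A1 (y \<circ> (p \<circ> rot)) x' * emon n X s a x' x)" by (simp only: o_assoc)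
    qed
    also have "\<dots> = (\<Sum>p\<in>?P. \<Sum>x'\<in>?Y. A1 (y \<circ> p) x' * emon n X s a x' x)"
      by (rule sum.reindex_bij_witness[of _ "\<lambda>p. p \<circ> Hilbert_Choice.inv rot" "\<lambda>p. p \<circ> rot"])
        (use rot permutes_inv[OF rot] permutes_inv_o[OF rot] in \<open>auto simp: o_assoc[symmetric] intro: permutes_compose\<close>)
    also have "\<dots> = (\<Sum>x'\<in>?Y. A y x' * emon n X s a x' x)"
      using y by (subst sum.swap) (simp add: A_def sum_distrib_right)
    finally show "(\<Sum>z\<in>?K \<rightarrow>\<^sub>E ?J. (\<Prod>q\<in>?K. vmon n C s N (y q) (z q)) * A z x) = (\<Sum>x'\<in>?Y. A y x' * emon n X s a x' x)" .
  qed
  ultimately show ?thesis by (rule that)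
qed

lemma funpow_mem: "\<sigma> \<in> D \<rightarrow> D \<Longrightarrow> v \<in> D \<Longrightarrow> (\<sigma> ^^ k) v \<in> D" for k :: nat
  by (induction k) auto
section \<open>Semidirect products with a cyclic group of automorphisms\<close>

locale finite_aut = group H for H :: "('h, 'm) monoid_scheme" (structure) +
  fixes \<phi> :: "'h \<Rightarrow> 'h"
  assumes fin: "finite (carrier H)" and aut: "\<phi> \<in> auto H"
begin

abbreviation A where "A \<equiv> AutoGroup H"

interpretation Aut: group A by (rule AutoGroup)

lemma aut_carrier: "\<phi> \<in> carrier A"
  using aut by (simp add: AutoGroup_def)

lemma aut_one: "\<one>\<^bsub>A\<^esub> = (\<lambda>x\<in>carrier H. x)"
  by (simp add: AutoGroup_def BijGroup_def)

lemma aut_mult: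
  "a \<in> carrier A \<Longrightarrow> b \<in> carrier A \<Longrightarrow> a \<otimes>\<^bsub>A\<^esub> b = compose (carrier H) a b"
  by (auto simp: AutoGroup_def BijGroup_def auto_def)

lemma aut_closed: "a \<in> carrier A \<Longrightarrow> h \<in> carrier H \<Longrightarrow> a h \<in> carrier H"
  by (auto simp: AutoGroup_def auto_def hom_def)

lemma aut_pow: "\<phi> [^]\<^bsub>A\<^esub> (k::nat) = (\<lambda>x\<in>carrier H. (\<phi> ^^ k) x)"
proof (induction k)
  case 0
  then show ?case by (simp add: aut_one)
next
  case (Suc k)
  have "\<phi> [^]\<^bsub>A\<^esub> Suc k = compose (carrier H) (\<phi> [^]\<^bsub>A\<^esub> k) \<phi>"
    using aut_mult[OF Aut.nat_pow_closed[OF aut_carrier] aut_carrier] by simp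
  also have "\<dots> = (\<lambda>x\<in>carrier H. (\<phi> ^^ Suc k) x)"
    unfolding compose_def by (rule restrict_ext) (simp add: Suc aut_closed[OF aut_carrier] funpow_swap1)
  finally show ?case .
qed

lemma finite_aut_group: "finite (carrier A)"
proof (rule finite_subset)
  show "carrier A \<subseteq> carrier H \<rightarrow>\<^sub>E carrier H"
    by (auto simp: AutoGroup_def auto_def Bij_def PiE_def hom_def)
  show "finite (carrier H \<rightarrow>\<^sub>E carrier H)" by (intro finite_PiE fin)
qed

lemma generate_aut: "generate A {\<phi>} = {\<phi> [^]\<^bsub>A\<^esub> k | k. k \<in> (UNIV::nat set)}"
  by (rule Aut.generate_pow_on_finite_carrier[OF finite_aut_group aut_carrier])

lemma generate_sub: "generate A {\<phi>} \<subseteq> carrier A"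
  using Aut.generate_incl[of "{\<phi>}"] aut_carrier by auto

definition ex :: "('h \<Rightarrow> 'h) \<Rightarrow> nat" where "ex a = (LEAST k::nat. a = \<phi> [^]\<^bsub>A\<^esub> k)"

lemma ex: "a \<in> generate A {\<phi>} \<Longrightarrow> a = \<phi> [^]\<^bsub>A\<^esub> ex a"
  unfolding ex_def generate_aut by (auto intro: LeastI)

lemma ext_act_eq: "ext_act H \<phi> \<rho> \<sigma> (g, a) v = \<rho> g ((\<sigma> ^^ ex a) v)"
  by (simp add: ext_act_def ex_def)

lemma ext_act_base: "ext_act H \<phi> \<rho> \<sigma> (g, \<one>\<^bsub>A\<^esub>) v = \<rho> g v"
proof -
  have "ex \<one>\<^bsub>A\<^esub> = 0" unfolding ex_def by (rule Least_equality) auto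
  then show ?thesis by (simp add: ext_act_eq)
qed

lemma semidirect_carrier: "carrier (semidirect H \<phi>) = carrier H \<times> generate A {\<phi>}"
  by (simp add: semidirect_def)

lemma semidirect_mult:
  "(g, a) \<otimes>\<^bsub>semidirect H \<phi>\<^esub> (h, b) = (g \<otimes> a h, a \<otimes>\<^bsub>A\<^esub> b)"
  by (simp add: semidirect_def)

lemma semidirect_one: "\<one>\<^bsub>semidirect H \<phi>\<^esub> = (\<one>, \<one>\<^bsub>A\<^esub>)"
  by (simp add: semidirect_def)

lemma finite_semidirect: "finite (carrier (semidirect H \<phi>))"
  unfolding semidirect_carrier using fin finite_subset[OF generate_sub finite_aut_group] by simp

lemma one_in_generate: "\<one>\<^bsub>A\<^esub> \<in> generate A {\<phi>}" by (rule generate.one)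

lemma phi_in_generate: "\<phi> \<in> generate A {\<phi>}" by (rule generate.incl) simp

lemma base_in_semidirect: "g \<in> carrier H \<Longrightarrow> (g, \<one>\<^bsub>A\<^esub>) \<in> carrier (semidirect H \<phi>)"
  by (simp add: semidirect_carrier one_in_generate)

text \<open>
  Exponents of \<open>\<phi>\<close> matter only up to its order, whereas the action is defined through the least one.
\<close>
lemma funpow_pow_eq:
  assumes \<sigma>: "\<sigma> \<in> D \<rightarrow> D" and id: "\<And>k v. \<phi> [^]\<^bsub>A\<^esub> (k::nat) = \<one>\<^bsub>A\<^esub> \<Longrightarrow> v \<in> D \<Longrightarrow> (\<sigma> ^^ k) v = v"
    and v: "v \<in> D" and eq: "\<phi> [^]\<^bsub>A\<^esub> (k::nat) = \<phi> [^]\<^bsub>A\<^esub> (l::nat)"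
  shows "(\<sigma> ^^ k) v = (\<sigma> ^^ l) v"
  using eq
proof (induction k l rule: linorder_wlog)
  case (le k l)
  have "\<phi> [^]\<^bsub>A\<^esub> k \<otimes>\<^bsub>A\<^esub> \<phi> [^]\<^bsub>A\<^esub> (l - k) = \<phi> [^]\<^bsub>A\<^esub> (k + (l - k))"
    by (rule Aut.nat_pow_mult[OF aut_carrier])
  also have "\<dots> = \<phi> [^]\<^bsub>A\<^esub> k" using le by simp
  finally have "\<phi> [^]\<^bsub>A\<^esub> k \<otimes>\<^bsub>A\<^esub> \<phi> [^]\<^bsub>A\<^esub> (l - k) = \<phi> [^]\<^bsub>A\<^esub> k" .
  then have "\<phi> [^]\<^bsub>A\<^esub> (l - k) = \<one>\<^bsub>A\<^esub>"
    using aut_carrier by (subst (asm) Aut.l_cancel_one) auto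
  then have "(\<sigma> ^^ (l - k)) v = v" using id v by blast
  then have "(\<sigma> ^^ (k + (l - k))) v = (\<sigma> ^^ k) v" unfolding funpow_add by simp
  then show ?case using le by simp
next
  case (sym k l)
  then show ?case by simp
qed

lemma ext_act_pow:
  assumes "\<sigma> \<in> D \<rightarrow> D" "\<And>k v. \<phi> [^]\<^bsub>A\<^esub> (k::nat) = \<one>\<^bsub>A\<^esub> \<Longrightarrow> v \<in> D \<Longrightarrow> (\<sigma> ^^ k) v = v" "v \<in> D"
  shows "ext_act H \<phi> \<rho> \<sigma> (g, \<phi> [^]\<^bsub>A\<^esub> k) v = \<rho> g ((\<sigma> ^^ k) v)"
proof -
  have "\<phi> [^]\<^bsub>A\<^esub> k \<in> generate A {\<phi>}" unfolding generate_aut by blast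
  from ex[OF this] have "(\<sigma> ^^ ex (\<phi> [^]\<^bsub>A\<^esub> k)) v = (\<sigma> ^^ k) v"
    by (intro funpow_pow_eq[OF assms]) simp_all
  then show ?thesis by (simp add: ext_act_eq)
qed

lemma ext_act_mult:
  assumes \<rho>: "\<And>g. g \<in> carrier H \<Longrightarrow> \<rho> g \<in> D \<rightarrow> D"
    and \<rho>_mult: "\<And>g h v. g \<in> carrier H \<Longrightarrow> h \<in> carrier H \<Longrightarrow> v \<in> D \<Longrightarrow> \<rho> (g \<otimes> h) v = \<rho> g (\<rho> h v)"
    and \<sigma>: "\<sigma> \<in> D \<rightarrow> D"
    and eqv: "\<And>h v. h \<in> carrier H \<Longrightarrow> v \<in> D \<Longrightarrow> \<sigma> (\<rho> h v) = \<rho> (\<phi> h) (\<sigma> v)"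
    and id: "\<And>k v. \<phi> [^]\<^bsub>A\<^esub> (k::nat) = \<one>\<^bsub>A\<^esub> \<Longrightarrow> v \<in> D \<Longrightarrow> (\<sigma> ^^ k) v = v"
    and x: "x \<in> carrier (semidirect H \<phi>)" and y: "y \<in> carrier (semidirect H \<phi>)" and v: "v \<in> D"
  shows "ext_act H \<phi> \<rho> \<sigma> (x \<otimes>\<^bsub>semidirect H \<phi>\<^esub> y) v = ext_act H \<phi> \<rho> \<sigma> x (ext_act H \<phi> \<rho> \<sigma> y v)"
proof -
  obtain g a h b where xy: "x = (g, a)" "y = (h, b)" by (cases x, cases y)
  then have gh: "g \<in> carrier H" "h \<in> carrier H" and ab: "a \<in> generate A {\<phi>}" "b \<in> generate A {\<phi>}"
    using x y by (auto simp: semidirect_carrier)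
  obtain i j :: nat where ij: "a = \<phi> [^]\<^bsub>A\<^esub> i" "b = \<phi> [^]\<^bsub>A\<^esub> j" using ex[OF ab(1)] ex[OF ab(2)] by blast
  have pw: "(\<phi> ^^ k) h \<in> carrier H" for k :: nat using aut_closed[OF aut_carrier] gh(2) by (induction k) auto
  have eqvk: "(\<sigma> ^^ k) (\<rho> h u) = \<rho> ((\<phi> ^^ k) h) ((\<sigma> ^^ k) u)" if "u \<in> D" for k u
    using that by (induction k) (simp_all add: eqv pw funpow_mem[OF \<sigma>])
  have ah: "a h = (\<phi> ^^ i) h" using gh by (simp add: ij aut_pow)
  have w: "(\<sigma> ^^ j) v \<in> D" by (rule funpow_mem[OF \<sigma> v])
  have w': "(\<sigma> ^^ i) ((\<sigma> ^^ j) v) \<in> D" by (rule funpow_mem[OF \<sigma> w])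
  have "a \<otimes>\<^bsub>A\<^esub> b = \<phi> [^]\<^bsub>A\<^esub> (i + j)" using aut_carrier by (simp add: ij Aut.nat_pow_mult)
  then have "ext_act H \<phi> \<rho> \<sigma> (x \<otimes>\<^bsub>semidirect H \<phi>\<^esub> y) v = \<rho> (g \<otimes> a h) ((\<sigma> ^^ (i + j)) v)"
    by (simp add: xy semidirect_mult ext_act_pow[OF \<sigma> id v])
  also have "\<dots> = \<rho> g (\<rho> ((\<phi> ^^ i) h) ((\<sigma> ^^ i) ((\<sigma> ^^ j) v)))"
    using \<rho>_mult[OF gh(1) pw w'] by (simp add: ah funpow_add)
  also have "\<dots> = \<rho> g ((\<sigma> ^^ i) (\<rho> h ((\<sigma> ^^ j) v)))" using eqvk[OF w] by simp
  also have "\<dots> = ext_act H \<phi> \<rho> \<sigma> x (ext_act H \<phi> \<rho> \<sigma> y v)"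
  proof -
    have "\<rho> h ((\<sigma> ^^ j) v) \<in> D" using \<rho>[OF gh(2)] w by auto
    then show ?thesis by (simp add: xy ij ext_act_pow[OF \<sigma> id] v)
  qed
  finally show ?thesis .
qed

text \<open>
  The order of \<open>\<sigma>\<close> divides that of \<open>\<phi>\<close> because \<open>(\<one>, \<phi>)\<close> acts as \<open>\<sigma>\<close>.
\<close>
lemma extends_by_order:
  assumes W: "extends_by H \<phi> W \<rho> \<sigma>" and k: "\<phi> [^]\<^bsub>A\<^esub> (k::nat) = \<one>\<^bsub>A\<^esub>" and v: "v \<in> carrier W"
  shows "(\<sigma> ^^ k) v = v"
proof -
  interpret S: group_module "semidirect H \<phi>" W "ext_act H \<phi> \<rho> \<sigma>" using W by (simp add: extends_by_def)
  let ?p = "(\<one>, \<phi>)"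
  have p: "?p \<in> carrier (semidirect H \<phi>)" by (simp add: semidirect_carrier phi_in_generate)
  have \<sigma>: "ext_act H \<phi> \<rho> \<sigma> ?p u = \<sigma> u" if "u \<in> carrier W" for u using W that by (simp add: extends_by_def)
  have a1: "a \<one> = \<one>" if "a \<in> carrier A" for a
  proof -
    have "a \<in> hom H H" using that by (simp add: AutoGroup_def auto_def)
    then show ?thesis by (rule hom_one) (rule is_group)+
  qed
  have "?p [^]\<^bsub>semidirect H \<phi>\<^esub> m = (\<one>, \<phi> [^]\<^bsub>A\<^esub> m)" for m :: nat
    by (induction m) (simp_all add: semidirect_one semidirect_mult a1 aut_carrier)
  then have "?p [^]\<^bsub>semidirect H \<phi>\<^esub> k = \<one>\<^bsub>semidirect H \<phi>\<^esub>" by (simp add: k semidirect_one)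
  then have "ext_act H \<phi> \<rho> \<sigma> (?p [^]\<^bsub>semidirect H \<phi>\<^esub> k) v = v" using S.act_one v by simp
  moreover have "u \<in> carrier W \<Longrightarrow> ext_act H \<phi> \<rho> \<sigma> (?p [^]\<^bsub>semidirect H \<phi>\<^esub> m) u = (\<sigma> ^^ m) u" for m u
  proof (induction m arbitrary: u)
    case 0
    then show ?case using S.act_one by simp
  next
    case (Suc m)
    have "ext_act H \<phi> \<rho> \<sigma> ?p u \<in> carrier W"
      using S.act_hom[OF p] Suc.prems by (auto simp: LinearCombinations.module_hom_def)
    then have "\<sigma> u \<in> carrier W" using \<sigma> Suc.prems by simp
    then show ?case using Suc p by (simp add: S.act_mult \<sigma> funpow_swap1)
  qed
  ultimately show ?thesis using v by simp
qed

end

section \<open>Irreducible characters\<close>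

lemma lin_system_vec:
  "lin_system (module_vec TYPE('k::field) m) {..<m} (unit_vec m) (\<lambda>i v. v $ i)"
proof -
  let ?V = "module_vec TYPE('k) m"
  have "f v = (\<Sum>j<m. v $ j * f (unit_vec m j))" if f: "lin_fun ?V f" and v: "v \<in> carrier_vec m" for f v
  proof -
    have f0: "f (0\<^sub>v m) = 0" using lin_fun_zero[OF vec_module f] by (simp add: module_vec_simps)
    have fa: "f (u + w) = f u + f w" "f (c \<cdot>\<^sub>v u) = c * f u" if "u \<in> carrier_vec m" "w \<in> carrier_vec m" for u w c
      using f that by (auto simp: lin_fun_def module_vec_simps)
    have "f (vec m (\<lambda>i. if i < l then v $ i else 0)) = (\<Sum>j<l. v $ j * f (unit_vec m j))" if "l \<le> m" for l
      using that
    proof (induction l)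
      case 0
      have "vec m (\<lambda>i. if i < 0 then v $ i else 0) = 0\<^sub>v m" by (rule eq_vecI) auto
      then show ?case using f0 by simp
    next
      case (Suc l)
      have "vec m (\<lambda>i. if i < Suc l then v $ i else 0)
         = vec m (\<lambda>i. if i < l then v $ i else 0) + v $ l \<cdot>\<^sub>v unit_vec m l"
        by (rule eq_vecI) (use Suc in \<open>auto simp: less_Suc_eq\<close>)
      also have "f \<dots> = f (vec m (\<lambda>i. if i < l then v $ i else 0)) + v $ l * f (unit_vec m l)"
        using fa(1)[of "vec m (\<lambda>i. if i < l then v $ i else 0)" "v $ l \<cdot>\<^sub>v unit_vec m l"]
          fa(2)[of "unit_vec m l" "unit_vec m l" "v $ l"] by simp
      finally show ?case using Suc by simp
    qed
    from this[of m] have "f (vec m (\<lambda>i. if i < m then v $ i else 0)) = (\<Sum>j<m. v $ j * f (unit_vec m j))" by simp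
    moreover have "vec m (\<lambda>i. if i < m then v $ i else 0) = v" by (rule eq_vecI) (use v in auto)
    ultimately show ?thesis by simp
  qed
  then show ?thesis by (auto simp: dual_system_def lin_fun_def module_vec_simps)
qed

lemma group_module_mat_rep:
  assumes M: "group_module H V \<rho>" and ls: "lin_system V J w e"
    and dual: "\<And>i j. i \<in> J \<Longrightarrow> j \<in> J \<Longrightarrow> e i (w j) = (if i = j then 1 else 0)"
  shows "mat_rep H J (\<lambda>h. smat J w e (\<rho> h))" "smat J w e (\<rho> \<one>\<^bsub>H\<^esub>) = id_mat J"
    "character H V \<rho> = (\<lambda>h\<in>carrier H. mtrace J (smat J w e (\<rho> h)))"
proof -
  interpret group_module H V \<rho> by fact
  have wD: "w \<in> J \<rightarrow> carrier V" and J: "finite J" using ls by (auto simp: dual_system_def)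
  have ad: "admissible (carrier V) {f. lin_fun V f} (\<rho> h)" if "h \<in> carrier H" for h
    by (rule admissible_linear[OF lin_closed_module act_hom[OF that]]) unfold_locales
  show "mat_rep H J (\<lambda>h. smat J w e (\<rho> h))"
    unfolding mat_rep_def
  proof (intro conjI ballI)
    fix g h assume gh: "g \<in> carrier H" "h \<in> carrier H"
    have "smat J w e (\<rho> (g \<otimes>\<^bsub>H\<^esub> h)) = smat J w e (\<rho> g \<circ> \<rho> h)"
      by (rule smat_cong[OF wD]) (simp add: act_mult gh)
    also have "\<dots> = mmul J (smat J w e (\<rho> g)) (smat J w e (\<rho> h))"
      by (rule smat_mult[OF ls ad[OF gh(1)] ad[OF gh(2)]])
    finally show "smat J w e (\<rho> (g \<otimes>\<^bsub>H\<^esub> h)) = mmul J (smat J w e (\<rho> g)) (smat J w e (\<rho> h))" .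
  qed (auto simp: J supp_in_smat)
  show "smat J w e (\<rho> \<one>\<^bsub>H\<^esub>) = id_mat J"
  proof -
    have "smat J w e (\<rho> \<one>\<^bsub>H\<^esub>) = smat J w e (\<lambda>v. v)" by (rule smat_cong[OF wD]) (simp add: act_one)
    also have "\<dots> = id_mat J" using dual by (auto simp: smat_def id_mat_def fun_eq_iff)
    finally show ?thesis .
  qed
  show "character H V \<rho> = (\<lambda>h\<in>carrier H. mtrace J (smat J w e (\<rho> h)))"
    unfolding character_def
  proof (rule restrict_ext)
    fix h assume "h \<in> carrier H"
    then show "endo_trace V (\<rho> h) = mtrace J (smat J w e (\<rho> h))"
      by (intro endo_trace_lin_system[OF _ fin_dim ls] act_hom) unfold_locales
  qed
qed

definition vec_rep :: "nat \<Rightarrow> ('h \<Rightarrow> 'k::field vec \<Rightarrow> 'k vec) \<Rightarrow> 'h \<Rightarrow> nat \<Rightarrow> nat \<Rightarrow> 'k" where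
  "vec_rep m \<rho> h = smat {..<m} (unit_vec m) (\<lambda>i v. v $ i) (\<rho> h)"

lemma vec_rep_properties:
  fixes \<rho> :: "'h \<Rightarrow> 'k::field vec \<Rightarrow> 'k vec"
  assumes "group_module H (module_vec TYPE('k) m) \<rho>"
  shows "mat_rep H {..<m} (vec_rep m \<rho>)" "vec_rep m \<rho> \<one>\<^bsub>H\<^esub> = id_mat {..<m}"
    "character H (module_vec TYPE('k) m) \<rho> = (\<lambda>h\<in>carrier H. mtrace {..<m} (vec_rep m \<rho> h))"
  unfolding vec_rep_def
  by (rule group_module_mat_rep[OF assms lin_system_vec], simp)+

lemma vec_rep_apply:
  fixes \<rho> :: "'h \<Rightarrow> 'k::field vec \<Rightarrow> 'k vec"
  assumes "group_module H (module_vec TYPE('k) m) \<rho>" "h \<in> carrier H" "v \<in> carrier_vec m" "i < m"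
  shows "\<rho> h v $ i = (\<Sum>j<m. vec_rep m \<rho> h i j * v $ j)"
proof -
  interpret group_module H "module_vec TYPE('k) m" \<rho> by fact
  have "admissible (carrier (module_vec TYPE('k) m)) {f. lin_fun (module_vec TYPE('k) m) f} (\<rho> h)"
    by (rule admissible_linear[OF lin_closed_module act_hom[OF assms(2)]]) unfold_locales
  moreover have "lin_fun (module_vec TYPE('k) m) (\<lambda>v. v $ i)"
    using assms(4) by (auto simp: lin_fun_def module_vec_simps)
  ultimately have "lin_fun (module_vec TYPE('k) m) (\<lambda>v\<in>carrier (module_vec TYPE('k) m). \<rho> h v $ i)"
    unfolding admissible_def by (auto dest: bspec[where x="\<lambda>v. v $ i"])
  then have "(\<lambda>v\<in>carrier (module_vec TYPE('k) m). \<rho> h v $ i) v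
     = (\<Sum>j<m. v $ j * (\<lambda>v\<in>carrier (module_vec TYPE('k) m). \<rho> h v $ i) (unit_vec m j))"
    using lin_system_vec[of m, where 'k='k] assms(3) unfolding dual_system_def module_vec_simps by blast
  then show ?thesis using assms by (simp add: module_vec_simps vec_rep_def smat_def mult.commute)
qed

text \<open>
  Schur's lemma: an eigenspace of an endomorphism is a submodule.
\<close>
lemma simple_multiplicity_one:
  fixes \<rho> :: "'h \<Rightarrow> 'k::{alg_closed_field, field_char_0} vec \<Rightarrow> 'k vec"
  assumes simple: "simple_module H (module_vec TYPE('k) m) \<rho>" and finH: "finite (carrier H)"
  shows "multiplicity H {..<m} (vec_rep m \<rho>) {..<m} (vec_rep m \<rho>) = 1"
proof -
  let ?V = "module_vec TYPE('k) m"
  let ?R = "vec_rep m \<rho>"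
  have gm: "group_module H ?V \<rho>" using simple by (simp add: simple_module_def)
  interpret group_module H ?V \<rho> by fact
  note VR = vec_rep_properties[OF gm]
  interpret rep_pair H "{..<m}" ?R "{..<m}" ?R
    using finH VR(1) by unfold_locales
  have m: "0 < m"
  proof (rule ccontr)
    assume "\<not> 0 < m"
    then have "carrier_vec m = {0\<^sub>v m :: 'k vec}" by auto
    then show False using simple by (simp add: simple_module_def module_vec_simps)
  qed
  have id: "intertwiner H {..<m} ?R {..<m} ?R (id_mat {..<m})"
    using VR(1) mmul_id_left[OF finite_lessThan supp_in_id, of m]
    unfolding intertwiner_def VR(2)
    by (auto simp: mat_rep_def supp_in_id mmul_id_left mmul_id_right)
  have id0: "id_mat {..<m} \<noteq> (\<lambda>_ _. 0 :: 'k)"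
    using m by (auto simp: id_mat_def fun_eq_iff intro!: exI[of _ 0])
  show ?thesis
  proof (rule multiplicity_one_if_proportional[OF id id0])
    fix A assume A: "intertwiner H {..<m} ?R {..<m} ?R A"
    define A' where "A' = mat m m (\<lambda>(i,j). A i j)"
    have A'c: "A' \<in> carrier_mat m m" by (simp add: A'_def)
    have "degree (char_poly A') > 0" using degree_monic_char_poly[OF A'c] m by simp
    then obtain c where "poly (char_poly A') c = 0" using alg_closed_imp_poly_has_root by blast
    then obtain v where v: "v \<in> carrier_vec m" "v \<noteq> 0\<^sub>v m" "A' *\<^sub>v v = c \<cdot>\<^sub>v v"
      using eigenvalue_root_char_poly[OF A'c] A'c by (auto simp: eigenvalue_def eigenvector_def)
    define W where "W = {u \<in> carrier_vec m. A' *\<^sub>v u = c \<cdot>\<^sub>v u}"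
    have A'_apply: "(A' *\<^sub>v u) $ i = (\<Sum>j<m. A i j * u $ j)" if "u \<in> carrier_vec m" "i < m" for u i
      using that by (simp add: A'_def scalar_prod_def lessThan_atLeast0)
    have sub: "submodule class_ring W ?V"
    proof (rule submodule.intro)
      show "Module.module class_ring ?V" by (rule vec_module)
      show "W \<subseteq> carrier ?V" by (auto simp: W_def module_vec_simps)
      show "\<zero>\<^bsub>?V\<^esub> \<in> W" using A'c by (auto simp: W_def module_vec_simps)
      show "u \<oplus>\<^bsub>?V\<^esub> w \<in> W" if "u \<in> W" "w \<in> W" for u w
        using that A'c by (auto simp: W_def module_vec_simps mult_add_distrib_mat_vec smult_add_distrib_vec)
      show "k \<odot>\<^bsub>?V\<^esub> w \<in> W" if "w \<in> W" for k w
        using that A'c by (auto simp: W_def module_vec_simps mult_mat_vec smult_smult_assoc mult.commute)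
    qed
    have inv: "\<rho> h u \<in> W" if h: "h \<in> carrier H" and u: "u \<in> W" for h u
    proof -
      have uc: "u \<in> carrier_vec m" and Au: "A' *\<^sub>v u = c \<cdot>\<^sub>v u" using u by (auto simp: W_def)
      have ruc: "\<rho> h u \<in> carrier_vec m"
        using act_hom[OF h] uc by (auto simp: LinearCombinations.module_hom_def module_vec_simps)
      have "A' *\<^sub>v \<rho> h u = c \<cdot>\<^sub>v \<rho> h u"
      proof (rule eq_vecI)
        fix i assume "i < dim_vec (c \<cdot>\<^sub>v \<rho> h u)"
        then have i: "i < m" using ruc by simp
        have "(A' *\<^sub>v \<rho> h u) $ i = (\<Sum>j<m. A i j * (\<Sum>k<m. ?R h j k * u $ k))"
          using i ruc uc h by (simp add: A'_apply vec_rep_apply[OF gm])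
        also have "\<dots> = mmul {..<m} A (mmul {..<m} (?R h) (\<lambda>k (_::unit). u $ k)) i ()" by (simp add: mmul_def)
        also have "\<dots> = mmul {..<m} (mmul {..<m} (?R h) A) (\<lambda>k (_::unit). u $ k) i ()"
          using A h by (simp add: mmul_assoc[symmetric] intertwiner_def)
        also have "\<dots> = (\<Sum>j<m. ?R h i j * (A' *\<^sub>v u) $ j)"
          unfolding mmul_assoc using uc by (simp add: mmul_def A'_apply)
        also have "\<dots> = (c \<cdot>\<^sub>v \<rho> h u) $ i"
          using Au uc i ruc h by (simp add: vec_rep_apply[OF gm] sum_distrib_left mult_ac)
        finally show "(A' *\<^sub>v \<rho> h u) $ i = (c \<cdot>\<^sub>v \<rho> h u) $ i" .
      qed (use ruc A'c in auto)
      then show ?thesis using ruc by (simp add: W_def)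
    qed
    have "W = carrier_vec m"
    proof -
      have "W = {\<zero>\<^bsub>?V\<^esub>} \<or> W = carrier ?V"
        using simple sub inv unfolding simple_module_def by blast
      moreover have "v \<in> W" using v by (simp add: W_def)
      ultimately show ?thesis using v(2) by (auto simp: module_vec_simps)
    qed
    then have "unit_vec m j \<in> W" for j by simp
    then have eig: "A' *\<^sub>v unit_vec m j = c \<cdot>\<^sub>v unit_vec m j" for j unfolding W_def by blast
    have "A i j = c * id_mat {..<m} i j" for i j
    proof (cases "i < m \<and> j < m")
      case True
      have "A i j = (A' *\<^sub>v unit_vec m j) $ i"
        using True by (simp add: A'_def)
      then show ?thesis using True by (simp add: eig id_mat_def)
    next
      case False
      moreover have "supp_in {..<m} {..<m} A" using A by (simp add: intertwiner_def)
      ultimately have "A i j = 0" by (intro supp_in_zero) auto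
      then show ?thesis using False by (auto simp: id_mat_def)
    qed
    then show "\<exists>c. A = (\<lambda>y x. c * id_mat {..<m} y x)" by blast
  qed
qed

lemma char_inner_mtrace:
  assumes "group H" "\<And>h. h \<in> carrier H \<Longrightarrow> \<chi> h = mtrace Y (S h)" "\<And>h. h \<in> carrier H \<Longrightarrow> \<theta> h = mtrace X (R h)"
  shows "char_inner H \<chi> \<theta> = multiplicity H Y S X R"
proof -
  interpret group H by fact
  show ?thesis by (simp add: char_inner_def multiplicity_def assms(2,3))
qed

text \<open>
  Coefficients of the Molien series are thereby multiplicities of matrix representations, to which
  \<open>multiplicity_nonzero_iff\<close> applies.
\<close>
lemma molien_nth:
  fixes V :: "('k::field_char_0, 'v) module"
  assumes H: "group H" and ls: "lin_system V J w e" and V: "lin_closed V"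
    and \<rho>: "\<And>h. h \<in> carrier H \<Longrightarrow> \<rho> h \<in> module_hom class_ring V V"
    and \<chi>: "\<And>h. h \<in> carrier H \<Longrightarrow> \<chi> h = mtrace X (R h)"
  shows "fps_nth (molien H V \<rho> \<chi>) d
    = multiplicity H ({..<d} \<rightarrow>\<^sub>E J) (\<lambda>h. sym_mat d J (smat J w e (\<rho> h))) X R"
  unfolding molien_def fps_nth_Abs_fps
  by (rule char_inner_mtrace[OF H _ \<chi>]) (simp_all add: character_def sym_power_trace[OF ls V] \<rho>)

section \<open>Cyclic permutation of factors\<close>
lemma cyc_pred_Suc: "i < n \<Longrightarrow> cyc_pred n (Suc i mod n) = i"
  by (cases "Suc i = n") (auto simp: cyc_pred_def mod_Suc)

lemma cyc_pred_less: "i < n \<Longrightarrow> cyc_pred n i < n"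
  by (simp add: cyc_pred_def)

lemma Suc_cyc_pred: "i < n \<Longrightarrow> Suc (cyc_pred n i) mod n = i"
  by (cases i) (auto simp: cyc_pred_def mod_Suc_eq Suc_diff_le)

lemma cyc_path_add:
  "cyc_path n f i (a + b) = cyc_path n f ((i + a) mod n) b \<circ> cyc_path n f i a"
proof (induction b)
  case (Suc b)
  have "((i + a) mod n + b) mod n = (i + (a + b)) mod n" by (simp add: mod_add_left_eq add.assoc)
  then show ?case using Suc by (simp add: o_assoc)
qed simp

lemma cyc_path_loop: "i < n \<Longrightarrow> cyc_path n f i (n * m) = cyc_loop n f i ^^ m"
proof (induction m)
  case (Suc m)
  have "cyc_path n f i (n * m + n) = cyc_path n f i n \<circ> cyc_path n f i (n * m)"
    using Suc.prems by (subst cyc_path_add) simp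
  then show ?case using Suc by (simp add: cyc_loop_def add.commute)
qed simp

lemma cyc_loop_conj:
  "i < n \<Longrightarrow> cyc_loop n f i \<circ> cyc_path n f 0 i = cyc_path n f 0 i \<circ> cyc_loop n f 0"
  using cyc_path_add[of n f 0 i n] cyc_path_add[of n f 0 n i] by (simp add: cyc_loop_def add.commute)

lemma cyc_shift_Suc: "i < n \<Longrightarrow> cyc_shift n f v (Suc i mod n) = f i (v i)"
  by (simp add: cyc_shift_def cyc_pred_Suc)

lemma cyc_shift_funpow:
  "j < n \<Longrightarrow> (cyc_shift n f ^^ k) v ((j + k) mod n) = cyc_path n f j k (v j)"
proof (induction k)
  case (Suc k)
  have "(cyc_shift n f ^^ Suc k) v ((j + Suc k) mod n)
      = cyc_shift n f ((cyc_shift n f ^^ k) v) (Suc ((j + k) mod n) mod n)"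
    by (simp add: mod_Suc_eq)
  also have "\<dots> = f ((j + k) mod n) ((cyc_shift n f ^^ k) v ((j + k) mod n))"
    using Suc.prems by (intro cyc_shift_Suc) simp
  finally show ?case using Suc by simp
qed simp

lemma cyc_shift_PiE:
  assumes "\<And>i. i < n \<Longrightarrow> f i \<in> D i \<rightarrow> D (Suc i mod n)"
  shows "cyc_shift n f \<in> (\<Pi>\<^sub>E i\<in>{..<n}. D i) \<rightarrow> (\<Pi>\<^sub>E i\<in>{..<n}. D i)"
proof
  fix v assume v: "v \<in> (\<Pi>\<^sub>E i\<in>{..<n}. D i)"
  have "f (cyc_pred n i) (v (cyc_pred n i)) \<in> D i" if "i < n" for i
    using assms[OF cyc_pred_less[OF that]] PiE_mem[OF v, of "cyc_pred n i"] that
    by (auto simp: cyc_pred_less Suc_cyc_pred)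
  then show "cyc_shift n f v \<in> (\<Pi>\<^sub>E i\<in>{..<n}. D i)" by (auto simp: cyc_shift_def)
qed

lemma cyc_shift_funpow_id:
  assumes f: "\<And>i. i < n \<Longrightarrow> f i \<in> D i \<rightarrow> D (Suc i mod n)" and v: "v \<in> (\<Pi>\<^sub>E i\<in>{..<n}. D i)"
    and id: "\<And>j x. j < n \<Longrightarrow> x \<in> D j \<Longrightarrow> (cyc_loop n f j ^^ m) x = x"
  shows "(cyc_shift n f ^^ (n * m)) v = v"
proof (rule PiE_ext)
  show "(cyc_shift n f ^^ (n * m)) v \<in> (\<Pi>\<^sub>E i\<in>{..<n}. D i)"
    by (rule funpow_mem[OF cyc_shift_PiE v]) (rule f)
  fix j assume "j \<in> {..<n}"
  then have j: "j < n" by simp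
  have "(cyc_shift n f ^^ (n * m)) v ((j + n * m) mod n) = (cyc_loop n f j ^^ m) (v j)"
    using cyc_shift_funpow[OF j, where f=f and k="n * m" and v=v] cyc_path_loop[OF j, where f=f and m=m] by simp
  then show "(cyc_shift n f ^^ (n * m)) v j = v j" using id[OF j] PiE_mem[OF v] j by simp
qed (rule v)

lemma cyc_path_bij:
  assumes f: "\<And>i. i < n \<Longrightarrow> bij_betw (f i) (D i) (D (Suc i mod n))" and i: "i < n"
  shows "bij_betw (cyc_path n f i k) (D i) (D ((i + k) mod n))"
proof (induction k)
  case 0
  then show ?case using i by (simp add: bij_betw_def)
next
  case (Suc k)
  have "bij_betw (f ((i + k) mod n)) (D ((i + k) mod n)) (D (Suc ((i + k) mod n) mod n))"
    using i by (intro f) simp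
  then have "bij_betw (f ((i + k) mod n)) (D ((i + k) mod n)) (D ((i + Suc k) mod n))"
    by (simp add: mod_Suc_eq)
  with Suc show ?case unfolding cyc_path.simps by (rule bij_betw_trans)
qed

text \<open>
  Outside of \<open>{..<n}\<close> it has to be the identity in order to be a permutation of that set.
\<close>
definition cyc_succ :: "nat \<Rightarrow> nat \<Rightarrow> nat" where
  "cyc_succ n i = (if i < n then Suc i mod n else i)"

lemma cyc_succ_permutes: "cyc_succ n permutes {..<n}"
proof (rule bij_imp_permutes)
  show "bij_betw (cyc_succ n) {..<n} {..<n}"
    by (rule bij_betw_byWitness[of _ "cyc_pred n"])
      (auto simp: cyc_succ_def cyc_pred_Suc Suc_cyc_pred cyc_pred_less)
qed (simp add: cyc_succ_def)

lemma module_hom_finsum: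
  assumes V: "Module.module class_ring V" and W: "Module.module class_ring W" and T: "T \<in> module_hom class_ring V W"
    and I: "finite I" and f: "f \<in> I \<rightarrow> carrier V"
  shows "T (finsum V f I) = finsum W (\<lambda>i. T (f i)) I"
proof -
  interpret V: Module.module class_ring V by fact
  interpret W: Module.module class_ring W by fact
  have Tc: "T v \<in> carrier W" if "v \<in> carrier V" for v using T that by (auto simp: LinearCombinations.module_hom_def)
  have Ta: "T (u \<oplus>\<^bsub>V\<^esub> v) = T u \<oplus>\<^bsub>W\<^esub> T v" if "u \<in> carrier V" "v \<in> carrier V" for u v
    using T that by (auto simp: LinearCombinations.module_hom_def)
  have T0: "T \<zero>\<^bsub>V\<^esub> = \<zero>\<^bsub>W\<^esub>"
  proof -
    have "T \<zero>\<^bsub>V\<^esub> = T \<zero>\<^bsub>V\<^esub> \<oplus>\<^bsub>W\<^esub> T \<zero>\<^bsub>V\<^esub>" using Ta[of "\<zero>\<^bsub>V\<^esub>" "\<zero>\<^bsub>V\<^esub>"] by simp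
    then show ?thesis using Tc[of "\<zero>\<^bsub>V\<^esub>"] by (metis V.zero_closed W.add.r_cancel_one')
  qed
  show ?thesis using I f
  proof (induction I rule: finite_induct)
    case empty
    then show ?case by (simp add: T0)
  next
    case (insert x I)
    then show ?case by (simp add: Ta Tc Pi_iff)
  qed
qed

lemma module_hom_zero:
  assumes "Module.module class_ring V" "Module.module class_ring W" "T \<in> module_hom class_ring V W"
  shows "T \<zero>\<^bsub>V\<^esub> = \<zero>\<^bsub>W\<^esub>"
  using module_hom_finsum[OF assms, of "{}" "\<lambda>_. \<zero>\<^bsub>V\<^esub>"] assms(1,2)
  by (simp add: abelian_monoid.finsum_empty Module.module_def abelian_group_def)

context cyclic_module
begin

abbreviation Gp where "Gp \<equiv> prod_group n G"
abbreviation Phi where "Phi \<equiv> cyc_aut n G \<phi>"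
abbreviation Gt where "Gt \<equiv> semidirect Gp Phi"
abbreviation emb where "emb \<equiv> factor_emb n G"

interpretation V: group_module Gp V \<rho> by (rule V_module)

lemma V_mod: "Module.module class_ring V" and V_vs: "vectorspace class_ring V" by unfold_locales

lemma group_Gp: "group Gp" by unfold_locales

lemma finite_Gp: "finite (carrier Gp)"
  unfolding carrier_product_group using finite_factor by (intro finite_PiE) auto

lemma phi_hom: "i < n \<Longrightarrow> g \<in> carrier (G i) \<Longrightarrow> h \<in> carrier (G i) \<Longrightarrow>
    \<phi> i (g \<otimes>\<^bsub>G i\<^esub> h) = \<phi> i g \<otimes>\<^bsub>G (Suc i mod n)\<^esub> \<phi> i h"
  using factor_iso by (auto simp: iso_def hom_def)

lemma phi_bij: "i < n \<Longrightarrow> bij_betw (\<phi> i) (carrier (G i)) (carrier (G (Suc i mod n)))"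
  using factor_iso by (auto simp: iso_def)

lemma phi_closed: "i < n \<Longrightarrow> \<phi> i \<in> carrier (G i) \<rightarrow> carrier (G (Suc i mod n))"
  using phi_bij bij_betw_imp_funcset by blast

lemma shift_closed: "g \<in> carrier Gp \<Longrightarrow> cyc_shift n \<phi> g \<in> carrier Gp"
  using cyc_shift_PiE[where D="\<lambda>i. carrier (G i)", OF phi_closed] by auto

lemma Phi_auto: "Phi \<in> auto Gp"
proof -
  have closed: "Phi \<in> carrier Gp \<rightarrow> carrier Gp" using shift_closed by (simp add: cyc_aut_def)
  have hom: "Phi (g \<otimes>\<^bsub>Gp\<^esub> h) = Phi g \<otimes>\<^bsub>Gp\<^esub> Phi h" if g: "g \<in> carrier Gp" and h: "h \<in> carrier Gp" for g h
  proof -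
    have gi: "g i \<in> carrier (G i)" "h i \<in> carrier (G i)" if "i < n" for i
      using g h that by (auto simp: PiE_iff)
    have "cyc_shift n \<phi> (g \<otimes>\<^bsub>Gp\<^esub> h) = cyc_shift n \<phi> g \<otimes>\<^bsub>Gp\<^esub> cyc_shift n \<phi> h"
      unfolding mult_product_group
    proof (rule ext)
      fix i
      show "cyc_shift n \<phi> (\<lambda>i\<in>{..<n}. g i \<otimes>\<^bsub>G i\<^esub> h i) i = (\<lambda>i\<in>{..<n}. cyc_shift n \<phi> g i \<otimes>\<^bsub>G i\<^esub> cyc_shift n \<phi> h i) i"
        using phi_hom[of "cyc_pred n i" "g (cyc_pred n i)" "h (cyc_pred n i)"] gi[of "cyc_pred n i"]
        by (simp add: cyc_shift_def cyc_pred_less Suc_cyc_pred)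
    qed
    then show ?thesis using g h V.m_closed[OF g h] by (simp only: cyc_aut_def restrict_apply' if_True)
  qed
  have inj: "inj_on Phi (carrier Gp)"
  proof (rule inj_onI)
    fix g h assume g: "g \<in> carrier Gp" and h: "h \<in> carrier Gp" and eq: "Phi g = Phi h"
    show "g = h"
    proof (rule PiE_ext)
      show "g \<in> (\<Pi>\<^sub>E i\<in>{..<n}. carrier (G i))" "h \<in> (\<Pi>\<^sub>E i\<in>{..<n}. carrier (G i))" using g h by simp_all
      fix i assume "i \<in> {..<n}"
      then have i: "i < n" by simp
      have "cyc_shift n \<phi> g (Suc i mod n) = cyc_shift n \<phi> h (Suc i mod n)"
        using eq g h by (simp add: cyc_aut_def)
      then have "\<phi> i (g i) = \<phi> i (h i)" by (simp add: cyc_shift_Suc[OF i])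
      then show "g i = h i" using phi_bij[OF i] g h i by (auto simp: bij_betw_def inj_on_def PiE_iff)
    qed
  qed
  have "bij_betw Phi (carrier Gp) (carrier Gp)"
    using inj endo_inj_surj[OF finite_Gp _ inj] closed by (simp add: bij_betw_def image_subset_iff_funcset)
  moreover have "Phi \<in> extensional (carrier Gp)" by (simp add: cyc_aut_def)
  ultimately show ?thesis using closed hom by (auto simp: auto_def Bij_def hom_def)
qed

sublocale P: finite_aut Gp Phi
  by (intro finite_aut.intro finite_aut_axioms.intro group_Gp finite_Gp Phi_auto)

lemma group_Gt: "group Gt"
  using \<sigma>_extends by (simp add: extends_by_def group_module_def)

subsection \<open>The factors act on the summands\<close>

lemma Vs_sub: "i < n \<Longrightarrow> Vs i \<subseteq> carrier V"
  using Vs_subspace submodule.subset by blast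

lemma emb_closed: "i < n \<Longrightarrow> g \<in> carrier (G i) \<Longrightarrow> emb i g \<in> carrier Gp"
  using group_factor by (auto simp: factor_emb_def group.is_monoid)

lemma act_closed: "g \<in> carrier Gp \<Longrightarrow> v \<in> carrier V \<Longrightarrow> \<rho> g v \<in> carrier V"
  using V.act_hom[of g] by (auto simp: LinearCombinations.module_hom_def simp del: carrier_product_group)

lemma act_add: "g \<in> carrier Gp \<Longrightarrow> u \<in> carrier V \<Longrightarrow> v \<in> carrier V \<Longrightarrow> \<rho> g (u \<oplus>\<^bsub>V\<^esub> v) = \<rho> g u \<oplus>\<^bsub>V\<^esub> \<rho> g v"
  using V.act_hom[of g] by (auto simp: LinearCombinations.module_hom_def simp del: carrier_product_group)

lemma emb_mult:
  assumes "i < n" "g \<in> carrier (G i)" "h \<in> carrier (G i)"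
  shows "emb i g \<otimes>\<^bsub>Gp\<^esub> emb i h = emb i (g \<otimes>\<^bsub>G i\<^esub> h)"
proof -
  have "\<one>\<^bsub>G j\<^esub> \<otimes>\<^bsub>G j\<^esub> \<one>\<^bsub>G j\<^esub> = \<one>\<^bsub>G j\<^esub>" if "j < n" for j
    using group_factor[OF that] by (simp add: group.is_monoid)
  then show ?thesis by (auto simp: factor_emb_def fun_eq_iff)
qed

lemma emb_commute:
  assumes "i < n" "j < n" "i \<noteq> j" "g \<in> carrier (G i)" "h \<in> carrier (G j)"
  shows "emb i g \<otimes>\<^bsub>Gp\<^esub> emb j h = emb j h \<otimes>\<^bsub>Gp\<^esub> emb i g"
proof -
  have "\<one>\<^bsub>G j\<^esub> \<otimes>\<^bsub>G j\<^esub> x = x" "x \<otimes>\<^bsub>G j\<^esub> \<one>\<^bsub>G j\<^esub> = x" if "j < n" "x \<in> carrier (G j)" for j x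
    using group_factor[OF that(1)] that(2) by (simp_all add: group.is_monoid monoid.l_one monoid.r_one)
  moreover have "\<one>\<^bsub>G j\<^esub> \<in> carrier (G j)" if "j < n" for j
    using group_factor[OF that] by (simp add: group.is_monoid)
  ultimately show ?thesis using assms by (auto simp: factor_emb_def fun_eq_iff)
qed

abbreviation Fix where "Fix i \<equiv> fixed_points (G i) V (\<lambda>g. \<rho> (emb i g))"

lemma decompose:
  assumes "i < n" "v \<in> carrier V"
  obtains a b where "a \<in> Vs i" "b \<in> Fix i" "v = a \<oplus>\<^bsub>V\<^esub> b"
proof -
  have "v \<in> (\<lambda>(v, w). v \<oplus>\<^bsub>V\<^esub> w) ` (Vs i \<times> Fix i)"
    using Vs_fixed_points[OF assms(1)] assms(2) by (simp add: bij_betw_def)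
  then show ?thesis using that by auto
qed

lemma Vs_zero: "i < n \<Longrightarrow> \<zero>\<^bsub>V\<^esub> \<in> Vs i"
  using Vs_subspace submodule.zero_closed by blast

lemma zero_Fix: "i < n \<Longrightarrow> \<zero>\<^bsub>V\<^esub> \<in> Fix i"
  using module_hom_zero[OF V_mod V_mod V.act_hom[OF emb_closed]] by (simp add: fixed_points_def)

lemma Vs_Fix:
  assumes i: "i < n" and v: "v \<in> Vs i" "v \<in> Fix i"
  shows "v = \<zero>\<^bsub>V\<^esub>"
proof -
  have "inj_on (\<lambda>(v, w). v \<oplus>\<^bsub>V\<^esub> w) (Vs i \<times> Fix i)"
    using Vs_fixed_points[OF i] by (simp add: bij_betw_def)
  then have "(v, \<zero>\<^bsub>V\<^esub>) = (\<zero>\<^bsub>V\<^esub>, v)"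
    by (rule inj_onD) (use v Vs_zero[OF i] zero_Fix[OF i] subsetD[OF Vs_sub[OF i] v(1)] in auto)
  then show ?thesis by (rule Pair_inject)
qed

definition orbit_sum :: "nat \<Rightarrow> 'v \<Rightarrow> 'v" where
  "orbit_sum j v = finsum V (\<lambda>h. \<rho> (emb j h) v) (carrier (G j))"

text \<open>
  The sum over an orbit is a fixed vector, and the only one in \<open>Vs j\<close> is 0.
\<close>
lemma orbit_sum_zero:
  assumes j: "j < n" and v: "v \<in> Vs j"
  shows "orbit_sum j v = \<zero>\<^bsub>V\<^esub>"
proof -
  interpret Gj: group "G j" by (rule group_factor[OF j])
  have vV: "v \<in> carrier V" using Vs_sub[OF j] v by auto
  have f: "(\<lambda>h. \<rho> (emb j h) v) \<in> carrier (G j) \<rightarrow> carrier V"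
    using act_closed emb_closed[OF j] vV by auto
  have "finsum (V\<lparr>carrier := Vs j\<rparr>) (\<lambda>h. \<rho> (emb j h) v) (carrier (G j)) \<in> Vs j"
  proof -
    interpret W: Module.module class_ring "V\<lparr>carrier := Vs j\<rparr>"
      by (rule V.submodule_is_module[OF Vs_subspace[OF j]])
    show ?thesis using W.M.finsum_closed[of "\<lambda>h. \<rho> (emb j h) v" "carrier (G j)"] Vs_invariant[OF j _ v] by auto
  qed
  moreover have "finsum (V\<lparr>carrier := Vs j\<rparr>) (\<lambda>h. \<rho> (emb j h) v) (carrier (G j)) = orbit_sum j v"
  proof -
    interpret W: Module.module class_ring "V\<lparr>carrier := Vs j\<rparr>"
      by (rule V.submodule_is_module[OF Vs_subspace[OF j]])
    have "finsum (V\<lparr>carrier := Vs j\<rparr>) (\<lambda>h. \<rho> (emb j h) v) K = finsum V (\<lambda>h. \<rho> (emb j h) v) K"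
      if "finite K" "K \<subseteq> carrier (G j)" for K
      using that
    proof (induction K rule: finite_induct)
      case (insert h K)
      have h: "h \<in> carrier (G j)" "K \<subseteq> carrier (G j)" using insert by auto
      have a: "(\<lambda>h. \<rho> (emb j h) v) \<in> K \<rightarrow> Vs j" "\<rho> (emb j h) v \<in> Vs j"
        using Vs_invariant[OF j _ v] h by auto
      have b: "(\<lambda>h. \<rho> (emb j h) v) \<in> K \<rightarrow> carrier V"
        by (rule Pi_I, rule funcset_mem[OF f], erule subsetD[OF h(2)])
      have b': "\<rho> (emb j h) v \<in> carrier V" by (rule funcset_mem[OF f h(1)])
      show ?case using insert.IH[OF h(2)] W.M.finsum_insert[OF insert.hyps, of "\<lambda>h. \<rho> (emb j h) v"]
          V.M.finsum_insert[OF insert.hyps b b'] a by simp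
    qed simp
    from this[OF finite_factor[OF j] subset_refl] show ?thesis by (simp add: orbit_sum_def)
  qed
  ultimately have "orbit_sum j v \<in> Vs j" by simp
  moreover have "orbit_sum j v \<in> Fix j"
  proof -
    have "\<rho> (emb j g) (orbit_sum j v) = orbit_sum j v" if g: "g \<in> carrier (G j)" for g
    proof -
      have "\<rho> (emb j g) (orbit_sum j v) = finsum V (\<lambda>h. \<rho> (emb j g) (\<rho> (emb j h) v)) (carrier (G j))"
        unfolding orbit_sum_def
        by (rule module_hom_finsum[OF V_mod V_mod V.act_hom[OF emb_closed[OF j g]] finite_factor[OF j] f])
      also have "\<dots> = finsum V (\<lambda>h. \<rho> (emb j (g \<otimes>\<^bsub>G j\<^esub> h)) v) (carrier (G j))"
        using f g j vV by (intro V.M.finsum_cong')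
          (auto simp: V.act_mult[symmetric] emb_closed emb_mult simp del: mult_product_group carrier_product_group)
      also have "\<dots> = finsum V (\<lambda>h. \<rho> (emb j h) v) ((\<lambda>h. g \<otimes>\<^bsub>G j\<^esub> h) ` carrier (G j))"
        using f g by (subst V.M.finsum_reindex) (auto simp: Pi_iff Gj.inj_on_cmult)
      also have "(\<lambda>h. g \<otimes>\<^bsub>G j\<^esub> h) ` carrier (G j) = carrier (G j)"
        using Gj.surj_const_mult[OF g] .
      finally show ?thesis by (simp add: orbit_sum_def)
    qed
    moreover have "orbit_sum j v \<in> carrier V" unfolding orbit_sum_def using f by (rule V.M.finsum_closed)
    ultimately show ?thesis by (simp add: fixed_points_def)
  qed
  ultimately show ?thesis by (rule Vs_Fix[OF j])
qed

end

lemma inv_into_bij: "bij_betw f A B \<Longrightarrow> x \<in> A \<Longrightarrow> inv_into A f (f x) = x"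
  "bij_betw f A B \<Longrightarrow> y \<in> B \<Longrightarrow> f (inv_into A f y) = y"
  "bij_betw f A B \<Longrightarrow> y \<in> B \<Longrightarrow> inv_into A f y \<in> A"
  by (auto simp: bij_betw_def inv_into_into f_inv_into_f)

lemma lin_system_iso:
  assumes ls: "lin_system W C w e" and closed: "lin_closed W"
    and f: "bij_betw f (carrier W) (carrier W')"
    and add: "\<And>u v. u \<in> carrier W \<Longrightarrow> v \<in> carrier W \<Longrightarrow> f (u \<oplus>\<^bsub>W\<^esub> v) = f u \<oplus>\<^bsub>W'\<^esub> f v"
    and scale: "\<And>c u. u \<in> carrier W \<Longrightarrow> f (c \<odot>\<^bsub>W\<^esub> u) = c \<odot>\<^bsub>W'\<^esub> f u"
  shows "lin_system W' C (\<lambda>c. f (w c)) (\<lambda>c v. e c (inv_into (carrier W) f v))"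
proof -
  let ?g = "inv_into (carrier W) f"
  note g = inv_into_bij[OF f]
  have fc: "f u \<in> carrier W'" if "u \<in> carrier W" for u using f that by (auto simp: bij_betw_def)
  have C: "finite C" and w: "\<And>c. c \<in> C \<Longrightarrow> w c \<in> carrier W" and e: "\<And>c. c \<in> C \<Longrightarrow> lin_fun W (e c)"
    and exp: "\<And>h v. lin_fun W h \<Longrightarrow> v \<in> carrier W \<Longrightarrow> h v = (\<Sum>c\<in>C. e c v * h (w c))"
    using ls by (auto simp: dual_system_def)
  have cl: "u \<oplus>\<^bsub>W\<^esub> v \<in> carrier W" "a \<odot>\<^bsub>W\<^esub> u \<in> carrier W" if "u \<in> carrier W" "v \<in> carrier W" for u v a
    using closed that by (auto simp: lin_closed_def)
  have ga: "?g (u \<oplus>\<^bsub>W'\<^esub> v) = ?g u \<oplus>\<^bsub>W\<^esub> ?g v" if "u \<in> carrier W'" "v \<in> carrier W'" for u v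
  proof -
    have "f (?g u \<oplus>\<^bsub>W\<^esub> ?g v) = u \<oplus>\<^bsub>W'\<^esub> v" using that by (simp add: add g)
    then show ?thesis using g(1)[OF cl(1)[OF g(3)[OF that(1)] g(3)[OF that(2)]]] by simp
  qed
  have gs: "?g (a \<odot>\<^bsub>W'\<^esub> u) = a \<odot>\<^bsub>W\<^esub> ?g u" if "u \<in> carrier W'" for u a
  proof -
    have "f (a \<odot>\<^bsub>W\<^esub> ?g u) = a \<odot>\<^bsub>W'\<^esub> u" using that by (simp add: scale g)
    then show ?thesis using g(1)[OF cl(2)[OF g(3)[OF that] g(3)[OF that]]] by metis
  qed
  have lf: "lin_fun W (\<lambda>u. h (f u))" if "lin_fun W' h" for h
    using that fc by (simp add: lin_fun_def add scale)
  have "h v = (\<Sum>c\<in>C. e c (?g v) * h (f (w c)))" if "lin_fun W' h" "v \<in> carrier W'" for h v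
    using exp[OF lf[OF that(1)] g(3)[OF that(2)]] g(2)[OF that(2)] by simp
  moreover have "lin_fun W' (\<lambda>v. e c (?g v))" if "c \<in> C" for c
    using e[OF that] g(3) by (simp add: lin_fun_def ga gs)
  ultimately show ?thesis using C w fc by (simp add: dual_system_def Pi_iff)
qed

context cyclic_module
begin

interpretation V: group_module Gp V \<rho> by (rule V_module)

lemma n0: "0 < n" by (rule n_pos)

lemma Vs_add: "i < n \<Longrightarrow> u \<in> Vs i \<Longrightarrow> v \<in> Vs i \<Longrightarrow> u \<oplus>\<^bsub>V\<^esub> v \<in> Vs i"
  using submodule.m_closed[OF Vs_subspace] by simp

lemma Vs_smult: "i < n \<Longrightarrow> u \<in> Vs i \<Longrightarrow> c \<odot>\<^bsub>V\<^esub> u \<in> Vs i"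
  using submodule.smult_closed[OF Vs_subspace] by simp

lemma Vs_V: "i < n \<Longrightarrow> u \<in> Vs i \<Longrightarrow> u \<in> carrier V"
  using Vs_sub by blast

lemma Vs_minus: "i < n \<Longrightarrow> u \<in> Vs i \<Longrightarrow> v \<in> Vs i \<Longrightarrow> u \<oplus>\<^bsub>V\<^esub> (\<ominus>\<^bsub>V\<^esub> v) \<in> Vs i"
proof -
  assume i: "i < n" and u: "u \<in> Vs i" and v: "v \<in> Vs i"
  have vV: "v \<in> carrier V" by (rule Vs_V[OF i v])
  have "(- 1) \<odot>\<^bsub>V\<^esub> v = \<ominus>\<^bsub>V\<^esub> v"
    using V.smult_l_minus[of 1 v] vV V.smult_one[of v] by (simp add: class_ring_simps)
  then show ?thesis using Vs_add[OF i u Vs_smult[OF i v, of "- 1"]] by simp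
qed

lemma single_finsum:
  assumes "j < n" "v \<in> carrier V"
  shows "finsum V (\<lambda>i\<in>{..<n}. if i = j then v else \<zero>\<^bsub>V\<^esub>) {..<n} = v"
proof -
  have "finsum V (\<lambda>i\<in>{..<n}. if i = j then v else \<zero>\<^bsub>V\<^esub>) {..<n} = finsum V (\<lambda>i. if j = i then v else \<zero>\<^bsub>V\<^esub>) {..<n}"
    using assms by (intro V.M.finsum_cong') auto
  also have "\<dots> = v" using assms V.M.finsum_singleton[of j "{..<n}" "\<lambda>_. v"] by simp
  finally show ?thesis .
qed

lemma single_PiE: "j < n \<Longrightarrow> v \<in> Vs j \<Longrightarrow> (\<lambda>i\<in>{..<n}. if i = j then v else \<zero>\<^bsub>V\<^esub>) \<in> (\<Pi>\<^sub>E i\<in>{..<n}. Vs i)"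
  using Vs_zero by auto

lemma Vs_Int:
  assumes "i < n" "j < n" "i \<noteq> j" "v \<in> Vs i" "v \<in> Vs j"
  shows "v = \<zero>\<^bsub>V\<^esub>"
proof -
  have "inj_on (\<lambda>u. finsum V u {..<n}) (\<Pi>\<^sub>E i\<in>{..<n}. Vs i)" using V_direct_sum by (simp add: bij_betw_def)
  then have "(\<lambda>k\<in>{..<n}. if k = i then v else \<zero>\<^bsub>V\<^esub>) = (\<lambda>k\<in>{..<n}. if k = j then v else \<zero>\<^bsub>V\<^esub>)"
    by (rule inj_onD) (simp_all only: single_finsum[OF assms(1) Vs_V[OF assms(1,4)]]
        single_finsum[OF assms(2) Vs_V[OF assms(2,5)]] single_PiE[OF assms(1,4)] single_PiE[OF assms(2,5)])
  from fun_cong[OF this, of i] show ?thesis using assms(1,3) by simp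
qed

text \<open>
  For \<open>i \<noteq> j\<close> write \<open>\<rho> (emb i g) v = a + b\<close> with \<open>a\<close> in \<open>Vs j\<close> and \<open>b\<close> fixed by \<open>G j\<close>. The sum over \<open>G j\<close>
  commutes with the action of \<open>g\<close>, so it annihilates the left-hand side. It also annihilates \<open>a\<close>, and it
  multiplies \<open>b\<close> by the order of \<open>G j\<close>. So \<open>b = 0\<close>.
\<close>
lemma Vs_stable:
  assumes i: "i < n" and j: "j < n" and g: "g \<in> carrier (G i)" and v: "v \<in> Vs j"
  shows "\<rho> (emb i g) v \<in> Vs j"
proof (cases "i = j")
  case True
  then show ?thesis using Vs_invariant g v i by simp
next
  case False
  let ?T = "\<rho> (emb i g)"
  have eg: "emb i g \<in> carrier Gp" by (rule emb_closed[OF i g])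
  have vV: "v \<in> carrier V" by (rule Vs_V[OF j v])
  have eh: "emb j h \<in> carrier Gp" if "h \<in> carrier (G j)" for h by (rule emb_closed[OF j that])
  have fV: "(\<lambda>h. \<rho> (emb j h) u) \<in> carrier (G j) \<rightarrow> carrier V" if "u \<in> carrier V" for u
    by (rule Pi_I) (rule act_closed[OF eh that])
  have TV: "?T v \<in> carrier V" by (rule act_closed[OF eg vV])
  obtain a b where ab: "a \<in> Vs j" "b \<in> Fix j" "?T v = a \<oplus>\<^bsub>V\<^esub> b" using decompose[OF j TV] .
  have aV: "a \<in> carrier V" by (rule Vs_V[OF j ab(1)])
  have bV: "b \<in> carrier V" and bfix: "\<And>h. h \<in> carrier (G j) \<Longrightarrow> \<rho> (emb j h) b = b"
    using ab(2) by (auto simp: fixed_points_def)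
  have "orbit_sum j (?T v) = finsum V (\<lambda>h. ?T (\<rho> (emb j h) v)) (carrier (G j))"
    unfolding orbit_sum_def
  proof (rule V.M.finsum_cong')
    fix h assume h: "h \<in> carrier (G j)"
    show "\<rho> (emb j h) (?T v) = ?T (\<rho> (emb j h) v)"
      using V.act_mult[OF eh[OF h] eg vV] V.act_mult[OF eg eh[OF h] vV] emb_commute[OF i j False g h] by simp
  qed (use act_closed[OF eg act_closed[OF eh vV]] in auto)
  also have "\<dots> = ?T (orbit_sum j v)"
    unfolding orbit_sum_def
    by (rule module_hom_finsum[OF V_mod V_mod V.act_hom[OF eg] finite_factor[OF j] fV[OF vV], symmetric])
  also have "\<dots> = \<zero>\<^bsub>V\<^esub>"
    using module_hom_zero[OF V_mod V_mod V.act_hom[OF eg]] by (simp add: orbit_sum_zero[OF j v])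
  finally have "\<zero>\<^bsub>V\<^esub> = orbit_sum j (a \<oplus>\<^bsub>V\<^esub> b)" using ab(3) by simp
  also have "\<dots> = finsum V (\<lambda>h. \<rho> (emb j h) a \<oplus>\<^bsub>V\<^esub> \<rho> (emb j h) b) (carrier (G j))"
    unfolding orbit_sum_def
    using act_closed[OF eh aV] act_closed[OF eh bV]
    by (intro V.M.finsum_cong') (auto simp: act_add[OF eh aV bV])
  also have "\<dots> = orbit_sum j a \<oplus>\<^bsub>V\<^esub> orbit_sum j b"
    unfolding orbit_sum_def by (rule V.M.finsum_addf[OF fV[OF aV] fV[OF bV]])
  also have "\<dots> = orbit_sum j b"
    using V.M.finsum_closed[OF fV[OF bV]] by (simp add: orbit_sum_zero[OF j ab(1)]) (simp add: orbit_sum_def)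
  also have "\<dots> = finsum V (\<lambda>h. b) (carrier (G j))"
    unfolding orbit_sum_def using bV bfix by (intro V.M.finsum_cong') auto
  also have "\<dots> = of_nat (card (carrier (G j))) \<odot>\<^bsub>V\<^esub> b"
  proof -
    have "finsum V (\<lambda>h. b) K = of_nat (card K) \<odot>\<^bsub>V\<^esub> b" if "finite K" for K :: "'g set"
      using that
    proof (induction K rule: finite_induct)
      case empty
      then show ?case using bV V.smult_l_null[of b] by simp
    next
      case (insert x K)
      then show ?case using bV V.smult_l_distr[of 1 "of_nat (card K)" b] V.smult_one[of b] by simp
    qed
    then show ?thesis using finite_factor[OF j] .
  qed
  finally have z: "\<zero>\<^bsub>V\<^esub> = (of_nat (card (carrier (G j))) :: 'k) \<odot>\<^bsub>V\<^esub> b" .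
  have c: "(of_nat (card (carrier (G j))) :: 'k) \<noteq> 0"
  proof -
    have "carrier (G j) \<noteq> {}" using group_factor[OF j] by (metis empty_iff group.is_monoid monoid.one_closed)
    then show ?thesis using finite_factor[OF j] by simp
  qed
  have "b = (inverse (of_nat (card (carrier (G j)))) * of_nat (card (carrier (G j)))) \<odot>\<^bsub>V\<^esub> b"
    using c bV V.smult_one[of b] by simp
  also have "\<dots> = inverse (of_nat (card (carrier (G j)))) \<odot>\<^bsub>V\<^esub> \<zero>\<^bsub>V\<^esub>"
    using V.smult_assoc1[of "inverse (of_nat (card (carrier (G j))))" "of_nat (card (carrier (G j)))" b] bV z by simp
  also have "\<dots> = \<zero>\<^bsub>V\<^esub>" by (rule V.smult_r_null) simp
  finally show ?thesis using ab aV by simp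
qed

text \<open>
  Let \<open>T\<close> be the action of \<open>g\<close>, and write \<open>v = a + b\<close> with \<open>a\<close> in \<open>Vs i\<close> and \<open>b\<close> fixed by \<open>G i\<close>. Then
  \<open>T v - v = T a - a\<close> lies in the intersection of \<open>Vs j\<close> and \<open>Vs i\<close>, which is 0.
\<close>
lemma Vs_trivial_action:
  assumes i: "i < n" and j: "j < n" and ij: "i \<noteq> j" and g: "g \<in> carrier (G i)" and v: "v \<in> Vs j"
  shows "\<rho> (emb i g) v = v"
proof -
  let ?T = "\<rho> (emb i g)"
  have eg: "emb i g \<in> carrier Gp" by (rule emb_closed[OF i g])
  have vV: "v \<in> carrier V" by (rule Vs_V[OF j v])
  obtain a b where ab: "a \<in> Vs i" "b \<in> Fix i" "v = a \<oplus>\<^bsub>V\<^esub> b" using decompose[OF i vV] .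
  have aV: "a \<in> carrier V" by (rule Vs_V[OF i ab(1)])
  have bV: "b \<in> carrier V" and Tb: "?T b = b" using ab(2) g by (auto simp: fixed_points_def)
  have TaV: "?T a \<in> carrier V" by (rule act_closed[OF eg aV])
  have TvV: "?T v \<in> carrier V" by (rule act_closed[OF eg vV])
  have "?T v = ?T a \<oplus>\<^bsub>V\<^esub> b" using act_add[OF eg aV bV] ab(3) Tb by simp
  then have "?T v \<oplus>\<^bsub>V\<^esub> (\<ominus>\<^bsub>V\<^esub> v) = (?T a \<oplus>\<^bsub>V\<^esub> b) \<oplus>\<^bsub>V\<^esub> (\<ominus>\<^bsub>V\<^esub> b \<oplus>\<^bsub>V\<^esub> \<ominus>\<^bsub>V\<^esub> a)"
    using aV bV ab(3) V.M.minus_add[of a b] V.M.a_comm by simp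
  also have "\<dots> = ?T a \<oplus>\<^bsub>V\<^esub> (\<ominus>\<^bsub>V\<^esub> a)"
    using aV bV TaV by (simp add: V.M.a_assoc V.M.r_neg2)
  finally have eq: "?T v \<oplus>\<^bsub>V\<^esub> (\<ominus>\<^bsub>V\<^esub> v) = ?T a \<oplus>\<^bsub>V\<^esub> (\<ominus>\<^bsub>V\<^esub> a)" .
  have "?T v \<oplus>\<^bsub>V\<^esub> (\<ominus>\<^bsub>V\<^esub> v) \<in> Vs j" by (rule Vs_minus[OF j Vs_stable[OF i j g v] v])
  moreover have "?T v \<oplus>\<^bsub>V\<^esub> (\<ominus>\<^bsub>V\<^esub> v) \<in> Vs i"
    unfolding eq by (rule Vs_minus[OF i Vs_stable[OF i i g ab(1)] ab(1)])
  ultimately have z: "?T v \<oplus>\<^bsub>V\<^esub> (\<ominus>\<^bsub>V\<^esub> v) = \<zero>\<^bsub>V\<^esub>" using Vs_Int[OF i j ij] by blast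
  have "?T v = (?T v \<oplus>\<^bsub>V\<^esub> (\<ominus>\<^bsub>V\<^esub> v)) \<oplus>\<^bsub>V\<^esub> v"
    using TvV vV by (simp add: V.M.a_assoc V.M.l_neg)
  then show ?thesis using z vV by simp
qed

lemma act_factor:
  assumes g: "g \<in> carrier Gp" and j: "j < n" and v: "v \<in> Vs j"
  shows "\<rho> g v = \<rho> (emb j (g j)) v"
proof -
  have gi: "g i \<in> carrier (G i)" if "i < n" for i using g that by (auto simp: PiE_iff)
  have one: "\<one>\<^bsub>G i\<^esub> \<in> carrier (G i)" "x \<in> carrier (G i) \<Longrightarrow> x \<otimes>\<^bsub>G i\<^esub> \<one>\<^bsub>G i\<^esub> = x"
    "x \<in> carrier (G i) \<Longrightarrow> \<one>\<^bsub>G i\<^esub> \<otimes>\<^bsub>G i\<^esub> x = x" if "i < n" for i x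
    using group_factor[OF that] by (simp_all add: group.is_monoid monoid.l_one monoid.r_one)
  define gK where "gK = (\<lambda>K. \<lambda>i\<in>{..<n}. if i \<in> K then g i else \<one>\<^bsub>G i\<^esub>)"
  have gKc: "gK K \<in> carrier Gp" for K using gi one(1) by (auto simp: gK_def)
  have vV: "v \<in> carrier V" by (rule Vs_V[OF j v])
  have triv: "\<rho> (gK K) v = v" if "finite K" "K \<subseteq> {..<n} - {j}" for K
    using that
  proof (induction K rule: finite_induct)
    case empty
    have e: "gK {} = \<one>\<^bsub>Gp\<^esub>" by (simp add: gK_def)
    show ?case unfolding e by (rule V.act_one[OF vV])
  next
    case (insert i K)
    then have i: "i < n" "i \<noteq> j" "i \<notin> K" "K \<subseteq> {..<n} - {j}" by auto
    have "gK (insert i K) = emb i (g i) \<otimes>\<^bsub>Gp\<^esub> gK K"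
      using i one gi by (auto simp: gK_def factor_emb_def fun_eq_iff)
    then have "\<rho> (gK (insert i K)) v = \<rho> (emb i (g i)) (\<rho> (gK K) v)"
      using V.act_mult[OF emb_closed[OF i(1) gi[OF i(1)]] gKc vV] by simp
    also have "\<dots> = \<rho> (emb i (g i)) v" using insert.IH[OF i(4)] by simp
    also have "\<dots> = v" by (rule Vs_trivial_action[OF i(1) j i(2) gi[OF i(1)] v])
    finally show ?case .
  qed
  have "g = emb j (g j) \<otimes>\<^bsub>Gp\<^esub> gK ({..<n} - {j})"
  proof
    fix i
    show "g i = (emb j (g j) \<otimes>\<^bsub>Gp\<^esub> gK ({..<n} - {j})) i"
    proof (cases "i < n")
      case True
      then show ?thesis using one[OF True] gi[OF True] one[OF j] gi[OF j] by (simp add: gK_def factor_emb_def)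
    next
      case False
      then show ?thesis using g by (simp add: PiE_def extensional_def)
    qed
  qed
  then have "\<rho> g v = \<rho> (emb j (g j)) (\<rho> (gK ({..<n} - {j})) v)"
    using V.act_mult[OF emb_closed[OF j gi[OF j]] gKc vV] by metis
  then show ?thesis using triv[of "{..<n} - {j}"] by simp
qed

subsection \<open>Going around the cycle\<close>

lemma sigma_s_hom:
  assumes "i < n" "u \<in> Vs i" "v \<in> Vs i"
  shows "\<sigma>s i u \<in> Vs (Suc i mod n)" "\<sigma>s i (u \<oplus>\<^bsub>V\<^esub> v) = \<sigma>s i u \<oplus>\<^bsub>V\<^esub> \<sigma>s i v" "\<sigma>s i (c \<odot>\<^bsub>V\<^esub> u) = c \<odot>\<^bsub>V\<^esub> \<sigma>s i u"
  using \<sigma>s_linear[OF assms(1)] assms(2,3)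
  by (auto simp: linear_isos_def LinearCombinations.module_hom_def)

lemma sigma_s_bij: "i < n \<Longrightarrow> bij_betw (\<sigma>s i) (Vs i) (Vs (Suc i mod n))"
  using \<sigma>s_linear by (auto simp: linear_isos_def)

lemma W_mod: "i < n \<Longrightarrow> Module.module class_ring (V\<lparr>carrier := Vs i\<rparr>)"
  by (rule V.submodule_is_module[OF Vs_subspace])

lemma sigma_s_zero: "i < n \<Longrightarrow> \<sigma>s i \<zero>\<^bsub>V\<^esub> = \<zero>\<^bsub>V\<^esub>"
  using module_hom_zero[OF W_mod W_mod, of i "Suc i mod n" "\<sigma>s i"] \<sigma>s_linear[of i]
  by (simp add: linear_isos_def)

lemma sigma_Vs:
  assumes i: "i < n" and v: "v \<in> Vs i"
  shows "\<sigma> v = \<sigma>s i v"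
proof -
  have vV: "v \<in> carrier V" by (rule Vs_V[OF i v])
  have s: "\<sigma>s i v \<in> carrier V" by (rule Vs_V[OF _ sigma_s_hom(1)[OF i v v]]) (use i in simp)
  have "\<sigma> v = finsum V (\<lambda>k. \<sigma>s k ((\<lambda>k\<in>{..<n}. if k = i then v else \<zero>\<^bsub>V\<^esub>) k)) {..<n}"
    using \<sigma>_def[OF single_PiE[OF i v]] by (simp only: single_finsum[OF i vV])
  also have "\<dots> = finsum V (\<lambda>k\<in>{..<n}. if k = i then \<sigma>s i v else \<zero>\<^bsub>V\<^esub>) {..<n}"
    using s sigma_s_zero by (intro V.M.finsum_cong') auto
  also have "\<dots> = \<sigma>s i v" by (rule single_finsum[OF i s])
  finally show ?thesis .
qed

abbreviation pth where "pth \<equiv> cyc_path n \<sigma>s 0"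
abbreviation qth where "qth \<equiv> cyc_path n \<phi> 0"

lemma pth_bij: "bij_betw (pth k) (Vs 0) (Vs (k mod n))"
  using cyc_path_bij[of n \<sigma>s Vs 0 k] sigma_s_bij n0 by simp

lemma pth_closed: "v \<in> Vs 0 \<Longrightarrow> pth k v \<in> Vs (k mod n)"
  using pth_bij[of k] by (auto simp: bij_betw_def)

lemma pth_hom:
  assumes "u \<in> Vs 0" "v \<in> Vs 0"
  shows "pth k (u \<oplus>\<^bsub>V\<^esub> v) = pth k u \<oplus>\<^bsub>V\<^esub> pth k v" "pth k (c \<odot>\<^bsub>V\<^esub> u) = c \<odot>\<^bsub>V\<^esub> pth k u"
proof -
  have k: "k mod n < n" for k using n0 by simp
  show "pth k (u \<oplus>\<^bsub>V\<^esub> v) = pth k u \<oplus>\<^bsub>V\<^esub> pth k v"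
    by (induction k) (simp_all add: sigma_s_hom(2)[OF k pth_closed[OF assms(1)] pth_closed[OF assms(2)]])
  show "pth k (c \<odot>\<^bsub>V\<^esub> u) = c \<odot>\<^bsub>V\<^esub> pth k u"
    by (induction k) (simp_all add: sigma_s_hom(3)[OF k pth_closed[OF assms(1)] pth_closed[OF assms(1)]])
qed

lemma qth_bij: "bij_betw (qth k) (carrier (G 0)) (carrier (G (k mod n)))"
  using cyc_path_bij[of n \<phi> "\<lambda>i. carrier (G i)" 0 k] phi_bij n0 by simp

lemma qth_closed: "g \<in> carrier (G 0) \<Longrightarrow> qth k g \<in> carrier (G (k mod n))"
  using qth_bij[of k] by (auto simp: bij_betw_def)

lemma qth_mult:
  assumes "g \<in> carrier (G 0)" "h \<in> carrier (G 0)"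
  shows "qth k (g \<otimes>\<^bsub>G 0\<^esub> h) = qth k g \<otimes>\<^bsub>G (k mod n)\<^esub> qth k h"
  using assms n0 by (induction k) (simp_all add: phi_hom qth_closed mod_Suc_eq)

lemma qth_one: "qth k \<one>\<^bsub>G 0\<^esub> = \<one>\<^bsub>G (k mod n)\<^esub>"
proof -
  have "qth k \<in> hom (G 0) (G (k mod n))" using qth_closed qth_mult by (auto simp: hom_def)
  then show ?thesis using n0 by (intro hom_one group_factor) auto
qed

lemma pth_equivariant:
  assumes "g \<in> carrier (G 0)" "v \<in> Vs 0"
  shows "pth k (\<rho> (emb 0 g) v) = \<rho> (emb (k mod n) (qth k g)) (pth k v)"
proof (induction k)
  case 0
  then show ?case by simp
next
  case (Suc k)
  have "k mod n < n" using n0 by simp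
  from \<sigma>s_equivariant[OF this qth_closed[OF assms(1)] pth_closed[OF assms(2)]]
  show ?case using Suc by (simp add: mod_Suc_eq)
qed

lemma sigma_funpow: "v \<in> Vs 0 \<Longrightarrow> (\<sigma> ^^ k) v = pth k v"
proof (induction k)
  case (Suc k)
  then show ?case using sigma_Vs[of "k mod n" "pth k v"] pth_closed[of v k] n0 by simp
qed simp

text \<open>
  A trivial factor would fix \<open>Vs 0\<close>, which is not 0. This ensures that the order of \<open>\<phi>\<close> is
  divisible by \<open>n\<close>.
\<close>
lemma G0_nontrivial: "\<exists>x\<in>carrier (G 0). x \<noteq> \<one>\<^bsub>G 0\<^esub>"
proof (rule ccontr)
  assume "\<not> ?thesis"
  then have *: "x = \<one>\<^bsub>G 0\<^esub>" if "x \<in> carrier (G 0)" for x using that by blast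
  obtain v where v: "v \<in> Vs 0" "v \<noteq> \<zero>\<^bsub>V\<^esub>" using Vs_nonzero[OF n0] Vs_zero[OF n0] by blast
  have "emb 0 \<one>\<^bsub>G 0\<^esub> = \<one>\<^bsub>Gp\<^esub>" by (auto simp: factor_emb_def fun_eq_iff)
  then have "\<rho> (emb 0 x) v = v" if "x \<in> carrier (G 0)" for x
    using *[OF that] V.act_one[OF Vs_V[OF n0 v(1)]] by simp
  then have "v \<in> Fix 0" using Vs_V[OF n0 v(1)] by (simp add: fixed_points_def)
  then show False using Vs_Fix[OF n0 v(1)] v(2) by simp
qed

lemma Phi_funpow: "g \<in> carrier Gp \<Longrightarrow> (Phi ^^ k) g = (cyc_shift n \<phi> ^^ k) g"
proof (induction k)
  case (Suc k)
  have "(cyc_shift n \<phi> ^^ k) g \<in> carrier Gp"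
    by (rule funpow_mem[OF _ Suc.prems]) (use shift_closed in auto)
  then show ?case using Suc by (simp add: cyc_aut_def del: carrier_product_group)
qed simp

lemma Phi_pow_id:
  assumes "Phi [^]\<^bsub>AutoGroup Gp\<^esub> k = \<one>\<^bsub>AutoGroup Gp\<^esub>"
  obtains m where "k = n * m" "\<And>j x. j < n \<Longrightarrow> x \<in> carrier (G j) \<Longrightarrow> (cyc_loop n \<phi> j ^^ m) x = x"
proof -
  have id: "(cyc_shift n \<phi> ^^ k) g = g" if g: "g \<in> carrier Gp" for g
  proof -
    have "(\<lambda>x\<in>carrier Gp. (Phi ^^ k) x) g = (\<lambda>x\<in>carrier Gp. x) g"
      using assms unfolding P.aut_pow P.aut_one by simp
    then show ?thesis using g Phi_funpow[OF g] by (simp del: carrier_product_group)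
  qed
  \<comment> \<open>Otherwise \<open>\<phi>\<^sup>k\<close> would move a nontrivial element of the factor 0 to another factor.\<close>
  have "k mod n = 0"
  proof (rule ccontr)
    assume k: "k mod n \<noteq> 0"
    obtain x where x: "x \<in> carrier (G 0)" "x \<noteq> \<one>\<^bsub>G 0\<^esub>" using G0_nontrivial by blast
    have "qth k x = (cyc_shift n \<phi> ^^ k) (emb 0 x) (k mod n)"
      using cyc_shift_funpow[OF n0, of k \<phi> "emb 0 x"] n0 by (simp add: factor_emb_def)
    also have "\<dots> = emb 0 x (k mod n)" by (simp only: id[OF emb_closed[OF n0 x(1)]])
    also have "\<dots> = qth k \<one>\<^bsub>G 0\<^esub>" using k n0 by (simp add: factor_emb_def qth_one)
    finally have "qth k x = qth k \<one>\<^bsub>G 0\<^esub>" .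
    moreover have "\<one>\<^bsub>G 0\<^esub> \<in> carrier (G 0)" using group_factor[OF n0] by (simp add: group.is_monoid)
    ultimately have "x = \<one>\<^bsub>G 0\<^esub>" using qth_bij[of k] x(1) by (auto simp: bij_betw_def inj_on_def)
    then show False using x(2) by simp
  qed
  then obtain m where m: "k = n * m" by auto
  have "(cyc_loop n \<phi> j ^^ m) x = x" if j: "j < n" and x: "x \<in> carrier (G j)" for j x
  proof -
    have "(cyc_shift n \<phi> ^^ k) (emb j x) ((j + k) mod n) = (cyc_loop n \<phi> j ^^ m) (emb j x j)"
      using cyc_shift_funpow[OF j, of k \<phi> "emb j x"] cyc_path_loop[OF j, of \<phi> m] m by simp
    then have "emb j x ((j + k) mod n) = (cyc_loop n \<phi> j ^^ m) (emb j x j)"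
      by (simp only: id[OF emb_closed[OF j x]])
    then have "emb j x j = (cyc_loop n \<phi> j ^^ m) (emb j x j)"
      using m j by simp
    then show ?thesis using j by (simp add: factor_emb_def)
  qed
  with m show ?thesis by (rule that)
qed

lemma loop_pow_id:
  assumes "\<And>x. x \<in> carrier (G 0) \<Longrightarrow> (cyc_loop n \<phi> 0 ^^ m) x = x"
  shows "Phi [^]\<^bsub>AutoGroup Gp\<^esub> (n * m) = \<one>\<^bsub>AutoGroup Gp\<^esub>"
proof -
  have "(cyc_loop n \<phi> j ^^ m) x = x" if j: "j < n" and x: "x \<in> carrier (G j)" for j x
  proof -
    obtain y where y: "y \<in> carrier (G 0)" "x = qth j y"
      using qth_bij[of j] x j by (auto simp: bij_betw_def image_iff set_eq_iff)
    have "(cyc_loop n \<phi> j ^^ m) (qth j y) = qth j ((cyc_loop n \<phi> 0 ^^ m) y)" for y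
      using fun_cong[OF cyc_loop_conj[OF j, of \<phi>]] by (induction m) simp_all
    then show ?thesis using y assms by simp
  qed
  then have "(cyc_shift n \<phi> ^^ (n * m)) g = g" if "g \<in> carrier Gp" for g
    using cyc_shift_funpow_id[where D="\<lambda>i. carrier (G i)", OF phi_closed] that by simp
  then show ?thesis unfolding P.aut_pow P.aut_one by (intro restrict_ext) (simp add: Phi_funpow)
qed

end

context cyclic_module
begin

interpretation V: group_module Gp V \<rho> by (rule V_module)

subsection \<open>The automorphism of a factor\<close>

lemma path_closed: "j < n \<Longrightarrow> g \<in> carrier (G j) \<Longrightarrow> cyc_path n \<phi> j k g \<in> carrier (G ((j + k) mod n))"
  using cyc_path_bij[of n \<phi> "\<lambda>i. carrier (G i)" j k] phi_bij by (auto simp: bij_betw_def)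

lemma path_mult:
  assumes "j < n" "g \<in> carrier (G j)" "h \<in> carrier (G j)"
  shows "cyc_path n \<phi> j k (g \<otimes>\<^bsub>G j\<^esub> h) = cyc_path n \<phi> j k g \<otimes>\<^bsub>G ((j + k) mod n)\<^esub> cyc_path n \<phi> j k h"
proof (induction k)
  case 0
  then show ?case using assms(1) by simp
next
  case (Suc k)
  have "(j + k) mod n < n" using n0 by simp
  from phi_hom[OF this path_closed[OF assms(1,2)] path_closed[OF assms(1,3)]]
  show ?case using Suc by (simp add: mod_Suc_eq)
qed

lemma loop_closed: "j < n \<Longrightarrow> g \<in> carrier (G j) \<Longrightarrow> cyc_loop n \<phi> j g \<in> carrier (G j)"
  using path_closed[of j g n] by (simp add: cyc_loop_def)

lemma loop_finite_aut:
  assumes j: "j < n"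
  shows "finite_aut (G j) (loop_aut n G \<phi> j)"
proof -
  have "bij_betw (cyc_loop n \<phi> j) (carrier (G j)) (carrier (G j))"
    using cyc_path_bij[of n \<phi> "\<lambda>i. carrier (G i)" j n] phi_bij j by (simp add: cyc_loop_def)
  then have "bij_betw (loop_aut n G \<phi> j) (carrier (G j)) (carrier (G j))"
    by (rule iffD1[OF bij_betw_cong, rotated]) (simp add: loop_aut_def)
  moreover have "loop_aut n G \<phi> j (g \<otimes>\<^bsub>G j\<^esub> h) = loop_aut n G \<phi> j g \<otimes>\<^bsub>G j\<^esub> loop_aut n G \<phi> j h"
    if "g \<in> carrier (G j)" "h \<in> carrier (G j)" for g h
  proof -
    have "g \<otimes>\<^bsub>G j\<^esub> h \<in> carrier (G j)"
      using group_factor[OF j] that by (simp add: group.is_monoid monoid.m_closed)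
    then show ?thesis using path_mult[OF j that, of n] that j by (simp add: loop_aut_def cyc_loop_def)
  qed
  ultimately have "loop_aut n G \<phi> j \<in> auto (G j)"
    using loop_closed[OF j] by (simp add: auto_def Bij_def hom_def Pi_iff) (simp add: loop_aut_def)
  then show ?thesis
    by (intro finite_aut.intro finite_aut_axioms.intro group_factor[OF j] finite_factor[OF j])
qed

lemma loop_aut_pow_one:
  assumes j: "j < n"
  shows "loop_aut n G \<phi> j [^]\<^bsub>AutoGroup (G j)\<^esub> m = \<one>\<^bsub>AutoGroup (G j)\<^esub> \<longleftrightarrow>
    (\<forall>x\<in>carrier (G j). (cyc_loop n \<phi> j ^^ m) x = x)"
proof -
  interpret L: finite_aut "G j" "loop_aut n G \<phi> j" by (rule loop_finite_aut[OF j])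
  have p: "(loop_aut n G \<phi> j ^^ k) x = (cyc_loop n \<phi> j ^^ k) x \<and> (cyc_loop n \<phi> j ^^ k) x \<in> carrier (G j)"
    if "x \<in> carrier (G j)" for x k
    using that by (induction k) (simp_all add: loop_aut_def loop_closed[OF j])
  show ?thesis
    unfolding L.aut_pow L.aut_one
  proof
    assume eq: "(\<lambda>x\<in>carrier (G j). (loop_aut n G \<phi> j ^^ m) x) = (\<lambda>x\<in>carrier (G j). x)"
    show "\<forall>x\<in>carrier (G j). (cyc_loop n \<phi> j ^^ m) x = x"
    proof
      fix x assume "x \<in> carrier (G j)"
      then show "(cyc_loop n \<phi> j ^^ m) x = x" using fun_cong[OF eq, of x] p by simp
    qed
  next
    assume "\<forall>x\<in>carrier (G j). (cyc_loop n \<phi> j ^^ m) x = x"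
    then show "(\<lambda>x\<in>carrier (G j). (loop_aut n G \<phi> j ^^ m) x) = (\<lambda>x\<in>carrier (G j). x)"
      using p by (intro restrict_ext) simp
  qed
qed

text \<open>
  This is inherited from \<open>\<sigma>\<close>, whose \<open>n\<close>-th power is \<open>\<tau>\<^sub>0\<close> on \<open>Vs 0\<close>. It makes \<open>Vs 0\<close> a module of the
  semidirect product.
\<close>
lemma tau_order:
  assumes "loop_aut n G \<phi> 0 [^]\<^bsub>AutoGroup (G 0)\<^esub> m = \<one>\<^bsub>AutoGroup (G 0)\<^esub>" and v: "v \<in> Vs 0"
  shows "(cyc_loop n \<sigma>s 0 ^^ m) v = v"
proof -
  have "Phi [^]\<^bsub>AutoGroup Gp\<^esub> (n * m) = \<one>\<^bsub>AutoGroup Gp\<^esub>"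
    using assms(1) loop_aut_pow_one[OF n0] by (intro loop_pow_id) blast
  then have "(\<sigma> ^^ (n * m)) v = v" by (rule P.extends_by_order[OF \<sigma>_extends]) (rule Vs_V[OF n0 v])
  then show ?thesis using sigma_funpow[OF v] cyc_path_loop[OF n0, where f=\<sigma>s and m=m] by simp
qed

subsection \<open>Coordinates\<close>

definition comp where "comp v = inv_into (\<Pi>\<^sub>E i\<in>{..<n}. Vs i) (\<lambda>u. finsum V u {..<n}) v"

lemma comp_PiE: "v \<in> carrier V \<Longrightarrow> comp v \<in> (\<Pi>\<^sub>E i\<in>{..<n}. Vs i)"
  unfolding comp_def by (rule inv_into_bij(3)[OF V_direct_sum])

lemma finsum_comp: "v \<in> carrier V \<Longrightarrow> finsum V (comp v) {..<n} = v"
  unfolding comp_def by (rule inv_into_bij(2)[OF V_direct_sum])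

lemma comp_finsum: "u \<in> (\<Pi>\<^sub>E i\<in>{..<n}. Vs i) \<Longrightarrow> comp (finsum V u {..<n}) = u"
  unfolding comp_def by (rule inv_into_bij(1)[OF V_direct_sum])

lemma comp_in: "v \<in> carrier V \<Longrightarrow> i < n \<Longrightarrow> comp v i \<in> Vs i"
  using comp_PiE by auto

lemma comp_add:
  assumes u: "u \<in> carrier V" and v: "v \<in> carrier V"
  shows "comp (u \<oplus>\<^bsub>V\<^esub> v) = (\<lambda>i\<in>{..<n}. comp u i \<oplus>\<^bsub>V\<^esub> comp v i)"
proof -
  have c: "comp x \<in> {..<n} \<rightarrow> carrier V" if "x \<in> carrier V" for x
    by (rule Pi_I) (simp add: Vs_V[OF _ comp_in[OF that]])
  have "finsum V (\<lambda>i\<in>{..<n}. comp u i \<oplus>\<^bsub>V\<^esub> comp v i) {..<n} = finsum V (\<lambda>i. comp u i \<oplus>\<^bsub>V\<^esub> comp v i) {..<n}"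
    using c[OF u] c[OF v] by (intro V.M.finsum_cong') auto
  also have "\<dots> = u \<oplus>\<^bsub>V\<^esub> v" using V.M.finsum_addf[OF c[OF u] c[OF v]] by (simp add: finsum_comp u v)
  finally have e: "finsum V (\<lambda>i\<in>{..<n}. comp u i \<oplus>\<^bsub>V\<^esub> comp v i) {..<n} = u \<oplus>\<^bsub>V\<^esub> v" .
  have "(\<lambda>i\<in>{..<n}. comp u i \<oplus>\<^bsub>V\<^esub> comp v i) \<in> (\<Pi>\<^sub>E i\<in>{..<n}. Vs i)"
    by (auto simp: Vs_add comp_in u v)
  from comp_finsum[OF this] show ?thesis by (simp only: e)
qed

lemma comp_smult:
  assumes u: "u \<in> carrier V"
  shows "comp (c \<odot>\<^bsub>V\<^esub> u) = (\<lambda>i\<in>{..<n}. c \<odot>\<^bsub>V\<^esub> comp u i)"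
proof -
  have cu: "comp u \<in> {..<n} \<rightarrow> carrier V" by (rule Pi_I) (simp add: Vs_V[OF _ comp_in[OF u]])
  have "finsum V (\<lambda>i\<in>{..<n}. c \<odot>\<^bsub>V\<^esub> comp u i) {..<n} = finsum V (\<lambda>i. c \<odot>\<^bsub>V\<^esub> comp u i) {..<n}"
    using cu by (intro V.M.finsum_cong') auto
  also have "\<dots> = c \<odot>\<^bsub>V\<^esub> finsum V (comp u) {..<n}"
    by (rule V.finsum_smult[symmetric]) (use cu in auto)
  also have "\<dots> = c \<odot>\<^bsub>V\<^esub> u" by (simp add: finsum_comp u)
  finally have e: "finsum V (\<lambda>i\<in>{..<n}. c \<odot>\<^bsub>V\<^esub> comp u i) {..<n} = c \<odot>\<^bsub>V\<^esub> u" .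
  have "(\<lambda>i\<in>{..<n}. c \<odot>\<^bsub>V\<^esub> comp u i) \<in> (\<Pi>\<^sub>E i\<in>{..<n}. Vs i)"
    by (auto simp: Vs_smult comp_in u)
  from comp_finsum[OF this] show ?thesis by (simp only: e)
qed

lemma comp_Vs: "j < n \<Longrightarrow> v \<in> Vs j \<Longrightarrow> comp v = (\<lambda>i\<in>{..<n}. if i = j then v else \<zero>\<^bsub>V\<^esub>)"
  using comp_finsum[OF single_PiE[of j v]] single_finsum[of j v] Vs_V[of j v] by simp

abbreviation W0 where "W0 \<equiv> V\<lparr>carrier := Vs 0\<rparr>"

text \<open>
  The basis \<open>w\<close> of \<open>Vs 0\<close> is transported to \<open>Vs i\<close> by \<open>\<sigma>\<^sub>i\<^sub>-\<^sub>1 \<cdots> \<sigma>\<^sub>0\<close>. Then \<open>\<sigma>\<close> merely shifts it, except at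
  the end of the cycle, where \<open>\<tau>\<^sub>0\<close> shows up.
\<close>
definition vbas :: "('c \<Rightarrow> 'v) \<Rightarrow> nat \<times> 'c \<Rightarrow> 'v" where
  "vbas w = (\<lambda>(i, c). pth i (w c))"

definition vcoord :: "('c \<Rightarrow> 'v \<Rightarrow> 'k) \<Rightarrow> nat \<times> 'c \<Rightarrow> 'v \<Rightarrow> 'k" where
  "vcoord e = (\<lambda>(i, c) v. e c (inv_into (Vs 0) (pth i) (comp v i)))"

lemma W0_closed: "lin_closed W0"
  by (rule lin_closed_module[OF W_mod[OF n0]])

lemma Vs_lin_system:
  assumes "lin_system W0 C w e" "i < n"
  shows "lin_system (V\<lparr>carrier := Vs i\<rparr>) C (\<lambda>c. pth i (w c)) (\<lambda>c v. e c (inv_into (Vs 0) (pth i) v))"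
proof -
  have "lin_system (V\<lparr>carrier := Vs i\<rparr>) C (\<lambda>c. pth i (w c)) (\<lambda>c v. e c (inv_into (carrier W0) (pth i) v))"
    by (rule lin_system_iso[OF assms(1) W0_closed]) (use pth_bij[of i] assms(2) pth_hom in auto)
  then show ?thesis by simp
qed

lemma V_lin_system:
  assumes ls: "lin_system W0 C w e"
  shows "lin_system V ({..<n} \<times> C) (vbas w) (vcoord e)"
proof -
  have C: "finite C" and w: "\<And>c. c \<in> C \<Longrightarrow> w c \<in> Vs 0" using ls by (auto simp: dual_system_def)
  have lsi: "lin_fun (V\<lparr>carrier := Vs i\<rparr>) (\<lambda>v. e c (inv_into (Vs 0) (pth i) v))" if "i < n" "c \<in> C" for i c
    using Vs_lin_system[OF ls that(1)] that(2) by (auto simp: dual_system_def)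
  have exp: "h v = (\<Sum>c\<in>C. e c (inv_into (Vs 0) (pth i) v) * h (pth i (w c)))"
    if "i < n" "lin_fun (V\<lparr>carrier := Vs i\<rparr>) h" "v \<in> Vs i" for i h v
    using Vs_lin_system[OF ls that(1)] that(2,3) unfolding dual_system_def by simp
  have "lin_fun V (vcoord e q)" if "q \<in> {..<n} \<times> C" for q
  proof -
    obtain i c where q: "q = (i, c)" "i < n" "c \<in> C" using \<open>q \<in> {..<n} \<times> C\<close> by auto
    note l = lsi[OF q(2,3), unfolded lin_fun_def, simplified]
    show ?thesis
      unfolding lin_fun_def q(1) vcoord_def prod.case
    proof (intro ballI conjI allI)
      fix u a assume u: "u \<in> carrier V"
      show "e c (inv_into (Vs 0) (pth i) (comp (a \<odot>\<^bsub>V\<^esub> u) i)) = a * e c (inv_into (Vs 0) (pth i) (comp u i))"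
        using l comp_in[OF u q(2)] q(2) by (simp add: comp_smult[OF u])
      fix v assume v: "v \<in> carrier V"
      show "e c (inv_into (Vs 0) (pth i) (comp (u \<oplus>\<^bsub>V\<^esub> v) i))
        = e c (inv_into (Vs 0) (pth i) (comp u i)) + e c (inv_into (Vs 0) (pth i) (comp v i))"
        using l comp_in[OF u q(2)] comp_in[OF v q(2)] q(2) by (simp add: comp_add[OF u v])
    qed
  qed
  moreover have "h v = (\<Sum>q\<in>{..<n} \<times> C. vcoord e q v * h (vbas w q))"
    if h: "lin_fun V h" and v: "v \<in> carrier V" for h v
  proof -
    have cv: "comp v \<in> {..<n} \<rightarrow> carrier V" by (rule Pi_I) (simp add: Vs_V[OF _ comp_in[OF v]])
    have "h v = h (finsum V (comp v) {..<n})" by (simp add: finsum_comp v)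
    also have "\<dots> = (\<Sum>i<n. h (comp v i))" by (rule lin_fun_finsum[OF V_mod h _ cv]) simp
    also have "\<dots> = (\<Sum>i<n. \<Sum>c\<in>C. e c (inv_into (Vs 0) (pth i) (comp v i)) * h (pth i (w c)))"
    proof (intro sum.cong refl)
      fix i assume "i \<in> {..<n}"
      then have i: "i < n" by simp
      have "lin_fun (V\<lparr>carrier := Vs i\<rparr>) h" using h Vs_V[OF i] by (simp add: lin_fun_def)
      from exp[OF i this comp_in[OF v i]]
      show "h (comp v i) = (\<Sum>c\<in>C. e c (inv_into (Vs 0) (pth i) (comp v i)) * h (pth i (w c)))" .
    qed
    also have "\<dots> = (\<Sum>q\<in>{..<n} \<times> C. vcoord e q v * h (vbas w q))"
      by (simp add: sum.cartesian_product vcoord_def vbas_def case_prod_unfold)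
    finally show ?thesis .
  qed
  moreover have "vbas w q \<in> carrier V" if q: "q \<in> {..<n} \<times> C" for q
  proof -
    obtain i c where q': "q = (i, c)" "i < n" "c \<in> C" using q by auto
    have "pth i (w c) \<in> Vs i" using pth_closed[OF w[OF q'(3)], of i] q'(2) by simp
    then show ?thesis using Vs_V[OF q'(2)] by (simp add: vbas_def q'(1))
  qed
  ultimately show ?thesis using C by (simp add: dual_system_def Pi_iff)
qed

lemma vcoord_Vs:
  assumes ls: "lin_system W0 C w e" and i: "i < n" and j: "j < n" and c: "c \<in> C" and u: "u \<in> Vs 0"
  shows "vcoord e (i, c) (pth j u) = (if i = j then e c u else 0)"
proof -
  have pu: "pth j u \<in> Vs j" using pth_closed[OF u, of j] j by simp
  show ?thesis
  proof (cases "i = j")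
    case True
    then show ?thesis
      using i by (simp add: vcoord_def comp_Vs[OF j pu] inv_into_bij(1)[OF pth_bij u])
  next
    case False
    have "pth i \<zero>\<^bsub>V\<^esub> = \<zero>\<^bsub>V\<^esub>"
      using pth_hom(2)[OF Vs_zero[OF n0] Vs_zero[OF n0], of i 0] Vs_zero[OF n0]
        Vs_V[OF _ pth_closed[OF Vs_zero[OF n0], of i]] n0
      by (simp add: V.smult_l_null[simplified])
    then have "inv_into (Vs 0) (pth i) \<zero>\<^bsub>V\<^esub> = \<zero>\<^bsub>V\<^esub>"
      using inv_into_bij(1)[OF pth_bij[of i] Vs_zero[OF n0]] by simp
    moreover have "e c \<zero>\<^bsub>V\<^esub> = 0"
      using lin_fun_zero[OF W_mod[OF n0], of "e c"] ls c by (auto simp: dual_system_def)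
    ultimately show ?thesis using False i by (simp add: vcoord_def comp_Vs[OF j pu])
  qed
qed

lemma vcoord_vbas:
  assumes ls: "lin_system W0 C w e"
    and dual: "\<And>c d. c \<in> C \<Longrightarrow> d \<in> C \<Longrightarrow> e c (w d) = (if c = d then 1 else 0)"
    and "p \<in> {..<n} \<times> C" "q \<in> {..<n} \<times> C"
  shows "vcoord e p (vbas w q) = (if p = q then 1 else 0)"
proof -
  obtain i c j d where pq: "p = (i, c)" "q = (j, d)" "i < n" "j < n" "c \<in> C" "d \<in> C" using assms(3,4) by auto
  have "w d \<in> Vs 0" using ls pq(6) by (auto simp: dual_system_def)
  from vcoord_Vs[OF ls pq(3,4,5) this] show ?thesis using dual[OF pq(5,6)] by (cases "c = d") (simp_all add: pq(1,2) vbas_def)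
qed

text \<open>
  The component \<open>g j\<close> transported back to \<open>G 0\<close>. It acts on the transported basis of \<open>Vs j\<close> as \<open>g j\<close> does.
\<close>
definition pull :: "(nat \<Rightarrow> 'g) \<Rightarrow> nat \<Rightarrow> 'g" where
  "pull g j = inv_into (carrier (G 0)) (qth j) (g j)"

lemma pull:
  assumes "g \<in> carrier Gp" "j < n"
  shows "pull g j \<in> carrier (G 0)" "qth j (pull g j) = g j"
proof -
  have "g j \<in> carrier (G (j mod n))" using assms by (auto simp: PiE_iff)
  then show "pull g j \<in> carrier (G 0)" "qth j (pull g j) = g j"
    unfolding pull_def by (rule inv_into_bij(3)[OF qth_bij], rule inv_into_bij(2)[OF qth_bij])
qed

lemma smat_act:
  fixes w :: "'c \<Rightarrow> 'v"
  assumes ls: "lin_system W0 C w e" and g: "g \<in> carrier Gp"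
  shows "smat ({..<n} \<times> C) (vbas w) (vcoord e) (\<rho> g)
    = vmon n C id (\<lambda>j. smat C w e (\<rho> (emb 0 (pull g j))))"
proof (intro ext)
  fix p q :: "nat \<times> 'c"
  obtain i c j d where pq: "p = (i, c)" "q = (j, d)" by (cases p, cases q)
  show "smat ({..<n} \<times> C) (vbas w) (vcoord e) (\<rho> g) p q
    = vmon n C id (\<lambda>j. smat C w e (\<rho> (emb 0 (pull g j)))) p q"
  proof (cases "i < n \<and> j < n \<and> c \<in> C \<and> d \<in> C")
    case True
    then have wd: "w d \<in> Vs 0" using ls by (auto simp: dual_system_def)
    have pd: "pth j (w d) \<in> Vs j" using pth_closed[OF wd, of j] True by simp
    have "\<rho> g (pth j (w d)) = \<rho> (emb j (g j)) (pth j (w d))" using act_factor[OF g _ pd] True by simp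
    also have "\<dots> = pth j (\<rho> (emb 0 (pull g j)) (w d))"
      using pth_equivariant[OF pull(1)[OF g, of j] wd, of j] pull(2)[OF g, of j] True by simp
    finally have eq: "\<rho> g (pth j (w d)) = pth j (\<rho> (emb 0 (pull g j)) (w d))" .
    have "\<rho> (emb 0 (pull g j)) (w d) \<in> Vs 0"
      using Vs_invariant[OF n0 pull(1)[OF g, of j] wd] True by simp
    then have "vcoord e (i, c) (\<rho> g (pth j (w d))) = (if i = j then e c (\<rho> (emb 0 (pull g j)) (w d)) else 0)"
      unfolding eq using vcoord_Vs[OF ls, of i j c] True by simp
    then show ?thesis using True by (simp add: pq smat_def vmon_def vbas_def)
  next
    case False
    then show ?thesis by (auto simp: pq smat_def vmon_def)
  qed
qed

lemma smat_sigma: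
  fixes w :: "'c \<Rightarrow> 'v"
  assumes ls: "lin_system W0 C w e"
    and dual: "\<And>c d. c \<in> C \<Longrightarrow> d \<in> C \<Longrightarrow> e c (w d) = (if c = d then 1 else 0)"
  shows "smat ({..<n} \<times> C) (vbas w) (vcoord e) \<sigma>
    = vmon n C (cyc_succ n) (\<lambda>j. if Suc j < n then id_mat C else smat C w e (cyc_loop n \<sigma>s 0))"
proof (intro ext)
  fix p q :: "nat \<times> 'c"
  obtain i c j d where pq: "p = (i, c)" "q = (j, d)" by (cases p, cases q)
  show "smat ({..<n} \<times> C) (vbas w) (vcoord e) \<sigma> p q
    = vmon n C (cyc_succ n) (\<lambda>j. if Suc j < n then id_mat C else smat C w e (cyc_loop n \<sigma>s 0)) p q"
  proof (cases "i < n \<and> j < n \<and> c \<in> C \<and> d \<in> C")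
    case True
    then have wd: "w d \<in> Vs 0" using ls by (auto simp: dual_system_def)
    have pd: "pth j (w d) \<in> Vs j" using pth_closed[OF wd, of j] True by simp
    have "\<sigma> (pth j (w d)) = pth (Suc j) (w d)" using sigma_Vs[OF _ pd] True by simp
    moreover have "vcoord e (i, c) (pth (Suc j) (w d))
        = (if i = cyc_succ n j then (if Suc j < n then id_mat C else smat C w e (cyc_loop n \<sigma>s 0)) c d else 0)"
    proof (cases "Suc j < n")
      case True2: True
      then show ?thesis using vcoord_Vs[OF ls _ True2 _ wd, of i c] True dual[of c d]
        by (simp add: cyc_succ_def id_mat_def)
    next
      case False
      then have j: "Suc j = n" using True by simp
      have lw: "cyc_loop n \<sigma>s 0 (w d) \<in> Vs 0" using pth_closed[OF wd, of n] by (simp add: cyc_loop_def)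
      have "pth (Suc j) (w d) = pth 0 (cyc_loop n \<sigma>s 0 (w d))" unfolding j by (simp add: cyc_loop_def)
      then show ?thesis using vcoord_Vs[OF ls _ n0 _ lw, of i c] True False j
        by (simp add: cyc_succ_def smat_def)
    qed
    ultimately show ?thesis using True by (simp add: pq smat_def vmon_def vbas_def)
  next
    case False
    then show ?thesis by (auto simp: pq smat_def vmon_def cyc_succ_def)
  qed
qed

end

section \<open>The tensor product in coordinates\<close>
lemma admissible_cyc_shift:
  assumes closed: "\<And>i. i < n \<Longrightarrow> lin_closed (E i)"
    and T: "\<And>i. i < n \<Longrightarrow> T i \<in> module_hom class_ring (E i) (E (Suc i mod n))"
  shows "admissible (\<Pi>\<^sub>E i\<in>{..<n}. carrier (E i)) (multilinear_forms {..<n} E) (cyc_shift n T)"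
proof -
  let ?D = "\<Pi>\<^sub>E i\<in>{..<n}. carrier (E i)"
  have upd: "v(i := x) \<in> ?D" if "v \<in> ?D" "i < n" "x \<in> carrier (E i)" for v i x
    using that by (auto simp: PiE_def extensional_def)
  have cl: "x \<oplus>\<^bsub>E i\<^esub> y \<in> carrier (E i)" "c \<odot>\<^bsub>E i\<^esub> x \<in> carrier (E i)"
    if "i < n" "x \<in> carrier (E i)" "y \<in> carrier (E i)" for i x y c
    using closed that by (auto simp: lin_closed_def)
  have Tc: "T i x \<in> carrier (E (Suc i mod n))" and Ta: "T i (x \<oplus>\<^bsub>E i\<^esub> y) = T i x \<oplus>\<^bsub>E (Suc i mod n)\<^esub> T i y"
    and Ts: "T i (c \<odot>\<^bsub>E i\<^esub> x) = c \<odot>\<^bsub>E (Suc i mod n)\<^esub> T i x"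
    if "i < n" "x \<in> carrier (E i)" "y \<in> carrier (E i)" for i x y c
    using T[OF that(1)] that(2,3) by (auto simp: LinearCombinations.module_hom_def)
  have sn: "Suc i mod n < n" if "i < n" for i using that by simp
  have TD: "cyc_shift n T v \<in> ?D" if "v \<in> ?D" for v
    using cyc_shift_PiE[of n T "\<lambda>i. carrier (E i)"] Tc that by blast
  have Tu: "cyc_shift n T (v(i := x)) = (cyc_shift n T v)(Suc i mod n := T i x)" if i: "i < n" for v i x
  proof
    fix k
    show "cyc_shift n T (v(i := x)) k = ((cyc_shift n T v)(Suc i mod n := T i x)) k"
    proof (cases "k < n")
      case True
      then show ?thesis using cyc_pred_Suc[OF i] Suc_cyc_pred[OF True] by (auto simp: cyc_shift_def)
    next
      case False
      then show ?thesis using sn[OF i] by (auto simp: cyc_shift_def)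
    qed
  qed
  have "(\<lambda>v\<in>?D. f (cyc_shift n T v)) \<in> multilinear_forms {..<n} E" if "f \<in> multilinear_forms {..<n} E" for f
    using that TD Tc sn by (simp add: multilinear_forms_def upd cl Tu Ta Ts del: fun_upd_apply)
  then show ?thesis using TD by (simp add: admissible_def)
qed

lemma admissible_id:
  assumes "F \<subseteq> D \<rightarrow>\<^sub>E UNIV"
  shows "admissible D F (\<lambda>v. v)"
proof -
  have "(\<lambda>v\<in>D. f v) = f" if "f \<in> F" for f
    using assms that by (auto intro: extensional_restrict)
  then show ?thesis by (auto simp: admissible_def)
qed

lemma admissible_funpow:
  assumes "F \<subseteq> D \<rightarrow>\<^sub>E UNIV" "admissible D F T"
  shows "admissible D F (T ^^ k)"
proof (induction k)
  case 0
  then show ?case using admissible_id[OF assms(1)] by (simp add: id_def)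
next
  case (Suc k)
  show ?case unfolding funpow.simps by (rule admissible_comp[OF assms(2) Suc])
qed

locale preferred = cyclic_module n G \<phi> V \<rho> Vs \<sigma>s \<sigma> B + b_preferred_data n G \<phi> V \<rho> Vs \<sigma>s \<chi> E r \<delta>
  for n :: nat
    and G :: "nat \<Rightarrow> ('g, 'm) monoid_scheme"
    and \<phi> :: "nat \<Rightarrow> 'g \<Rightarrow> 'g"
    and V :: "('k::{alg_closed_field, field_char_0}, 'v) module"
    and \<rho> :: "(nat \<Rightarrow> 'g) \<Rightarrow> 'v \<Rightarrow> 'v"
    and Vs B :: "nat \<Rightarrow> 'v set"
    and \<sigma>s :: "nat \<Rightarrow> 'v \<Rightarrow> 'v"
    and \<sigma> :: "'v \<Rightarrow> 'v"
    and \<chi> :: "(nat \<Rightarrow> 'g) \<Rightarrow> 'k"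
    and E :: "nat \<Rightarrow> ('k, 'e) module"
    and r :: "nat \<Rightarrow> 'g \<Rightarrow> 'e \<Rightarrow> 'e"
    and \<delta> :: "nat \<Rightarrow> 'e \<Rightarrow> 'e"
begin

lemma E_module: "i < n \<Longrightarrow> group_module (G i) (E i) (r i)"
  using E_simple by (simp add: simple_module_def)

lemma E_mod: "i < n \<Longrightarrow> Module.module class_ring (E i)"
  using E_module by (simp add: group_module_def vectorspace_def)

lemma E_closed: "i < n \<Longrightarrow> lin_closed (E i)"
  by (rule lin_closed_module[OF E_mod])

lemma r_hom: "i < n \<Longrightarrow> g \<in> carrier (G i) \<Longrightarrow> r i g \<in> module_hom class_ring (E i) (E i)"
  using group_module.act_hom[OF E_module] .

lemma r_closed: "i < n \<Longrightarrow> g \<in> carrier (G i) \<Longrightarrow> v \<in> carrier (E i) \<Longrightarrow> r i g v \<in> carrier (E i)"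
  using r_hom[of i g] by (auto simp: LinearCombinations.module_hom_def)

lemma delta_hom: "i < n \<Longrightarrow> \<delta> i \<in> module_hom class_ring (E i) (E (Suc i mod n))"
  using \<delta>_linear by (simp add: linear_isos_def)

lemma delta_bij: "i < n \<Longrightarrow> bij_betw (\<delta> i) (carrier (E i)) (carrier (E (Suc i mod n)))"
  using \<delta>_linear by (simp add: linear_isos_def)

lemma delta_closed: "i < n \<Longrightarrow> \<delta> i \<in> carrier (E i) \<rightarrow> carrier (E (Suc i mod n))"
  using delta_bij bij_betw_imp_funcset by blast

lemma delta_lin:
  assumes "i < n" "u \<in> carrier (E i)" "v \<in> carrier (E i)"
  shows "\<delta> i (u \<oplus>\<^bsub>E i\<^esub> v) = \<delta> i u \<oplus>\<^bsub>E (Suc i mod n)\<^esub> \<delta> i v"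
    "\<delta> i (c \<odot>\<^bsub>E i\<^esub> u) = c \<odot>\<^bsub>E (Suc i mod n)\<^esub> \<delta> i u"
  using delta_hom[OF assms(1)] assms(2,3) by (auto simp: LinearCombinations.module_hom_def)

abbreviation tth where "tth \<equiv> cyc_path n \<delta> 0"

lemma tth_bij: "bij_betw (tth k) (carrier (E 0)) (carrier (E (k mod n)))"
  using cyc_path_bij[of n \<delta> "\<lambda>i. carrier (E i)" 0 k] delta_bij n0 by simp

lemma tth_closed: "v \<in> carrier (E 0) \<Longrightarrow> tth k v \<in> carrier (E (k mod n))"
  using tth_bij[of k] by (auto simp: bij_betw_def)

lemma tth_hom:
  assumes "u \<in> carrier (E 0)" "v \<in> carrier (E 0)"
  shows "tth k (u \<oplus>\<^bsub>E 0\<^esub> v) = tth k u \<oplus>\<^bsub>E (k mod n)\<^esub> tth k v"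
    "tth k (c \<odot>\<^bsub>E 0\<^esub> u) = c \<odot>\<^bsub>E (k mod n)\<^esub> tth k u"
proof -
  have k: "k mod n < n" for k using n0 by simp
  show "tth k (u \<oplus>\<^bsub>E 0\<^esub> v) = tth k u \<oplus>\<^bsub>E (k mod n)\<^esub> tth k v"
    by (induction k) (simp_all add: n0 mod_Suc_eq delta_lin(1)[OF k tth_closed[OF assms(1)] tth_closed[OF assms(2)]])
  show "tth k (c \<odot>\<^bsub>E 0\<^esub> u) = c \<odot>\<^bsub>E (k mod n)\<^esub> tth k u"
    by (induction k) (simp_all add: n0 mod_Suc_eq delta_lin(2)[OF k tth_closed[OF assms(1)] tth_closed[OF assms(1)]])
qed

lemma tth_equivariant:
  assumes "g \<in> carrier (G 0)" "v \<in> carrier (E 0)"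
  shows "tth k (r 0 g v) = r (k mod n) (qth k g) (tth k v)"
proof (induction k)
  case 0
  then show ?case by simp
next
  case (Suc k)
  have "k mod n < n" using n0 by simp
  from \<delta>_equivariant[OF this qth_closed[OF assms(1)] tth_closed[OF assms(2)]]
  show ?case using Suc by (simp add: mod_Suc_eq)
qed

abbreviation D where "D \<equiv> (\<Pi>\<^sub>E i\<in>{..<n}. carrier (E i))"
abbreviation F where "F \<equiv> multilinear_forms {..<n} E"

text \<open>
  The actions of \<open>G\<close> and of its extension on tuples, whose push-forwards are the actions on the tensor product.
  Being maps of tuples, they can be compared pointwise.
\<close>
definition rE :: "(nat \<Rightarrow> 'g) \<Rightarrow> (nat \<Rightarrow> 'e) \<Rightarrow> nat \<Rightarrow> 'e" where
  "rE g = (\<lambda>v. \<lambda>i\<in>{..<n}. r i (g i) (v i))"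

definition exE :: "(nat \<Rightarrow> 'g) \<times> ((nat \<Rightarrow> 'g) \<Rightarrow> nat \<Rightarrow> 'g) \<Rightarrow> (nat \<Rightarrow> 'e) \<Rightarrow> nat \<Rightarrow> 'e" where
  "exE = ext_act Gp Phi rE (cyc_shift n \<delta>)"

lemma F_subspace: "fun_subspace D F"
  by (rule fun_subspace_multilinear) (simp add: E_closed)

lemma F_ext: "F \<subseteq> D \<rightarrow>\<^sub>E UNIV"
  using F_subspace by (simp add: fun_subspace_def)

lemma Gp_comp: "g \<in> carrier Gp \<Longrightarrow> i < n \<Longrightarrow> g i \<in> carrier (G i)"
  by (auto simp: PiE_iff)

lemma rE_admissible: "g \<in> carrier Gp \<Longrightarrow> admissible D F (rE g)"
  unfolding rE_def by (rule admissible_factorwise) (simp_all add: E_closed r_hom Gp_comp del: carrier_product_group)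

lemma shift_admissible: "admissible D F (cyc_shift n \<delta>)"
  by (rule admissible_cyc_shift) (simp_all add: E_closed delta_hom)

lemma rE_D: "g \<in> carrier Gp \<Longrightarrow> rE g \<in> D \<rightarrow> D"
  using rE_admissible by (simp add: admissible_def del: carrier_product_group)

lemma shift_D: "cyc_shift n \<delta> \<in> D \<rightarrow> D"
  using shift_admissible by (simp add: admissible_def)

lemma rE_mult:
  assumes "g \<in> carrier Gp" "h \<in> carrier Gp" "v \<in> D"
  shows "rE (g \<otimes>\<^bsub>Gp\<^esub> h) v = rE g (rE h v)"
  unfolding rE_def
proof (rule restrict_ext)
  fix i assume "i \<in> {..<n}"
  then have i: "i < n" by simp
  show "r i ((g \<otimes>\<^bsub>Gp\<^esub> h) i) (v i) = r i (g i) ((\<lambda>i\<in>{..<n}. r i (h i) (v i)) i)"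
    using group_module.act_mult[OF E_module[OF i] Gp_comp[OF assms(1) i] Gp_comp[OF assms(2) i] PiE_mem[OF assms(3)]] i
    by simp
qed

lemma shift_rE:
  assumes h: "h \<in> carrier Gp" and v: "v \<in> D"
  shows "cyc_shift n \<delta> (rE h v) = rE (Phi h) (cyc_shift n \<delta> v)"
proof
  fix k
  show "cyc_shift n \<delta> (rE h v) k = rE (Phi h) (cyc_shift n \<delta> v) k"
  proof (cases "k < n")
    case True
    let ?i = "cyc_pred n k"
    have i: "?i < n" by (rule cyc_pred_less[OF True])
    have "\<delta> ?i (r ?i (h ?i) (v ?i)) = r (Suc ?i mod n) (\<phi> ?i (h ?i)) (\<delta> ?i (v ?i))"
      by (rule \<delta>_equivariant[OF i Gp_comp[OF h i] PiE_mem[OF v]]) (use i in simp)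
    then show ?thesis using True i h
      by (simp add: cyc_shift_def rE_def cyc_aut_def Suc_cyc_pred[OF True] del: carrier_product_group)
  qed (simp add: cyc_shift_def rE_def)
qed

text \<open>
  If \<open>\<phi>\<^sup>k = 1\<close>, then \<open>k = n * m\<close> and \<open>\<psi>\<^sub>j\<^sup>m = 1\<close> for all loops, so \<open>\<alpha>\<^sub>j\<^sup>m = 1\<close>.
\<close>
lemma shift_order:
  assumes "Phi [^]\<^bsub>AutoGroup Gp\<^esub> k = \<one>\<^bsub>AutoGroup Gp\<^esub>" and v: "v \<in> D"
  shows "(cyc_shift n \<delta> ^^ k) v = v"
proof -
  obtain m where m: "k = n * m" "\<And>j x. j < n \<Longrightarrow> x \<in> carrier (G j) \<Longrightarrow> (cyc_loop n \<phi> j ^^ m) x = x"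
    using Phi_pow_id[OF assms(1)] by blast
  have "(cyc_loop n \<delta> j ^^ m) x = x" if j: "j < n" and x: "x \<in> carrier (E j)" for j x
  proof -
    have "loop_aut n G \<phi> j [^]\<^bsub>AutoGroup (G j)\<^esub> m = \<one>\<^bsub>AutoGroup (G j)\<^esub>"
      using loop_aut_pow_one[OF j] m(2)[OF j] by blast
    from finite_aut.extends_by_order[OF loop_finite_aut[OF j] \<alpha>_extends[OF j] this x] show ?thesis .
  qed
  then show ?thesis unfolding m(1)
    using cyc_shift_funpow_id[where D="\<lambda>i. carrier (E i)", OF delta_closed v] by blast
qed

lemma exE_mult:
  "x \<in> carrier Gt \<Longrightarrow> y \<in> carrier Gt \<Longrightarrow> v \<in> D \<Longrightarrow> exE (x \<otimes>\<^bsub>Gt\<^esub> y) v = exE x (exE y v)"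
  unfolding exE_def
  by (rule P.ext_act_mult[where D=D, OF rE_D rE_mult shift_D shift_rE shift_order])

lemma exE_eq: "exE (g, a) = rE g \<circ> (cyc_shift n \<delta> ^^ P.ex a)"
  by (auto simp: exE_def P.ext_act_eq)

lemma exE_admissible: "x \<in> carrier Gt \<Longrightarrow> admissible D F (exE x)"
  unfolding P.semidirect_carrier
  by (cases x) (simp add: exE_eq admissible_comp admissible_funpow F_ext shift_admissible rE_admissible del: carrier_product_group)

lemma exE_base: "exE (g, \<one>\<^bsub>AutoGroup Gp\<^esub>) = rE g"
  by (rule ext) (simp only: exE_def P.ext_act_base)

text \<open>
  The tuple behind the pure tensor of the basis vectors \<open>w (x i)\<close>, transported to \<open>E i\<close> by \<open>\<delta>\<close>.
\<close>
definition ebas :: "('x \<Rightarrow> 'e) \<Rightarrow> (nat \<Rightarrow> 'x) \<Rightarrow> nat \<Rightarrow> 'e" where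
  "ebas w = (\<lambda>x. \<lambda>i\<in>{..<n}. tth i (w (x i)))"

definition ecoord :: "('x \<Rightarrow> 'e \<Rightarrow> 'k) \<Rightarrow> (nat \<Rightarrow> 'x) \<Rightarrow> (nat \<Rightarrow> 'e) \<Rightarrow> 'k" where
  "ecoord e = tensor_form {..<n} E (\<lambda>i x v. e x (inv_into (carrier (E 0)) (tth i) v))"

lemma E_lin_system:
  assumes "lin_system (E 0) X w e" "i < n"
  shows "lin_system (E i) X (\<lambda>x. tth i (w x)) (\<lambda>x v. e x (inv_into (carrier (E 0)) (tth i) v))"
  by (rule lin_system_iso[OF assms(1) E_closed[OF n0]]) (use tth_bij[of i] assms(2) tth_hom[where k=i] in auto)

lemma E_system:
  assumes "lin_system (E 0) X w e"
  shows "dual_system D F ({..<n} \<rightarrow>\<^sub>E X) (ebas w) (ecoord e)"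
  unfolding ebas_def ecoord_def
  by (rule tensor_system) (use E_lin_system[OF assms] E_closed in auto)

lemma character_tensor:
  assumes ls: "lin_system (E 0) X w e"
  shows "\<chi> = (\<lambda>g\<in>carrier Gp. mtrace ({..<n} \<rightarrow>\<^sub>E X) (smat ({..<n} \<rightarrow>\<^sub>E X) (ebas w) (ecoord e) (rE g)))"
  unfolding E_affords character_def tensor_def
proof (rule restrict_ext)
  fix g assume g: "g \<in> carrier Gp"
  show "endo_trace (dual_space (form_space D F)) (tensor_act {..<n} E r g)
     = mtrace ({..<n} \<rightarrow>\<^sub>E X) (smat ({..<n} \<rightarrow>\<^sub>E X) (ebas w) (ecoord e) (rE g))"
    by (rule endo_trace_push[OF F_subspace E_system[OF ls] rE_admissible[OF g]]) (simp add: tensor_act_def rE_def)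
qed

lemma b_preferred_ext_eq:
  assumes ls: "lin_system (E 0) X w e"
  shows "b_preferred_ext n G \<phi> E r \<delta>
    = (\<lambda>x\<in>carrier Gt. mtrace ({..<n} \<rightarrow>\<^sub>E X) (smat ({..<n} \<rightarrow>\<^sub>E X) (ebas w) (ecoord e) (exE x)))"
  unfolding b_preferred_ext_def Let_def character_def tensor_def
proof (rule restrict_ext)
  fix x assume x: "x \<in> carrier Gt"
  obtain g a where ga: "x = (g, a)" by (cases x)
  have g: "g \<in> carrier Gp" using x by (simp add: ga P.semidirect_carrier)
  show "endo_trace (dual_space (form_space D F)) (ext_act Gp Phi (tensor_act {..<n} E r) (push D F (cyc_shift n \<delta>)) x)
     = mtrace ({..<n} \<rightarrow>\<^sub>E X) (smat ({..<n} \<rightarrow>\<^sub>E X) (ebas w) (ecoord e) (exE x))"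
  proof (rule endo_trace_push[OF F_subspace E_system[OF ls] exE_admissible[OF x]])
    fix s assume s: "s \<in> carrier (dual_space (form_space D F))"
    have "ext_act Gp Phi (tensor_act {..<n} E r) (push D F (cyc_shift n \<delta>)) x s
        = push D F (rE g) ((push D F (cyc_shift n \<delta>) ^^ P.ex a) s)"
      by (simp add: ga P.ext_act_eq tensor_act_def rE_def)
    also have "\<dots> = push D F (rE g) (push D F (cyc_shift n \<delta> ^^ P.ex a) s)"
      by (simp only: push_funpow[OF F_subspace shift_admissible s])
    also have "\<dots> = push D F (exE x) s"
      unfolding ga exE_eq
      by (rule push_comp) (use rE_admissible[OF g] funpow_mem[OF shift_D] in \<open>auto simp: admissible_def\<close>)
    finally show "ext_act Gp Phi (tensor_act {..<n} E r) (push D F (cyc_shift n \<delta>)) x s = push D F (exE x) s" .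
  qed
qed

lemma ecoord_eq:
  "v \<in> D \<Longrightarrow> ecoord e y v = (\<Prod>i<n. e (y i) (inv_into (carrier (E 0)) (tth i) (v i)))"
  by (simp add: ecoord_def tensor_form_def)

lemma ebas_D:
  assumes "lin_system (E 0) X w e" "x \<in> {..<n} \<rightarrow>\<^sub>E X"
  shows "ebas w x \<in> D"
  using E_system[OF assms(1)] assms(2) by (auto simp: dual_system_def)

lemma smat_E_act:
  assumes ls: "lin_system (E 0) X w e" and g: "g \<in> carrier Gp"
  shows "smat ({..<n} \<rightarrow>\<^sub>E X) (ebas w) (ecoord e) (rE g)
    = emon n X id (\<lambda>j. smat X w e (r 0 (pull g j)))"
proof (intro ext)
  fix y x
  show "smat ({..<n} \<rightarrow>\<^sub>E X) (ebas w) (ecoord e) (rE g) y x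
    = emon n X id (\<lambda>j. smat X w e (r 0 (pull g j))) y x"
  proof (cases "y \<in> {..<n} \<rightarrow>\<^sub>E X \<and> x \<in> {..<n} \<rightarrow>\<^sub>E X")
    case True
    have wx: "w (x i) \<in> carrier (E 0)" if "i < n" for i
    proof -
      have "x i \<in> X" by (rule PiE_mem[of x "{..<n}" "\<lambda>_. X"]) (use True that in auto)
      then show ?thesis using ls by (auto simp: dual_system_def)
    qed
    have "rE g (ebas w x) \<in> D" using rE_D[OF g] ebas_D[OF ls] True by blast
    then have "ecoord e y (rE g (ebas w x))
       = (\<Prod>i<n. e (y i) (inv_into (carrier (E 0)) (tth i) (rE g (ebas w x) i)))" by (rule ecoord_eq)
    also have "\<dots> = (\<Prod>i<n. smat X w e (r 0 (pull g i)) (y i) (x i))"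
    proof (intro prod.cong refl)
      fix i assume "i \<in> {..<n}"
      then have i: "i < n" by simp
      have "rE g (ebas w x) i = r i (g i) (tth i (w (x i)))" using i by (simp add: rE_def ebas_def)
      also have "\<dots> = tth i (r 0 (pull g i) (w (x i)))"
        using tth_equivariant[OF pull(1)[OF g i] wx[OF i], of i] pull(2)[OF g i] i by simp
      finally have "inv_into (carrier (E 0)) (tth i) (rE g (ebas w x) i) = r 0 (pull g i) (w (x i))"
        using inv_into_bij(1)[OF tth_bij r_closed[OF n0 pull(1)[OF g i] wx[OF i]]] by simp
      moreover have "y i \<in> X" "x i \<in> X" using True i by (auto simp: PiE_iff)
      ultimately show "e (y i) (inv_into (carrier (E 0)) (tth i) (rE g (ebas w x) i)) = smat X w e (r 0 (pull g i)) (y i) (x i)"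
        by (simp add: smat_def)
    qed
    finally show ?thesis using True by (simp add: smat_def[of "{..<n} \<rightarrow>\<^sub>E X"] emon_def)
  next
    case False
    then show ?thesis unfolding smat_def[of "{..<n} \<rightarrow>\<^sub>E X"] emon_def by (simp only: if_False)
  qed
qed

lemma smat_E_shift:
  assumes ls: "lin_system (E 0) X w e"
    and dual: "\<And>c d. c \<in> X \<Longrightarrow> d \<in> X \<Longrightarrow> e c (w d) = (if c = d then 1 else 0)"
  shows "smat ({..<n} \<rightarrow>\<^sub>E X) (ebas w) (ecoord e) (cyc_shift n \<delta>)
    = emon n X (cyc_succ n) (\<lambda>j. if Suc j < n then id_mat X else smat X w e (cyc_loop n \<delta> 0))"
proof (intro ext)
  fix y x
  let ?a = "\<lambda>j. if Suc j < n then id_mat X else smat X w e (cyc_loop n \<delta> 0)"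
  show "smat ({..<n} \<rightarrow>\<^sub>E X) (ebas w) (ecoord e) (cyc_shift n \<delta>) y x = emon n X (cyc_succ n) ?a y x"
  proof (cases "y \<in> {..<n} \<rightarrow>\<^sub>E X \<and> x \<in> {..<n} \<rightarrow>\<^sub>E X")
    case True
    have xX: "x i \<in> X" and yX: "y i \<in> X" if "i < n" for i
      using True that by (auto simp: PiE_iff)
    have wx: "w (x i) \<in> carrier (E 0)" if "i < n" for i using ls xX[OF that] by (auto simp: dual_system_def)
    let ?v = "cyc_shift n \<delta> (ebas w x)"
    have "?v \<in> D" using shift_D ebas_D[OF ls] True by blast
    then have "ecoord e y ?v = (\<Prod>i<n. e (y i) (inv_into (carrier (E 0)) (tth i) (?v i)))" by (rule ecoord_eq)
    also have "\<dots> = (\<Prod>j<n. e (y (cyc_succ n j)) (inv_into (carrier (E 0)) (tth (cyc_succ n j)) (?v (cyc_succ n j))))"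
      by (rule prod_comp_permutes[OF cyc_succ_permutes, symmetric])
    also have "\<dots> = (\<Prod>j<n. ?a j (y (cyc_succ n j)) (x j))"
    proof (intro prod.cong refl)
      fix j assume "j \<in> {..<n}"
      then have j: "j < n" by simp
      have s: "cyc_succ n j < n" using j by (simp add: cyc_succ_def)
      have "?v (cyc_succ n j) = \<delta> j (tth j (w (x j)))"
        using j cyc_shift_Suc[OF j, of \<delta> "ebas w x"] by (simp add: cyc_succ_def ebas_def)
      also have "\<dots> = tth (Suc j) (w (x j))" using j by simp
      finally have v: "?v (cyc_succ n j) = tth (Suc j) (w (x j))" .
      show "e (y (cyc_succ n j)) (inv_into (carrier (E 0)) (tth (cyc_succ n j)) (?v (cyc_succ n j))) = ?a j (y (cyc_succ n j)) (x j)"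
      proof (cases "Suc j < n")
        case True
        then have "cyc_succ n j = Suc j" using j by (simp add: cyc_succ_def)
        then show ?thesis
          using v inv_into_bij(1)[OF tth_bij wx[OF j], of "Suc j"] dual[OF yX[OF s] xX[OF j]] yX[OF s] True
          by (simp add: id_mat_def)
      next
        case False
        then have n: "Suc j = n" using j by simp
        then have n2: "cyc_succ n j = 0" using j by (simp add: cyc_succ_def)
        have "tth (Suc j) (w (x j)) = tth 0 (cyc_loop n \<delta> 0 (w (x j)))" unfolding n by (simp add: cyc_loop_def)
        moreover have "cyc_loop n \<delta> 0 (w (x j)) \<in> carrier (E 0)"
          using tth_closed[OF wx[OF j], of n] by (simp add: cyc_loop_def)
        ultimately show ?thesis
          using v inv_into_bij(1)[OF tth_bij, of _ 0] yX[OF s] xX[OF j] False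
          by (simp only: n2 smat_def if_False if_True simp_thms)
      qed
    qed
    finally show ?thesis using True by (simp add: smat_def[of "{..<n} \<rightarrow>\<^sub>E X"] emon_def)
  next
    case False
    then show ?thesis unfolding smat_def[of "{..<n} \<rightarrow>\<^sub>E X"] emon_def by (simp only: if_False)
  qed
qed

end

section \<open>Bases of both modules\<close>
lemma vmon_cong: "(\<And>j. j < n \<Longrightarrow> N j = N' j) \<Longrightarrow> vmon n C s N = vmon n C s N'"
  by (auto simp: vmon_def fun_eq_iff)

lemma emon_cong: "(\<And>j. j < n \<Longrightarrow> a j = a' j) \<Longrightarrow> emon n X s a = emon n X s a'"
  unfolding emon_def by (intro ext if_cong refl prod.cong) auto

lemma emon_id: "finite X \<Longrightarrow> emon n X id (\<lambda>j. id_mat X) = id_mat ({..<n} \<rightarrow>\<^sub>E X)"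
proof (intro ext)
  fix y x
  show "emon n X id (\<lambda>j. id_mat X) y x = (id_mat ({..<n} \<rightarrow>\<^sub>E X) y x :: 'b)"
  proof (cases "y \<in> {..<n} \<rightarrow>\<^sub>E X \<and> x \<in> {..<n} \<rightarrow>\<^sub>E X")
    case True
    then have "(\<Prod>j<n. id_mat X (y (id j)) (x j)) = (if y = x then 1 else (0::'b))"
      using prod_id_mat[of "{..<n}" y X x] by simp
    then show ?thesis using True unfolding emon_def id_mat_def[of "{..<n} \<rightarrow>\<^sub>E X"] by simp
  next
    case False
    then have "\<not> (y = x \<and> y \<in> {..<n} \<rightarrow>\<^sub>E X)" by blast
    then show ?thesis using False unfolding emon_def id_mat_def[of "{..<n} \<rightarrow>\<^sub>E X"] by (simp only: if_False)
  qed
qed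

context preferred
begin

interpretation V: group_module Gp V \<rho> by (rule V_module)

lemma W0_vectorspace: "vectorspace class_ring W0"
  unfolding vectorspace_def using W_mod[OF n0] class_field by auto

text \<open>
  Linear independence is inherited by \<open>V\<close>, which is finite dimensional.
\<close>
lemma finite_B0: "finite (B 0)"
proof -
  interpret W0: vectorspace class_ring W0 by (rule W0_vectorspace)
  have b: "W0.basis (B 0)" by (rule B_basis[OF n0])
  then have sub: "B 0 \<subseteq> Vs 0" and li: "\<not> LinearCombinations.module.lin_dep class_ring W0 (B 0)"
    by (simp_all add: W0.basis_def)
  have "\<not> LinearCombinations.module.lin_dep class_ring V (B 0)"
    using li V.span_li_not_depend(2)[OF sub Vs_subspace[OF n0]] by simp
  moreover have "B 0 \<subseteq> carrier V" using sub Vs_sub[OF n0] by (rule subset_trans)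
  ultimately show ?thesis by (rule V.fin_dim_li_fin[OF V.fin_dim])
qed

end

text \<open>
  The duality makes the matrices of the unit elements identity matrices.
\<close>
locale preferred_bases = preferred +
  fixes C e0 X e
  assumes lsV: "lin_system W0 C (\<lambda>b. b) e0"
    and dualV: "\<And>c d. c \<in> C \<Longrightarrow> d \<in> C \<Longrightarrow> e0 c d = (if c = d then 1 else 0)"
    and lsE: "lin_system (E 0) X (\<lambda>b. b) e"
    and dualE: "\<And>c d. c \<in> X \<Longrightarrow> d \<in> X \<Longrightarrow> e c d = (if c = d then 1 else 0)"
begin

interpretation V: group_module Gp V \<rho> by (rule V_module)

lemma finite_C: "finite C" and finite_X: "finite X"
  using lsV lsE by (auto simp: dual_system_def)

abbreviation J where "J \<equiv> {..<n} \<times> C"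
abbreviation Y where "Y \<equiv> {..<n} \<rightarrow>\<^sub>E X"
abbreviation VB where "VB \<equiv> vbas (\<lambda>b. b)"
abbreviation VC where "VC \<equiv> vcoord e0"
abbreviation EB where "EB \<equiv> ebas (\<lambda>b. b)"
abbreviation EC where "EC \<equiv> ecoord e"
abbreviation iota where "iota g \<equiv> (g, \<one>\<^bsub>AutoGroup Gp\<^esub>)"
abbreviation exV where "exV \<equiv> ext_act Gp Phi \<rho> \<sigma>"

text \<open>
  \<open>M\<close> and \<open>S\<close> are the representations of the semidirect product on \<open>V\<close> and on \<open>E\<close>. Below, \<open>m0\<close> and
  \<open>r0\<close> are those of \<open>G 0\<close> on \<open>Vs 0\<close> and \<open>E 0\<close>, and \<open>Mt0\<close> and \<open>St0\<close> are their extensions by \<open>\<tau>\<^sub>0\<close> and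
  \<open>\<alpha>\<^sub>0\<close>.
\<close>
definition M where "M x = smat J VB VC (exV x)"
definition S where "S x = smat Y EB EC (exE x)"

lemma finite_J: "finite J" and finite_Y: "finite Y"
  using finite_C finite_X by (auto intro: finite_PiE)

lemma VLS: "lin_system V J VB VC" by (rule V_lin_system[OF lsV])

lemma ELS: "dual_system D F Y EB EC" by (rule E_system[OF lsE])

lemma exV_module: "group_module Gt V exV"
  using \<sigma>_extends by (simp add: extends_by_def)

lemma M_rep: "mat_rep Gt J M" and M_one: "M \<one>\<^bsub>Gt\<^esub> = id_mat J"
  unfolding M_def using group_module_mat_rep[OF exV_module VLS] vcoord_vbas[OF lsV dualV] by simp_all

lemma M_iota: "M (iota g) = smat J VB VC (\<rho> g)"
proof -
  have "exV (iota g) = \<rho> g" by (rule ext) (rule P.ext_act_base)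
  then show ?thesis by (simp add: M_def)
qed

lemma S_iota: "S (iota g) = smat Y EB EC (rE g)"
  by (simp only: S_def exE_base)

lemma S_rep: "mat_rep Gt Y S"
  unfolding mat_rep_def
proof (intro conjI ballI)
  fix x y assume xy: "x \<in> carrier Gt" "y \<in> carrier Gt"
  have "EB \<in> Y \<rightarrow> D" using ELS by (simp add: dual_system_def)
  then have "S (x \<otimes>\<^bsub>Gt\<^esub> y) = smat Y EB EC (exE x \<circ> exE y)"
    unfolding S_def by (rule smat_cong) (simp add: exE_mult xy)
  also have "\<dots> = mmul Y (S x) (S y)"
    unfolding S_def by (rule smat_mult[OF ELS exE_admissible[OF xy(1)] exE_admissible[OF xy(2)]])
  finally show "S (x \<otimes>\<^bsub>Gt\<^esub> y) = mmul Y (S x) (S y)" .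
qed (simp_all only: finite_Y S_def supp_in_smat)

lemma G0: "group (G 0)" by (rule group_factor[OF n0])

lemma one_G0: "\<one>\<^bsub>G 0\<^esub> \<in> carrier (G 0)"
  using G0 by (simp add: group.is_monoid)

lemma emb0_module: "group_module (G 0) W0 (\<lambda>g. \<rho> (emb 0 g))"
proof -
  interpret G0: group "G 0" by (rule G0)
  interpret W: Module.module class_ring W0 by (rule W_mod[OF n0])
  have one: "emb 0 \<one>\<^bsub>G 0\<^esub> = \<one>\<^bsub>Gp\<^esub>" by (auto simp: factor_emb_def fun_eq_iff)
  show ?thesis
  proof (intro group_module.intro G0 W0_vectorspace group_module_axioms.intro)
    show "vectorspace.fin_dim class_ring W0"
    proof -
      interpret W0: vectorspace class_ring W0 by (rule W0_vectorspace)
      show ?thesis using finite_B0 B_basis[OF n0] unfolding W0.fin_dim_def W0.basis_def by blast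
    qed
    show "\<rho> (emb 0 g) \<in> module_hom class_ring W0 W0" if g: "g \<in> carrier (G 0)" for g
      using V.act_hom[OF emb_closed[OF n0 g]] Vs_invariant[OF n0 g] Vs_V[OF n0]
      by (auto simp: LinearCombinations.module_hom_def)
    show "\<rho> (emb 0 \<one>\<^bsub>G 0\<^esub>) v = v" if "v \<in> carrier W0" for v
      unfolding one by (rule V.act_one[OF Vs_V[OF n0]]) (use that in simp)
    show "\<rho> (emb 0 (g \<otimes>\<^bsub>G 0\<^esub> h)) v = \<rho> (emb 0 g) (\<rho> (emb 0 h) v)"
      if gh: "g \<in> carrier (G 0)" "h \<in> carrier (G 0)" and v: "v \<in> carrier W0" for g h v
    proof -
      have "v \<in> carrier V" using v Vs_V[OF n0] by simp
      from V.act_mult[OF emb_closed[OF n0 gh(1)] emb_closed[OF n0 gh(2)] this]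
      show ?thesis by (simp only: emb_mult[OF n0 gh])
    qed
  qed
qed

definition m0 where "m0 g = smat C (\<lambda>b. b) e0 (\<rho> (emb 0 g))"
definition r0 where "r0 g = smat X (\<lambda>b. b) e (r 0 g)"

lemma m0_rep: "mat_rep (G 0) C m0" "m0 \<one>\<^bsub>G 0\<^esub> = id_mat C"
  unfolding m0_def by (rule group_module_mat_rep[OF emb0_module lsV], simp add: dualV)+

lemma r0_rep: "mat_rep (G 0) X r0" "r0 \<one>\<^bsub>G 0\<^esub> = id_mat X"
  "character (G 0) (E 0) (r 0) = (\<lambda>g\<in>carrier (G 0). mtrace X (r0 g))"
  unfolding r0_def by (rule group_module_mat_rep[OF E_module[OF n0] lsE], simp add: dualE)+

lemma M_iota_eq: "g \<in> carrier Gp \<Longrightarrow> M (iota g) = vmon n C id (\<lambda>j. m0 (pull g j))"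
  unfolding M_iota m0_def by (rule smat_act[OF lsV])

lemma S_iota_eq: "g \<in> carrier Gp \<Longrightarrow> S (iota g) = emon n X id (\<lambda>j. r0 (pull g j))"
  unfolding S_iota r0_def by (rule smat_E_act[OF lsE])

lemma pull_emb:
  assumes i: "i < n" and j: "j < n" and g: "g \<in> carrier (G 0)"
  shows "pull (emb i (qth i g)) j = (if j = i then g else \<one>\<^bsub>G 0\<^esub>)"
proof (cases "j = i")
  case True
  then show ?thesis using inv_into_bij(1)[OF qth_bij g, of i] i by (simp add: pull_def factor_emb_def)
next
  case False
  have "inv_into (carrier (G 0)) (qth j) \<one>\<^bsub>G j\<^esub> = \<one>\<^bsub>G 0\<^esub>"
    using inv_into_bij(1)[OF qth_bij one_G0, of j] qth_one[of j] j by simp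
  then show ?thesis using False j by (simp add: pull_def factor_emb_def)
qed

lemma S_one: "S \<one>\<^bsub>Gt\<^esub> = id_mat Y"
proof -
  have q: "emb 0 (qth 0 \<one>\<^bsub>G 0\<^esub>) = \<one>\<^bsub>Gp\<^esub>" by (auto simp: factor_emb_def fun_eq_iff)
  have one: "\<one>\<^bsub>Gp\<^esub> \<in> carrier Gp" by (rule P.one_closed)
  have "S \<one>\<^bsub>Gt\<^esub> = emon n X id (\<lambda>j. r0 (pull \<one>\<^bsub>Gp\<^esub> j))"
    unfolding P.semidirect_one by (rule S_iota_eq[OF one])
  also have "\<dots> = emon n X id (\<lambda>j. id_mat X)"
    by (rule emon_cong) (simp only: q[symmetric] pull_emb[OF n0 _ one_G0] if_cancel r0_rep(2))
  also have "\<dots> = id_mat Y" by (rule emon_id[OF finite_X])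
  finally show ?thesis .
qed

lemma iota_mult: "g \<in> carrier Gp \<Longrightarrow> h \<in> carrier Gp \<Longrightarrow> iota g \<otimes>\<^bsub>Gt\<^esub> iota h = iota (g \<otimes>\<^bsub>Gp\<^esub> h)"
proof -
  assume g: "g \<in> carrier Gp" and h: "h \<in> carrier Gp"
  interpret A: group "AutoGroup Gp" by (rule P.AutoGroup)
  have "\<one>\<^bsub>AutoGroup Gp\<^esub> h = h" using h by (simp only: P.aut_one restrict_apply' if_True)
  then show ?thesis by (simp only: P.semidirect_mult A.l_one A.one_closed)
qed

lemma iota_closed: "g \<in> carrier Gp \<Longrightarrow> iota g \<in> carrier Gt"
  by (rule P.base_in_semidirect)

lemma rep_restrict: "mat_rep Gt Z T \<Longrightarrow> mat_rep Gp Z (\<lambda>g. T (iota g))"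
proof -
  assume T: "mat_rep Gt Z T"
  then have T': "finite Z" "\<And>x. x \<in> carrier Gt \<Longrightarrow> supp_in Z Z (T x)"
    "\<And>x y. x \<in> carrier Gt \<Longrightarrow> y \<in> carrier Gt \<Longrightarrow> T (x \<otimes>\<^bsub>Gt\<^esub> y) = mmul Z (T x) (T y)"
    unfolding mat_rep_def by blast+
  show ?thesis
    unfolding mat_rep_def
  proof (intro conjI ballI T'(1) T'(2) iota_closed)
    fix g h assume g: "g \<in> carrier Gp" and h: "h \<in> carrier Gp"
    from T'(3)[OF iota_closed[OF g] iota_closed[OF h]]
    show "T (iota (g \<otimes>\<^bsub>Gp\<^esub> h)) = mmul Z (T (iota g)) (T (iota h))" unfolding iota_mult[OF g h] .
  qed
qed

lemma intertwiner_restrict: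
  "intertwiner Gt Z T X' R A \<Longrightarrow> intertwiner Gp Z (\<lambda>g. T (iota g)) X' (\<lambda>g. R (iota g)) A"
  unfolding intertwiner_def P.semidirect_one
  by (elim conjE, intro conjI ballI) (assumption, assumption, rule bspec, assumption, rule iota_closed)

lemma chi_eq: "g \<in> carrier Gp \<Longrightarrow> \<chi> g = mtrace Y (S (iota g))"
  by (subst character_tensor[OF lsE]) (simp only: S_iota restrict_apply' if_True)

lemma V_closed: "lin_closed V" by (rule lin_closed_module[OF V_mod])

lemma nth_Gp:
  "fps_nth (molien Gp V \<rho> \<chi>) k = multiplicity Gp ({..<k} \<rightarrow>\<^sub>E J) (\<lambda>g. sym_mat k J (M (iota g))) Y (\<lambda>g. S (iota g))"
  unfolding M_iota by (rule molien_nth[OF group_Gp VLS V_closed V.act_hom chi_eq])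

lemma nth_Gt:
  assumes "\<And>x. x \<in> carrier Gt \<Longrightarrow> \<psi> x = mtrace Z (R x)"
  shows "fps_nth (molien Gt V exV \<psi>) k = multiplicity Gt ({..<k} \<rightarrow>\<^sub>E J) (\<lambda>x. sym_mat k J (M x)) Z R"
  unfolding M_def by (rule molien_nth[OF group_Gt VLS V_closed group_module.act_hom[OF exV_module] assms])

lemma nth_G0:
  "fps_nth (molien (G 0) W0 (\<lambda>g. \<rho> (emb 0 g)) (character (G 0) (E 0) (r 0))) k
    = multiplicity (G 0) ({..<k} \<rightarrow>\<^sub>E C) (\<lambda>g. sym_mat k C (m0 g)) X r0"
  unfolding m0_def
  by (rule molien_nth[OF G0 lsV W0_closed group_module.act_hom[OF emb0_module]])
    (simp_all only: r0_rep(3) restrict_apply' if_True)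

lemma pair_Gp: "rep_pair Gp ({..<k} \<rightarrow>\<^sub>E J) (\<lambda>g. sym_mat k J (M (iota g))) Y (\<lambda>g. S (iota g))"
  by (intro rep_pair.intro rep_pair_axioms.intro group_Gp finite_Gp mat_rep_sym rep_restrict M_rep S_rep)

lemma pair_Gt: "mat_rep Gt Z R \<Longrightarrow> rep_pair Gt ({..<k} \<rightarrow>\<^sub>E J) (\<lambda>x. sym_mat k J (M x)) Z R"
  by (intro rep_pair.intro rep_pair_axioms.intro group_Gt P.finite_semidirect mat_rep_sym M_rep)

lemma pair_G0: "rep_pair (G 0) ({..<k} \<rightarrow>\<^sub>E C) (\<lambda>g. sym_mat k C (m0 g)) X r0"
  by (intro rep_pair.intro rep_pair_axioms.intro G0 finite_factor[OF n0] mat_rep_sym m0_rep r0_rep)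

section \<open>The two bounds\<close>
text \<open>
  A tensor for \<open>V\<close> and \<open>E\<close> with the nonzero entry \<open>(y0, x0)\<close> restricts to a tensor for each block, of degree the
  number \<open>c i\<close> of positions which \<open>y0\<close> puts into block \<open>i\<close>. It commutes with \<open>G i\<close>, and so with \<open>G 0\<close> after
  transport.
\<close>
lemma lower_bound:
  assumes nz: "multiplicity Gp ({..<k} \<rightarrow>\<^sub>E J) (\<lambda>g. sym_mat k J (M (iota g))) Y (\<lambda>g. S (iota g)) \<noteq> 0"
  obtains c where "(\<Sum>i<n. c i) = k"
    "\<And>i. i < n \<Longrightarrow> multiplicity (G 0) ({..<c i} \<rightarrow>\<^sub>E C) (\<lambda>g. sym_mat (c i) C (m0 g)) X r0 \<noteq> 0"
proof -
  obtain A where A: "intertwiner Gp ({..<k} \<rightarrow>\<^sub>E J) (\<lambda>g. sym_mat k J (M (iota g))) Y (\<lambda>g. S (iota g)) A"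
    "A \<noteq> (\<lambda>_ _. 0)"
    using iffD1[OF rep_pair.multiplicity_nonzero_iff[OF pair_Gp] nz] by (elim exE conjE)
  have sS: "supp_in Y Y (S (iota g))" for g unfolding S_def by (rule supp_in_smat)
  have M1: "M (iota \<one>\<^bsub>Gp\<^esub>) = id_mat J" using M_one unfolding P.semidirect_one .
  have "sym_tensor {..<k} J Y A \<and> (\<forall>g\<in>carrier Gp. ten_comm {..<k} J Y A (M (iota g)) (S (iota g)))"
    by (rule iffD1[OF intertwiner_sym_iff[where M="\<lambda>g. M (iota g)" and H=Gp and R="\<lambda>g. S (iota g)"] A(1)])
      (rule finite_J M1 finite_Y sS)+
  then have st: "sym_tensor {..<k} J Y A"
    and tc: "\<And>g. g \<in> carrier Gp \<Longrightarrow> ten_comm {..<k} J Y A (M (iota g)) (S (iota g))"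
    by blast+
  obtain y0 x0 where yx: "A y0 x0 \<noteq> 0" using A(2) by (metis ext)
  then have y0: "y0 \<in> {..<k} \<rightarrow>\<^sub>E J" using st unfolding sym_tensor_def supp_in_def by blast
  define Kf where "Kf i = {q\<in>{..<k}. fst (y0 q) = i}" for i
  have nz': "multiplicity (G 0) ({..<card (Kf i)} \<rightarrow>\<^sub>E C) (\<lambda>g. sym_mat (card (Kf i)) C (m0 g)) X r0 \<noteq> 0"
    if i: "i < n" for i
  proof -
    obtain A' where A': "sym_tensor (Kf i) C X A'" "A' \<noteq> (\<lambda>_ _. 0)"
      "\<And>N a. ten_comm {..<k} J Y A
         (vmon n C id (\<lambda>j. if j = i then N else id_mat C)) (emon n X id (\<lambda>j. if j = i then a else id_mat X)) \<Longrightarrow>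
         ten_comm (Kf i) C X A' N a"
      by (rule block_restriction[OF finite_lessThan finite_C finite_X st yx i, folded Kf_def]) (rule that)
    have "ten_comm (Kf i) C X A' (m0 g) (r0 g)" if g: "g \<in> carrier (G 0)" for g
    proof (rule A'(3))
      let ?g = "emb i (qth i g)"
      have gc: "?g \<in> carrier Gp" by (rule emb_closed[OF i]) (use qth_closed[OF g, of i] i in simp)
      have "M (iota ?g) = vmon n C id (\<lambda>j. if j = i then m0 g else id_mat C)"
        unfolding M_iota_eq[OF gc] by (rule vmon_cong) (simp add: pull_emb[OF i _ g] m0_rep(2))
      moreover have "S (iota ?g) = emon n X id (\<lambda>j. if j = i then r0 g else id_mat X)"
        unfolding S_iota_eq[OF gc] by (rule emon_cong) (simp add: pull_emb[OF i _ g] r0_rep(2))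
      ultimately show "ten_comm {..<k} J Y A (vmon n C id (\<lambda>j. if j = i then m0 g else id_mat C))
          (emon n X id (\<lambda>j. if j = i then r0 g else id_mat X))"
        using tc[OF gc] by simp
    qed
    note tc' = this
    have "finite (Kf i)" by (simp add: Kf_def)
    from ex_bij_betw_nat_finite[OF this] obtain h where h: "bij_betw h {..<card (Kf i)} (Kf i)"
      unfolding atLeast0LessThan by blast
    obtain A'' where A'': "sym_tensor {..<card (Kf i)} C X A''" "A'' \<noteq> (\<lambda>_ _. 0)"
      "\<And>N a. ten_comm (Kf i) C X A' N a \<Longrightarrow> ten_comm {..<card (Kf i)} C X A'' N a"
      by (rule sym_tensor_reindex[OF h A'(1,2)]) (rule that)
    have sr: "supp_in X X (r0 g)" for g unfolding r0_def by (rule supp_in_smat)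
    have "intertwiner (G 0) ({..<card (Kf i)} \<rightarrow>\<^sub>E C) (\<lambda>g. sym_mat (card (Kf i)) C (m0 g)) X r0 A''"
    proof (rule iffD2[OF intertwiner_sym_iff[where M=m0 and H="G 0" and R=r0]])
      show "sym_tensor {..<card (Kf i)} C X A'' \<and> (\<forall>g\<in>carrier (G 0). ten_comm {..<card (Kf i)} C X A'' (m0 g) (r0 g))"
        by (intro conjI ballI A''(1) A''(3) tc')
    qed (rule finite_C m0_rep(2) finite_X sr)+
    then show ?thesis by (intro iffD2[OF rep_pair.multiplicity_nonzero_iff[OF pair_G0]] exI[of _ A''] conjI A''(2))
  qed
  have "(\<Sum>i<n. card (Kf i)) = k"
  proof -
    have "(\<Sum>i<n. card (Kf i)) = card (\<Union>i\<in>{..<n}. Kf i)"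
      by (rule card_UN_disjoint[symmetric]) (auto simp: Kf_def)
    also have "(\<Union>i\<in>{..<n}. Kf i) = {..<k}"
    proof
      show "{..<k} \<subseteq> (\<Union>i\<in>{..<n}. Kf i)"
      proof
        fix q assume q: "q \<in> {..<k}"
        have "y0 q \<in> J" by (rule PiE_mem[OF y0 q])
        then have "fst (y0 q) \<in> {..<n}" by (rule mem_Times_iff[THEN iffD1, THEN conjunct1])
        moreover have "q \<in> Kf (fst (y0 q))" using q by (simp only: Kf_def mem_Collect_eq simp_thms)
        ultimately show "q \<in> (\<Union>i\<in>{..<n}. Kf i)" by (rule UN_I)
      qed
    qed (auto simp: Kf_def)
    finally show ?thesis by simp
  qed
  from that[of "\<lambda>i. card (Kf i)", OF this nz'] show ?thesis .
qed

abbreviation psi0 where "psi0 \<equiv> loop_aut n G \<phi> 0"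
abbreviation Gt0 where "Gt0 \<equiv> semidirect (G 0) psi0"
abbreviation exV0 where "exV0 \<equiv> ext_act (G 0) psi0 (\<lambda>g. \<rho> (emb 0 g)) (cyc_loop n \<sigma>s 0)"
abbreviation exE0 where "exE0 \<equiv> ext_act (G 0) psi0 (r 0) (cyc_loop n \<delta> 0)"

definition Mt0 where "Mt0 x = smat C (\<lambda>b. b) e0 (exV0 x)"
definition St0 where "St0 x = smat X (\<lambda>b. b) e (exE0 x)"

interpretation L: finite_aut "G 0" psi0 by (rule loop_finite_aut[OF n0])

lemma exE0_module: "group_module Gt0 (E 0) exE0"
  using \<alpha>_extends[OF n0] by (simp add: extends_by_def)

lemma group_Gt0: "group Gt0"
  using exE0_module by (simp add: group_module_def)

lemma St0_rep: "mat_rep Gt0 X St0" "St0 \<one>\<^bsub>Gt0\<^esub> = id_mat X"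
  "character Gt0 (E 0) exE0 = (\<lambda>g\<in>carrier Gt0. mtrace X (St0 g))"
  unfolding St0_def by (rule group_module_mat_rep[OF exE0_module lsE], simp add: dualE)+

lemma exV0_module: "group_module Gt0 W0 exV0"
proof -
  interpret W: group_module "G 0" W0 "\<lambda>g. \<rho> (emb 0 g)" by (rule emb0_module)
  have tau: "cyc_loop n \<sigma>s 0 \<in> Vs 0 \<rightarrow> Vs 0" using pth_closed[of _ n] by (auto simp: cyc_loop_def)
  have tau_a: "cyc_loop n \<sigma>s 0 (u \<oplus>\<^bsub>V\<^esub> v) = cyc_loop n \<sigma>s 0 u \<oplus>\<^bsub>V\<^esub> cyc_loop n \<sigma>s 0 v"
    "cyc_loop n \<sigma>s 0 (c \<odot>\<^bsub>V\<^esub> u) = c \<odot>\<^bsub>V\<^esub> cyc_loop n \<sigma>s 0 u" if "u \<in> Vs 0" "v \<in> Vs 0" for u v c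
    using pth_hom[OF that, of n] by (simp_all add: cyc_loop_def)
  have eqv: "cyc_loop n \<sigma>s 0 (\<rho> (emb 0 h) v) = \<rho> (emb 0 (psi0 h)) (cyc_loop n \<sigma>s 0 v)"
    if "h \<in> carrier (G 0)" "v \<in> Vs 0" for h v
    using pth_equivariant[OF that, of n] that(1) by (simp add: cyc_loop_def loop_aut_def)
  have rho: "\<rho> (emb 0 g) \<in> Vs 0 \<rightarrow> Vs 0" if "g \<in> carrier (G 0)" for g
    using Vs_invariant[OF n0 that] by auto
  have rho_a: "\<rho> (emb 0 g) (u \<oplus>\<^bsub>V\<^esub> v) = \<rho> (emb 0 g) u \<oplus>\<^bsub>V\<^esub> \<rho> (emb 0 g) v"
    "\<rho> (emb 0 g) (c \<odot>\<^bsub>V\<^esub> u) = c \<odot>\<^bsub>V\<^esub> \<rho> (emb 0 g) u" if "g \<in> carrier (G 0)" "u \<in> Vs 0" "v \<in> Vs 0" for g u v c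
    using W.act_hom[OF that(1)] that(2,3) by (auto simp: LinearCombinations.module_hom_def)
  have pw: "(cyc_loop n \<sigma>s 0 ^^ k) v \<in> Vs 0" if "v \<in> Vs 0" for k v by (rule funpow_mem[OF tau that])
  have pw_a: "(cyc_loop n \<sigma>s 0 ^^ k) (u \<oplus>\<^bsub>V\<^esub> v) = (cyc_loop n \<sigma>s 0 ^^ k) u \<oplus>\<^bsub>V\<^esub> (cyc_loop n \<sigma>s 0 ^^ k) v"
    "(cyc_loop n \<sigma>s 0 ^^ k) (c \<odot>\<^bsub>V\<^esub> u) = c \<odot>\<^bsub>V\<^esub> (cyc_loop n \<sigma>s 0 ^^ k) u" if "u \<in> Vs 0" "v \<in> Vs 0" for u v c k
  proof -
    show "(cyc_loop n \<sigma>s 0 ^^ k) (u \<oplus>\<^bsub>V\<^esub> v) = (cyc_loop n \<sigma>s 0 ^^ k) u \<oplus>\<^bsub>V\<^esub> (cyc_loop n \<sigma>s 0 ^^ k) v"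
      by (induction k) (simp_all add: tau_a(1)[OF pw[OF that(1)] pw[OF that(2)]])
    show "(cyc_loop n \<sigma>s 0 ^^ k) (c \<odot>\<^bsub>V\<^esub> u) = c \<odot>\<^bsub>V\<^esub> (cyc_loop n \<sigma>s 0 ^^ k) u"
      by (induction k) (simp_all add: tau_a(2)[OF pw[OF that(1)] pw[OF that(1)]])
  qed
  show ?thesis
  proof (intro group_module.intro group_Gt0 W.vectorspace_axioms group_module_axioms.intro W.fin_dim)
    show "exV0 x \<in> module_hom class_ring W0 W0" if "x \<in> carrier Gt0" for x
    proof -
      obtain g a where x: "x = (g, a)" by (cases x)
      have g: "g \<in> carrier (G 0)" using that by (simp add: x L.semidirect_carrier)
      show ?thesis
        using funcset_mem[OF rho[OF g] pw] rho_a[OF g pw pw] pw_a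
        by (auto simp: x L.ext_act_eq LinearCombinations.module_hom_def)
    qed
    show "exV0 \<one>\<^bsub>Gt0\<^esub> v = v" if "v \<in> carrier W0" for v
      unfolding L.semidirect_one L.ext_act_base by (rule W.act_one[OF that])
    show "exV0 (x \<otimes>\<^bsub>Gt0\<^esub> y) v = exV0 x (exV0 y v)"
      if xy: "x \<in> carrier Gt0" "y \<in> carrier Gt0" and v: "v \<in> carrier W0" for x y v
    proof -
      have mult: "\<rho> (emb 0 (g \<otimes>\<^bsub>G 0\<^esub> h)) v = \<rho> (emb 0 g) (\<rho> (emb 0 h) v)"
        if "g \<in> carrier (G 0)" "h \<in> carrier (G 0)" "v \<in> Vs 0" for g h v
        using W.act_mult[OF that(1,2)] that(3) by simp
      have "v \<in> Vs 0" using v by simp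
      from L.ext_act_mult[where \<rho>="\<lambda>g. \<rho> (emb 0 g)" and D="Vs 0" and \<sigma>="cyc_loop n \<sigma>s 0", OF rho mult tau eqv tau_order xy this]
      show ?thesis .
    qed
  qed
qed

lemma Mt0_rep: "mat_rep Gt0 C Mt0" "Mt0 \<one>\<^bsub>Gt0\<^esub> = id_mat C"
  unfolding Mt0_def by (rule group_module_mat_rep[OF exV0_module lsV], simp add: dualV)+

lemma nth_Gt0:
  "fps_nth (molien Gt0 W0 exV0 (character Gt0 (E 0) exE0)) k
    = multiplicity Gt0 ({..<k} \<rightarrow>\<^sub>E C) (\<lambda>g. sym_mat k C (Mt0 g)) X St0"
  unfolding Mt0_def
  by (rule molien_nth[OF group_Gt0 lsV W0_closed group_module.act_hom[OF exV0_module]])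
    (simp_all only: St0_rep(3) restrict_apply' if_True)

end

context preferred_bases
begin

interpretation V: group_module Gp V \<rho> by (rule V_module)
interpretation L: finite_aut "G 0" psi0 by (rule loop_finite_aut[OF n0])

abbreviation tau where "tau \<equiv> cyc_loop n \<sigma>s 0"
abbreviation alpha0 where "alpha0 \<equiv> cyc_loop n \<delta> 0"

lemma sigma_hom: "\<sigma> \<in> module_hom class_ring V V"
  using \<sigma>_extends by (simp add: extends_by_def module_isos_def linear_isos_def)

lemma twist_mat: "Mt0 (\<one>\<^bsub>G 0\<^esub>, psi0) = smat C (\<lambda>b. b) e0 tau" "St0 (\<one>\<^bsub>G 0\<^esub>, psi0) = smat X (\<lambda>b. b) e alpha0"
proof -
  interpret W: group_module "G 0" W0 "\<lambda>g. \<rho> (emb 0 g)" by (rule emb0_module)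
  have tau: "tau \<in> Vs 0 \<rightarrow> Vs 0" using pth_closed[of _ n] by (auto simp: cyc_loop_def)
  have p1: "psi0 [^]\<^bsub>AutoGroup (G 0)\<^esub> (1::nat) = psi0"
    unfolding L.aut_pow by (simp add: loop_aut_def restrict_def fun_eq_iff)
  have "exV0 (\<one>\<^bsub>G 0\<^esub>, psi0) v = tau v" if v: "v \<in> Vs 0" for v
  proof -
    have "exV0 (\<one>\<^bsub>G 0\<^esub>, psi0 [^]\<^bsub>AutoGroup (G 0)\<^esub> (1::nat)) v = \<rho> (emb 0 \<one>\<^bsub>G 0\<^esub>) ((tau ^^ (1::nat)) v)"
      by (rule L.ext_act_pow[where D="Vs 0", OF tau tau_order v])
    then show ?thesis using W.act_one[of "tau v"] funcset_mem[OF tau v] by (simp only: p1) simp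
  qed
  moreover have "(\<lambda>b. b) \<in> C \<rightarrow> Vs 0" using lsV by (simp add: dual_system_def)
  ultimately show "Mt0 (\<one>\<^bsub>G 0\<^esub>, psi0) = smat C (\<lambda>b. b) e0 tau"
    unfolding Mt0_def by (intro smat_cong[where D="Vs 0"])
  have "exE0 (\<one>\<^bsub>G 0\<^esub>, psi0) v = alpha0 v" if v: "v \<in> carrier (E 0)" for v
    using \<alpha>_extends[OF n0] v by (simp add: extends_by_def)
  moreover have "(\<lambda>b. b) \<in> X \<rightarrow> carrier (E 0)" using lsE by (simp add: dual_system_def)
  ultimately show "St0 (\<one>\<^bsub>G 0\<^esub>, psi0) = smat X (\<lambda>b. b) e alpha0"
    unfolding St0_def by (intro smat_cong[where D="carrier (E 0)"])
qed

lemma base_mat: "Mt0 (g, \<one>\<^bsub>AutoGroup (G 0)\<^esub>) = m0 g" "St0 (g, \<one>\<^bsub>AutoGroup (G 0)\<^esub>) = r0 g"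
proof -
  have "exV0 (g, \<one>\<^bsub>AutoGroup (G 0)\<^esub>) = \<rho> (emb 0 g)" by (rule ext) (rule L.ext_act_base)
  then show "Mt0 (g, \<one>\<^bsub>AutoGroup (G 0)\<^esub>) = m0 g" by (simp only: Mt0_def m0_def)
  have "exE0 (g, \<one>\<^bsub>AutoGroup (G 0)\<^esub>) = r 0 g" by (rule ext) (rule L.ext_act_base)
  then show "St0 (g, \<one>\<^bsub>AutoGroup (G 0)\<^esub>) = r0 g" by (simp only: St0_def r0_def)
qed

lemma pair_Gt0: "rep_pair Gt0 ({..<k} \<rightarrow>\<^sub>E C) (\<lambda>g. sym_mat k C (Mt0 g)) X St0"
  by (intro rep_pair.intro rep_pair_axioms.intro group_Gt0 L.finite_semidirect mat_rep_sym Mt0_rep St0_rep)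

lemma M_split: "M (g, a) = smat J VB VC (\<rho> g \<circ> \<sigma> ^^ P.ex a)"
proof -
  have "exV (g, a) = \<rho> g \<circ> \<sigma> ^^ P.ex a" by (rule ext) (simp only: P.ext_act_eq o_apply)
  then show ?thesis by (simp only: M_def)
qed

lemma smat_sigma_funpow:
  "smat J VB VC (\<sigma> ^^ Suc k) = mmul J (smat J VB VC \<sigma>) (smat J VB VC (\<sigma> ^^ k))"
  "g \<in> carrier Gp \<Longrightarrow> smat J VB VC (\<rho> g \<circ> \<sigma> ^^ k) = mmul J (smat J VB VC (\<rho> g)) (smat J VB VC (\<sigma> ^^ k))"
proof -
  have sV: "\<sigma> \<in> carrier V \<rightarrow> carrier V" using sigma_hom by (auto simp: LinearCombinations.module_hom_def)
  have pw: "\<sigma> ^^ k \<in> carrier V \<rightarrow> carrier V" by (rule Pi_I) (rule funpow_mem[OF sV])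
  have adm: "(\<lambda>v\<in>carrier V. f (T v)) \<in> {f. lin_fun V f}"
    if "T \<in> module_hom class_ring V V" "f \<in> {f. lin_fun V f}" for T f
    by (rule bspec[OF conjunct2[OF admissible_linear[OF V_closed that(1), unfolded admissible_def]] that(2)])
  show "smat J VB VC (\<sigma> ^^ Suc k) = mmul J (smat J VB VC \<sigma>) (smat J VB VC (\<sigma> ^^ k))"
    unfolding funpow.simps by (rule smat_comp[OF VLS adm[OF sigma_hom] pw])
  show "smat J VB VC (\<rho> g \<circ> \<sigma> ^^ k) = mmul J (smat J VB VC (\<rho> g)) (smat J VB VC (\<sigma> ^^ k))"
    if g: "g \<in> carrier Gp"
    by (rule smat_comp[OF VLS adm[OF V.act_hom[OF g]] pw])
qed

lemma EB_D: "EB \<in> Y \<rightarrow> D" using ELS by (simp add: dual_system_def)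

lemma smat_ids: "smat J VB VC (\<sigma> ^^ 0) = id_mat J" "smat Y EB EC (cyc_shift n \<delta> ^^ 0) = id_mat Y"
proof -
  show "smat J VB VC (\<sigma> ^^ 0) = id_mat J"
    using vcoord_vbas[OF lsV dualV] by (simp add: smat_def id_mat_def fun_eq_iff)
  have "rE \<one>\<^bsub>Gp\<^esub> v = v" if v: "v \<in> D" for v
  proof
    fix i show "rE \<one>\<^bsub>Gp\<^esub> v i = v i"
    proof (cases "i < n")
      case True
      then have "v i \<in> carrier (E i)" using PiE_mem[OF v] by simp
      from group_module.act_one[OF E_module[OF True] this] True show ?thesis by (simp add: rE_def)
    next
      case False
      then show ?thesis using PiE_arb[OF v] by (simp add: rE_def)
    qed
  qed
  then have "smat Y EB EC (cyc_shift n \<delta> ^^ 0) = S \<one>\<^bsub>Gt\<^esub>"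
    unfolding P.semidirect_one S_iota by (intro smat_cong[OF EB_D]) simp
  then show "smat Y EB EC (cyc_shift n \<delta> ^^ 0) = id_mat Y" by (simp only: S_one)
qed

text \<open>
  The block product of a tensor for \<open>Vs 0\<close> and \<open>E 0\<close> commutes with \<open>G\<close>, since the given one commutes with
  \<open>G 0\<close>. The blocks of \<open>\<sigma>\<close> and of the shift of \<open>E\<close> are unit matrices except for \<open>\<tau>\<^sub>0\<close> and \<open>\<alpha>\<^sub>0\<close> at
  the end of the cycle, with which the given tensor commutes as well. So the product commutes with the shift.
\<close>
lemma upper_bound:
  assumes nz: "multiplicity Gt0 ({..<b} \<rightarrow>\<^sub>E C) (\<lambda>g. sym_mat b C (Mt0 g)) X St0 \<noteq> 0"
  shows "multiplicity Gt ({..<n * b} \<rightarrow>\<^sub>E J) (\<lambda>x. sym_mat (n * b) J (M x)) Y S \<noteq> 0"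
proof -
  obtain A0 where A0: "intertwiner Gt0 ({..<b} \<rightarrow>\<^sub>E C) (\<lambda>g. sym_mat b C (Mt0 g)) X St0 A0" "A0 \<noteq> (\<lambda>_ _. 0)"
    using iffD1[OF rep_pair.multiplicity_nonzero_iff[OF pair_Gt0] nz] by (elim exE conjE)
  have sS: "supp_in X X (St0 g)" for g unfolding St0_def by (rule supp_in_smat)
  have "sym_tensor {..<b} C X A0 \<and> (\<forall>x\<in>carrier Gt0. ten_comm {..<b} C X A0 (Mt0 x) (St0 x))"
    by (rule iffD1[OF intertwiner_sym_iff[where M=Mt0 and H=Gt0 and R=St0] A0(1)])
      (rule finite_C Mt0_rep(2) finite_X sS)+
  note st0 = this[THEN conjunct1] and tc = bspec[OF this[THEN conjunct2]]
  have base: "ten_comm {..<b} C X A0 (m0 g) (r0 g)" if g: "g \<in> carrier (G 0)" for g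
    using tc[OF L.base_in_semidirect[OF g]] by (simp only: base_mat)
  have "(\<one>\<^bsub>G 0\<^esub>, psi0) \<in> carrier Gt0"
    by (simp add: L.semidirect_carrier L.phi_in_generate one_G0)
  from tc[OF this] have twist: "ten_comm {..<b} C X A0 (smat C (\<lambda>b. b) e0 tau) (smat X (\<lambda>b. b) e alpha0)"
    by (simp only: twist_mat)
  have "supp_in ({..<b} \<rightarrow>\<^sub>E C) X A0" using st0 by (simp add: sym_tensor_def)
  from ten_comm_id[OF finite_lessThan finite_C this finite_X]
  have unit: "ten_comm {..<b} C X A0 (id_mat C) (id_mat X)" .
  obtain A1 where A1: "sym_tensor ({..<n} \<times> {..<b}) J Y A1" "A1 \<noteq> (\<lambda>_ _. 0)"
    and A1c: "\<And>s N a. s permutes {..<n} \<Longrightarrow> (\<And>j. j < n \<Longrightarrow> ten_comm {..<b} C X A0 (N j) (a j)) \<Longrightarrow>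
       ten_comm ({..<n} \<times> {..<b}) J Y A1 (vmon n C s N) (emon n X s a)"
  proof (rule block_product[OF finite_C finite_X st0 A0(2), of n])
    fix A assume a: "sym_tensor ({..<n} \<times> {..<b}) J Y A" "A \<noteq> (\<lambda>_ _. 0)"
      "\<And>s N a. s permutes {..<n} \<Longrightarrow> (\<And>j. j < n \<Longrightarrow> ten_comm {..<b} C X A0 (N j) (a j)) \<Longrightarrow>
       ten_comm ({..<n} \<times> {..<b}) J Y A (vmon n C s N) (emon n X s a)"
    show thesis by (rule that[OF a])
  qed
  obtain h where h: "bij_betw h {..<n * b} ({..<n} \<times> {..<b})"
    using finite_same_card_bij[of "{..<n * b}" "{..<n} \<times> {..<b}"] by (auto simp: card_cartesian_product)
  obtain A where A: "sym_tensor {..<n * b} J Y A" "A \<noteq> (\<lambda>_ _. 0)"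
    and Ac: "\<And>N a. ten_comm ({..<n} \<times> {..<b}) J Y A1 N a \<Longrightarrow> ten_comm {..<n * b} J Y A N a"
    by (rule sym_tensor_reindex[OF h A1]) (rule that)
  have act: "ten_comm {..<n * b} J Y A (M (iota g)) (S (iota g))" if g: "g \<in> carrier Gp" for g
    unfolding M_iota_eq[OF g] S_iota_eq[OF g] by (rule Ac, rule A1c, rule permutes_id, rule base, rule pull(1)[OF g])
  have sh: "ten_comm {..<n * b} J Y A (smat J VB VC \<sigma>) (smat Y EB EC (cyc_shift n \<delta>))"
  proof (subst smat_sigma[OF lsV], rule dualV, assumption, assumption,
      subst smat_E_shift[OF lsE], rule dualE, assumption, assumption, rule Ac, rule A1c, rule cyc_succ_permutes)
    fix j assume "j < n"
    show "ten_comm {..<b} C X A0 (if Suc j < n then id_mat C else smat C (\<lambda>b. b) e0 tau)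
      (if Suc j < n then id_mat X else smat X (\<lambda>b. b) e alpha0)"
      by (cases "Suc j < n") (simp_all only: if_True if_False unit twist)
  qed
  have pw: "ten_comm {..<n * b} J Y A (smat J VB VC (\<sigma> ^^ k)) (smat Y EB EC (cyc_shift n \<delta> ^^ k))" for k
  proof (induction k)
    case 0
    have "supp_in ({..<n * b} \<rightarrow>\<^sub>E J) Y A" using A(1) by (simp add: sym_tensor_def)
    from ten_comm_id[OF finite_lessThan finite_J this finite_Y] show ?case unfolding smat_ids .
  next
    case (Suc k)
    have "smat Y EB EC (cyc_shift n \<delta> ^^ Suc k)
      = mmul Y (smat Y EB EC (cyc_shift n \<delta>)) (smat Y EB EC (cyc_shift n \<delta> ^^ k))"
      unfolding funpow.simps by (rule smat_mult[OF ELS shift_admissible admissible_funpow[OF F_ext shift_admissible]])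
    with ten_comm_mmul[OF finite_lessThan finite_J sh Suc] show ?case by (simp only: smat_sigma_funpow(1))
  qed
  have "ten_comm {..<n * b} J Y A (M x) (S x)" if x: "x \<in> carrier Gt" for x
  proof -
    obtain g a where ga: "x = (g, a)" by (cases x)
    have g: "g \<in> carrier Gp" using x by (simp add: ga P.semidirect_carrier del: carrier_product_group)
    have "S x = mmul Y (S (iota g)) (smat Y EB EC (cyc_shift n \<delta> ^^ P.ex a))"
      unfolding ga S_iota unfolding S_def exE_eq
      by (rule smat_mult[OF ELS rE_admissible[OF g] admissible_funpow[OF F_ext shift_admissible]])
    moreover have "M x = mmul J (M (iota g)) (smat J VB VC (\<sigma> ^^ P.ex a))"
      unfolding ga M_iota unfolding M_split by (rule smat_sigma_funpow(2)[OF g])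
    ultimately show ?thesis using ten_comm_mmul[OF finite_lessThan finite_J act[OF g] pw] by simp
  qed
  note all = this
  have sY: "supp_in Y Y (S x)" for x unfolding S_def by (rule supp_in_smat)
  have "intertwiner Gt ({..<n * b} \<rightarrow>\<^sub>E J) (\<lambda>x. sym_mat (n * b) J (M x)) Y S A"
  proof (rule iffD2[OF intertwiner_sym_iff[where M=M and H=Gt and R=S]])
    show "sym_tensor {..<n * b} J Y A \<and> (\<forall>x\<in>carrier Gt. ten_comm {..<n * b} J Y A (M x) (S x))"
      by (intro conjI ballI A(1) all)
  qed (rule finite_J M_one finite_Y sY)+
  then show ?thesis
    by (intro iffD2[OF rep_pair.multiplicity_nonzero_iff[OF pair_Gt[OF S_rep]]] exI[of _ A] conjI A(2))
qed

end

section \<open>Representations restricted along a homomorphism\<close>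

lemma irr_obtain:
  fixes \<psi> :: "'h \<Rightarrow> 'k::{alg_closed_field, field_char_0}"
  assumes "\<psi> \<in> irr H" "finite (carrier H)"
  obtains m R where "mat_rep H {..<m::nat} R" "R \<one>\<^bsub>H\<^esub> = id_mat {..<m}"
    "\<psi> = (\<lambda>h\<in>carrier H. mtrace {..<m} (R h))" "multiplicity H {..<m} R {..<m} R = 1"
proof -
  obtain m \<rho> where m: "\<psi> = character H (module_vec TYPE('k) m) \<rho>" "simple_module H (module_vec TYPE('k) m) \<rho>"
    using assms(1) by (auto simp: irr_def)
  have gm: "group_module H (module_vec TYPE('k) m) \<rho>" using m(2) by (simp add: simple_module_def)
  show ?thesis
    using that[of m "vec_rep m \<rho>"] vec_rep_properties[OF gm] simple_multiplicity_one[OF m(2) assms(2)] m(1)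
    by simp
qed

lemma multiplicity_cong:
  assumes "group H" "\<And>h. h \<in> carrier H \<Longrightarrow> mtrace Y (S h) = mtrace Y' (S' h)"
    "\<And>h. h \<in> carrier H \<Longrightarrow> mtrace X (R h) = mtrace X' (R' h)"
  shows "multiplicity H Y S X R = multiplicity H Y' S' X' R'"
proof -
  interpret group H by fact
  show ?thesis by (simp add: multiplicity_def assms(2,3))
qed

locale finite_group_hom = Gp: group Gp + Gt: group Gt
  for Gp :: "('p, 'a) monoid_scheme" and Gt :: "('t, 'b) monoid_scheme" +
  fixes i :: "'p \<Rightarrow> 't"
  assumes finite_Gp: "finite (carrier Gp)" and finite_Gt: "finite (carrier Gt)"
    and i_hom: "i \<in> hom Gp Gt"
begin

lemma i_closed: "g \<in> carrier Gp \<Longrightarrow> i g \<in> carrier Gt"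
  using i_hom by (auto simp: hom_def)

lemma i_mult: "g \<in> carrier Gp \<Longrightarrow> h \<in> carrier Gp \<Longrightarrow> i (g \<otimes>\<^bsub>Gp\<^esub> h) = i g \<otimes>\<^bsub>Gt\<^esub> i h"
  using i_hom by (auto simp: hom_def)

lemma i_one: "i \<one>\<^bsub>Gp\<^esub> = \<one>\<^bsub>Gt\<^esub>"
  by (rule hom_one[OF i_hom]) unfold_locales

lemma i_inv: "g \<in> carrier Gp \<Longrightarrow> i (inv\<^bsub>Gp\<^esub> g) = inv\<^bsub>Gt\<^esub> (i g)"
  by (rule sym, rule Gt.inv_equality) (simp_all add: i_mult[symmetric] i_one[symmetric] i_closed)

lemma mat_rep_i: "mat_rep Gt Z T \<Longrightarrow> mat_rep Gp Z (\<lambda>g. T (i g))"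
  by (simp add: mat_rep_def i_mult i_closed)

lemma intertwiner_i:
  "intertwiner Gt Z T X R A \<Longrightarrow> intertwiner Gp Z (\<lambda>g. T (i g)) X (\<lambda>g. R (i g)) A"
  by (simp add: intertwiner_def i_one i_closed)

text \<open>
  An isomorphism with a simple \<open>Gp\<close>-module on a coordinate space transports the action of \<open>Gt\<close> to that
  space, and a submodule for \<open>Gt\<close> is one for \<open>Gp\<close>.
\<close>
lemma irr_of_restriction:
  fixes S :: "'t \<Rightarrow> 'y \<Rightarrow> 'y \<Rightarrow> 'k::{alg_closed_field, field_char_0}"
  assumes S: "mat_rep Gt Y S" "S \<one>\<^bsub>Gt\<^esub> = id_mat Y"
    and \<chi>: "\<chi> \<in> irr Gp" "\<And>g. g \<in> carrier Gp \<Longrightarrow> \<chi> g = mtrace Y (S (i g))"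
  shows "(\<lambda>x\<in>carrier Gt. mtrace Y (S x)) \<in> irr Gt"
proof -
  obtain m \<rho> where m: "\<chi> = character Gp (module_vec TYPE('k) m) \<rho>" "simple_module Gp (module_vec TYPE('k) m) \<rho>"
    using \<chi>(1) by (auto simp: irr_def)
  let ?V = "module_vec TYPE('k) m" and ?X = "{..<m}"
  define R where "R = vec_rep m \<rho>"
  have gm: "group_module Gp ?V \<rho>" using m(2) by (simp add: simple_module_def)
  interpret V: group_module Gp ?V \<rho> by (rule gm)
  note R = vec_rep_properties[OF gm, folded R_def]
  have trR: "mtrace ?X (R g) = mtrace Y (S (i g))" if "g \<in> carrier Gp" for g
    using \<chi>(2)[OF that] that R(3) m(1) by simp
  have RR: "multiplicity Gp ?X R ?X R = 1"
    unfolding R_def by (rule simple_multiplicity_one[OF m(2) finite_Gp])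
  have SS: "multiplicity Gp Y (\<lambda>g. S (i g)) Y (\<lambda>g. S (i g)) = 1"
    unfolding RR[symmetric] by (rule multiplicity_cong[OF Gp.is_group]) (simp_all only: trR)
  have SR: "multiplicity Gp Y (\<lambda>g. S (i g)) ?X R = 1"
    unfolding RR[symmetric] by (rule multiplicity_cong[OF Gp.is_group]) (simp_all only: trR)
  interpret rp: rep_pair Gp Y "\<lambda>g. S (i g)" ?X R
    using finite_Gp mat_rep_i[OF S(1)] R(1) by unfold_locales
  obtain A where A: "intertwiner Gp Y (\<lambda>g. S (i g)) ?X R A" "A \<noteq> (\<lambda>_ _. 0)"
    using rp.multiplicity_nonzero_iff SR by auto
  have S1: "S (i \<one>\<^bsub>Gp\<^esub>) = id_mat Y" by (simp add: i_one S(2))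
  obtain C where C: "intertwiner Gp ?X R Y (\<lambda>g. S (i g)) C" "mmul Y C A = id_mat ?X" "mmul ?X A C = id_mat Y"
    by (rule rp.inverse_intertwiner[OF R(2) S1 RR SS A])
  have sA: "supp_in Y ?X A" and sC: "supp_in ?X Y C" using A(1) C(1) by (simp_all add: intertwiner_def)
  have finY: "finite Y" and sS: "\<And>x. x \<in> carrier Gt \<Longrightarrow> supp_in Y Y (S x)"
    and Sm: "\<And>x y. x \<in> carrier Gt \<Longrightarrow> y \<in> carrier Gt \<Longrightarrow> S (x \<otimes>\<^bsub>Gt\<^esub> y) = mmul Y (S x) (S y)"
    using S(1) by (auto simp: mat_rep_def)
  \<comment> \<open>transport of \<open>S\<close> along the isomorphism \<open>A\<close> with inverse \<open>C\<close>\<close>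
  define T where "T x = mmul Y C (mmul Y (S x) A)" for x
  have T_mult: "T (x \<otimes>\<^bsub>Gt\<^esub> y) = mmul ?X (T x) (T y)" if xy: "x \<in> carrier Gt" "y \<in> carrier Gt" for x y
  proof -
    have "mmul ?X (T x) (T y) = mmul Y C (mmul Y (S x) (mmul Y (mmul ?X A C) (mmul Y (S y) A)))"
      by (simp only: T_def mmul_assoc)
    also have "mmul Y (mmul ?X A C) (mmul Y (S y) A) = mmul Y (S y) A"
      unfolding C(3) by (rule mmul_id_left[OF finY supp_in_mmul[OF sS[OF xy(2)] sA]])
    finally show ?thesis by (simp only: T_def Sm[OF xy] mmul_assoc)
  qed
  have T_one: "T \<one>\<^bsub>Gt\<^esub> = id_mat ?X"
    by (simp only: T_def S(2) mmul_id_left[OF finY sA] C(2))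
  have T_i: "T (i g) = R g" if g: "g \<in> carrier Gp" for g
  proof -
    have sR: "supp_in ?X ?X (R g)" using R(1) g by (simp add: mat_rep_def)
    have "mmul Y (S (i g)) A = mmul ?X A (R g)" using A(1) g by (simp add: intertwiner_def)
    then have "T (i g) = mmul ?X (mmul Y C A) (R g)" by (simp only: T_def mmul_assoc)
    also have "\<dots> = R g"
      unfolding C(2) by (rule mmul_id_left[OF finite_lessThan sR])
    finally show ?thesis .
  qed
  define act where "act x v = vec m (\<lambda>k. \<Sum>j<m. T x k j * v $ j)" for x and v :: "'k vec"
  have act_c: "act x v \<in> carrier_vec m" for x v by (simp add: act_def)
  have act_i: "act (i g) v = \<rho> g v" if g: "g \<in> carrier Gp" and v: "v \<in> carrier_vec m" for g v
  proof (rule eq_vecI)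
    have c: "\<rho> g v \<in> carrier_vec m"
      using V.act_hom[OF g] v by (auto simp: LinearCombinations.module_hom_def module_vec_simps)
    then show "dim_vec (act (i g) v) = dim_vec (\<rho> g v)" by (simp add: act_def)
    show "act (i g) v $ k = \<rho> g v $ k" if "k < dim_vec (\<rho> g v)" for k
      using that c vec_rep_apply[OF gm g v, of k] by (simp add: act_def T_i[OF g] R_def)
  qed
  have gmt: "group_module Gt ?V act"
  proof (intro group_module.intro Gt.is_group V.vectorspace_axioms group_module_axioms.intro V.fin_dim)
    show "act x \<in> module_hom class_ring ?V ?V" if "x \<in> carrier Gt" for x
    proof -
      have "act x (u + v) = act x u + act x v" if "u \<in> carrier_vec m" "v \<in> carrier_vec m" for u v
        by (rule eq_vecI) (use that in \<open>simp_all add: act_def distrib_left sum.distrib\<close>)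
      moreover have "act x (c \<cdot>\<^sub>v v) = c \<cdot>\<^sub>v act x v" if "v \<in> carrier_vec m" for c v
        by (rule eq_vecI) (use that in \<open>simp_all add: act_def sum_distrib_left mult.left_commute\<close>)
      ultimately show ?thesis by (simp add: LinearCombinations.module_hom_def module_vec_simps act_c)
    qed
    show "act \<one>\<^bsub>Gt\<^esub> v = v" if "v \<in> carrier ?V" for v
    proof (rule eq_vecI)
      have v: "v \<in> carrier_vec m" using that by (simp add: module_vec_simps)
      then show "dim_vec (act \<one>\<^bsub>Gt\<^esub> v) = dim_vec v" by (simp add: act_def)
      fix k assume "k < dim_vec v"
      then have k: "k < m" using v by simp
      have "(\<Sum>j<m. id_mat ?X k j * v $ j) = (\<Sum>j<m. if j = k then v $ j else 0)"
        using k by (intro sum.cong) (auto simp: id_mat_def)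
      then show "act \<one>\<^bsub>Gt\<^esub> v $ k = v $ k" using k by (simp add: act_def T_one)
    qed
    show "act (x \<otimes>\<^bsub>Gt\<^esub> y) v = act x (act y v)"
      if xy: "x \<in> carrier Gt" "y \<in> carrier Gt" and "v \<in> carrier ?V" for x y v
    proof (rule eq_vecI)
      show "dim_vec (act (x \<otimes>\<^bsub>Gt\<^esub> y) v) = dim_vec (act x (act y v))" by (simp add: act_def)
      fix k assume "k < dim_vec (act x (act y v))"
      then have k: "k < m" by (simp add: act_def)
      have "act (x \<otimes>\<^bsub>Gt\<^esub> y) v $ k = mmul ?X (mmul ?X (T x) (T y)) (\<lambda>j (_::unit). v $ j) k ()"
        using k by (simp add: act_def T_mult[OF xy] mmul_def)
      also have "\<dots> = act x (act y v) $ k"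
        unfolding mmul_assoc using k by (simp add: mmul_def act_def)
      finally show "act (x \<otimes>\<^bsub>Gt\<^esub> y) v $ k = act x (act y v) $ k" .
    qed
  qed
  have "simple_module Gt ?V act"
    unfolding simple_module_def
  proof (intro conjI gmt allI impI)
    show "carrier ?V \<noteq> {\<zero>\<^bsub>?V\<^esub>}" using m(2) by (simp add: simple_module_def)
    fix W assume W: "submodule class_ring W ?V \<and> (\<forall>h\<in>carrier Gt. act h ` W \<subseteq> W)"
    then have "W \<subseteq> carrier_vec m" by (auto simp: submodule_def module_vec_simps)
    then have "\<rho> g ` W \<subseteq> W" if "g \<in> carrier Gp" for g
      using W i_closed[OF that] act_i[OF that] by force
    then show "W = {\<zero>\<^bsub>?V\<^esub>} \<or> W = carrier ?V" using m(2) W unfolding simple_module_def by blast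
  qed
  moreover have "character Gt ?V act = (\<lambda>x\<in>carrier Gt. mtrace Y (S x))"
    unfolding vec_rep_properties(3)[OF gmt]
  proof (rule restrict_ext)
    fix x assume x: "x \<in> carrier Gt"
    have e: "vec_rep m act x k k = T x k k" if "k < m" for k
    proof -
      have "(\<Sum>j<m. T x k j * unit_vec m k $ j) = (\<Sum>j<m. if j = k then T x k j else 0)"
        using that by (intro sum.cong) auto
      then show ?thesis using that by (simp add: vec_rep_def smat_def act_def)
    qed
    have "mtrace ?X (vec_rep m act x) = mtrace ?X (T x)" by (simp add: mtrace_def e)
    also have "\<dots> = mtrace Y (mmul ?X (mmul Y (S x) A) C)" unfolding T_def by (rule mtrace_mmul)
    also have "\<dots> = mtrace Y (mmul Y (S x) (id_mat Y))" by (simp only: mmul_assoc C(3))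
    also have "\<dots> = mtrace Y (S x)" by (simp only: mmul_id_right[OF finY sS[OF x]])
    finally show "mtrace ?X (vec_rep m act x) = mtrace Y (S x)" .
  qed
  ultimately show ?thesis unfolding irr_def mem_Collect_eq by (intro exI[of _ m] exI[of _ act]) simp
qed

text \<open>
  The map \<open>u\<close> of \<open>Gp\<close>-modules is recovered from its composite with \<open>f'\<close> by the left inverse \<open>l\<close> of
  \<open>f'\<close>. As \<open>Y\<close> occurs only once in \<open>Z\<close>, that composite is a multiple of \<open>f\<close>. So \<open>u\<close> is a multiple of
  \<open>l f\<close>, which is a map of \<open>Gt\<close>-modules.
\<close>
lemma extension_unique:
  fixes S :: "'t \<Rightarrow> 'y \<Rightarrow> 'y \<Rightarrow> 'k::field_char_0"
  assumes T: "mat_rep Gt Z T" and S: "mat_rep Gt Y S" "S \<one>\<^bsub>Gt\<^esub> = id_mat Y"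
    and R: "mat_rep Gt X R" "R \<one>\<^bsub>Gt\<^esub> = id_mat X"
    and irr: "multiplicity Gt Y S Y S = 1" "multiplicity Gt X R X R = 1"
    and one: "multiplicity Gp Z (\<lambda>g. T (i g)) Y (\<lambda>g. S (i g)) = 1"
    and TS: "multiplicity Gt Z T Y S \<noteq> 0" and TR: "multiplicity Gt Z T X R \<noteq> 0"
    and RS: "multiplicity Gp X (\<lambda>g. R (i g)) Y (\<lambda>g. S (i g)) \<noteq> 0"
    and x: "x \<in> carrier Gt"
  shows "mtrace X (R x) = mtrace Y (S x)"
proof -
  interpret TS: rep_pair Gt Z T Y S using finite_Gt T S(1) by unfold_locales
  interpret TR: rep_pair Gt Z T X R using finite_Gt T R(1) by unfold_locales
  interpret RS: rep_pair Gt X R Y S using finite_Gt R(1) S(1) by unfold_locales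
  interpret TSp: rep_pair Gp Z "\<lambda>g. T (i g)" Y "\<lambda>g. S (i g)"
    using finite_Gp mat_rep_i[OF T] mat_rep_i[OF S(1)] by unfold_locales
  interpret RSp: rep_pair Gp X "\<lambda>g. R (i g)" Y "\<lambda>g. S (i g)"
    using finite_Gp mat_rep_i[OF R(1)] mat_rep_i[OF S(1)] by unfold_locales
  obtain u where u: "intertwiner Gp X (\<lambda>g. R (i g)) Y (\<lambda>g. S (i g)) u" "u \<noteq> (\<lambda>_ _. 0)"
    using iffD1[OF RSp.multiplicity_nonzero_iff RS] by blast
  obtain f where f: "intertwiner Gt Z T Y S f" "f \<noteq> (\<lambda>_ _. 0)"
    using iffD1[OF TS.multiplicity_nonzero_iff TS] by blast
  obtain f' where f': "intertwiner Gt Z T X R f'" "f' \<noteq> (\<lambda>_ _. 0)"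
    using iffD1[OF TR.multiplicity_nonzero_iff TR] by blast
  obtain l where l: "intertwiner Gt X R Z T l" "mmul Z l f' = id_mat X"
    by (rule TR.left_inverse[OF R(2) irr(2) f'])
  have "intertwiner Gp Z (\<lambda>g. T (i g)) Y (\<lambda>g. S (i g)) (mmul X f' u)"
    by (rule intertwiner_mmul[OF intertwiner_i[OF f'(1)] u(1)])
  from TSp.multiplicity_one_proportional[OF one this intertwiner_i[OF f(1)] f(2)]
  obtain c where c: "mmul X f' u = (\<lambda>z y. c * f z y)" by blast
  define w where "w = mmul Z l f"
  have w: "intertwiner Gt X R Y S w" unfolding w_def by (rule intertwiner_mmul[OF l(1) f(1)])
  have su: "supp_in X Y u" using u(1) by (simp add: intertwiner_def)
  have "u = mmul X (mmul Z l f') u"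
    unfolding l(2) by (rule mmul_id_left[OF RS.finY su, symmetric])
  also have "\<dots> = (\<lambda>z y. c * w z y)"
    unfolding mmul_assoc c mmul_scale_right w_def by (rule refl)
  finally have "w \<noteq> (\<lambda>_ _. 0)" using u(2) by auto
  then obtain v where "intertwiner Gt Y S X R v" "mmul X v w = id_mat Y" "mmul Y w v = id_mat X"
    by (rule RS.inverse_intertwiner[OF S(2) R(2) irr w])
  then show ?thesis
    using w x R(1) S(1) RS.finX RS.finY
    by (intro mtrace_conj[where A=w and C=v]) (auto simp: intertwiner_def mat_rep_def)
qed

end

text \<open>
  Frobenius reciprocity: each of the \<open>|G|\<close> conjugating elements contributes the same sum over \<open>H\<close>.
\<close>
lemma frobenius:
  fixes \<psi> :: "'h \<Rightarrow> 'k::field_char_0"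
  assumes G: "group G" and fin: "finite (carrier G)" and H: "H \<subseteq> carrier G"
    and \<psi>: "\<And>x y. x \<in> carrier G \<Longrightarrow> y \<in> carrier G \<Longrightarrow> \<psi> (y \<otimes>\<^bsub>G\<^esub> x \<otimes>\<^bsub>G\<^esub> inv\<^bsub>G\<^esub> y) = \<psi> x"
  shows "char_inner G (induced G H \<chi>) \<psi> = (\<Sum>h\<in>H. \<chi> h * \<psi> (inv\<^bsub>G\<^esub> h)) / of_nat (card H)"
proof -
  interpret group G by fact
  let ?c = "\<lambda>z. if z \<in> H then \<chi> z else 0"
  have conj: "(\<Sum>x\<in>carrier G. ?c (y \<otimes>\<^bsub>G\<^esub> x \<otimes>\<^bsub>G\<^esub> inv\<^bsub>G\<^esub> y) * \<psi> (inv\<^bsub>G\<^esub> x)) = (\<Sum>h\<in>H. \<chi> h * \<psi> (inv\<^bsub>G\<^esub> h))"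
    if y: "y \<in> carrier G" for y
  proof -
    have iv: "\<psi> (inv\<^bsub>G\<^esub> (y \<otimes>\<^bsub>G\<^esub> x \<otimes>\<^bsub>G\<^esub> inv\<^bsub>G\<^esub> y)) = \<psi> (inv\<^bsub>G\<^esub> x)" if x: "x \<in> carrier G" for x
    proof -
      have "inv\<^bsub>G\<^esub> (y \<otimes>\<^bsub>G\<^esub> x \<otimes>\<^bsub>G\<^esub> inv\<^bsub>G\<^esub> y) = y \<otimes>\<^bsub>G\<^esub> inv\<^bsub>G\<^esub> x \<otimes>\<^bsub>G\<^esub> inv\<^bsub>G\<^esub> y"
        using x y by (simp add: inv_mult_group m_assoc)
      then show ?thesis using \<psi>[of "inv\<^bsub>G\<^esub> x" y] x y by simp
    qed
    have c1: "inv\<^bsub>G\<^esub> y \<otimes>\<^bsub>G\<^esub> (y \<otimes>\<^bsub>G\<^esub> a) = a" and c2: "y \<otimes>\<^bsub>G\<^esub> (inv\<^bsub>G\<^esub> y \<otimes>\<^bsub>G\<^esub> a) = a"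
      if "a \<in> carrier G" for a
      using y that by (simp_all add: m_assoc[symmetric])
    have "(\<Sum>x\<in>carrier G. ?c (y \<otimes>\<^bsub>G\<^esub> x \<otimes>\<^bsub>G\<^esub> inv\<^bsub>G\<^esub> y) * \<psi> (inv\<^bsub>G\<^esub> x))
        = (\<Sum>x\<in>carrier G. ?c (y \<otimes>\<^bsub>G\<^esub> x \<otimes>\<^bsub>G\<^esub> inv\<^bsub>G\<^esub> y) * \<psi> (inv\<^bsub>G\<^esub> (y \<otimes>\<^bsub>G\<^esub> x \<otimes>\<^bsub>G\<^esub> inv\<^bsub>G\<^esub> y)))"
      by (intro sum.cong refl) (simp only: iv)
    also have "\<dots> = (\<Sum>z\<in>carrier G. ?c z * \<psi> (inv\<^bsub>G\<^esub> z))"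
      by (rule sum.reindex_bij_witness[of _ "\<lambda>z. inv\<^bsub>G\<^esub> y \<otimes>\<^bsub>G\<^esub> z \<otimes>\<^bsub>G\<^esub> y" "\<lambda>x. y \<otimes>\<^bsub>G\<^esub> x \<otimes>\<^bsub>G\<^esub> inv\<^bsub>G\<^esub> y"])
        (use y c1 c2 in \<open>simp_all add: m_assoc\<close>)
    also have "\<dots> = (\<Sum>h\<in>H. \<chi> h * \<psi> (inv\<^bsub>G\<^esub> h))"
      using H fin by (intro sum.mono_neutral_cong_right) auto
    finally show ?thesis .
  qed
  have cG: "of_nat (card (carrier G)) \<noteq> (0::'k)" using fin one_closed by (auto simp: card_eq_0_iff)
  have "(\<Sum>x\<in>carrier G. induced G H \<chi> x * \<psi> (inv\<^bsub>G\<^esub> x))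
      = (\<Sum>x\<in>carrier G. \<Sum>y\<in>carrier G. ?c (y \<otimes>\<^bsub>G\<^esub> x \<otimes>\<^bsub>G\<^esub> inv\<^bsub>G\<^esub> y) * \<psi> (inv\<^bsub>G\<^esub> x)) / of_nat (card H)"
    unfolding sum_divide_distrib by (intro sum.cong refl) (simp add: induced_def sum_distrib_right sum_divide_distrib)
  also have "(\<Sum>x\<in>carrier G. \<Sum>y\<in>carrier G. ?c (y \<otimes>\<^bsub>G\<^esub> x \<otimes>\<^bsub>G\<^esub> inv\<^bsub>G\<^esub> y) * \<psi> (inv\<^bsub>G\<^esub> x))
      = (\<Sum>y\<in>carrier G. \<Sum>h\<in>H. \<chi> h * \<psi> (inv\<^bsub>G\<^esub> h))"
    by (subst sum.swap) (intro sum.cong refl conj)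
  finally show ?thesis using cG by (simp add: char_inner_def)
qed

section \<open>The quotient by the fixed points\<close>
lemma coords_basis:
  assumes W: "vectorspace class_ring W" and B: "finite B" "vectorspace.basis class_ring W B" and cd: "c \<in> B" "d \<in> B"
  shows "coords W B d c = (if c = d then 1 else 0)"
proof -
  interpret vectorspace class_ring W by fact
  have sub: "B \<subseteq> carrier W" using B(2) by (simp add: basis_def)
  let ?a = "\<lambda>x\<in>B. if x = d then 1 else 0"
  have "lincomb ?a B = finsum W (\<lambda>x. if d = x then x else \<zero>\<^bsub>W\<^esub>) B"
    unfolding lincomb_def
    by (rule M.finsum_cong') (use sub in \<open>auto simp: smult_one[simplified] smult_l_null[simplified]\<close>)
  also have "\<dots> = d" by (rule M.finsum_singleton[OF cd(2) B(1)]) (use sub in auto)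
  finally have "coords W B d = ?a"
    using coords_properties(3)[OF W B, of d ?a] sub cd(2) by auto
  then show ?thesis using cd(1) by simp
qed

context preferred_bases
begin

interpretation V: group_module Gp V \<rho> by (rule V_module)

abbreviation H0 where "H0 \<equiv> Gt\<lparr>carrier := base_subgroup Gp\<rparr>"

lemma iota_group_hom: "finite_group_hom Gp Gt (\<lambda>g. iota g)"
  by (intro finite_group_hom.intro finite_group_hom_axioms.intro group_Gp group_Gt finite_Gp P.finite_semidirect
      homI iota_closed iota_mult[symmetric])

interpretation I: finite_group_hom Gp Gt "\<lambda>g. iota g" by (rule iota_group_hom)

lemma base_eq: "base_subgroup Gp = (\<lambda>g. iota g) ` carrier Gp"
  unfolding base_subgroup_def by blast

lemma iota_inj: "inj_on (\<lambda>g. iota g) (carrier Gp)"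
  by (rule inj_onI) (rule Pair_inject)

lemma base_subgroup: "subgroup (base_subgroup Gp) Gt"
proof -
  have "group_hom Gp Gt (\<lambda>g. iota g)"
    by (intro group_hom.intro group_hom_axioms.intro group_Gp group_Gt I.i_hom)
  from group_hom.img_is_subgroup[OF this] show ?thesis unfolding base_eq .
qed

lemma carrier_H0: "carrier H0 = (\<lambda>g. iota g) ` carrier Gp"
proof -
  have "carrier (Q\<lparr>carrier := X\<rparr>) = X" for Q :: "('q, 'r) monoid_scheme" and X by simp
  then show ?thesis unfolding base_eq by this
qed

lemma group_H0: "group H0"
  by (rule group.subgroup_imp_group[OF group_Gt base_subgroup])

lemma multiplicity_H0: "multiplicity H0 Z T X' R = multiplicity Gp Z (\<lambda>g. T (iota g)) X' (\<lambda>g. R (iota g))"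
proof -
  have inv: "inv\<^bsub>H0\<^esub> (iota g) = iota (inv\<^bsub>Gp\<^esub> g)" if g: "g \<in> carrier Gp" for g
  proof -
    have "iota g \<in> base_subgroup Gp" unfolding base_eq by (rule imageI[OF g])
    from group.m_inv_consistent[OF group_Gt base_subgroup this] show ?thesis by (simp only: I.i_inv[OF g])
  qed
  note carrier_H0
  moreover have "(\<Sum>h\<in>(\<lambda>g. iota g) ` carrier Gp. mtrace Z (T h) * mtrace X' (R (inv\<^bsub>H0\<^esub> h)))
      = (\<Sum>g\<in>carrier Gp. mtrace Z (T (iota g)) * mtrace X' (R (iota (inv\<^bsub>Gp\<^esub> g))))"
    unfolding sum.reindex[OF iota_inj] o_def by (intro sum.cong refl) (simp only: inv)
  ultimately show ?thesis unfolding multiplicity_def by (simp only: card_image[OF iota_inj])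
qed

text \<open>
  The component of a fixed vector in \<open>Vs i\<close> is fixed by \<open>G i\<close>, since \<open>G i\<close> preserves all summands.
\<close>
lemma fixed_points_trivial: "fixed_points H0 V exV = {\<zero>\<^bsub>V\<^esub>}"
proof
  show "{\<zero>\<^bsub>V\<^esub>} \<subseteq> fixed_points H0 V exV"
  proof -
    have "exV h \<zero>\<^bsub>V\<^esub> = \<zero>\<^bsub>V\<^esub>" if "h \<in> carrier Gt" for h
      by (rule module_hom_zero[OF V_mod V_mod group_module.act_hom[OF exV_module that]])
    moreover have "base_subgroup Gp \<subseteq> carrier Gt" by (rule subgroup.subset[OF base_subgroup])
    ultimately show ?thesis by (auto simp: fixed_points_def)
  qed
  show "fixed_points H0 V exV \<subseteq> {\<zero>\<^bsub>V\<^esub>}"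
  proof
    fix v assume v: "v \<in> fixed_points H0 V exV"
    then have vV: "v \<in> carrier V" by (simp add: fixed_points_def)
    have fx: "\<rho> g v = v" if "g \<in> carrier Gp" for g
    proof -
      have "iota g \<in> carrier H0" unfolding carrier_H0 by (rule imageI[OF that])
      with v have "exV (iota g) v = v" unfolding fixed_points_def by blast
      then show ?thesis by (simp only: P.ext_act_base)
    qed
    have cv: "comp v \<in> {..<n} \<rightarrow> carrier V" by (rule Pi_I) (simp add: Vs_V[OF _ comp_in[OF vV]])
    have "comp v i = \<zero>\<^bsub>V\<^esub>" if i: "i < n" for i
    proof (rule Vs_Fix[OF i comp_in[OF vV i]])
      have "\<rho> (emb i g) (comp v i) = comp v i" if g: "g \<in> carrier (G i)" for g
      proof -
        have eg: "emb i g \<in> carrier Gp" by (rule emb_closed[OF i g])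
        let ?u = "\<lambda>j\<in>{..<n}. \<rho> (emb i g) (comp v j)"
        have uV: "?u \<in> (\<Pi>\<^sub>E j\<in>{..<n}. Vs j)"
        proof (rule restrict_PiE_iff[THEN iffD2], rule ballI)
          fix j assume "j \<in> {..<n}"
          then have j: "j < n" by simp
          show "\<rho> (emb i g) (comp v j) \<in> Vs j"
          proof (cases "i = j")
            case True
            then show ?thesis using Vs_invariant[OF i g] comp_in[OF vV i] by simp
          next
            case False
            then show ?thesis using Vs_trivial_action[OF i j False g comp_in[OF vV j]] comp_in[OF vV j] by simp
          qed
        qed
        have "v = \<rho> (emb i g) (finsum V (comp v) {..<n})" by (simp only: finsum_comp[OF vV] fx[OF eg])
        also have "\<dots> = finsum V (\<lambda>j. \<rho> (emb i g) (comp v j)) {..<n}"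
          by (rule module_hom_finsum[OF V_mod V_mod V.act_hom[OF eg] finite_lessThan cv])
        also have "\<dots> = finsum V ?u {..<n}"
        proof (rule V.M.finsum_cong')
          show "?u \<in> {..<n} \<rightarrow> carrier V" using PiE_mem[OF uV] Vs_V by (intro Pi_I) simp
        qed simp_all
        finally have "comp v = ?u" using comp_finsum[OF uV] by simp
        from fun_cong[OF this, of i] i show ?thesis by simp
      qed
      then show "comp v i \<in> Fix i" using Vs_V[OF i comp_in[OF vV i]] by (simp add: fixed_points_def)
    qed
    then have "finsum V (comp v) {..<n} = finsum V (\<lambda>i. \<zero>\<^bsub>V\<^esub>) {..<n}"
      by (intro V.M.finsum_cong') auto
    then show "v \<in> {\<zero>\<^bsub>V\<^esub>}" by (simp add: finsum_comp[OF vV])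
  qed
qed

abbreviation U where "U \<equiv> quotient_space V {\<zero>\<^bsub>V\<^esub>}"

text \<open>
  The cosets of the zero space are the singletons.
\<close>
lemma U_simps:
  "carrier U = (\<lambda>v. {v}) ` carrier V"
  "v \<in> carrier V \<Longrightarrow> w \<in> carrier V \<Longrightarrow> {v} \<oplus>\<^bsub>U\<^esub> {w} = {v \<oplus>\<^bsub>V\<^esub> w}"
  "v \<in> carrier V \<Longrightarrow> c \<odot>\<^bsub>U\<^esub> {v} = {c \<odot>\<^bsub>V\<^esub> v}"
proof -
  have c: "{\<zero>\<^bsub>V\<^esub>} +>\<^bsub>V\<^esub> v = {v}" if "v \<in> carrier V" for v
    using that by (simp add: a_r_coset_def')
  have cl: "c \<odot>\<^bsub>V\<^esub> v \<in> carrier V" if "v \<in> carrier V" for c v using V_closed that by (simp add: lin_closed_def)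
  show "carrier U = (\<lambda>v. {v}) ` carrier V" by (auto simp: quotient_space_def A_RCOSETS_def' c)
  show "{v} \<oplus>\<^bsub>U\<^esub> {w} = {v \<oplus>\<^bsub>V\<^esub> w}" for v w by (simp add: quotient_space_def set_add_def')
  show "c \<odot>\<^bsub>U\<^esub> {v} = {c \<odot>\<^bsub>V\<^esub> v}" if "v \<in> carrier V" by (simp add: quotient_space_def c cl that)
qed

lemma U_closed: "lin_closed U"
  using V_closed by (simp add: lin_closed_def U_simps)

lemma U_lin_system: "lin_system U J (\<lambda>j. {VB j}) (\<lambda>j u. VC j (the_elem u))"
proof -
  have "f {v} = (\<Sum>j\<in>J. VC j v * f {VB j})" if f: "lin_fun U f" and v: "v \<in> carrier V" for f v
  proof -
    have "lin_fun V (\<lambda>v. f {v})" using f by (simp add: lin_fun_def U_simps)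
    then have f': "(\<lambda>v. f {v}) \<in> {f. lin_fun V f}" by simp
    have "\<forall>f\<in>{f. lin_fun V f}. \<forall>v\<in>carrier V. f v = (\<Sum>j\<in>J. VC j v * f (VB j))"
      using VLS unfolding dual_system_def by (elim conjE)
    from bspec[OF bspec[OF this f'] v] show ?thesis .
  qed
  note ex = this
  have lf: "lin_fun U (\<lambda>u. VC j (the_elem u))" if "j \<in> J" for j
  proof -
    have "lin_fun V (VC j)" using VLS that unfolding dual_system_def by blast
    then show ?thesis by (simp add: lin_fun_def U_simps)
  qed
  have mem: "{VB j} \<in> carrier U" if "j \<in> J" for j
    using VLS that unfolding dual_system_def U_simps by blast
  show ?thesis
    unfolding dual_system_def
  proof (intro conjI Pi_I ballI finite_J)
    fix f u assume f: "f \<in> {f. lin_fun U f}" and u: "u \<in> carrier U"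
    obtain v where v: "u = {v}" "v \<in> carrier V" using u unfolding U_simps(1) by (rule imageE)
    have "lin_fun U f" using f by (rule CollectD)
    from ex[OF this v(2)] show "f u = (\<Sum>j\<in>J. VC j (the_elem u) * f {VB j})" by (simp only: v(1) the_elem_eq)
  qed (erule mem, rule CollectI, erule lf)
qed

lemma molien_H0: "molien H0 U (quotient_act exV) (base_char Gp \<chi>) = molien Gp V \<rho> \<chi>"
proof (rule fps_ext)
  fix k
  have sub: "h \<in> carrier H0 \<Longrightarrow> h \<in> carrier Gt" for h using subgroup.subset[OF base_subgroup] by auto
  have hom: "quotient_act exV h \<in> module_hom class_ring U U" if "h \<in> carrier H0" for h
  proof -
    have "exV h \<in> module_hom class_ring V V" by (rule group_module.act_hom[OF exV_module sub[OF that]])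
    then have "exV h v \<in> carrier V" "exV h (v \<oplus>\<^bsub>V\<^esub> w) = exV h v \<oplus>\<^bsub>V\<^esub> exV h w"
      "exV h (c \<odot>\<^bsub>V\<^esub> v) = c \<odot>\<^bsub>V\<^esub> exV h v" if "v \<in> carrier V" "w \<in> carrier V" for v w c
      using that by (auto simp: LinearCombinations.module_hom_def)
    then have "quotient_act exV h u \<in> carrier U" "quotient_act exV h (u \<oplus>\<^bsub>U\<^esub> t) = quotient_act exV h u \<oplus>\<^bsub>U\<^esub> quotient_act exV h t"
      "quotient_act exV h (c \<odot>\<^bsub>U\<^esub> u) = c \<odot>\<^bsub>U\<^esub> quotient_act exV h u" if "u \<in> carrier U" "t \<in> carrier U" for u t c
      using that unfolding U_simps(1) by (auto simp only: U_simps(2,3) quotient_act_def image_insert image_empty)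
    then show ?thesis by (simp add: LinearCombinations.module_hom_def)
  qed
  have bc: "base_char Gp \<chi> h = mtrace Y (S h)" if h: "h \<in> carrier H0" for h
  proof -
    obtain g where g: "g \<in> carrier Gp" "h = iota g" using h unfolding carrier_H0 by (rule imageE)
    have "h \<in> base_subgroup Gp" unfolding base_eq g(2) by (rule imageI[OF g(1)])
    then have "base_char Gp \<chi> h = \<chi> (fst h)" unfolding base_char_def by (rule restrict_apply')
    then show ?thesis by (simp only: g(2) fst_conv chi_eq[OF g(1)])
  qed
  have sm: "smat J (\<lambda>j. {VB j}) (\<lambda>j u. VC j (the_elem u)) (quotient_act exV h) = M h" for h
    unfolding smat_def M_def quotient_act_def image_insert image_empty the_elem_eq by (rule refl)
  have "fps_nth (molien H0 U (quotient_act exV) (base_char Gp \<chi>)) k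
      = multiplicity H0 ({..<k} \<rightarrow>\<^sub>E J) (\<lambda>h. sym_mat k J (M h)) Y S"
    unfolding sm[symmetric] by (rule molien_nth[OF group_H0 U_lin_system U_closed hom bc])
  then show "fps_nth (molien H0 U (quotient_act exV) (base_char Gp \<chi>)) k = fps_nth (molien Gp V \<rho> \<chi>) k"
    by (simp only: multiplicity_H0 nth_Gp)
qed

end

section \<open>The value of \<open>j\<close>-induction\<close>
lemma b_inv_enat:
  "b_inv H V \<rho> \<chi> = enat d \<longleftrightarrow>
     fps_nth (molien H V \<rho> \<chi>) d \<noteq> 0 \<and> (\<forall>k<d. fps_nth (molien H V \<rho> \<chi>) k = 0)"
proof
  assume "b_inv H V \<rho> \<chi> = enat d"
  then have "molien H V \<rho> \<chi> \<noteq> 0" "subdegree (molien H V \<rho> \<chi>) = d"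
    by (auto simp: b_inv_def split: if_splits)
  then show "fps_nth (molien H V \<rho> \<chi>) d \<noteq> 0 \<and> (\<forall>k<d. fps_nth (molien H V \<rho> \<chi>) k = 0)"
    using nth_subdegree_nonzero nth_less_subdegree_zero by blast
next
  assume *: "fps_nth (molien H V \<rho> \<chi>) d \<noteq> 0 \<and> (\<forall>k<d. fps_nth (molien H V \<rho> \<chi>) k = 0)"
  then have "subdegree (molien H V \<rho> \<chi>) = d" by (intro subdegreeI) auto
  moreover have "molien H V \<rho> \<chi> \<noteq> 0" using * by auto
  ultimately show "b_inv H V \<rho> \<chi> = enat d" by (simp add: b_inv_def)
qed

lemma mtrace_class_function:
  fixes R :: "'h \<Rightarrow> 'x \<Rightarrow> 'x \<Rightarrow> 'k::comm_ring_1"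
  assumes H: "group H" and R: "mat_rep H X R" and xy: "x \<in> carrier H" "y \<in> carrier H"
  shows "mtrace X (R (y \<otimes>\<^bsub>H\<^esub> x \<otimes>\<^bsub>H\<^esub> inv\<^bsub>H\<^esub> y)) = mtrace X (R x)"
proof -
  interpret group H by fact
  have m: "R (g \<otimes>\<^bsub>H\<^esub> h) = mmul X (R g) (R h)" if "g \<in> carrier H" "h \<in> carrier H" for g h
    using R that by (simp add: mat_rep_def)
  have "mtrace X (R (y \<otimes>\<^bsub>H\<^esub> x \<otimes>\<^bsub>H\<^esub> inv\<^bsub>H\<^esub> y)) = mtrace X (mmul X (R (y \<otimes>\<^bsub>H\<^esub> x)) (R (inv\<^bsub>H\<^esub> y)))"
    using xy by (simp only: m m_closed inv_closed)
  also have "\<dots> = mtrace X (mmul X (R (inv\<^bsub>H\<^esub> y)) (R (y \<otimes>\<^bsub>H\<^esub> x)))" by (rule mtrace_mmul)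
  also have "\<dots> = mtrace X (R (inv\<^bsub>H\<^esub> y \<otimes>\<^bsub>H\<^esub> (y \<otimes>\<^bsub>H\<^esub> x)))"
    using xy by (simp only: m m_closed inv_closed)
  also have "inv\<^bsub>H\<^esub> y \<otimes>\<^bsub>H\<^esub> (y \<otimes>\<^bsub>H\<^esub> x) = x" using xy by (simp add: m_assoc[symmetric])
  finally show ?thesis .
qed

context preferred_bases
begin

interpretation I: finite_group_hom Gp Gt "\<lambda>g. iota g" by (rule iota_group_hom)

abbreviation ext where "ext \<equiv> b_preferred_ext n G \<phi> E r \<delta>"

lemma ext_eq: "ext = (\<lambda>x\<in>carrier Gt. mtrace Y (S x))"
  unfolding S_def by (rule b_preferred_ext_eq[OF lsE])

lemma ext_apply: "x \<in> carrier Gt \<Longrightarrow> ext x = mtrace Y (S x)"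
  by (simp only: ext_eq restrict_apply' )

lemma nth_ext: "fps_nth (molien Gt V exV ext) k
    = multiplicity Gt ({..<k} \<rightarrow>\<^sub>E J) (\<lambda>x. sym_mat k J (M x)) Y S"
  by (rule nth_Gt) (rule ext_apply)

lemma restriction_nonzero:
  assumes "multiplicity Gt ({..<k} \<rightarrow>\<^sub>E J) (\<lambda>x. sym_mat k J (M x)) Y S \<noteq> 0"
  shows "multiplicity Gp ({..<k} \<rightarrow>\<^sub>E J) (\<lambda>g. sym_mat k J (M (iota g))) Y (\<lambda>g. S (iota g)) \<noteq> 0"
proof -
  obtain A where A: "intertwiner Gt ({..<k} \<rightarrow>\<^sub>E J) (\<lambda>x. sym_mat k J (M x)) Y S A" "A \<noteq> (\<lambda>_ _. 0)"
    using iffD1[OF rep_pair.multiplicity_nonzero_iff[OF pair_Gt[OF S_rep]] assms] by (elim exE conjE)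
  then show ?thesis
    by (intro iffD2[OF rep_pair.multiplicity_nonzero_iff[OF pair_Gp]] exI[of _ A] conjI
        intertwiner_restrict[where T="\<lambda>x. sym_mat k J (M x)"])
qed

text \<open>
  Combine \<open>n * b \<le> d\<close> from the lower bound with \<open>d \<le> n * b\<close>, which holds because the constituent found
  by the upper bound restricts to \<open>\<chi>\<close>.
\<close>
lemma b_inv_ext:
  assumes d: "b_inv Gp V \<rho> \<chi> = enat d"
  shows "b_inv Gt V exV ext = enat d"
proof -
  have dn: "fps_nth (molien Gp V \<rho> \<chi>) d \<noteq> 0" and dl: "\<And>k. k < d \<Longrightarrow> fps_nth (molien Gp V \<rho> \<chi>) k = 0"
    using d by (simp_all add: b_inv_enat)
  let ?P0 = "molien (G 0) W0 (\<lambda>g. \<rho> (emb 0 g)) (character (G 0) (E 0) (r 0))"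
  obtain c where c: "(\<Sum>i<n. c i) = d" "\<And>i. i < n \<Longrightarrow> fps_nth ?P0 (c i) \<noteq> 0"
    using lower_bound[OF dn[unfolded nth_Gp]] unfolding nth_G0 by blast
  define b where "b = subdegree ?P0"
  have "?P0 \<noteq> 0" using c(2)[OF n0] by auto
  then have "b_inv (G 0) W0 (\<lambda>g. \<rho> (emb 0 g)) (character (G 0) (E 0) (r 0)) = enat b"
    by (simp add: b_inv_def b_def)
  then have "b_inv Gt0 W0 exV0 (character Gt0 (E 0) exE0) = enat b"
    using b_preserved[OF n0] by simp
  then have "fps_nth (molien Gt0 W0 exV0 (character Gt0 (E 0) exE0)) b \<noteq> 0" by (simp only: b_inv_enat simp_thms)
  from upper_bound[OF this[unfolded nth_Gt0]]
  have nb: "multiplicity Gt ({..<n * b} \<rightarrow>\<^sub>E J) (\<lambda>x. sym_mat (n * b) J (M x)) Y S \<noteq> 0" .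
  have ub: "fps_nth (molien Gp V \<rho> \<chi>) (n * b) \<noteq> 0"
    unfolding nth_Gp by (rule restriction_nonzero[OF nb])
  have "b \<le> c i" if "i < n" for i unfolding b_def by (rule subdegree_leI[OF c(2)[OF that]])
  then have "of_nat (card {..<n}) * b \<le> (\<Sum>i<n. c i)" by (intro sum_bounded_below) simp
  then have "n * b = d" using dl[of "n * b"] ub c(1) by (simp add: order_antisym_conv not_less[symmetric]) (metis nat_neq_iff not_less)
  then have "fps_nth (molien Gt V exV ext) d \<noteq> 0" using nb unfolding nth_ext by simp
  moreover have "fps_nth (molien Gt V exV ext) k = 0" if k: "k < d" for k
  proof (rule ccontr)
    assume "fps_nth (molien Gt V exV ext) k \<noteq> 0"
    from restriction_nonzero[OF this[unfolded nth_ext]] dl[OF k] show False unfolding nth_Gp by (rule notE)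
  qed
  ultimately show ?thesis unfolding b_inv_enat by (intro conjI allI impI)
qed

lemma char_inner_induced:
  assumes R: "mat_rep Gt X' R"
  shows "char_inner Gt (induced Gt (base_subgroup Gp) (base_char Gp \<chi>)) (\<lambda>x\<in>carrier Gt. mtrace X' (R x))
    = multiplicity Gp Y (\<lambda>g. S (iota g)) X' (\<lambda>g. R (iota g))"
proof -
  let ?\<psi> = "\<lambda>x\<in>carrier Gt. mtrace X' (R x)"
  interpret Gt: group Gt by (rule group_Gt)
  have cl: "?\<psi> (y \<otimes>\<^bsub>Gt\<^esub> x \<otimes>\<^bsub>Gt\<^esub> inv\<^bsub>Gt\<^esub> y) = ?\<psi> x" if "x \<in> carrier Gt" "y \<in> carrier Gt" for x y
    using that mtrace_class_function[OF group_Gt R that] by simp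
  have "char_inner Gt (induced Gt (base_subgroup Gp) (base_char Gp \<chi>)) ?\<psi>
      = (\<Sum>h\<in>base_subgroup Gp. base_char Gp \<chi> h * ?\<psi> (inv\<^bsub>Gt\<^esub> h)) / of_nat (card (base_subgroup Gp))"
    by (rule frobenius[OF group_Gt P.finite_semidirect subgroup.subset[OF base_subgroup] cl])
  also have "(\<Sum>h\<in>base_subgroup Gp. base_char Gp \<chi> h * ?\<psi> (inv\<^bsub>Gt\<^esub> h))
      = (\<Sum>g\<in>carrier Gp. base_char Gp \<chi> (iota g) * ?\<psi> (inv\<^bsub>Gt\<^esub> (iota g)))"
    unfolding base_eq sum.reindex[OF iota_inj] o_def by (rule refl)
  also have "\<dots> = (\<Sum>g\<in>carrier Gp. mtrace Y (S (iota g)) * mtrace X' (R (iota (inv\<^bsub>Gp\<^esub> g))))"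
  proof (intro sum.cong refl)
    fix g assume g: "g \<in> carrier Gp"
    have gi: "inv\<^bsub>Gp\<^esub> g \<in> carrier Gp" by (rule group.inv_closed[OF group_Gp g])
    have "iota g \<in> base_subgroup Gp" unfolding base_eq by (rule imageI[OF g])
    then show "base_char Gp \<chi> (iota g) * ?\<psi> (inv\<^bsub>Gt\<^esub> (iota g)) = mtrace Y (S (iota g)) * mtrace X' (R (iota (inv\<^bsub>Gp\<^esub> g)))"
      by (simp only: base_char_def restrict_apply' fst_conv chi_eq[OF g] I.i_inv[OF g, symmetric] iota_closed[OF gi])
  qed
  also have "of_nat (card (base_subgroup Gp)) = of_nat (card (carrier Gp))"
    unfolding base_eq card_image[OF iota_inj] by (rule refl)
  finally show ?thesis by (simp only: multiplicity_def)
qed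

text \<open>
  The irreducibility of the extension comes from its restriction, and uniqueness from \<open>extension_unique\<close> applied to the
  \<open>d\<close>-th symmetric power.
\<close>
lemma j_induction_ext:
  assumes \<chi>: "\<chi> \<in> irr_deg Gp V \<rho> d"
  shows "j_induction Gt (base_subgroup Gp) V exV (base_char Gp \<chi>) = ext"
proof -
  have irr: "\<chi> \<in> irr Gp" and b: "b_inv Gp V \<rho> \<chi> = enat d" and g: "gamma_inv Gp V \<rho> \<chi> = 1"
    using \<chi> by (simp_all only: irr_deg_def mem_Collect_eq)
  have "subdegree (molien Gp V \<rho> \<chi>) = d" using b by (simp add: b_inv_def split: if_splits)
  then have "fps_nth (molien Gp V \<rho> \<chi>) d = 1" using g by (simp add: gamma_inv_def)
  then have one: "multiplicity Gp ({..<d} \<rightarrow>\<^sub>E J) (\<lambda>g. sym_mat d J (M (iota g))) Y (\<lambda>g. S (iota g)) = 1"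
    by (simp only: nth_Gp)
  have b0: "b_inv H0 U (quotient_act exV) (base_char Gp \<chi>) = enat d"
    using b by (simp only: b_inv_def molien_H0)
  have bt: "b_inv Gt V exV ext = enat d" by (rule b_inv_ext[OF b])
  have irr_t: "ext \<in> irr Gt"
    unfolding ext_eq by (rule I.irr_of_restriction[OF S_rep S_one irr chi_eq])
  have SS: "multiplicity Gp Y (\<lambda>g. S (iota g)) Y (\<lambda>g. S (iota g)) = 1"
  proof -
    obtain m R where R: "\<chi> = (\<lambda>h\<in>carrier Gp. mtrace {..<m::nat} (R h))" "multiplicity Gp {..<m} R {..<m} R = 1"
      by (rule irr_obtain[OF irr finite_Gp])
    have "mtrace Y (S (iota h)) = mtrace {..<m} (R h)" if "h \<in> carrier Gp" for h
      using chi_eq[OF that] that by (simp only: R(1) restrict_apply')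
    then show ?thesis unfolding R(2)[symmetric] by (intro multiplicity_cong[OF group_Gp])
  qed
  have SSt: "multiplicity Gt Y S Y S = 1"
  proof -
    obtain m R where R: "ext = (\<lambda>h\<in>carrier Gt. mtrace {..<m::nat} (R h))" "multiplicity Gt {..<m} R {..<m} R = 1"
      by (rule irr_obtain[OF irr_t P.finite_semidirect])
    have "mtrace Y (S h) = mtrace {..<m} (R h)" if "h \<in> carrier Gt" for h
      using ext_apply[OF that] that by (simp only: R(1) restrict_apply')
    then show ?thesis unfolding R(2)[symmetric] by (intro multiplicity_cong[OF group_Gt])
  qed
  have TS: "multiplicity Gt ({..<d} \<rightarrow>\<^sub>E J) (\<lambda>x. sym_mat d J (M x)) Y S \<noteq> 0"
    using bt unfolding b_inv_enat nth_ext by (rule conjunct1)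
  show ?thesis
    unfolding j_induction_def Let_def fixed_points_trivial b0
  proof (rule the_equality)
    show "ext \<in> irr Gt \<and> char_inner Gt (induced Gt (base_subgroup Gp) (base_char Gp \<chi>)) ext = 1 \<and>
        b_inv Gt V exV ext = enat d"
    proof (intro conjI irr_t bt)
      show "char_inner Gt (induced Gt (base_subgroup Gp) (base_char Gp \<chi>)) ext = 1"
        unfolding ext_eq char_inner_induced[OF S_rep] by (rule SS)
    qed
    fix \<psi> assume \<psi>: "\<psi> \<in> irr Gt \<and> char_inner Gt (induced Gt (base_subgroup Gp) (base_char Gp \<chi>)) \<psi> = 1 \<and>
        b_inv Gt V exV \<psi> = enat d"
    obtain m R where R: "mat_rep Gt {..<m::nat} R" "R \<one>\<^bsub>Gt\<^esub> = id_mat {..<m}"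
      "\<psi> = (\<lambda>h\<in>carrier Gt. mtrace {..<m} (R h))" "multiplicity Gt {..<m} R {..<m} R = 1"
      by (rule irr_obtain[OF conjunct1[OF \<psi>] P.finite_semidirect])
    have "multiplicity Gp Y (\<lambda>g. S (iota g)) {..<m} (\<lambda>g. R (iota g)) = 1"
      using \<psi> unfolding R(3) char_inner_induced[OF R(1)] by (elim conjE)
    then have RS: "multiplicity Gp {..<m} (\<lambda>g. R (iota g)) Y (\<lambda>g. S (iota g)) \<noteq> 0"
      using multiplicity_sym[OF group_Gp, of "{..<m}" "\<lambda>g. R (iota g)" Y "\<lambda>g. S (iota g)"] by simp
    have \<psi>_apply: "\<psi> x = mtrace {..<m} (R x)" if "x \<in> carrier Gt" for x
      using that by (simp only: R(3) restrict_apply')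
    have TR: "multiplicity Gt ({..<d} \<rightarrow>\<^sub>E J) (\<lambda>x. sym_mat d J (M x)) {..<m} R \<noteq> 0"
    proof -
      have "fps_nth (molien Gt V exV \<psi>) d = multiplicity Gt ({..<d} \<rightarrow>\<^sub>E J) (\<lambda>x. sym_mat d J (M x)) {..<m} R"
        by (rule nth_Gt) (rule \<psi>_apply)
      moreover have "fps_nth (molien Gt V exV \<psi>) d \<noteq> 0"
        using \<psi> unfolding b_inv_enat by (elim conjE)
      ultimately show ?thesis by simp
    qed
    show "\<psi> = ext"
      unfolding R(3) ext_eq
    proof (rule restrict_ext)
      fix x assume x: "x \<in> carrier Gt"
      show "mtrace {..<m} (R x) = mtrace Y (S x)"
        by (rule I.extension_unique[where T="\<lambda>x. sym_mat d J (M x)" and Z="{..<d} \<rightarrow>\<^sub>E J",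
              OF mat_rep_sym[OF M_rep] S_rep S_one R(1,2) SSt R(4) one TS TR RS x])
    qed
  qed
qed

end

context preferred
begin

lemma j_induction_b_preferred_ext:
  assumes "\<chi> \<in> irr_deg Gp V \<rho> d"
  shows "j_induction Gt (base_subgroup Gp) V (ext_act Gp Phi \<rho> \<sigma>) (base_char Gp \<chi>) = b_preferred_ext n G \<phi> E r \<delta>"
proof -
  have E0: "vectorspace class_ring (E 0)" using E_module[OF n0] by (simp add: group_module_def)
  obtain X where X: "finite X" "vectorspace.basis class_ring (E 0) X"
    using vectorspace.finite_basis_exists[OF E0 group_module.fin_dim[OF E_module[OF n0]]] by blast
  note W0 = W0_vectorspace finite_B0 B_basis[OF n0]
  have "preferred_bases n G \<phi> V \<rho> Vs B \<sigma>s \<sigma> \<chi> E r \<delta> (B 0) (\<lambda>b v. coords W0 (B 0) v b) X (\<lambda>b v. coords (E 0) X v b)"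
    by (intro preferred_bases.intro preferred_bases_axioms.intro preferred_axioms
        lin_system_basis[OF W0] lin_system_basis[OF E0 X] coords_basis[OF W0] coords_basis[OF E0 X])
  from preferred_bases.j_induction_ext[OF this assms] show ?thesis .
qed

end

theorem propositionA8:
  fixes n d :: nat
    and G :: "nat \<Rightarrow> ('g, 'm) monoid_scheme"
    and \<phi> :: "nat \<Rightarrow> 'g \<Rightarrow> 'g"
    and V :: "('k::{alg_closed_field, field_char_0}, 'v) module"
    and \<rho> :: "(nat \<Rightarrow> 'g) \<Rightarrow> 'v \<Rightarrow> 'v"
    and Vs B :: "nat \<Rightarrow> 'v set"
    and \<sigma>s :: "nat \<Rightarrow> 'v \<Rightarrow> 'v"
    and \<sigma> :: "'v \<Rightarrow> 'v"
    and \<chi> :: "(nat \<Rightarrow> 'g) \<Rightarrow> 'k"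
    and E :: "nat \<Rightarrow> ('k, 'e) module"
    and r :: "nat \<Rightarrow> 'g \<Rightarrow> 'e \<Rightarrow> 'e"
    and \<delta> :: "nat \<Rightarrow> 'e \<Rightarrow> 'e"
  assumes "cyclic_module n G \<phi> V \<rho> Vs \<sigma>s \<sigma> B"
    and "prime n"
    and "\<chi> \<in> irr_deg (prod_group n G) V \<rho> d"
    and "\<forall>g\<in>carrier (prod_group n G). \<chi> (cyc_aut n G \<phi> g) = \<chi> g"
    and "b_preferred_data n G \<phi> V \<rho> Vs \<sigma>s \<chi> E r \<delta>"
  shows "j_induction (semidirect (prod_group n G) (cyc_aut n G \<phi>)) (base_subgroup (prod_group n G))
           V (ext_act (prod_group n G) (cyc_aut n G \<phi>) \<rho> \<sigma>) (base_char (prod_group n G) \<chi>)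
         = b_preferred_ext n G \<phi> E r \<delta>"
  by (rule preferred.j_induction_b_preferred_ext[OF preferred.intro[OF assms(1,5)] assms(3)])

end
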